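(* Let $F$ be a field. Let $\mathcal{V}$ be a variety of modular lattices (resp., a variety of bounded modular lattices). Assume that all finitely generated lattices of $\mathcal{V}$ have finite length. Then \[ \mathrm{crit}(\mathcal{V};\mathbf{Var}_0(\mathrm{Sub}\,F^n\mid n\in\omega))\ge\aleph_2\quad(\text{resp., }\ \mathrm{crit}(\mathcal{V};\mathbf{Var}_{0,1}(\mathrm{Sub}\,F^n\mid n\in\omega))\ge\aleph_2). \] Moreover, for every $L\in\mathcal{V}$ of cardinality at most $\aleph_1$ there exists a regular ring $A$ such that $\mathrm{Con}\,L\cong\mathrm{Con}\,\mathbb{L}(A)$ and $\mathbb{L}(A)\in\mathbf{Var}_0(\mathrm{Sub}\,F^n\mid n\in\omega)$ (resp., $\mathbb{L}(A)\in\mathbf{Var}_{0,1}(\mathrm{Sub}\,F^n\mid n\in\omega)$). If there exists $n<\omega$ such that $\mathrm{lh}(K)\le n$ for each simple lattice $K\in\mathcal{V}$ of finite length, then \[ \mathrm{crit}(\mathcal{V};\mathbf{Var}_0(\mathrm{Sub}\,F^n))\ge\aleph_2\quad(\text{resp., }\ \mathrm{crit}(\mathcal{V};\mathbf{Var}_{0,1}(\mathrm{Sub}\,F^n))\ge\aleph_2). \] Moreover, for every $L\in\mathcal{V}$ of cardinality at most $\aleph_1$ there exists a regular ring $A$ such that $\mathrm{Con}\,L\cong\mathrm{Con}\,\mathbb{L}(A)$ and $\mathbb{L}(A)\in\mathbf{Var}_0(\mathrm{Sub}\,F^n)$ (resp., $\mathbb{L}(A)\in\mathbf{Var}_{0,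1}(\mathrm{Sub}\,F^n)$).
   Context: For an algebra $A$, $\mathrm{Con}\,A$ is its congruence lattice and $\mathrm{Con}_c\,A$ is the $(\vee,0)$-semilattice of its compact (i.e., finitely generated) congruences. For a variety $\mathcal{V}$ of algebras, $\mathrm{Con}_c\,\mathcal{V}$ is the class of all $(\vee,0)$-semilattices isomorphic to $\mathrm{Con}_c\,A$ for some $A\in\mathcal{V}$. For varieties $\mathcal{V},\mathcal{W}$ (possibly of different similarity types), the critical point $\mathrm{crit}(\mathcal{V};\mathcal{W})$ is the smallest cardinality of a semilattice in $\mathrm{Con}_c\,\mathcal{V}-\mathrm{Con}_c\,\mathcal{W}$ if one exists, and $\infty$ otherwise (where $\infty$ is larger than all cardinals). $\mathrm{Sub}\,E$ is the lattice of subspaces of a vector space $E$. $\mathbf{Var}_0$ (resp., $\mathbf{Var}_{0,1}$) of a lattice or family of lattices denotes the variety of lattices with $0$ as a constant (resp., bounded lattices, with $0,1$ as constants) that it generates. A variety of bounded lattices has both bounds as constants in the signature. $\mathrm{lh}(K)$ denotes the length of $K$ (the supremum of the integers $k$ such that $K$ has a chain with $k+1$ elements). Rings are associative but not necessarily unital; "regular" means von Neumann regular (for every $a$ there is $y$ with $a=aya$). For a regular ring $A$, $\mathbb{L}(A)$ is the set of principal right ideals of $A$, ordered by inclusion; it is a lattice with $0$. *)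

theory Defs
  imports
    "HOL-Algebra.Ring"
    "HOL-Library.Extended_Nat"
    "HOL-Library.Countable_Set"
    "HOL-Library.Function_Algebras"
begin

unbundle cardinal_syntax

section \<open>Algebras, congruences, varieties\<close>

text \<open>A similarity type is a partial map from operation symbols to arities. Values of
  \<open>opn\<close> on symbols outside the similarity type, on lists of the wrong length, or on
  arguments outside the carrier are irrelevant.\<close>

type_synonym 'o similarity = "'o \<Rightarrow> nat option"

record ('a, 'o) ualg = "'a partial_object" +
  opn :: "'o \<Rightarrow> 'a list \<Rightarrow> 'a"

definition is_algebra :: "'o similarity \<Rightarrow> ('a, 'o) ualg \<Rightarrow> bool" where
  "is_algebra \<sigma> A \<longleftrightarrow> carrier A \<noteq> {} \<and>
     (\<forall>f xs. \<sigma> f = Some (length xs) \<and> set xs \<subseteq> carrier A \<longrightarrow> opn A f xs \<in> carrier A)"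

definition isomorphic :: "'o similarity \<Rightarrow> ('a, 'o) ualg \<Rightarrow> ('b, 'o) ualg \<Rightarrow> bool" where
  "isomorphic \<sigma> A B \<longleftrightarrow> (\<exists>h. bij_betw h (carrier A) (carrier B) \<and>
     (\<forall>f xs. \<sigma> f = Some (length xs) \<and> set xs \<subseteq> carrier A \<longrightarrow>
        h (opn A f xs) = opn B f (map h xs)))"

definition subuniverse :: "'o similarity \<Rightarrow> ('a, 'o) ualg \<Rightarrow> 'a set \<Rightarrow> bool" where
  "subuniverse \<sigma> A B \<longleftrightarrow> B \<subseteq> carrier A \<and>
     (\<forall>f xs. \<sigma> f = Some (length xs) \<and> set xs \<subseteq> B \<longrightarrow> opn A f xs \<in> B)"

definition finitely_generated :: "'o similarity \<Rightarrow> ('a, 'o) ualg \<Rightarrow> bool" where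
  "finitely_generated \<sigma> A \<longleftrightarrow>
     (\<exists>X. finite X \<and> X \<subseteq> carrier A \<and> subuniverse \<sigma> A hull X = carrier A)"

definition congruence :: "'o similarity \<Rightarrow> ('a, 'o) ualg \<Rightarrow> ('a \<times> 'a) set \<Rightarrow> bool" where
  "congruence \<sigma> A \<theta> \<longleftrightarrow> equiv (carrier A) \<theta> \<and>
     (\<forall>f xs ys. \<sigma> f = Some (length xs) \<and> list_all2 (\<lambda>x y. (x, y) \<in> \<theta>) xs ys \<longrightarrow>
        (opn A f xs, opn A f ys) \<in> \<theta>)"

definition simple_algebra :: "'o similarity \<Rightarrow> ('a, 'o) ualg \<Rightarrow> bool" where
  "simple_algebra \<sigma> A \<longleftrightarrow> Id_on (carrier A) \<noteq> carrier A \<times> carrier A \<and>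
     {\<theta>. congruence \<sigma> A \<theta>} = {Id_on (carrier A), carrier A \<times> carrier A}"

datatype 'o trm = Var nat | Op 'o "'o trm list"

fun trm_ok :: "'o similarity \<Rightarrow> 'o trm \<Rightarrow> bool" where
  "trm_ok \<sigma> (Var n) \<longleftrightarrow> True"
| "trm_ok \<sigma> (Op f ts) \<longleftrightarrow> \<sigma> f = Some (length ts) \<and> (\<forall>t\<in>set ts. trm_ok \<sigma> t)"

fun trm_value :: "('a, 'o) ualg \<Rightarrow> (nat \<Rightarrow> 'a) \<Rightarrow> 'o trm \<Rightarrow> 'a" where
  "trm_value A \<rho> (Var n) = \<rho> n"
| "trm_value A \<rho> (Op f ts) = opn A f (map (trm_value A \<rho>) ts)"

definition identities :: "'o similarity \<Rightarrow> ('o trm \<times> 'o trm) set" where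
  "identities \<sigma> = {(s, t). trm_ok \<sigma> s \<and> trm_ok \<sigma> t}"

definition satisfies :: "('a, 'o) ualg \<Rightarrow> 'o trm \<times> 'o trm \<Rightarrow> bool" where
  "satisfies A e \<longleftrightarrow>
     (\<forall>\<rho>. range \<rho> \<subseteq> carrier A \<longrightarrow> trm_value A \<rho> (fst e) = trm_value A \<rho> (snd e))"

definition models :: "'o similarity \<Rightarrow> ('o trm \<times> 'o trm) set \<Rightarrow> ('a, 'o) ualg set" where
  "models \<sigma> E = {A. is_algebra \<sigma> A \<and> (\<forall>e\<in>E. satisfies A e)}"

text \<open>Classes of algebras are collected inside a type \<open>'a\<close>, which plays the role of a
  universe. A variety is an equational class.\<close>

definition variety :: "'o similarity \<Rightarrow> ('a, 'o) ualg set \<Rightarrow> bool" where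
  "variety \<sigma> \<V> \<longleftrightarrow> (\<exists>E \<subseteq> identities \<sigma>. \<V> = models \<sigma> E)"

text \<open>The smallest equational class containing \<open>\<K>\<close>. Its members may live in another type
  than the generators.\<close>

definition Variety_of :: "'o similarity \<Rightarrow> ('b, 'o) ualg set \<Rightarrow> ('a, 'o) ualg set" where
  "Variety_of \<sigma> \<K> = models \<sigma> {e \<in> identities \<sigma>. \<forall>A\<in>\<K>. satisfies A e}"

section \<open>Lattices\<close>

datatype lat_op = Join | Meet | Zero | One

definition semilattice0_sig :: "lat_op similarity" where
  "semilattice0_sig = [Join \<mapsto> 2, Zero \<mapsto> 0]"

definition lattice_sig :: "lat_op similarity" where
  "lattice_sig = [Join \<mapsto> 2, Meet \<mapsto> 2]"

definition lattice0_sig :: "lat_op similarity" where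
  "lattice0_sig = [Join \<mapsto> 2, Meet \<mapsto> 2, Zero \<mapsto> 0]"

definition lattice01_sig :: "lat_op similarity" where
  "lattice01_sig = [Join \<mapsto> 2, Meet \<mapsto> 2, Zero \<mapsto> 0, One \<mapsto> 0]"

abbreviation ljoin :: "('a, lat_op) ualg \<Rightarrow> 'a \<Rightarrow> 'a \<Rightarrow> 'a" where
  "ljoin L x y \<equiv> opn L Join [x, y]"

abbreviation lmeet :: "('a, lat_op) ualg \<Rightarrow> 'a \<Rightarrow> 'a \<Rightarrow> 'a" where
  "lmeet L x y \<equiv> opn L Meet [x, y]"

abbreviation lle :: "('a, lat_op) ualg \<Rightarrow> 'a \<Rightarrow> 'a \<Rightarrow> bool" where
  "lle L x y \<equiv> ljoin L x y = y"

text \<open>The constants \<open>Zero\<close> and \<open>One\<close> are required to be bounds exactly if they belong to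
  the similarity type; so \<open>\<sigma>\<close> decides between lattices, lattices with zero and bounded
  lattices.\<close>

definition lattice_algebra :: "lat_op similarity \<Rightarrow> ('a, lat_op) ualg \<Rightarrow> bool" where
  "lattice_algebra \<sigma> L \<longleftrightarrow> is_algebra \<sigma> L \<and> \<sigma> Join = Some 2 \<and> \<sigma> Meet = Some 2 \<and>
     (\<forall>x\<in>carrier L. \<forall>y\<in>carrier L. \<forall>z\<in>carrier L.
        ljoin L x y = ljoin L y x \<and> lmeet L x y = lmeet L y x \<and>
        ljoin L (ljoin L x y) z = ljoin L x (ljoin L y z) \<and>
        lmeet L (lmeet L x y) z = lmeet L x (lmeet L y z) \<and>
        ljoin L x (lmeet L x y) = x \<and> lmeet L x (ljoin L x y) = x) \<and>
     (Zero \<in> dom \<sigma> \<longrightarrow> (\<forall>x\<in>carrier L. lle L (opn L Zero []) x)) \<and>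
     (One \<in> dom \<sigma> \<longrightarrow> (\<forall>x\<in>carrier L. lle L x (opn L One [])))"

definition modular_lattice :: "lat_op similarity \<Rightarrow> ('a, lat_op) ualg \<Rightarrow> bool" where
  "modular_lattice \<sigma> L \<longleftrightarrow> lattice_algebra \<sigma> L \<and>
     (\<forall>x\<in>carrier L. \<forall>y\<in>carrier L. \<forall>z\<in>carrier L. lle L x z \<longrightarrow>
        ljoin L x (lmeet L y z) = lmeet L (ljoin L x y) z)"

definition lh :: "('a, lat_op) ualg \<Rightarrow> enat" where
  "lh L = Sup {enat k | k. \<exists>C \<subseteq> carrier L. finite C \<and> card C = k + 1 \<and>
                 (\<forall>x\<in>C. \<forall>y\<in>C. lle L x y \<or> lle L y x)}"

abbreviation finite_length :: "('a, lat_op) ualg \<Rightarrow> bool" where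
  "finite_length L \<equiv> lh L < \<infinity>"

text \<open>A family of sets ordered by inclusion, with the lattice operations and bounds of that
  order (as far as they exist).\<close>

definition incl_order :: "'a set set \<Rightarrow> 'a set gorder" where
  "incl_order X = \<lparr>carrier = X, eq = (=), le = (\<subseteq>)\<rparr>"

fun order_opn :: "'a gorder \<Rightarrow> lat_op \<Rightarrow> 'a list \<Rightarrow> 'a" where
  "order_opn P Join [x, y] = x \<squnion>\<^bsub>P\<^esub> y"
| "order_opn P Meet [x, y] = x \<sqinter>\<^bsub>P\<^esub> y"
| "order_opn P Zero [] = \<bottom>\<^bsub>P\<^esub>"
| "order_opn P One [] = \<top>\<^bsub>P\<^esub>"

definition incl_lattice :: "'a set set \<Rightarrow> ('a set, lat_op) ualg" where
  "incl_lattice X = \<lparr>carrier = X, opn = order_opn (incl_order X)\<rparr>"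

definition Con :: "'o similarity \<Rightarrow> ('a, 'o) ualg \<Rightarrow> (('a \<times> 'a) set, lat_op) ualg" where
  "Con \<sigma> A = incl_lattice {\<theta>. congruence \<sigma> A \<theta>}"

definition Con_c :: "'o similarity \<Rightarrow> ('a, 'o) ualg \<Rightarrow> (('a \<times> 'a) set, lat_op) ualg" where
  "Con_c \<sigma> A = incl_lattice
     {congruence \<sigma> A hull X | X. finite X \<and> X \<subseteq> carrier A \<times> carrier A}"

section \<open>Critical points\<close>

text \<open>Semilattices and algebras all range over the same universe \<open>'u\<close>.\<close>

definition Con_c_class ::
    "'o similarity \<Rightarrow> ('u, 'o) ualg set \<Rightarrow> ('u, lat_op) ualg set" where
  "Con_c_class \<sigma> \<V> = {S. is_algebra semilattice0_sig S \<and>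
     (\<exists>A\<in>\<V>. isomorphic semilattice0_sig S (Con_c \<sigma> A))}"

text \<open>\<open>None\<close> stands for \<open>\<infinity>\<close>; cardinals are represented by cardinal orders, up to
  \<open>=o\<close>.\<close>

definition crit ::
    "'o similarity \<Rightarrow> ('u, 'o) ualg set \<Rightarrow> 'p similarity \<Rightarrow> ('u, 'p) ualg set \<Rightarrow> 'u rel option"
  where
  "crit \<sigma> \<V> \<tau> \<W> =
     (let D = Con_c_class \<sigma> \<V> - Con_c_class \<tau> \<W>
      in if D = {} then None
         else Some (SOME \<kappa>. (\<exists>S\<in>D. \<kappa> = |carrier S| ) \<and> (\<forall>S\<in>D. \<kappa> \<le>o |carrier S| )))"

definition le_crit :: "'k rel \<Rightarrow> 'u rel option \<Rightarrow> bool" where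
  "le_crit \<kappa> c \<longleftrightarrow> (case c of None \<Rightarrow> True | Some \<mu> \<Rightarrow> \<kappa> \<le>o \<mu>)"

abbreviation aleph1 :: "nat set rel" where
  "aleph1 \<equiv> cardSuc natLeq"

abbreviation aleph2 :: "nat set set rel" where
  "aleph2 \<equiv> cardSuc aleph1"

section \<open>Subspace lattices and regular rings\<close>

text \<open>Vectors of \<open>F\<^sup>n\<close> are the functions on \<open>nat\<close> vanishing from \<open>n\<close> on.\<close>

definition fscale :: "'f::field \<Rightarrow> (nat \<Rightarrow> 'f) \<Rightarrow> (nat \<Rightarrow> 'f)" where
  "fscale c v = (\<lambda>i. c * v i)"

interpretation fun_space: vector_space fscale
  by unfold_locales (auto simp: fscale_def fun_eq_iff algebra_simps)

definition Sub_pow :: "'f::field itself \<Rightarrow> nat \<Rightarrow> ((nat \<Rightarrow> 'f) set, lat_op) ualg" where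
  "Sub_pow _ n = incl_lattice
     {U. fun_space.subspace U \<and> U \<subseteq> {v. \<forall>i\<ge>n. v i = 0}}"

text \<open>Rings need not have a unit: the field \<open>one\<close> of the record is ignored.\<close>

definition nonunital_ring :: "'a ring \<Rightarrow> bool" where
  "nonunital_ring R \<longleftrightarrow> abelian_group R \<and>
     (\<forall>x\<in>carrier R. \<forall>y\<in>carrier R. x \<otimes>\<^bsub>R\<^esub> y \<in> carrier R) \<and>
     (\<forall>x\<in>carrier R. \<forall>y\<in>carrier R. \<forall>z\<in>carrier R.
        (x \<otimes>\<^bsub>R\<^esub> y) \<otimes>\<^bsub>R\<^esub> z = x \<otimes>\<^bsub>R\<^esub> (y \<otimes>\<^bsub>R\<^esub> z) \<and>
        (x \<oplus>\<^bsub>R\<^esub> y) \<otimes>\<^bsub>R\<^esub> z = x \<otimes>\<^bsub>R\<^esub> z \<oplus>\<^bsub>R\<^esub> y \<otimes>\<^bsub>R\<^esub> z \<and>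
        z \<otimes>\<^bsub>R\<^esub> (x \<oplus>\<^bsub>R\<^esub> y) = z \<otimes>\<^bsub>R\<^esub> x \<oplus>\<^bsub>R\<^esub> z \<otimes>\<^bsub>R\<^esub> y)"

definition regular_ring :: "'a ring \<Rightarrow> bool" where
  "regular_ring R \<longleftrightarrow> nonunital_ring R \<and>
     (\<forall>a\<in>carrier R. \<exists>y\<in>carrier R. a = a \<otimes>\<^bsub>R\<^esub> y \<otimes>\<^bsub>R\<^esub> a)"

text \<open>In a regular ring \<open>a = a (y a)\<close> lies in \<open>aR\<close>, so \<open>aR\<close> is the right ideal generated
  by \<open>a\<close> even without a unit.\<close>

definition principal_right_ideals :: "'a ring \<Rightarrow> 'a set set" where
  "principal_right_ideals R = (\<lambda>a. (\<lambda>x. a \<otimes>\<^bsub>R\<^esub> x) ` carrier R) ` carrier R"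

definition LL :: "'a ring \<Rightarrow> ('a set, lat_op) ualg" where
  "LL R = incl_lattice (principal_right_ideals R)"

end

theory Submission imports Defs "HOL-Library.Countable_Set_Type" begin

text \<open>
  A lattice \<open>L\<close> of cardinality at most \<open>\<aleph>\<^sub>1\<close> is the union of its finitely generated sublattices
  \<open>K i\<close>, indexed by a lower finite directed set in which every proper lower segment is the union of
  at most two principal ideals meeting in a principal ideal (a ladder). Each \<open>K i\<close> is modular of finite
  length, so its congruences are the sets of projectivity classes \<open>s\<close> of prime intervals; counting the
  intervals of class \<open>s\<close> in maximal chains gives a rank function \<open>rk s\<close>, with kernel a maximal
  congruence. To \<open>K i\<close> belongs the product over \<open>s\<close> of the matrix rings of size \<open>rk s top\<close> over a
  countable subfield, and to \<open>K i \<subseteq> K j\<close> the block diagonal homomorphisms with the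
  multiplicities with which an interval of class \<open>s\<close> is composed of intervals of class \<open>t\<close>. Two such
  homomorphisms differ by a permutation of coordinates, which suffices to choose them coherently along the
  ladder. The direct limit is a regular ring whose principal right ideals form a lattice with the same
  system of congruences; its identities are controlled by the numbers \<open>rk s top\<close>, the lengths of the
  simple quotients of the \<open>K i\<close>.
\<close>


section \<open>Lattices of sets\<close>

text \<open>The obstacle is that a block diagonal homomorphism is determined by its multiplicities
  only up to a permutation of coordinates, so the diagram of the \<open>K i\<close> does not lift to
  rings by itself. When an index is added above two principal ideals, the maps coming from them must
  be reconciled on one common principal ideal, and a single permutation does this. With three ideals
  the pairwise corrections would also have to fit together. Ladders of this width come from cofinal
  sequences in countable initial segments, whence the bound aleph_1. The subfield is countable
  because the ring has to be named by elements of a universe known only to be uncountable: countable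
  stages over at most aleph_1 indices give at most aleph_1 elements. The matrices still act on
  columns over the whole field, which brings in its subspaces. For the critical point, a semilattice
  with at most aleph_1 elements may come from a far larger lattice. A Loewenheim-Skolem argument
  replaces that lattice by a subalgebra with at most aleph_1 elements and isomorphic compact
  congruences.\<close>

lemma incl_sup:
  assumes "Z \<in> X" "\<And>A. A \<in> Q \<Longrightarrow> A \<subseteq> Z" "\<And>Y. Y \<in> X \<Longrightarrow> (\<And>A. A \<in> Q \<Longrightarrow> A \<subseteq> Y) \<Longrightarrow> Z \<subseteq> Y"
    and "Q \<subseteq> X"
  shows "Lattice.sup (incl_order X) Q = Z"
proof -
  have U: "Upper (incl_order X) Q = {u \<in> X. \<forall>A\<in>Q. A \<subseteq> u}" (is "_ = ?U")
    using assms(4) by (auto simp: Upper_def incl_order_def)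
  have "Z \<in> ?U" "\<And>y. y \<in> ?U \<Longrightarrow> Z \<subseteq> y" using assms(1,2,3) by simp_all
  then have iff: "least (incl_order X) x (Upper (incl_order X) Q) \<longleftrightarrow> x = Z" for x
    unfolding least_def U by (simp add: incl_order_def) (metis subset_antisym)
  show ?thesis unfolding Lattice.sup_def iff by simp
qed

lemma incl_inf:
  assumes "Z \<in> X" "\<And>A. A \<in> Q \<Longrightarrow> Z \<subseteq> A" "\<And>Y. Y \<in> X \<Longrightarrow> (\<And>A. A \<in> Q \<Longrightarrow> Y \<subseteq> A) \<Longrightarrow> Y \<subseteq> Z"
    and "Q \<subseteq> X"
  shows "Lattice.inf (incl_order X) Q = Z"
proof -
  have U: "Lower (incl_order X) Q = {u \<in> X. \<forall>A\<in>Q. u \<subseteq> A}" (is "_ = ?U")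
    using assms(4) by (auto simp: Lower_def incl_order_def)
  have "Z \<in> ?U" "\<And>y. y \<in> ?U \<Longrightarrow> y \<subseteq> Z" using assms(1,2,3) by simp_all
  then have iff: "greatest (incl_order X) x (Lower (incl_order X) Q) \<longleftrightarrow> x = Z" for x
    unfolding greatest_def U by (simp add: incl_order_def) (metis subset_antisym)
  show ?thesis unfolding Lattice.inf_def iff by simp
qed

lemma carrier_incl_lattice [simp]: "carrier (incl_lattice X) = X"
  by (simp add: incl_lattice_def)

lemma ljoin_incl:
  assumes "A \<in> X" "B \<in> X" "Z \<in> X" "A \<subseteq> Z" "B \<subseteq> Z"
    "\<And>Y. Y \<in> X \<Longrightarrow> A \<subseteq> Y \<Longrightarrow> B \<subseteq> Y \<Longrightarrow> Z \<subseteq> Y"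
  shows "ljoin (incl_lattice X) A B = Z"
  unfolding incl_lattice_def by (simp add: join_def) (rule incl_sup, use assms in auto)

lemma lmeet_incl:
  assumes "A \<in> X" "B \<in> X" "Z \<in> X" "Z \<subseteq> A" "Z \<subseteq> B"
    "\<And>Y. Y \<in> X \<Longrightarrow> Y \<subseteq> A \<Longrightarrow> Y \<subseteq> B \<Longrightarrow> Y \<subseteq> Z"
  shows "lmeet (incl_lattice X) A B = Z"
  unfolding incl_lattice_def by (simp add: meet_def) (rule incl_inf, use assms in auto)

lemma bottom_incl:
  assumes "Z \<in> X" "\<And>Y. Y \<in> X \<Longrightarrow> Z \<subseteq> Y"
  shows "opn (incl_lattice X) Zero [] = Z"
proof -
  have iff: "least (incl_order X) x X \<longleftrightarrow> x = Z" for x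
    using assms by (auto simp: least_def incl_order_def)
  have "carrier (incl_order X) = X" by (simp add: incl_order_def)
  then show ?thesis by (simp add: incl_lattice_def bottom_def iff)
qed

lemma top_incl:
  assumes "Z \<in> X" "\<And>Y. Y \<in> X \<Longrightarrow> Y \<subseteq> Z"
  shows "opn (incl_lattice X) One [] = Z"
proof -
  have iff: "greatest (incl_order X) x X \<longleftrightarrow> x = Z" for x
    using assms by (auto simp: greatest_def incl_order_def)
  have "carrier (incl_order X) = X" by (simp add: incl_order_def)
  then show ?thesis by (simp add: incl_lattice_def top_def iff)
qed

text \<open>The operations of \<open>incl_lattice\<close> come from the order alone and are
  meaningful only where the bounds exist, so existence is recorded as a separate property of the
  family.\<close>

definition has_joins :: "'a set set \<Rightarrow> bool" where
  "has_joins X \<longleftrightarrow> (\<forall>A\<in>X. \<forall>B\<in>X. \<exists>Z. Z \<in> X \<and> A \<subseteq> Z \<and> B \<subseteq> Z \<and>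
     (\<forall>Y. Y \<in> X \<longrightarrow> A \<subseteq> Y \<longrightarrow> B \<subseteq> Y \<longrightarrow> Z \<subseteq> Y))"

definition has_meets :: "'a set set \<Rightarrow> bool" where
  "has_meets X \<longleftrightarrow> (\<forall>A\<in>X. \<forall>B\<in>X. \<exists>Z. Z \<in> X \<and> Z \<subseteq> A \<and> Z \<subseteq> B \<and>
     (\<forall>Y. Y \<in> X \<longrightarrow> Y \<subseteq> A \<longrightarrow> Y \<subseteq> B \<longrightarrow> Y \<subseteq> Z))"

lemma has_joinsD: "\<lbrakk>has_joins X; A \<in> X; B \<in> X\<rbrakk> \<Longrightarrow>
    \<exists>Z. Z \<in> X \<and> A \<subseteq> Z \<and> B \<subseteq> Z \<and> (\<forall>Y. Y \<in> X \<longrightarrow> A \<subseteq> Y \<longrightarrow> B \<subseteq> Y \<longrightarrow> Z \<subseteq> Y)"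
  by (simp add: has_joins_def)

lemma has_meetsD: "\<lbrakk>has_meets X; A \<in> X; B \<in> X\<rbrakk> \<Longrightarrow>
    \<exists>Z. Z \<in> X \<and> Z \<subseteq> A \<and> Z \<subseteq> B \<and> (\<forall>Y. Y \<in> X \<longrightarrow> Y \<subseteq> A \<longrightarrow> Y \<subseteq> B \<longrightarrow> Y \<subseteq> Z)"
  by (simp add: has_meets_def)

text \<open>Isomorphisms are handled through the order: this preserves all joins, meets and bounds
  that exist and respects compactness. Operations return only in statements about
  \<open>isomorphic\<close>.\<close>

definition order_iso :: "('a set \<Rightarrow> 'b set) \<Rightarrow> 'a set set \<Rightarrow> 'b set set \<Rightarrow> bool" where
  "order_iso h X Y \<longleftrightarrow> bij_betw h X Y \<and> (\<forall>A\<in>X. \<forall>B\<in>X. A \<subseteq> B \<longleftrightarrow> h A \<subseteq> h B)"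

lemma order_isoD:
  assumes "order_iso h X Y"
  shows "h ` X = Y" "A \<in> X \<Longrightarrow> B \<in> X \<Longrightarrow> A \<subseteq> B \<longleftrightarrow> h A \<subseteq> h B" "bij_betw h X Y" "inj_on h X"
  using assms unfolding order_iso_def bij_betw_def by blast+

lemma order_iso_join:
  assumes h: "order_iso h X Y" and X: "has_joins X" "A \<in> X" "B \<in> X"
  shows "h (ljoin (incl_lattice X) A B) = ljoin (incl_lattice Y) (h A) (h B)"
proof -
  obtain Z where Z: "Z \<in> X" "A \<subseteq> Z" "B \<subseteq> Z" "\<And>Y. Y \<in> X \<Longrightarrow> A \<subseteq> Y \<Longrightarrow> B \<subseteq> Y \<Longrightarrow> Z \<subseteq> Y"
    using has_joinsD[OF X] by metis
  have i: "h ` X = Y" "\<And>A B. A \<in> X \<Longrightarrow> B \<in> X \<Longrightarrow> A \<subseteq> B \<longleftrightarrow> h A \<subseteq> h B"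
    using order_isoD[OF h] by blast+
  have "ljoin (incl_lattice Y) (h A) (h B) = h Z"
  proof (rule ljoin_incl)
    fix V assume V: "V \<in> Y" "h A \<subseteq> V" "h B \<subseteq> V"
    then obtain x where x: "x \<in> X" "V = h x" using i(1) by blast
    then have "A \<subseteq> x" "B \<subseteq> x" using i(2)[OF X(2) x(1)] i(2)[OF X(3) x(1)] V x(2) by simp_all
    then show "h Z \<subseteq> V" using Z(4)[OF x(1)] i(2)[OF Z(1) x(1)] x(2) by simp
  next
    show "h A \<subseteq> h Z" "h B \<subseteq> h Z" using i(2)[OF X(2) Z(1)] i(2)[OF X(3) Z(1)] Z by simp_all
  qed (use i(1) X Z in blast)+
  then show ?thesis using ljoin_incl[OF X(2,3) Z] by simp
qed

lemma order_iso_meet: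
  assumes h: "order_iso h X Y" and X: "has_meets X" "A \<in> X" "B \<in> X"
  shows "h (lmeet (incl_lattice X) A B) = lmeet (incl_lattice Y) (h A) (h B)"
proof -
  obtain Z where Z: "Z \<in> X" "Z \<subseteq> A" "Z \<subseteq> B" "\<And>Y. Y \<in> X \<Longrightarrow> Y \<subseteq> A \<Longrightarrow> Y \<subseteq> B \<Longrightarrow> Y \<subseteq> Z"
    using has_meetsD[OF X] by metis
  have i: "h ` X = Y" "\<And>A B. A \<in> X \<Longrightarrow> B \<in> X \<Longrightarrow> A \<subseteq> B \<longleftrightarrow> h A \<subseteq> h B"
    using order_isoD[OF h] by blast+
  have "lmeet (incl_lattice Y) (h A) (h B) = h Z"
  proof (rule lmeet_incl)
    fix V assume V: "V \<in> Y" "V \<subseteq> h A" "V \<subseteq> h B"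
    then obtain x where x: "x \<in> X" "V = h x" using i(1) by blast
    then have "x \<subseteq> A" "x \<subseteq> B" using i(2)[OF x(1) X(2)] i(2)[OF x(1) X(3)] V x(2) by simp_all
    then show "V \<subseteq> h Z" using Z(4)[OF x(1)] i(2)[OF x(1) Z(1)] x(2) by simp
  next
    show "h Z \<subseteq> h A" "h Z \<subseteq> h B" using i(2)[OF Z(1) X(2)] i(2)[OF Z(1) X(3)] Z by simp_all
  qed (use i(1) X Z in blast)+
  then show ?thesis using lmeet_incl[OF X(2,3) Z] by simp
qed

lemma order_iso_isomorphic_lattice:
  assumes h: "order_iso h X Y" and X: "has_joins X" "has_meets X"
  shows "isomorphic lattice_sig (incl_lattice X) (incl_lattice Y)"
  unfolding isomorphic_def
proof (intro exI[of _ h] conjI allI impI)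
  show "bij_betw h (carrier (incl_lattice X)) (carrier (incl_lattice Y))"
    using h by (simp add: order_iso_def)
  fix f xs assume a: "lattice_sig f = Some (length xs) \<and> set xs \<subseteq> carrier (incl_lattice X)"
  then have "f \<in> {Join, Meet}" "length xs = 2" by (auto simp: lattice_sig_def split: if_splits)
  then obtain x y where xs: "xs = [x, y]" by (auto simp: numeral_2_eq_2 length_Suc_conv)
  show "h (opn (incl_lattice X) f xs) = opn (incl_lattice Y) f (map h xs)"
    using \<open>f \<in> _\<close> xs a order_iso_join[OF h X(1)] order_iso_meet[OF h X(2)] by auto
qed

lemma order_iso_isomorphic_semilattice:
  assumes h: "order_iso h X Y" and X: "has_joins X" "Z \<in> X" "\<And>A. A \<in> X \<Longrightarrow> Z \<subseteq> A"
  shows "isomorphic semilattice0_sig (incl_lattice X) (incl_lattice Y)"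
  unfolding isomorphic_def
proof (intro exI[of _ h] conjI allI impI)
  have i: "h ` X = Y" "\<And>A B. A \<in> X \<Longrightarrow> B \<in> X \<Longrightarrow> A \<subseteq> B \<longleftrightarrow> h A \<subseteq> h B"
    using order_isoD[OF h] by blast+
  show "bij_betw h (carrier (incl_lattice X)) (carrier (incl_lattice Y))"
    using h by (simp add: order_iso_def)
  fix f xs assume a: "semilattice0_sig f = Some (length xs) \<and> set xs \<subseteq> carrier (incl_lattice X)"
  then consider "f = Join" "length xs = 2" | "f = Zero" "xs = []"
    by (auto simp: semilattice0_sig_def split: if_splits)
  then show "h (opn (incl_lattice X) f xs) = opn (incl_lattice Y) f (map h xs)"
  proof cases
    case 1
    then obtain x y where xs: "xs = [x, y]" by (auto simp: numeral_2_eq_2 length_Suc_conv)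
    then show ?thesis using 1 a order_iso_join[OF h X(1)] by auto
  next
    case 2
    have "opn (incl_lattice Y) Zero [] = h Z" by (rule bottom_incl) (use i X in auto)
    then show ?thesis using 2 bottom_incl[OF X(2,3)] by simp
  qed
qed

lemma order_iso_comp: "order_iso h X Y \<Longrightarrow> order_iso g Y Z \<Longrightarrow> order_iso (g \<circ> h) X Z"
  unfolding order_iso_def using bij_betw_trans[of h X Y g Z]
  by (metis bij_betw_apply comp_apply)

lemma order_iso_inv:
  assumes "order_iso h X Y"
  shows "order_iso (the_inv_into X h) Y X"
proof -
  have b: "bij_betw h X Y" using assms by (simp add: order_iso_def)
  then have "bij_betw (the_inv_into X h) Y X" by (rule bij_betw_the_inv_into)
  moreover have "h (the_inv_into X h y) = y" if "y \<in> Y" for y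
    using b that f_the_inv_into_f by (fastforce simp: bij_betw_def)
  ultimately show ?thesis using order_isoD(2)[OF assms] unfolding order_iso_def
    by (metis bij_betw_apply)
qed

lemma isomorphic_trans:
  assumes "isomorphic \<sigma> A B" "isomorphic \<sigma> B C"
  shows "isomorphic \<sigma> A C"
proof -
  obtain h where h: "bij_betw h (carrier A) (carrier B)"
     "\<And>f xs. \<sigma> f = Some (length xs) \<and> set xs \<subseteq> carrier A \<Longrightarrow> h (opn A f xs) = opn B f (map h xs)"
    using assms(1) by (auto simp: isomorphic_def)
  obtain g where g: "bij_betw g (carrier B) (carrier C)"
     "\<And>f xs. \<sigma> f = Some (length xs) \<and> set xs \<subseteq> carrier B \<Longrightarrow> g (opn B f xs) = opn C f (map g xs)"
    using assms(2) by (auto simp: isomorphic_def)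
  have "(g \<circ> h) (opn A f xs) = opn C f (map (g \<circ> h) xs)" if a: "\<sigma> f = Some (length xs) \<and> set xs \<subseteq> carrier A" for f xs
  proof -
    have "set (map h xs) \<subseteq> carrier B" using a h(1) by (auto simp: bij_betw_def)
    then show ?thesis using h(2)[OF a] g(2)[of f "map h xs"] a by simp
  qed
  then show ?thesis unfolding isomorphic_def using bij_betw_trans[OF h(1) g(1)] by blast
qed

section \<open>Congruences and terms\<close>

lemma congruenceD:
  assumes "congruence \<sigma> A \<theta>"
  shows "\<theta> \<subseteq> carrier A \<times> carrier A" "x \<in> carrier A \<Longrightarrow> (x, x) \<in> \<theta>"
    "(x, y) \<in> \<theta> \<Longrightarrow> (y, x) \<in> \<theta>" "(x, y) \<in> \<theta> \<Longrightarrow> (y, z) \<in> \<theta> \<Longrightarrow> (x, z) \<in> \<theta>"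
    "\<lbrakk>\<sigma> f = Some (length xs); list_all2 (\<lambda>x y. (x, y) \<in> \<theta>) xs ys\<rbrakk> \<Longrightarrow> (opn A f xs, opn A f ys) \<in> \<theta>"
  using assms unfolding congruence_def equiv_def refl_on_def sym_def trans_def by blast+

lemma congruenceI:
  assumes "\<theta> \<subseteq> carrier A \<times> carrier A" "\<And>x. x \<in> carrier A \<Longrightarrow> (x, x) \<in> \<theta>"
    "\<And>x y. (x, y) \<in> \<theta> \<Longrightarrow> (y, x) \<in> \<theta>" "\<And>x y z. (x, y) \<in> \<theta> \<Longrightarrow> (y, z) \<in> \<theta> \<Longrightarrow> (x, z) \<in> \<theta>"
    "\<And>f xs ys. \<lbrakk>\<sigma> f = Some (length xs); list_all2 (\<lambda>x y. (x, y) \<in> \<theta>) xs ys\<rbrakk> \<Longrightarrow> (opn A f xs, opn A f ys) \<in> \<theta>"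
  shows "congruence \<sigma> A \<theta>"
  unfolding congruence_def equiv_def refl_on_def sym_def trans_def using assms by blast

lemma congruence_full:
  assumes "is_algebra \<sigma> A"
  shows "congruence \<sigma> A (carrier A \<times> carrier A)"
proof (rule congruenceI)
  fix f xs ys assume a: "\<sigma> f = Some (length xs)" "list_all2 (\<lambda>x y. (x, y) \<in> carrier A \<times> carrier A) xs ys"
  then have "set xs \<subseteq> carrier A" "set ys \<subseteq> carrier A" "length ys = length xs"
    by (auto simp: list_all2_conv_all_nth in_set_conv_nth)
  then show "(opn A f xs, opn A f ys) \<in> carrier A \<times> carrier A"
    using assms a(1) unfolding is_algebra_def by (metis SigmaI)
qed auto

lemma congruence_Inter:
  assumes "\<D> \<noteq> {}" "\<And>\<theta>. \<theta> \<in> \<D> \<Longrightarrow> congruence \<sigma> A \<theta>"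
  shows "congruence \<sigma> A (\<Inter>\<D>)"
proof (rule congruenceI)
  show "\<Inter>\<D> \<subseteq> carrier A \<times> carrier A" using assms congruenceD(1) by blast
  show "(x, y) \<in> \<Inter>\<D> \<Longrightarrow> (y, z) \<in> \<Inter>\<D> \<Longrightarrow> (x, z) \<in> \<Inter>\<D>" for x y z
    using congruenceD(4)[OF assms(2)] by (meson InterE InterI)
  fix f xs ys assume a: "\<sigma> f = Some (length xs)" "list_all2 (\<lambda>x y. (x, y) \<in> \<Inter>\<D>) xs ys"
  have "list_all2 (\<lambda>x y. (x, y) \<in> \<theta>) xs ys" if "\<theta> \<in> \<D>" for \<theta>
    using a(2) that by (auto intro: list_all2_mono)
  then show "(opn A f xs, opn A f ys) \<in> \<Inter>\<D>" using congruenceD(5)[OF assms(2) a(1)] by blast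
qed (use congruenceD(2,3)[OF assms(2)] in blast)+

definition directed_sets :: "'a set set \<Rightarrow> bool" where
  "directed_sets \<D> \<longleftrightarrow> \<D> \<noteq> {} \<and> (\<forall>A\<in>\<D>. \<forall>B\<in>\<D>. \<exists>C\<in>\<D>. A \<subseteq> C \<and> B \<subseteq> C)"

lemma directed_setsD: "\<lbrakk>directed_sets \<D>; A \<in> \<D>; B \<in> \<D>\<rbrakk> \<Longrightarrow> \<exists>C\<in>\<D>. A \<subseteq> C \<and> B \<subseteq> C"
  by (simp add: directed_sets_def)

lemma directed_finite:
  assumes "directed_sets \<D>" "finite X" "X \<subseteq> \<Union>\<D>"
  shows "\<exists>A\<in>\<D>. X \<subseteq> A"
  using assms(2,3)
proof (induction X rule: finite_induct)
  case (insert x X)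
  then obtain A B where AB: "A \<in> \<D>" "X \<subseteq> A" "B \<in> \<D>" "x \<in> B" by auto
  then obtain C where "C \<in> \<D>" "A \<subseteq> C" "B \<subseteq> C" using directed_setsD[OF assms(1)] by blast
  then show ?case using AB by (intro bexI[of _ C]) auto
qed (use assms(1) in \<open>auto simp: directed_sets_def\<close>)

text \<open>Arities are finite, so every closure condition involves finitely many pairs, and these
  lie in one member of the directed family.\<close>

lemma congruence_directed_Union:
  assumes d: "directed_sets \<D>" and c: "\<And>\<theta>. \<theta> \<in> \<D> \<Longrightarrow> congruence \<sigma> A \<theta>"
  shows "congruence \<sigma> A (\<Union>\<D>)"
proof (rule congruenceI)
  show "\<Union>\<D> \<subseteq> carrier A \<times> carrier A" using c congruenceD(1) by blast
  show "x \<in> carrier A \<Longrightarrow> (x, x) \<in> \<Union>\<D>" for x using d c congruenceD(2) by (fastforce simp: directed_sets_def)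
  show "(x, y) \<in> \<Union>\<D> \<Longrightarrow> (y, x) \<in> \<Union>\<D>" for x y using congruenceD(3)[OF c] by (meson UnionE UnionI)
  show "(x, z) \<in> \<Union>\<D>" if xyz: "(x, y) \<in> \<Union>\<D>" "(y, z) \<in> \<Union>\<D>" for x y z
  proof -
    obtain \<theta> where "\<theta> \<in> \<D>" "{(x, y), (y, z)} \<subseteq> \<theta>" using directed_finite[OF d, of "{(x, y), (y, z)}"] xyz by auto
    then have "(x, z) \<in> \<theta>" using congruenceD(4)[OF c, of \<theta> x y z] by auto
    then show ?thesis using \<open>\<theta> \<in> \<D>\<close> by auto
  qed
  fix f xs ys assume a: "\<sigma> f = Some (length xs)" "list_all2 (\<lambda>x y. (x, y) \<in> \<Union>\<D>) xs ys"
  have "set (zip xs ys) \<subseteq> \<Union>\<D>" "length xs = length ys" using a(2) by (auto simp: list_all2_iff)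
  then obtain \<theta> where \<theta>: "\<theta> \<in> \<D>" "set (zip xs ys) \<subseteq> \<theta>" using directed_finite[OF d, of "set (zip xs ys)"] by auto
  then have "list_all2 (\<lambda>x y. (x, y) \<in> \<theta>) xs ys" using \<open>length xs = length ys\<close> by (auto simp: list_all2_iff)
  then show "(opn A f xs, opn A f ys) \<in> \<Union>\<D>" using congruenceD(5)[OF c[OF \<theta>(1)] a(1)] \<theta>(1) by blast
qed

abbreviation Cg :: "'o similarity \<Rightarrow> ('a, 'o) ualg \<Rightarrow> ('a \<times> 'a) set \<Rightarrow> ('a \<times> 'a) set" where
  "Cg \<sigma> A X \<equiv> congruence \<sigma> A hull X"

lemma Cg_congruence:
  assumes "is_algebra \<sigma> A" "X \<subseteq> carrier A \<times> carrier A"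
  shows "congruence \<sigma> A (Cg \<sigma> A X)"
  unfolding hull_def by (rule congruence_Inter) (use congruence_full[OF assms(1)] assms(2) in auto)

lemma Cg_least: "congruence \<sigma> A \<theta> \<Longrightarrow> Cg \<sigma> A X \<subseteq> \<theta> \<longleftrightarrow> X \<subseteq> \<theta>"
  by (meson hull_minimal hull_subset subset_trans)

abbreviation congruences :: "'o similarity \<Rightarrow> ('a, 'o) ualg \<Rightarrow> ('a \<times> 'a) set set" where
  "congruences \<sigma> A \<equiv> {\<theta>. congruence \<sigma> A \<theta>}"

definition fg_congruences :: "'o similarity \<Rightarrow> ('a, 'o) ualg \<Rightarrow> ('a \<times> 'a) set set" where
  "fg_congruences \<sigma> A = {Cg \<sigma> A X | X. finite X \<and> X \<subseteq> carrier A \<times> carrier A}"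

lemma congruences_joins_meets:
  assumes A: "is_algebra \<sigma> A"
  shows "has_joins (congruences \<sigma> A)" "has_meets (congruences \<sigma> A)"
proof -
  show "has_joins (congruences \<sigma> A)" unfolding has_joins_def
  proof (intro ballI)
    fix \<alpha> \<beta> assume ab: "\<alpha> \<in> congruences \<sigma> A" "\<beta> \<in> congruences \<sigma> A"
    have u: "\<alpha> \<union> \<beta> \<subseteq> carrier A \<times> carrier A" using ab congruenceD(1) by blast
    show "\<exists>Z. Z \<in> congruences \<sigma> A \<and> \<alpha> \<subseteq> Z \<and> \<beta> \<subseteq> Z \<and>
        (\<forall>Y. Y \<in> congruences \<sigma> A \<longrightarrow> \<alpha> \<subseteq> Y \<longrightarrow> \<beta> \<subseteq> Y \<longrightarrow> Z \<subseteq> Y)"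
      using Cg_congruence[OF A u] Cg_least[of \<sigma> A _ "\<alpha> \<union> \<beta>"] hull_subset[of "\<alpha> \<union> \<beta>" "congruence \<sigma> A"]
      by (intro exI[of _ "Cg \<sigma> A (\<alpha> \<union> \<beta>)"]) simp
  qed
  show "has_meets (congruences \<sigma> A)" unfolding has_meets_def
  proof (intro ballI)
    fix \<alpha> \<beta> assume ab: "\<alpha> \<in> congruences \<sigma> A" "\<beta> \<in> congruences \<sigma> A"
    then have "congruence \<sigma> A (\<Inter>{\<alpha>, \<beta>})" by (intro congruence_Inter) auto
    then show "\<exists>Z. Z \<in> congruences \<sigma> A \<and> Z \<subseteq> \<alpha> \<and> Z \<subseteq> \<beta> \<and>
        (\<forall>Y. Y \<in> congruences \<sigma> A \<longrightarrow> Y \<subseteq> \<alpha> \<longrightarrow> Y \<subseteq> \<beta> \<longrightarrow> Y \<subseteq> Z)"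
      by (intro exI[of _ "\<alpha> \<inter> \<beta>"]) simp
  qed
qed

lemma fg_congruences_joins:
  assumes A: "is_algebra \<sigma> A"
  shows "has_joins (fg_congruences \<sigma> A)"
  unfolding has_joins_def
proof (intro ballI)
  fix \<alpha> \<beta> assume "\<alpha> \<in> fg_congruences \<sigma> A" "\<beta> \<in> fg_congruences \<sigma> A"
  then obtain X Y where XY: "\<alpha> = Cg \<sigma> A X" "\<beta> = Cg \<sigma> A Y" "finite X" "finite Y"
    "X \<subseteq> carrier A \<times> carrier A" "Y \<subseteq> carrier A \<times> carrier A" by (auto simp: fg_congruences_def)
  have c: "congruence \<sigma> A \<theta>" if "\<theta> \<in> fg_congruences \<sigma> A" for \<theta>
    using that Cg_congruence[OF A] by (auto simp: fg_congruences_def)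
  have "Cg \<sigma> A (X \<union> Y) \<in> fg_congruences \<sigma> A" unfolding fg_congruences_def using XY by blast
  moreover have "\<alpha> \<subseteq> Cg \<sigma> A (X \<union> Y)" "\<beta> \<subseteq> Cg \<sigma> A (X \<union> Y)" unfolding XY by (auto intro: hull_mono[THEN subsetD])
  moreover have "Cg \<sigma> A (X \<union> Y) \<subseteq> \<theta>" if "\<theta> \<in> fg_congruences \<sigma> A" "\<alpha> \<subseteq> \<theta>" "\<beta> \<subseteq> \<theta>" for \<theta>
    using that XY Cg_least[OF c[OF that(1)]] by auto
  ultimately show "\<exists>Z. Z \<in> fg_congruences \<sigma> A \<and> \<alpha> \<subseteq> Z \<and> \<beta> \<subseteq> Z \<and>
      (\<forall>Y. Y \<in> fg_congruences \<sigma> A \<longrightarrow> \<alpha> \<subseteq> Y \<longrightarrow> \<beta> \<subseteq> Y \<longrightarrow> Z \<subseteq> Y)"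
    by (intro exI[of _ "Cg \<sigma> A (X \<union> Y)"]) simp
qed

lemma fg_congruences_bottom:
  "Cg \<sigma> A {} \<in> fg_congruences \<sigma> A" "\<theta> \<in> fg_congruences \<sigma> A \<Longrightarrow> Cg \<sigma> A {} \<subseteq> \<theta>"
  by (auto simp: fg_congruences_def intro: hull_mono[THEN subsetD])

text \<open>Finite generation becomes a property of the order, so that isomorphisms of congruence
  lattices respect it. For the converse, \<open>\<theta>\<close> is the directed union of the
  congruences generated by its finite subsets, hence equal to one of them.\<close>

lemma fg_congruences_compact:
  assumes A: "is_algebra \<sigma> A" and \<theta>: "congruence \<sigma> A \<theta>"
  shows "\<theta> \<in> fg_congruences \<sigma> A \<longleftrightarrow>
    (\<forall>\<D>\<subseteq>congruences \<sigma> A. directed_sets \<D> \<and> \<theta> \<subseteq> \<Union>\<D> \<longrightarrow> (\<exists>\<delta>\<in>\<D>. \<theta> \<subseteq> \<delta>))"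
proof
  assume "\<theta> \<in> fg_congruences \<sigma> A"
  then obtain X where X: "\<theta> = Cg \<sigma> A X" "finite X" by (auto simp: fg_congruences_def)
  show "\<forall>\<D>\<subseteq>congruences \<sigma> A. directed_sets \<D> \<and> \<theta> \<subseteq> \<Union>\<D> \<longrightarrow> (\<exists>\<delta>\<in>\<D>. \<theta> \<subseteq> \<delta>)"
  proof (intro allI impI, elim conjE)
    fix \<D> assume D: "\<D> \<subseteq> congruences \<sigma> A" "directed_sets \<D>" "\<theta> \<subseteq> \<Union>\<D>"
    have "X \<subseteq> \<Union>\<D>" using D(3) hull_subset[of X "congruence \<sigma> A"] X by auto
    then obtain \<delta> where "\<delta> \<in> \<D>" "X \<subseteq> \<delta>" using directed_finite[OF D(2) X(2)] by auto
    then show "\<exists>\<delta>\<in>\<D>. \<theta> \<subseteq> \<delta>" using D(1) Cg_least X(1) by (intro bexI[of _ \<delta>]) blast+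
  qed
next
  assume c: "\<forall>\<D>\<subseteq>congruences \<sigma> A. directed_sets \<D> \<and> \<theta> \<subseteq> \<Union>\<D> \<longrightarrow> (\<exists>\<delta>\<in>\<D>. \<theta> \<subseteq> \<delta>)"
  let ?D = "{Cg \<sigma> A X | X. finite X \<and> X \<subseteq> \<theta>}"
  have sub: "\<theta> \<subseteq> carrier A \<times> carrier A" using congruenceD(1)[OF \<theta>] .
  have "?D \<subseteq> congruences \<sigma> A" using Cg_congruence[OF A] sub by blast
  moreover have "directed_sets ?D" unfolding directed_sets_def
  proof (intro conjI ballI)
    fix \<alpha> \<beta> assume "\<alpha> \<in> ?D" "\<beta> \<in> ?D"
    then obtain X Y where "\<alpha> = Cg \<sigma> A X" "\<beta> = Cg \<sigma> A Y" "finite X" "finite Y" "X \<subseteq> \<theta>" "Y \<subseteq> \<theta>" by auto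
    then show "\<exists>\<gamma>\<in>?D. \<alpha> \<subseteq> \<gamma> \<and> \<beta> \<subseteq> \<gamma>"
      by (intro bexI[of _ "Cg \<sigma> A (X \<union> Y)"]) (auto intro: hull_mono[THEN subsetD])
  qed auto
  moreover have "\<theta> \<subseteq> \<Union>?D"
  proof
    fix x assume "x \<in> \<theta>"
    then have "Cg \<sigma> A {x} \<in> ?D" by blast
    moreover have "x \<in> Cg \<sigma> A {x}" by (rule hull_inc) simp
    ultimately show "x \<in> \<Union>?D" by blast
  qed
  ultimately obtain \<delta> where "\<delta> \<in> ?D" "\<theta> \<subseteq> \<delta>" using c by meson
  then obtain X where X: "finite X" "X \<subseteq> \<theta>" "\<theta> \<subseteq> Cg \<sigma> A X" by auto
  then have "\<theta> = Cg \<sigma> A X" using Cg_least[OF \<theta>] by blast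
  then show "\<theta> \<in> fg_congruences \<sigma> A" using X sub by (auto simp: fg_congruences_def)
qed

text \<open>Compactness is tested by pulling a directed family of congruences of \<open>B\<close>
  back along the inverse isomorphism.\<close>

lemma order_iso_fg_half:
  assumes A: "is_algebra \<sigma> A" and B: "is_algebra \<tau> B"
    and h: "order_iso h (congruences \<sigma> A) (congruences \<tau> B)" and \<theta>: "\<theta> \<in> fg_congruences \<sigma> A"
  shows "h \<theta> \<in> fg_congruences \<tau> B"
proof -
  let ?g = "the_inv_into (congruences \<sigma> A) h"
  have g: "order_iso ?g (congruences \<tau> B) (congruences \<sigma> A)" by (rule order_iso_inv[OF h])
  have hB: "congruence \<tau> B (h \<alpha>)" if "congruence \<sigma> A \<alpha>" for \<alpha>
    using order_isoD(1)[OF h] that by blast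
  have gA: "congruence \<sigma> A (?g \<alpha>)" if "congruence \<tau> B \<alpha>" for \<alpha>
    using order_isoD(1)[OF g] that by blast
  have hg: "h (?g \<beta>) = \<beta>" if "congruence \<tau> B \<beta>" for \<beta>
    using f_the_inv_into_f[OF order_isoD(4)[OF h]] order_isoD(1)[OF h] that by blast
  have ho: "\<alpha> \<subseteq> \<beta> \<longleftrightarrow> h \<alpha> \<subseteq> h \<beta>" if "congruence \<sigma> A \<alpha>" "congruence \<sigma> A \<beta>" for \<alpha> \<beta>
    using order_isoD(2)[OF h] that by blast
  have go: "\<alpha> \<subseteq> \<beta> \<longleftrightarrow> ?g \<alpha> \<subseteq> ?g \<beta>" if "congruence \<tau> B \<alpha>" "congruence \<tau> B \<beta>" for \<alpha> \<beta>
    using order_isoD(2)[OF g] that by blast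
  have t: "congruence \<sigma> A \<theta>" using \<theta> Cg_congruence[OF A] by (auto simp: fg_congruences_def)
  show ?thesis unfolding fg_congruences_compact[OF B hB[OF t]]
  proof (intro allI impI, elim conjE)
    fix \<D> assume D: "\<D> \<subseteq> congruences \<tau> B" "directed_sets \<D>" "h \<theta> \<subseteq> \<Union>\<D>"
    have cU: "congruence \<tau> B (\<Union>\<D>)" using congruence_directed_Union[OF D(2)] D(1) by blast
    have d': "directed_sets (?g ` \<D>)" unfolding directed_sets_def
    proof (intro conjI ballI)
      show "?g ` \<D> \<noteq> {}" using D(2) by (auto simp: directed_sets_def)
      fix \<alpha> \<beta> assume "\<alpha> \<in> ?g ` \<D>" "\<beta> \<in> ?g ` \<D>"
      then obtain a b where ab: "\<alpha> = ?g a" "\<beta> = ?g b" "a \<in> \<D>" "b \<in> \<D>" by auto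
      then obtain c where c: "c \<in> \<D>" "a \<subseteq> c" "b \<subseteq> c" using D(2) unfolding directed_sets_def by meson
      then have "\<alpha> \<subseteq> ?g c" "\<beta> \<subseteq> ?g c" using go ab D(1) by (metis mem_Collect_eq subsetD)+
      then show "\<exists>C\<in>?g ` \<D>. \<alpha> \<subseteq> C \<and> \<beta> \<subseteq> C" using c by blast
    qed
    have gD: "?g ` \<D> \<subseteq> congruences \<sigma> A" using D(1) gA by blast
    have cU': "congruence \<sigma> A (\<Union>(?g ` \<D>))" using congruence_directed_Union[OF d'] gD by blast
    have "\<Union>\<D> \<subseteq> h (\<Union>(?g ` \<D>))"
    proof (rule Union_least)
      fix \<delta> assume d: "\<delta> \<in> \<D>"
      then have "?g \<delta> \<subseteq> \<Union>(?g ` \<D>)" by blast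
      then have "h (?g \<delta>) \<subseteq> h (\<Union>(?g ` \<D>))" using ho gA D(1) d cU' by blast
      then show "\<delta> \<subseteq> h (\<Union>(?g ` \<D>))" using hg D(1) d by auto
    qed
    then have "h \<theta> \<subseteq> h (\<Union>(?g ` \<D>))" using D(3) by blast
    then have "\<theta> \<subseteq> \<Union>(?g ` \<D>)" using ho t cU' by blast
    then obtain \<delta> where d: "\<delta> \<in> \<D>" "\<theta> \<subseteq> ?g \<delta>"
      using fg_congruences_compact[OF A t] \<theta> gD d' by blast
    then have "h \<theta> \<subseteq> h (?g \<delta>)" using ho t gA D(1) by blast
    then show "\<exists>\<delta>\<in>\<D>. h \<theta> \<subseteq> \<delta>" using hg D(1) d by auto
  qed
qed

lemma order_iso_fg:
  assumes A: "is_algebra \<sigma> A" and B: "is_algebra \<tau> B"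
    and h: "order_iso h (congruences \<sigma> A) (congruences \<tau> B)"
  shows "order_iso h (fg_congruences \<sigma> A) (fg_congruences \<tau> B)"
proof -
  let ?g = "the_inv_into (congruences \<sigma> A) h"
  have sub: "fg_congruences \<sigma> A \<subseteq> congruences \<sigma> A" "fg_congruences \<tau> B \<subseteq> congruences \<tau> B"
    using Cg_congruence[OF A] Cg_congruence[OF B] by (auto simp: fg_congruences_def)
  have "h ` fg_congruences \<sigma> A = fg_congruences \<tau> B"
  proof
    show "h ` fg_congruences \<sigma> A \<subseteq> fg_congruences \<tau> B" using order_iso_fg_half[OF A B h] by blast
    show "fg_congruences \<tau> B \<subseteq> h ` fg_congruences \<sigma> A"
    proof
      fix \<beta> assume b: "\<beta> \<in> fg_congruences \<tau> B"
      have "h (?g \<beta>) = \<beta>" 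
        by (rule f_the_inv_into_f[OF order_isoD(4)[OF h]]) (use order_isoD(1)[OF h] sub(2) b in auto)
      then show "\<beta> \<in> h ` fg_congruences \<sigma> A"
        using order_iso_fg_half[OF B A order_iso_inv[OF h] b] by (metis imageI)
    qed
  qed
  then show ?thesis using h sub unfolding order_iso_def bij_betw_def by (meson inj_on_subset subsetD)
qed

section \<open>Terms and identities under partially defined homomorphisms\<close>

fun tvars :: "'o trm \<Rightarrow> nat set" where
  "tvars (Var n) = {n}"
| "tvars (Op f ts) = (\<Union>t\<in>set ts. tvars t)"

lemma finite_tvars: "finite (tvars t)"
  by (induction t) auto

text \<open>The domain \<open>D\<close> is closed under the operations of \<open>A\<close> but may
  be a proper part of it: the maps into subspace lattices exist on single stages of a directed
  union.\<close>

definition hom_on :: "'o similarity \<Rightarrow> 'a set \<Rightarrow> ('a, 'o) ualg \<Rightarrow> ('b, 'o) ualg \<Rightarrow> ('a \<Rightarrow> 'b) \<Rightarrow> bool" where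
  "hom_on \<sigma> D A B \<phi> \<longleftrightarrow> (\<forall>f xs. \<sigma> f = Some (length xs) \<and> set xs \<subseteq> D \<longrightarrow>
     opn A f xs \<in> D \<and> \<phi> (opn A f xs) = opn B f (map \<phi> xs))"

lemma trm_value_hom:
  assumes h: "hom_on \<sigma> D A B \<phi>"
  shows "trm_ok \<sigma> t \<Longrightarrow> (\<And>k. k \<in> tvars t \<Longrightarrow> \<rho> k \<in> D \<and> \<rho>' k = \<phi> (\<rho> k)) \<Longrightarrow>
     trm_value A \<rho> t \<in> D \<and> \<phi> (trm_value A \<rho> t) = trm_value B \<rho>' t"
proof (induction t)
  case (Op f ts)
  have IH: "trm_value A \<rho> t \<in> D \<and> \<phi> (trm_value A \<rho> t) = trm_value B \<rho>' t" if "t \<in> set ts" for t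
    using Op that by auto
  let ?xs = "map (trm_value A \<rho>) ts"
  have "opn A f ?xs \<in> D \<and> \<phi> (opn A f ?xs) = opn B f (map \<phi> ?xs)"
    using h Op.prems(1) IH unfolding hom_on_def by (auto dest!: spec[of _ f] spec[of _ ?xs])
  moreover have "map \<phi> ?xs = map (trm_value B \<rho>') ts" using IH by auto
  ultimately show ?case unfolding trm_value.simps by metis
qed auto

text \<open>Two terms have finitely many variables, so one subalgebra \<open>D\<close> containing
  their values decides an assignment; \<open>D\<close> and its separating maps may depend on the
  assignment. The predicate \<open>\<Phi>\<close> lists maps together with their targets, which
  vary.\<close>

lemma satisfies_by_homs:
  fixes A :: "('a, 'o) ualg"
  assumes ok: "trm_ok \<sigma> s" "trm_ok \<sigma> t"
    and sep: "\<And>\<rho>. range \<rho> \<subseteq> carrier A \<Longrightarrow>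
      \<exists>D (\<Phi> :: ('a \<Rightarrow> 'b) \<Rightarrow> ('b, 'o) ualg \<Rightarrow> bool). D \<noteq> {} \<and> \<rho> ` (tvars s \<union> tvars t) \<subseteq> D \<and>
      (\<forall>\<phi> B. \<Phi> \<phi> B \<longrightarrow> hom_on \<sigma> D A B \<phi> \<and> \<phi> ` D \<subseteq> carrier B \<and> satisfies B (s, t)) \<and>
      (\<forall>x\<in>D. \<forall>y\<in>D. (\<forall>\<phi> B. \<Phi> \<phi> B \<longrightarrow> \<phi> x = \<phi> y) \<longrightarrow> x = y) \<and>
      hom_on \<sigma> D A A (\<lambda>x. x)"
  shows "satisfies A (s, t)"
  unfolding satisfies_def
proof (intro allI impI)
  fix \<rho> :: "nat \<Rightarrow> 'a" assume "range \<rho> \<subseteq> carrier A"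
  from sep[OF this]
  show "trm_value A \<rho> (fst (s, t)) = trm_value A \<rho> (snd (s, t))"
  proof (elim exE conjE)
    fix D and \<Phi> :: "('a \<Rightarrow> 'b) \<Rightarrow> ('b, 'o) ualg \<Rightarrow> bool"
    assume D: "D \<noteq> {}" "\<rho> ` (tvars s \<union> tvars t) \<subseteq> D"
      and D3: "\<forall>\<phi> B. \<Phi> \<phi> B \<longrightarrow> hom_on \<sigma> D A B \<phi> \<and> \<phi> ` D \<subseteq> carrier B \<and> satisfies B (s, t)"
      and D4: "\<forall>x\<in>D. \<forall>y\<in>D. (\<forall>\<phi> B. \<Phi> \<phi> B \<longrightarrow> \<phi> x = \<phi> y) \<longrightarrow> x = y"
      and D5: "hom_on \<sigma> D A A (\<lambda>x. x)"
    obtain d where d: "d \<in> D" using D(1) by blast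
    have "trm_value A \<rho> s = trm_value A \<rho> t"
    proof (rule D4[rule_format])
      from trm_value_hom[OF D5, of _ \<rho> \<rho>] ok D(2)
      show "trm_value A \<rho> s \<in> D" "trm_value A \<rho> t \<in> D" by auto
    next
      fix \<phi> B assume "\<Phi> \<phi> B"
      then have p: "hom_on \<sigma> D A B \<phi>" "\<phi> ` D \<subseteq> carrier B" "satisfies B (s, t)" using D3 by auto
      \<comment> \<open>Assignments are total: variables outside both terms receive the image of an
        arbitrary \<open>d\<close>, since \<open>\<rho>\<close> may leave \<open>D\<close>
        there.\<close>
      define \<rho>' where "\<rho>' = (\<lambda>k. if k \<in> tvars s \<union> tvars t then \<phi> (\<rho> k) else \<phi> d)"
      have "range \<rho>' \<subseteq> carrier B" using D(2) p(2) d by (auto simp: \<rho>'_def)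
      then have "trm_value B \<rho>' s = trm_value B \<rho>' t" using p(3) by (simp add: satisfies_def)
      moreover have c: "\<rho> k \<in> D \<and> \<rho>' k = \<phi> (\<rho> k)" if "k \<in> tvars s \<union> tvars t" for k
        using D(2) that by (auto simp: \<rho>'_def)
      ultimately have "trm_value B \<rho>' s = trm_value B \<rho>' t" by blast
      moreover have "\<phi> (trm_value A \<rho> s) = trm_value B \<rho>' s" "\<phi> (trm_value A \<rho> t) = trm_value B \<rho>' t"
        using trm_value_hom[OF p(1) ok(1), of \<rho> \<rho>'] trm_value_hom[OF p(1) ok(2), of \<rho> \<rho>'] c by blast+
      ultimately show "\<phi> (trm_value A \<rho> s) = \<phi> (trm_value A \<rho> t)" by simp
    qed
    then show ?thesis by simp
  qed
qed


section \<open>Congruences of the two lattice operations, and of directed unions\<close>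

definition cong2 :: "'a set \<Rightarrow> ('a \<Rightarrow> 'a \<Rightarrow> 'a) \<Rightarrow> ('a \<Rightarrow> 'a \<Rightarrow> 'a) \<Rightarrow> ('a \<times> 'a) set \<Rightarrow> bool" where
  "cong2 C jn mt \<theta> \<longleftrightarrow> equiv C \<theta> \<and>
     (\<forall>x y z w. (x, y) \<in> \<theta> \<and> (z, w) \<in> \<theta> \<longrightarrow> (jn x z, jn y w) \<in> \<theta> \<and> (mt x z, mt y w) \<in> \<theta>)"

lemma cong2D:
  assumes "cong2 C jn mt \<theta>"
  shows "x \<in> C \<Longrightarrow> (x, x) \<in> \<theta>" "sym \<theta>" "trans \<theta>" "\<theta> \<subseteq> C \<times> C"
    "(a, b) \<in> \<theta> \<Longrightarrow> (c, d) \<in> \<theta> \<Longrightarrow> (jn a c, jn b d) \<in> \<theta> \<and> (mt a c, mt b d) \<in> \<theta>"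
  using assms by (auto simp: cong2_def equiv_def refl_on_def)

lemma cong2_interval_iff:
  assumes \<theta>: "cong2 C jn mt \<theta>" and C: "x \<in> C" "y \<in> C" "jn x y \<in> C" "mt x y \<in> C"
    and idem: "jn x x = x" "jn y y = y" "mt x x = x" "mt y y = y"
    and ab: "jn x (mt x y) = x" "jn y (mt x y) = y" "jn x (jn x y) = jn x y" "jn y (jn x y) = jn x y"
  shows "(x, y) \<in> \<theta> \<longleftrightarrow> (mt x y, jn x y) \<in> \<theta>"
proof -
  note r = cong2D(1)[OF \<theta>] and c = cong2D(5)[OF \<theta>] and sy = cong2D(2)[OF \<theta>] and tr = cong2D(3)[OF \<theta>]
  show ?thesis
  proof
    assume a: "(x, y) \<in> \<theta>"
    have "(jn x y, y) \<in> \<theta>" "(mt x y, y) \<in> \<theta>" using c[OF a r[OF C(2)]] idem by simp_all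
    then show "(mt x y, jn x y) \<in> \<theta>" using sy tr by (meson symD transD)
  next
    assume a: "(mt x y, jn x y) \<in> \<theta>"
    have "(x, jn x y) \<in> \<theta>" "(y, jn x y) \<in> \<theta>" using c[OF r[OF C(1)] a] c[OF r[OF C(2)] a] ab by simp_all
    then show "(x, y) \<in> \<theta>" using sy tr by (meson symD transD)
  qed
qed

definition system_ideals ::
    "'i set \<Rightarrow> ('i \<Rightarrow> 'i \<Rightarrow> bool) \<Rightarrow> ('i \<Rightarrow> 's set) \<Rightarrow> ('i \<Rightarrow> 'i \<Rightarrow> 's \<Rightarrow> 's \<Rightarrow> bool) \<Rightarrow> ('i \<times> 's) set set" where
  "system_ideals I lq S R = {J. J \<subseteq> Sigma I S \<and>
     (\<forall>i\<in>I. \<forall>j\<in>I. \<forall>s\<in>S i. lq i j \<longrightarrow>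
        ((i, s) \<in> J \<longleftrightarrow> (\<forall>t\<in>S j. R i j s t \<longrightarrow> (j, t) \<in> J)))}"

text \<open>Each stage \<open>K i\<close> carries congruences \<open>\<psi> i s\<close> such that
  the witness of \<open>s\<close> lies in all of them but its own. A congruence is coded at stage
  \<open>i\<close> by the set of those \<open>s\<close> whose witness it collapses, and
  \<open>R\<close> relates the codes at different stages. The codes form
  \<open>system_ideals\<close>, in which the lattice itself no longer occurs: two lattices with the
  same \<open>I\<close>, \<open>lq\<close>, \<open>S\<close> and \<open>R\<close> have isomorphic
  congruence lattices.\<close>

locale congruence_system =
  fixes C :: "'a set" and jn mt :: "'a \<Rightarrow> 'a \<Rightarrow> 'a"
    and I :: "'i set" and lq :: "'i \<Rightarrow> 'i \<Rightarrow> bool" and K :: "'i \<Rightarrow> 'a set"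
    and S :: "'i \<Rightarrow> 's set" and R :: "'i \<Rightarrow> 'i \<Rightarrow> 's \<Rightarrow> 's \<Rightarrow> bool"
    and \<psi> :: "'i \<Rightarrow> 's \<Rightarrow> ('a \<times> 'a) set" and wit :: "'i \<Rightarrow> 's \<Rightarrow> 'a \<times> 'a"
  assumes nonempty: "I \<noteq> {}"
    and directed: "\<lbrakk>i \<in> I; j \<in> I\<rbrakk> \<Longrightarrow> \<exists>k\<in>I. lq i k \<and> lq j k"
    and union: "C = (\<Union>i\<in>I. K i)"
    and mono: "\<lbrakk>i \<in> I; j \<in> I; lq i j\<rbrakk> \<Longrightarrow> K i \<subseteq> K j"
    and jn_closed: "\<lbrakk>i \<in> I; x \<in> K i; y \<in> K i\<rbrakk> \<Longrightarrow> jn x y \<in> K i"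
    and mt_closed: "\<lbrakk>i \<in> I; x \<in> K i; y \<in> K i\<rbrakk> \<Longrightarrow> mt x y \<in> K i"
    and cong: "\<lbrakk>i \<in> I; s \<in> S i\<rbrakk> \<Longrightarrow> cong2 (K i) jn mt (\<psi> i s)"
    and restrict: "\<lbrakk>i \<in> I; j \<in> I; lq i j; t \<in> S j; x \<in> K i; y \<in> K i\<rbrakk> \<Longrightarrow>
       (x, y) \<in> \<psi> j t \<longleftrightarrow> (\<forall>s\<in>S i. R i j s t \<longrightarrow> (x, y) \<in> \<psi> i s)"
    and wit_in: "\<lbrakk>i \<in> I; s \<in> S i\<rbrakk> \<Longrightarrow> wit i s \<in> K i \<times> K i"
    and wit_iff: "\<lbrakk>i \<in> I; s \<in> S i; t \<in> S i\<rbrakk> \<Longrightarrow> wit i s \<in> \<psi> i t \<longleftrightarrow> t \<noteq> s"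
    and determined: "\<lbrakk>cong2 C jn mt \<theta>; i \<in> I; x \<in> K i; y \<in> K i\<rbrakk> \<Longrightarrow>
       (x, y) \<in> \<theta> \<longleftrightarrow> (\<forall>s\<in>S i. (x, y) \<notin> \<psi> i s \<longrightarrow> wit i s \<in> \<theta>)"
begin

definition ideal_of :: "('a \<times> 'a) set \<Rightarrow> ('i \<times> 's) set" where
  "ideal_of \<theta> = {(i, s). i \<in> I \<and> s \<in> S i \<and> wit i s \<in> \<theta>}"

text \<open>This is the congruence of \<open>K i\<close> coded by the part of \<open>J\<close> at
  stage \<open>i\<close>.\<close>

definition local_le :: "('i \<times> 's) set \<Rightarrow> 'i \<Rightarrow> 'a \<Rightarrow> 'a \<Rightarrow> bool" where
  "local_le J i x y \<longleftrightarrow> (\<forall>s\<in>S i. (x, y) \<notin> \<psi> i s \<longrightarrow> (i, s) \<in> J)"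

definition cong_of :: "('i \<times> 's) set \<Rightarrow> ('a \<times> 'a) set" where
  "cong_of J = {(x, y). \<exists>i\<in>I. x \<in> K i \<and> y \<in> K i \<and> local_le J i x y}"

lemma ideal_of_in:
  assumes "cong2 C jn mt \<theta>"
  shows "ideal_of \<theta> \<in> system_ideals I lq S R"
proof -
  have "(i, s) \<in> ideal_of \<theta> \<longleftrightarrow> (\<forall>t\<in>S j. R i j s t \<longrightarrow> (j, t) \<in> ideal_of \<theta>)"
    if i: "i \<in> I" and j: "j \<in> I" and s: "s \<in> S i" and l: "lq i j" for i j s
  proof -
    obtain a b where ab: "wit i s = (a, b)" by fastforce
    have aK: "a \<in> K i" "b \<in> K i" using wit_in[OF i s] ab by auto
    \<comment> \<open>On \<open>K i\<close>, \<open>\<psi> j t\<close> is the intersection of the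
      \<open>\<psi> i s'\<close> related to \<open>t\<close>, and the witness of \<open>s\<close>
      lies in each of these except \<open>\<psi> i s\<close>.\<close>
    have 1: "(a, b) \<in> \<psi> j t \<longleftrightarrow> \<not> R i j s t" if t: "t \<in> S j" for t
      using restrict[OF i j l t aK] wit_iff[OF i s] ab s by auto
    have "(a, b) \<in> \<theta> \<longleftrightarrow> (\<forall>t\<in>S j. (a, b) \<notin> \<psi> j t \<longrightarrow> wit j t \<in> \<theta>)"
      using determined[OF assms j] mono[OF i j l] aK by blast
    then show ?thesis using 1 ab i j s by (auto simp: ideal_of_def)
  qed
  then show ?thesis by (auto simp: system_ideals_def ideal_of_def)
qed

text \<open>Once \<open>restrict\<close> expresses the later congruences through stage
  \<open>i\<close>, the condition defining \<open>system_ideals\<close> is exactly agreement on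
  \<open>K i\<close> of the congruences coded at \<open>i\<close> and at \<open>j\<close>.\<close>

lemma local_le_transfer:
  assumes J: "J \<in> system_ideals I lq S R"
    and i: "i \<in> I" and j: "j \<in> I" and l: "lq i j" and x: "x \<in> K i" "y \<in> K i"
  shows "local_le J i x y \<longleftrightarrow> local_le J j x y"
proof -
  have 1: "(i, s) \<in> J \<longleftrightarrow> (\<forall>t\<in>S j. R i j s t \<longrightarrow> (j, t) \<in> J)" if "s \<in> S i" for s
    using J i j l that by (auto simp: system_ideals_def)
  have 2: "(x, y) \<notin> \<psi> j t \<longleftrightarrow> (\<exists>s\<in>S i. R i j s t \<and> (x, y) \<notin> \<psi> i s)" if t: "t \<in> S j" for t
    using restrict[OF i j l t x] by blast
  show ?thesis unfolding local_le_def using 1 2 by blast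
qed

text \<open>Directedness leads from the stage that witnesses membership to any other stage
  containing the pair.\<close>

lemma cong_of_iff:
  assumes J: "J \<in> system_ideals I lq S R" and i: "i \<in> I" and x: "x \<in> K i" "y \<in> K i"
  shows "(x, y) \<in> cong_of J \<longleftrightarrow> local_le J i x y"
proof
  assume "(x, y) \<in> cong_of J"
  then obtain j where j: "j \<in> I" "x \<in> K j" "y \<in> K j" "local_le J j x y"
    by (auto simp: cong_of_def)
  obtain k where k: "k \<in> I" "lq i k" "lq j k" using directed i j by blast
  then show "local_le J i x y"
    using local_le_transfer[OF J i k(1,2) x] local_le_transfer[OF J j(1) k(1,3) j(2,3)] j(4) by blast
qed (use i x in \<open>auto simp: cong_of_def\<close>)

lemma common_index:
  assumes "finite X" "X \<subseteq> C"
  shows "\<exists>i\<in>I. X \<subseteq> K i"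
  using assms
proof (induction X rule: finite_induct)
  case empty
  then show ?case using nonempty by auto
next
  case (insert x X)
  then obtain i j where ij: "i \<in> I" "X \<subseteq> K i" "j \<in> I" "x \<in> K j" using union by auto
  then obtain k where k: "k \<in> I" "lq i k" "lq j k" using directed by blast
  then have "insert x X \<subseteq> K k" using ij mono[of i k] mono[of j k] by auto
  then show ?case using k by blast
qed

lemma cong_of_cong:
  assumes J: "J \<in> system_ideals I lq S R"
  shows "cong2 C jn mt (cong_of J)"
proof -
  have sub: "cong_of J \<subseteq> C \<times> C" by (auto simp: cong_of_def union)
  have eq: "equiv (K i) (\<psi> i s)" if "i \<in> I" "s \<in> S i" for i s
    using cong that by (auto simp: cong2_def)
  have "refl_on C (cong_of J)"
  proof (intro refl_onI)
    fix x assume "x \<in> C"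
    then obtain i where i: "i \<in> I" "x \<in> K i" using union by auto
    have "local_le J i x x" using eq[OF i(1)] i(2) by (auto simp: local_le_def equiv_def refl_on_def)
    then show "(x, x) \<in> cong_of J" using i by (auto simp: cong_of_def)
  qed
  moreover have "sym (cong_of J)"
  proof (intro symI)
    fix x y assume "(x, y) \<in> cong_of J"
    then obtain i where i: "i \<in> I" "x \<in> K i" "y \<in> K i" "local_le J i x y"
      by (auto simp: cong_of_def)
    have "local_le J i y x" using eq[OF i(1)] i(4) by (auto simp: local_le_def equiv_def sym_def)
    then show "(y, x) \<in> cong_of J" using i by (auto simp: cong_of_def)
  qed
  moreover have "trans (cong_of J)"
  proof (intro transI)
    fix x y z assume a: "(x, y) \<in> cong_of J" "(y, z) \<in> cong_of J"
    then have "{x, y, z} \<subseteq> C" using sub by auto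
    then obtain i where i: "i \<in> I" "{x, y, z} \<subseteq> K i" using common_index[of "{x, y, z}"] by auto
    then have "local_le J i x y" "local_le J i y z" using a cong_of_iff[OF J i(1)] by auto
    then have "local_le J i x z" unfolding local_le_def using eq[OF i(1)]
      by (meson equiv_def transE)
    then show "(x, z) \<in> cong_of J" using i by (auto simp: cong_of_def)
  qed
  moreover have "(jn x z, jn y w) \<in> cong_of J \<and> (mt x z, mt y w) \<in> cong_of J"
    if a: "(x, y) \<in> cong_of J" "(z, w) \<in> cong_of J" for x y z w
  proof -
    have "{x, y, z, w} \<subseteq> C" using a sub by auto
    then obtain i where i: "i \<in> I" "{x, y, z, w} \<subseteq> K i"
      using common_index[of "{x, y, z, w}"] by auto
    then have l: "local_le J i x y" "local_le J i z w" using a cong_of_iff[OF J i(1)] by auto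
    have "(jn x z, jn y w) \<in> \<psi> i s \<and> (mt x z, mt y w) \<in> \<psi> i s"
      if "s \<in> S i" "(x, y) \<in> \<psi> i s" "(z, w) \<in> \<psi> i s" for s
      using cong[OF i(1) that(1)] that by (auto simp: cong2_def)
    then have "local_le J i (jn x z) (jn y w)" "local_le J i (mt x z) (mt y w)"
      using l unfolding local_le_def by meson+
    moreover have "{jn x z, jn y w, mt x z, mt y w} \<subseteq> K i"
      using i jn_closed[OF i(1)] mt_closed[OF i(1)] by auto
    ultimately show ?thesis using i(1) unfolding cong_of_def by blast
  qed
  ultimately show ?thesis using sub by (auto simp: cong2_def equiv_def)
qed

lemma ideal_of_cong_of:
  assumes J: "J \<in> system_ideals I lq S R"
  shows "ideal_of (cong_of J) = J"
proof -
  have "wit i s \<in> cong_of J \<longleftrightarrow> (i, s) \<in> J" if i: "i \<in> I" and s: "s \<in> S i" for i s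
  proof -
    obtain a b where ab: "wit i s = (a, b)" by fastforce
    have aK: "a \<in> K i" "b \<in> K i" using wit_in[OF i s] ab by auto
    then show ?thesis using cong_of_iff[OF J i aK] ab wit_iff[OF i s] s
      by (auto simp: local_le_def)
  qed
  then show ?thesis using J by (auto simp: ideal_of_def system_ideals_def)
qed

lemma ideal_of_subset_iff:
  assumes "cong2 C jn mt \<theta>" "cong2 C jn mt \<theta>'"
  shows "ideal_of \<theta> \<subseteq> ideal_of \<theta>' \<longleftrightarrow> \<theta> \<subseteq> \<theta>'"
proof
  assume s: "ideal_of \<theta> \<subseteq> ideal_of \<theta>'"
  show "\<theta> \<subseteq> \<theta>'"
  proof clarify
    fix x y assume xy: "(x, y) \<in> \<theta>"
    then have "{x, y} \<subseteq> C" using assms(1) by (auto simp: cong2_def equiv_def)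
    then obtain i where i: "i \<in> I" "{x, y} \<subseteq> K i" using common_index[of "{x, y}"] by auto
    then show "(x, y) \<in> \<theta>'"
      using determined[OF assms(1) i(1), of x y] determined[OF assms(2) i(1), of x y] xy s
      by (auto simp: ideal_of_def)
  qed
qed (auto simp: ideal_of_def)

lemma ideal_of_bij:
  "bij_betw ideal_of {\<theta>. cong2 C jn mt \<theta>} (system_ideals I lq S R)"
proof (rule bij_betw_imageI)
  show "inj_on ideal_of {\<theta>. cong2 C jn mt \<theta>}"
    by (rule inj_onI) (metis ideal_of_subset_iff mem_Collect_eq subset_antisym order_refl)
  show "ideal_of ` {\<theta>. cong2 C jn mt \<theta>} = system_ideals I lq S R"
    using ideal_of_in cong_of_cong ideal_of_cong_of by (auto simp: image_iff) metis
qed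

end


section \<open>Modular lattices of finite length\<close>

locale finite_length_modular =
  fixes C :: "'a set" and jn mt :: "'a \<Rightarrow> 'a \<Rightarrow> 'a"
  assumes nonempty: "C \<noteq> {}"
    and jn_closed: "\<lbrakk>x \<in> C; y \<in> C\<rbrakk> \<Longrightarrow> jn x y \<in> C"
    and mt_closed: "\<lbrakk>x \<in> C; y \<in> C\<rbrakk> \<Longrightarrow> mt x y \<in> C"
    and jn_comm: "\<lbrakk>x \<in> C; y \<in> C\<rbrakk> \<Longrightarrow> jn x y = jn y x"
    and mt_comm: "\<lbrakk>x \<in> C; y \<in> C\<rbrakk> \<Longrightarrow> mt x y = mt y x"
    and jn_assoc: "\<lbrakk>x \<in> C; y \<in> C; z \<in> C\<rbrakk> \<Longrightarrow> jn (jn x y) z = jn x (jn y z)"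
    and mt_assoc: "\<lbrakk>x \<in> C; y \<in> C; z \<in> C\<rbrakk> \<Longrightarrow> mt (mt x y) z = mt x (mt y z)"
    and jn_absorb: "\<lbrakk>x \<in> C; y \<in> C\<rbrakk> \<Longrightarrow> jn x (mt x y) = x"
    and mt_absorb: "\<lbrakk>x \<in> C; y \<in> C\<rbrakk> \<Longrightarrow> mt x (jn x y) = x"
    and modular: "\<lbrakk>x \<in> C; y \<in> C; z \<in> C; jn x z = z\<rbrakk> \<Longrightarrow> jn x (mt y z) = mt (jn x y) z"
    and bounded: "\<exists>N. \<forall>D\<subseteq>C. finite D \<and> (\<forall>x\<in>D. \<forall>y\<in>D. jn x y = y \<or> jn y x = x) \<longrightarrow> card D \<le> N"
begin

abbreviation leq (infix "\<preceq>" 50) where "x \<preceq> y \<equiv> jn x y = y"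

lemma leq_refl: "x \<in> C \<Longrightarrow> x \<preceq> x"
  by (metis jn_absorb mt_absorb jn_closed)
lemma leq_mt: "\<lbrakk>x \<in> C; y \<in> C\<rbrakk> \<Longrightarrow> x \<preceq> y \<longleftrightarrow> mt x y = x"
  by (metis jn_absorb mt_absorb jn_comm mt_comm)
lemma leq_antisym: "\<lbrakk>x \<in> C; y \<in> C; x \<preceq> y; y \<preceq> x\<rbrakk> \<Longrightarrow> x = y"
  by (metis jn_comm)
lemma leq_trans: "\<lbrakk>x \<in> C; y \<in> C; z \<in> C; x \<preceq> y; y \<preceq> z\<rbrakk> \<Longrightarrow> x \<preceq> z"
  by (metis jn_assoc)
lemma jn_upper1: "\<lbrakk>x \<in> C; y \<in> C\<rbrakk> \<Longrightarrow> x \<preceq> jn x y"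
  by (metis jn_assoc leq_refl)
lemma jn_upper2: "\<lbrakk>x \<in> C; y \<in> C\<rbrakk> \<Longrightarrow> y \<preceq> jn x y"
  by (metis jn_upper1 jn_comm)
lemma jn_least: "\<lbrakk>x \<in> C; y \<in> C; z \<in> C; x \<preceq> z; y \<preceq> z\<rbrakk> \<Longrightarrow> jn x y \<preceq> z"
  by (metis jn_assoc)
lemma mt_lower1: "\<lbrakk>x \<in> C; y \<in> C\<rbrakk> \<Longrightarrow> mt x y \<preceq> x"
  by (metis jn_absorb jn_comm mt_closed)
lemma mt_lower2: "\<lbrakk>x \<in> C; y \<in> C\<rbrakk> \<Longrightarrow> mt x y \<preceq> y"
  by (metis mt_lower1 mt_comm)
lemma mt_greatest: "\<lbrakk>x \<in> C; y \<in> C; z \<in> C; z \<preceq> x; z \<preceq> y\<rbrakk> \<Longrightarrow> z \<preceq> mt x y"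
  by (metis leq_mt mt_assoc mt_closed)

lemma leq_jnI1: "\<lbrakk>a \<in> C; b \<in> C; c \<in> C; a \<preceq> b\<rbrakk> \<Longrightarrow> a \<preceq> jn b c"
  using leq_trans[of a b "jn b c"] jn_upper1 jn_closed by blast
lemma leq_jnI2: "\<lbrakk>a \<in> C; b \<in> C; c \<in> C; a \<preceq> c\<rbrakk> \<Longrightarrow> a \<preceq> jn b c"
  using leq_trans[of a c "jn b c"] jn_upper2 jn_closed by blast
lemma mt_leqI1: "\<lbrakk>a \<in> C; b \<in> C; c \<in> C; b \<preceq> a\<rbrakk> \<Longrightarrow> mt b c \<preceq> a"
  using leq_trans[of "mt b c" b a] mt_lower1 mt_closed by blast
lemma mt_leqI2: "\<lbrakk>a \<in> C; b \<in> C; c \<in> C; c \<preceq> a\<rbrakk> \<Longrightarrow> mt b c \<preceq> a"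
  using leq_trans[of "mt b c" c a] mt_lower2 mt_closed by blast

lemma no_infinite_chain:
  fixes f :: "nat \<Rightarrow> 'a"
  assumes "\<And>i. f i \<in> C" "inj f" "\<And>i j. i \<le> j \<Longrightarrow> f i \<preceq> f j \<or> f j \<preceq> f i"
  shows False
proof -
  obtain N where N: "\<And>D. \<lbrakk>D \<subseteq> C; finite D; \<forall>x\<in>D. \<forall>y\<in>D. jn x y = y \<or> jn y x = x\<rbrakk> \<Longrightarrow> card D \<le> N"
    using bounded by meson
  have "card (f ` {..N}) \<le> N"
    by (rule N) (use assms nat_le_linear in \<open>auto, metis\<close>)
  moreover have "card (f ` {..N}) = Suc N"
    using assms(2) by (subst card_image) (auto intro: inj_on_subset)
  ultimately show False by simp
qed

definition below :: "('a \<times> 'a) set" where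
  "below = {(x, y). x \<in> C \<and> y \<in> C \<and> x \<preceq> y \<and> x \<noteq> y}"

lemma below_trans: "trans below"
  unfolding below_def trans_def using leq_trans leq_antisym by blast

lemma wf_below: "wf below"
proof (rule ccontr)
  assume "\<not> wf below"
  then obtain f where f: "\<And>i. (f (Suc i), f i) \<in> below"
    unfolding wf_iff_no_infinite_down_chain by blast
  have lt: "(f j, f i) \<in> below" if "i < j" for i j using that
    by (induction j) (use f below_trans in \<open>auto simp: less_Suc_eq dest: transD\<close>)
  show False
  proof (rule no_infinite_chain[of f])
    show "f i \<in> C" for i using f[of i] by (auto simp: below_def)
    show "inj f" using lt by (intro injI) (metis (mono_tags, lifting) below_def case_prodD linorder_neqE_nat mem_Collect_eq)
    show "f i \<preceq> f j \<or> f j \<preceq> f i" if "i \<le> j" for i j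
      using lt[of i j] that f[of i] by (cases "i = j") (auto simp: below_def leq_refl)
  qed
qed

lemma wf_above: "wf (below\<inverse>)"
proof (rule ccontr)
  assume "\<not> wf (below\<inverse>)"
  then obtain f where f: "\<And>i. (f i, f (Suc i)) \<in> below"
    unfolding wf_iff_no_infinite_down_chain by blast
  have lt: "(f i, f j) \<in> below" if "i < j" for i j using that
    by (induction j) (use f below_trans in \<open>auto simp: less_Suc_eq dest: transD\<close>)
  show False
  proof (rule no_infinite_chain[of f])
    show "f i \<in> C" for i using f[of i] by (auto simp: below_def)
    show "inj f" using lt by (intro injI) (metis (mono_tags, lifting) below_def case_prodD linorder_neqE_nat mem_Collect_eq)
    show "f i \<preceq> f j \<or> f j \<preceq> f i" if "i \<le> j" for i j
      using lt[of i j] that f[of i] by (cases "i = j") (auto simp: below_def leq_refl)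
  qed
qed

lemma ex_bot: "\<exists>b\<in>C. \<forall>x\<in>C. b \<preceq> x"
proof -
  obtain b where b: "b \<in> C" "\<And>y. (y, b) \<in> below \<Longrightarrow> y \<notin> C"
    using wfE_min[OF wf_below] nonempty by (metis ex_in_conv)
  have "b \<preceq> x" if x: "x \<in> C" for x
  proof -
    have "mt b x = b" using b(1) b(2)[of "mt b x"] x mt_closed mt_lower1 by (auto simp: below_def)
    then show ?thesis using leq_mt b(1) x by simp
  qed
  then show ?thesis using b(1) by blast
qed

lemma ex_top: "\<exists>b\<in>C. \<forall>x\<in>C. x \<preceq> b"
proof -
  obtain b where b: "b \<in> C" "\<And>y. (y, b) \<in> below\<inverse> \<Longrightarrow> y \<notin> C"
    using wfE_min[OF wf_above] nonempty by (metis ex_in_conv)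
  have "x \<preceq> b" if x: "x \<in> C" for x
  proof -
    have "jn b x = b" using b(1) b(2)[of "jn b x"] x jn_closed jn_upper1[of b x] by (fastforce simp: below_def)
    then show ?thesis using jn_comm b(1) x by simp
  qed
  then show ?thesis using b(1) by blast
qed

definition bot where "bot = (SOME b. b \<in> C \<and> (\<forall>x\<in>C. b \<preceq> x))"
definition top where "top = (SOME b. b \<in> C \<and> (\<forall>x\<in>C. x \<preceq> b))"

lemma bot: "bot \<in> C" "x \<in> C \<Longrightarrow> bot \<preceq> x"
  using someI_ex[of "\<lambda>b. b \<in> C \<and> (\<forall>x\<in>C. b \<preceq> x)"] ex_bot by (auto simp: bot_def)
lemma top: "top \<in> C" "x \<in> C \<Longrightarrow> x \<preceq> top"
  using someI_ex[of "\<lambda>b. b \<in> C \<and> (\<forall>x\<in>C. x \<preceq> b)"] ex_top by (auto simp: top_def)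

definition cov :: "'a \<Rightarrow> 'a \<Rightarrow> bool" where
  "cov a b \<longleftrightarrow> a \<in> C \<and> b \<in> C \<and> a \<preceq> b \<and> a \<noteq> b \<and> (\<forall>x\<in>C. a \<preceq> x \<and> x \<preceq> b \<longrightarrow> x = a \<or> x = b)"

lemma cov_between: "\<lbrakk>cov a b; x \<in> C; a \<preceq> x; x \<preceq> b\<rbrakk> \<Longrightarrow> x = a \<or> x = b"
  by (simp add: cov_def)

text \<open>Saturated chains, remembered only by their length \<open>n\<close> and by the total
  weight \<open>k\<close> of their prime intervals.\<close>

inductive path :: "('a \<times> 'a \<Rightarrow> nat) \<Rightarrow> nat \<Rightarrow> 'a \<Rightarrow> 'a \<Rightarrow> nat \<Rightarrow> bool" for w where
  Nil: "a \<in> C \<Longrightarrow> path w 0 a a 0"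
| Step: "cov a c \<Longrightarrow> path w n c b k \<Longrightarrow> path w (Suc n) a b (w (a, c) + k)"

lemma path_in: "path w n a b k \<Longrightarrow> a \<in> C \<and> b \<in> C \<and> a \<preceq> b"
  by (induction rule: path.induct) (auto simp: leq_refl cov_def intro: leq_trans)

lemma path_same: "path w n a a k \<Longrightarrow> n = 0 \<and> k = 0"
proof (erule path.cases)
  fix a' c n' b k' assume h: "n = Suc n'" "a = a'" "a = b" "cov a' c" "path w n' c b k'"
  then have "c \<preceq> a" using path_in[OF h(5)] by auto
  then show "n = 0 \<and> k = 0" using h leq_antisym[of a c] by (auto simp: cov_def)
qed auto

lemma ex_cover:
  assumes "a \<in> C" "b \<in> C" "a \<preceq> b" "a \<noteq> b"
  shows "\<exists>c. cov a c \<and> c \<preceq> b"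
proof -
  let ?Q = "{x \<in> C. a \<preceq> x \<and> a \<noteq> x \<and> x \<preceq> b}"
  have "b \<in> ?Q" using assms leq_refl by auto
  then obtain c where c: "c \<in> ?Q" "\<And>y. (y, c) \<in> below \<Longrightarrow> y \<notin> ?Q"
    using wfE_min[OF wf_below, of b ?Q] by blast
  have "x = a \<or> x = c" if x: "x \<in> C" "a \<preceq> x" "x \<preceq> c" for x
  proof (rule ccontr)
    assume n: "\<not> (x = a \<or> x = c)"
    then have "(x, c) \<in> below" using x c(1) by (auto simp: below_def)
    moreover have "x \<in> ?Q" using x n c(1) assms leq_trans[of x c b] by auto
    ultimately show False using c(2) by blast
  qed
  then show ?thesis using c(1) assms(1) by (intro exI[of _ c]) (auto simp: cov_def)
qed

lemma ex_path: "a \<in> C \<Longrightarrow> b \<in> C \<Longrightarrow> a \<preceq> b \<Longrightarrow> \<exists>n k. path w n a b k"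
proof (induction a rule: wf_induct_rule[OF wf_above])
  case (1 a)
  show ?case
  proof (cases "a = b")
    case True
    then show ?thesis using path.Nil 1(2) by blast
  next
    case False
    then obtain c where c: "cov a c" "c \<preceq> b" using ex_cover 1 by blast
    then have "(c, a) \<in> below\<inverse>" "c \<in> C" by (auto simp: below_def cov_def)
    then obtain n k where "path w n c b k" using 1 c by blast
    then show ?thesis using path.Step[OF c(1)] by blast
  qed
qed

text \<open>The modular law recovers an element between \<open>y\<close> and \<open>jn b y\<close>
  from its meet with \<open>b\<close>: one half of the isomorphism of transposed intervals.\<close>

lemma modular_interval:
  assumes "a \<in> C" "b \<in> C" "y \<in> C" "t \<in> C" "y \<preceq> t" "t \<preceq> jn b y"
  shows "t = jn y (mt b t)"
proof -
  have "jn y (mt b t) = mt (jn y b) t" using assms by (intro modular) auto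
  also have "\<dots> = t" using assms jn_comm[of b y] mt_comm leq_mt jn_closed by metis
  finally show ?thesis by simp
qed

text \<open>By \<open>modular_interval\<close> an element \<open>t\<close> between \<open>y\<close>
  and \<open>jn c y\<close> is the join of \<open>y\<close> with \<open>mt c t\<close>, and the
  latter lies in the prime interval from \<open>a\<close> to \<open>c\<close>.\<close>

lemma cov_transpose:
  assumes "cov a c" "y \<in> C" "mt c y = a"
  shows "cov y (jn c y)"
proof -
  have C: "a \<in> C" "c \<in> C" and ac: "a \<preceq> c" "a \<noteq> c" using assms(1) by (auto simp: cov_def)
  have "y \<noteq> jn c y"
  proof
    assume "y = jn c y"
    then have "c \<preceq> y" by simp
    then show False using leq_mt assms C ac by metis
  qed
  moreover have "t = y \<or> t = jn c y" if t: "t \<in> C" "y \<preceq> t" "t \<preceq> jn c y" for t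
  proof -
    have e: "t = jn y (mt c t)" using modular_interval[OF C assms(2) t] .
    have "a \<preceq> y" using mt_lower2[OF C(2) assms(2)] assms(3) by simp
    then have "a \<preceq> mt c t" using t C ac assms(2) by (intro mt_greatest) (auto intro: leq_trans[of a y t])
    then have "mt c t = a \<or> mt c t = c" using assms(1) mt_lower1 mt_closed C t unfolding cov_def by blast
    moreover have "jn y a = y" using assms C mt_lower2[of c y] jn_comm by metis
    ultimately show ?thesis using e jn_comm C assms(2) by metis
  qed
  ultimately show ?thesis using C assms(2) jn_closed jn_upper2 by (auto simp: cov_def)
qed

section \<open>Weights invariant under transposition and the Jordan-Hoelder theorem\<close>

definition transposes :: "(('a \<times> 'a) \<times> ('a \<times> 'a)) set" where
  "transposes = {((a, b), (c, d)). cov a b \<and> cov c d \<and> mt b c = a \<and> jn b c = d}"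

definition invariant :: "('a \<times> 'a \<Rightarrow> nat) \<Rightarrow> bool" where
  "invariant w \<longleftrightarrow> (\<forall>(p, q)\<in>transposes. w p = w q)"

lemma invariantD: "\<lbrakk>invariant w; cov a b; cov c d; mt b c = a; jn b c = d\<rbrakk> \<Longrightarrow> w (a, b) = w (c, d)"
  by (auto simp: invariant_def transposes_def)

text \<open>Induction along the first chain. If the chains begin with different covers
  \<open>x\<close> and \<open>y\<close> of \<open>a\<close>, both are compared with chains through
  \<open>jn x y\<close>. In the square of \<open>a\<close>, \<open>x\<close>, \<open>y\<close> and
  \<open>jn x y\<close> opposite sides are transposed, so they have equal weights.\<close>

lemma jordan_hoelder:
  assumes "invariant w"
  shows "path w n a b k \<Longrightarrow> path w n' a b k' \<Longrightarrow> n = n' \<and> k = k'"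
proof (induction n arbitrary: a k n' k')
  case 0
  from 0(1) have "a = b" "k = 0" by (cases rule: path.cases; simp)+
  then show ?case using path_same 0(2) by blast
next
  case (Suc n)
  from Suc.prems(1) obtain x k1 where x: "cov a x" "path w n x b k1" "k = w (a, x) + k1"
    by (cases rule: path.cases) auto
  have xC: "x \<in> C" "a \<in> C" "b \<in> C" "x \<preceq> b" "a \<preceq> x" "a \<noteq> x" using x path_in by (auto simp: cov_def)
  have "a \<noteq> b" using xC leq_antisym by blast
  with Suc.prems(2) obtain y n1 k2 where y: "cov a y" "path w n1 y b k2" "k' = w (a, y) + k2" "n' = Suc n1"
    by (cases rule: path.cases) auto
  have yC: "y \<in> C" "y \<preceq> b" "a \<preceq> y" "a \<noteq> y" using y path_in by (auto simp: cov_def)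
  show ?case
  proof (cases "x = y")
    case True
    then show ?thesis using Suc.IH[OF x(2)] x(3) y by auto
  next
    case False
    have m: "mt x y = a"
    proof -
      have "a \<preceq> mt x y" using xC yC by (intro mt_greatest) auto
      then have "mt x y = a \<or> mt x y = x" "mt x y = a \<or> mt x y = y"
        using cov_between[OF x(1) mt_closed[OF xC(1) yC(1)] _ mt_lower1[OF xC(1) yC(1)]]
          cov_between[OF y(1) mt_closed[OF xC(1) yC(1)] _ mt_lower2[OF xC(1) yC(1)]] by auto
      then show ?thesis using False by auto
    qed
    have m': "mt y x = a" using m mt_comm xC yC by simp
    have c: "cov y (jn x y)" "cov x (jn y x)"
      using cov_transpose[OF x(1) yC(1) m] cov_transpose[OF y(1) xC(1) m'] .
    have z: "jn y x = jn x y" "jn x y \<in> C" "jn x y \<preceq> b"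
      using jn_comm jn_closed jn_least xC yC by auto
    obtain p q where pq: "path w p (jn x y) b q" using ex_path z xC by blast
    have cx: "cov x (jn x y)" using c(2) z(1) by simp
    have 1: "n = Suc p \<and> k1 = w (x, jn x y) + q"
      by (rule Suc.IH[OF x(2) path.Step[OF cx pq]])
    have py: "path w n y b (w (y, jn x y) + q)" using 1 path.Step[OF c(1) pq] by simp
    have 2: "n = n1 \<and> w (y, jn x y) + q = k2" by (rule Suc.IH[OF py y(2)])
    have "w (a, x) = w (y, jn x y)" using invariantD[OF assms x(1) c(1) m] by simp
    moreover have "w (a, y) = w (x, jn x y)" using invariantD[OF assms y(1) c(2) m'] z(1) by simp
    ultimately show ?thesis using 1 2 x(3) y(3,4) by simp
  qed
qed

lemma path_append: "path w n a b k \<Longrightarrow> path w n' b c k' \<Longrightarrow> path w (n + n') a c (k + k')"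
  by (induction rule: path.induct) (auto simp: add.assoc intro: path.Step)

definition height :: "('a \<times> 'a \<Rightarrow> nat) \<Rightarrow> 'a \<Rightarrow> nat" where
  "height w x = (THE k. \<exists>n. path w n bot x k)"

lemma height_eq: "invariant w \<Longrightarrow> path w n bot x k \<Longrightarrow> height w x = k"
  unfolding height_def by (rule the_equality) (use jordan_hoelder in blast)+

lemma height_path:
  assumes "invariant w" "path w n a b k"
  shows "height w b = height w a + k"
proof -
  obtain n' k' where p: "path w n' bot a k'" using ex_path bot path_in[OF assms(2)] by meson
  then show ?thesis using height_eq[OF assms(1) p] height_eq[OF assms(1) path_append[OF p assms(2)]] by simp
qed

text \<open>Joining with \<open>y\<close> maps the interval from \<open>mt b y\<close> to
  \<open>b\<close> isomorphically onto the one from \<open>y\<close> to \<open>jn b y\<close>; it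
  preserves covers and, \<open>w\<close> being invariant, weights.\<close>

lemma path_transpose:
  assumes "invariant w"
  shows "path w n a b k \<Longrightarrow> y \<in> C \<Longrightarrow> mt b y = a \<Longrightarrow> path w n y (jn b y) k"
proof (induction arbitrary: y rule: path.induct)
  case (Nil a)
  then have "jn a y = y" using leq_mt by simp
  then show ?case using path.Nil Nil by simp
next
  case (Step a c n b k)
  have C: "a \<in> C" "c \<in> C" "b \<in> C" "c \<preceq> b" "a \<preceq> c" using Step path_in by (auto simp: cov_def)
  note y = Step.prems
  have "a \<preceq> mt c y" using C y by (intro mt_greatest) (auto intro: mt_lower2)
  moreover have "mt c y \<preceq> mt b y" using C y
    by (intro mt_greatest) (auto intro: leq_trans[of "mt c y" c b] mt_closed mt_lower1 mt_lower2)
  ultimately have m: "mt c y = a" using y(2) leq_antisym mt_closed C y(1) by metis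
  note c = cov_transpose[OF Step(1) y(1) m]
  have j: "jn c y \<in> C" using C y jn_closed by simp
  \<comment> \<open>The modular law gives \<open>mt b (jn c y) = c\<close>, so the induction
    hypothesis applies to the rest of the chain, from \<open>c\<close> to \<open>b\<close>, joined
    with \<open>jn c y\<close>.\<close>
  have "mt b (jn c y) = mt (jn c y) b" using mt_comm j C by simp
  also have "\<dots> = jn c (mt y b)" using modular[of c y b] C y by simp
  also have "\<dots> = c" using y mt_comm[of b y] C jn_comm by metis
  finally have "path w n (jn c y) (jn b (jn c y)) k" using Step.IH[OF j] by simp
  moreover have "jn b (jn c y) = jn b y" using C y jn_assoc[of b c y] jn_comm[of b c] by simp
  ultimately have "path w (Suc n) y (jn b y) (w (y, jn c y) + k)" using path.Step[OF c] by simp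
  moreover have "w (a, c) = w (y, jn c y)" using invariantD[OF assms Step(1) c m] by simp
  ultimately show ?case by simp
qed

definition valuation :: "('a \<Rightarrow> nat) \<Rightarrow> bool" where
  "valuation u \<longleftrightarrow> (\<forall>x\<in>C. \<forall>y\<in>C. u (jn x y) + u (mt x y) = u x + u y) \<and>
     (\<forall>x\<in>C. \<forall>y\<in>C. x \<preceq> y \<longrightarrow> u x \<le> u y)"

text \<open>The intervals from \<open>mt x y\<close> to \<open>x\<close> and from \<open>y\<close>
  to \<open>jn x y\<close> are transposed, so the height grows equally across both.\<close>

lemma height_valuation:
  assumes "invariant w"
  shows "valuation (height w)"
proof -
  have "height w (jn x y) + height w (mt x y) = height w x + height w y" if xy: "x \<in> C" "y \<in> C" for x y
  proof -
    obtain n k where p: "path w n (mt x y) x k" using ex_path mt_closed mt_lower1 xy by meson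
    show ?thesis using height_path[OF assms p] height_path[OF assms path_transpose[OF assms p xy(2)]] by simp
  qed
  moreover have "height w x \<le> height w y" if "x \<in> C" "y \<in> C" "x \<preceq> y" for x y
    using ex_path[OF that] height_path[OF assms] by (metis le_add1)
  ultimately show ?thesis by (auto simp: valuation_def)
qed

lemma valuation_mod: "\<lbrakk>valuation u; x \<in> C; y \<in> C\<rbrakk> \<Longrightarrow> u (jn x y) + u (mt x y) = u x + u y"
  by (auto simp: valuation_def)
lemma valuation_mono: "\<lbrakk>valuation u; x \<in> C; y \<in> C; x \<preceq> y\<rbrakk> \<Longrightarrow> u x \<le> u y"
  by (auto simp: valuation_def)

section \<open>Projectivity classes of prime intervals and their rank functions\<close>

definition primes :: "('a \<times> 'a) set" where "primes = {(a, b). cov a b}"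
definition projective :: "(('a \<times> 'a) \<times> ('a \<times> 'a)) set" where
  "projective = (transposes \<union> transposes\<inverse>)\<^sup>* \<inter> primes \<times> primes"
definition pclasses :: "('a \<times> 'a) set set" where "pclasses = primes // projective"

lemma equiv_projective: "equiv primes projective"
proof -
  have "sym ((transposes \<union> transposes\<inverse>)\<^sup>*)" by (intro sym_rtrancl sym_Un_converse)
  then show ?thesis unfolding projective_def
    by (intro equivI) (auto intro: refl_onI symI transI dest: symD)
qed

lemma classes_mem: "s \<in> pclasses \<Longrightarrow> (a, b) \<in> s \<Longrightarrow> cov a b"
  using in_quotient_imp_subset[OF equiv_projective, of s] by (auto simp: pclasses_def primes_def)

lemma classes_ne: "s \<in> pclasses \<Longrightarrow> \<exists>a b. (a, b) \<in> s"
  using in_quotient_imp_non_empty[OF equiv_projective, of s] by (auto simp: pclasses_def)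

lemma class_of: "cov a b \<Longrightarrow> \<exists>s\<in>pclasses. (a, b) \<in> s"
  unfolding pclasses_def using equiv_projective
  by (metis Image_singleton_iff equiv_class_self mem_Collect_eq primes_def case_prodI quotientI)

lemma classes_unique: "\<lbrakk>s \<in> pclasses; t \<in> pclasses; p \<in> s; p \<in> t\<rbrakk> \<Longrightarrow> s = t"
  using quotient_disj[OF equiv_projective] unfolding pclasses_def by blast

lemma transposes_projective: "(p, q) \<in> transposes \<Longrightarrow> (p, q) \<in> projective"
  by (auto simp: projective_def transposes_def primes_def)

lemma classes_transpose: "\<lbrakk>s \<in> pclasses; (p, q) \<in> transposes\<rbrakk> \<Longrightarrow> p \<in> s \<longleftrightarrow> q \<in> s"
  unfolding pclasses_def using transposes_projective[of p q] equiv_projective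
  by (meson equivE in_quotient_imp_closed symD)

lemma class_induct:
  assumes s: "s \<in> pclasses" "p \<in> s" "q \<in> s" and P: "P p"
    and step: "\<And>a b. \<lbrakk>(a, b) \<in> transposes; a \<in> s\<rbrakk> \<Longrightarrow> P a \<longleftrightarrow> P b"
  shows "P q"
proof -
  have "(p, q) \<in> projective" using s quotient_eq_iff[OF equiv_projective, of s s p q] by (auto simp: pclasses_def)
  then have "(p, q) \<in> (transposes \<union> transposes\<inverse>)\<^sup>*" by (auto simp: projective_def)
  then have "q \<in> s \<and> P q"
  proof (induction rule: rtrancl_induct)
    case (step y z)
    then show ?case using assms(5) classes_transpose[OF s(1)] by blast
  qed (use s P in auto)
  then show ?thesis by simp
qed

definition rk :: "('a \<times> 'a) set \<Rightarrow> 'a \<Rightarrow> nat" where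
  "rk s = height (\<lambda>p. if p \<in> s then 1 else 0)"

lemma indicator_invariant: "s \<in> pclasses \<Longrightarrow> invariant (\<lambda>p. if p \<in> s then 1 else 0)"
  using classes_transpose by (auto simp: invariant_def)

lemma rk_valuation: "s \<in> pclasses \<Longrightarrow> valuation (rk s)"
  unfolding rk_def using height_valuation indicator_invariant by blast

lemma rk_bot: "s \<in> pclasses \<Longrightarrow> rk s bot = 0"
  unfolding rk_def using height_eq[OF indicator_invariant path.Nil] bot by blast

lemma rk_cov:
  assumes "s \<in> pclasses" "cov a b"
  shows "rk s b = rk s a + (if (a, b) \<in> s then 1 else 0)"
proof -
  have "path (\<lambda>p. if p \<in> s then 1 else 0) (Suc 0) a b ((if (a, b) \<in> s then 1 else 0) + 0)"
    using path.Step[OF assms(2) path.Nil, of "\<lambda>p. if p \<in> s then 1 else 0"] assms(2) by (simp add: cov_def)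
  then show ?thesis using height_path[OF indicator_invariant[OF assms(1)]] by (simp add: rk_def)
qed

text \<open>Induction along a saturated chain that is extended by one step at its lower end.\<close>

lemma interval_induct [consumes 3, case_names refl step]:
  assumes "a \<in> C" "b \<in> C" "a \<preceq> b"
    and "\<And>a. a \<in> C \<Longrightarrow> P a a"
    and "\<And>a c b. \<lbrakk>cov a c; c \<in> C; b \<in> C; c \<preceq> b; P c b\<rbrakk> \<Longrightarrow> P a b"
  shows "P a b"
proof -
  obtain n k where "path (\<lambda>_. 0) n a b k" using ex_path assms by meson
  then show ?thesis
    by (induction rule: path.induct) (use assms(4,5) path_in in blast)+
qed

text \<open>A step of a saturated chain belongs to one class and changes no other rank.\<close>

lemma finite_changing:
  assumes "a \<in> C" "b \<in> C" "a \<preceq> b"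
  shows "finite {s \<in> pclasses. rk s a \<noteq> rk s b}"
  using assms
proof (induction rule: interval_induct)
  case (step a c b)
  obtain s where s: "s \<in> pclasses" "(a, c) \<in> s" using class_of step by blast
  have "{s \<in> pclasses. rk s a \<noteq> rk s b} \<subseteq> {s} \<union> {s \<in> pclasses. rk s c \<noteq> rk s b}"
  proof (intro subsetI)
    fix t assume t: "t \<in> {s \<in> pclasses. rk s a \<noteq> rk s b}"
    have "(a, c) \<notin> t" if "t \<noteq> s" using classes_unique[OF _ s(1) _ s(2)] t that by blast
    then show "t \<in> {s} \<union> {s \<in> pclasses. rk s c \<noteq> rk s b}" using rk_cov[OF _ step(1)] t by auto
  qed
  then show ?case using step finite_subset by blast
qed auto

lemma rk_top_pos: "s \<in> pclasses \<Longrightarrow> 0 < rk s top"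
proof -
  assume s: "s \<in> pclasses"
  then obtain a b where ab: "(a, b) \<in> s" using classes_ne by blast
  then have c: "cov a b" using classes_mem s by blast
  have "rk s b = rk s a + 1" using rk_cov[OF s c] ab by simp
  moreover have "rk s b \<le> rk s top" using valuation_mono[OF rk_valuation[OF s]] top c by (auto simp: cov_def)
  ultimately show ?thesis by simp
qed

text \<open>Every class has rank zero at \<open>bot\<close> and positive rank at \<open>top\<close>,
  so all classes change between these two elements.\<close>

lemma finite_classes: "finite pclasses"
proof -
  have "pclasses \<subseteq> {s \<in> pclasses. rk s bot \<noteq> rk s top}" using rk_top_pos rk_bot by fastforce
  then show ?thesis using finite_changing[OF bot(1) top(1)] bot top finite_subset by blast
qed

definition rep :: "('a \<times> 'a) set \<Rightarrow> 'a \<times> 'a" where "rep s = (SOME p. p \<in> s)"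

lemma rep: "s \<in> pclasses \<Longrightarrow> rep s \<in> s"
  using classes_ne unfolding rep_def by (metis someI_ex)

definition coeff :: "('a \<Rightarrow> nat) \<Rightarrow> ('a \<times> 'a) set \<Rightarrow> nat" where
  "coeff u s = u (snd (rep s)) - u (fst (rep s))"

text \<open>For transposed intervals the valuation law says that \<open>u\<close> grows equally, so
  the growth across the representative of \<open>s\<close> is the growth across every member of
  \<open>s\<close>.\<close>

lemma coeff_eq:
  assumes u: "valuation u" and s: "s \<in> pclasses" "(a, b) \<in> s"
  shows "u b = u a + coeff u s"
proof -
  have "u (snd (a, b)) = u (fst (a, b)) + coeff u s"
  proof (rule class_induct[OF s(1) rep[OF s(1)] s(2)])
    show "u (snd (rep s)) = u (fst (rep s)) + coeff u s"
      using valuation_mono[OF u] classes_mem[OF s(1), of "fst (rep s)" "snd (rep s)"] rep[OF s(1)]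
      by (auto simp: coeff_def cov_def)
    show "u (snd p) = u (fst p) + coeff u s \<longleftrightarrow> u (snd q) = u (fst q) + coeff u s"
      if pq: "(p, q) \<in> transposes" for p q
    proof -
      obtain a b c d where e: "p = (a, b)" "q = (c, d)" by (cases p, cases q) auto
      then have "b \<in> C" "c \<in> C" "mt b c = a" "jn b c = d" using pq by (auto simp: transposes_def cov_def)
      then show ?thesis using e valuation_mod[OF u, of b c] by auto
    qed
  qed
  then show ?thesis by simp
qed

text \<open>This sums \<open>coeff_eq\<close> over a saturated chain, in which the class
  \<open>s\<close> occurs \<open>rk s b - rk s a\<close> times. Ranks are monotone, so the truncated
  differences are true ones.\<close>

lemma valuation_expand:
  assumes u: "valuation u" and "a \<in> C" "b \<in> C" "a \<preceq> b"
  shows "u b = u a + (\<Sum>s\<in>pclasses. coeff u s * (rk s b - rk s a))"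
  using assms(2-4)
proof (induction rule: interval_induct)
  case (step a c b)
  obtain s0 where s: "s0 \<in> pclasses" "(a, c) \<in> s0" using class_of step by blast
  have "coeff u s * (rk s b - rk s a) =
      coeff u s * (rk s b - rk s c) + (if s = s0 then coeff u s else 0)" if "s \<in> pclasses" for s
  proof -
    have "rk s c \<le> rk s b" using valuation_mono[OF rk_valuation[OF that]] step by blast
    then obtain d where "rk s b = rk s c + d" using le_Suc_ex by blast
    moreover have "(a, c) \<in> s \<longleftrightarrow> s = s0" using classes_unique[OF that s(1) _ s(2)] s by blast
    ultimately show ?thesis using rk_cov[OF that step(1)]
      by (cases "s = s0") simp_all
  qed
  then have "(\<Sum>s\<in>pclasses. coeff u s * (rk s b - rk s a)) =
      (\<Sum>s\<in>pclasses. coeff u s * (rk s b - rk s c)) + coeff u s0"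
    using s(1) finite_classes by (simp add: sum.distrib)
  then show ?case using step coeff_eq[OF u s] by simp
qed auto

section \<open>Kernels of valuations and the congruences they determine\<close>

definition ker :: "('a \<Rightarrow> nat) \<Rightarrow> ('a \<times> 'a) set" where
  "ker u = {(x, y). x \<in> C \<and> y \<in> C \<and> u (jn x y) = u (mt x y)}"

lemma ker_cov_iff: "\<lbrakk>x \<in> C; y \<in> C; x \<preceq> y\<rbrakk> \<Longrightarrow> (x, y) \<in> ker u \<longleftrightarrow> u x = u y"
  using leq_mt[of x y] by (auto simp: ker_def)

lemma ker_iff_jn:
  assumes "valuation u" "x \<in> C" "y \<in> C"
  shows "(x, y) \<in> ker u \<longleftrightarrow> u (jn x y) = u x \<and> u (jn x y) = u y"
  using valuation_mod[OF assms] valuation_mono[OF assms(1), of x "jn x y"]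
    valuation_mono[OF assms(1), of y "jn x y"] jn_upper1 jn_upper2 jn_closed assms
  by (auto simp: ker_def)

lemma ker_iff_mt:
  assumes "valuation u" "x \<in> C" "y \<in> C"
  shows "(x, y) \<in> ker u \<longleftrightarrow> u (mt x y) = u x \<and> u (mt x y) = u y"
  using valuation_mod[OF assms] valuation_mono[OF assms(1), of "mt x y" x]
    valuation_mono[OF assms(1), of "mt x y" y] mt_lower1 mt_lower2 mt_closed assms
  by (auto simp: ker_def)

text \<open>The valuation law with the meet replaced by any common lower bound. Together with its
  dual it bounds the length of an interval without exact knowledge of its ends.\<close>

lemma valuation_submod:
  assumes u: "valuation u" and C: "x \<in> C" "y \<in> C" "z \<in> C" and z: "z \<preceq> x" "z \<preceq> y"
  shows "u (jn x y) + u z \<le> u x + u y"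
  using valuation_mod[OF u C(1,2)] valuation_mono[OF u C(3) mt_closed[OF C(1,2)] mt_greatest[OF C z]] by simp

lemma valuation_supermod:
  assumes u: "valuation u" and C: "x \<in> C" "y \<in> C" "z \<in> C" and z: "x \<preceq> z" "y \<preceq> z"
  shows "u x + u y \<le> u (mt x y) + u z"
  using valuation_mod[OF u C(1,2)] valuation_mono[OF u jn_closed[OF C(1,2)] C(3) jn_least[OF C z]] by simp

text \<open>A pair is in the kernel iff the interval from its meet to its join has
  \<open>u\<close>-length zero. Sub- and supermodularity bound the intervals that arise under
  transitivity, joins and meets by intervals already of length zero.\<close>

lemma ker_cong:
  assumes u: "valuation u"
  shows "cong2 C jn mt (ker u)"
proof -
  note J = ker_iff_jn[OF u] and M = ker_iff_mt[OF u]
  have sub: "ker u \<subseteq> C \<times> C" by (auto simp: ker_def)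
  have sym: "sym (ker u)" using jn_comm mt_comm by (intro symI) (auto simp: ker_def)
  have trans: "(x, z) \<in> ker u" if xy: "(x, y) \<in> ker u" and yz: "(y, z) \<in> ker u" for x y z
  proof -
    have C: "x \<in> C" "y \<in> C" "z \<in> C" using xy yz sub by auto
    \<comment> \<open>\<open>y\<close> is a common lower bound of \<open>jn x y\<close> and
      \<open>jn y z\<close>, so the join of all three elements has no larger value than
      \<open>y\<close>.\<close>
    have 1: "u (jn (jn x y) (jn y z)) + u y \<le> u (jn x y) + u (jn y z)"
      using C by (intro valuation_submod[OF u]) (auto simp: jn_closed jn_upper1 jn_upper2)
    have l: "x \<preceq> jn (jn x y) (jn y z)" "z \<preceq> jn (jn x y) (jn y z)"
      using C by (meson jn_closed jn_upper1 jn_upper2 leq_trans)+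
    have "jn x z \<preceq> jn (jn x y) (jn y z)" using C by (intro jn_least jn_closed l) auto
    then have "u (jn x z) \<le> u (jn (jn x y) (jn y z))" using C by (intro valuation_mono[OF u] jn_closed) auto
    moreover have "u x \<le> u (jn x z)" using C by (intro valuation_mono[OF u] jn_closed jn_upper1) auto
    ultimately show ?thesis using 1 xy yz J C by simp
  qed
  \<comment> \<open>One argument is varied at a time; the general case follows by
    transitivity.\<close>
  have half: "(jn x z, jn y z) \<in> ker u \<and> (mt x z, mt y z) \<in> ker u"
    if xy: "(x, y) \<in> ker u" and zC: "z \<in> C" for x y z
  proof -
    have C: "x \<in> C" "y \<in> C" "z \<in> C" using xy sub zC by auto
    have c: "jn x y \<in> C" "jn x z \<in> C" "jn y z \<in> C" "mt x y \<in> C" "mt x z \<in> C" "mt y z \<in> C"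
      using C jn_closed mt_closed by auto
    have "jn (jn x z) (jn y z) \<preceq> jn (jn x y) (jn x z)" "jn (jn x z) (jn y z) \<preceq> jn (jn x y) (jn y z)"
      using C c by (auto intro!: jn_least jn_closed leq_refl
          intro: leq_jnI1[OF _ _ _ jn_upper1] leq_jnI1[OF _ _ _ jn_upper2]
            leq_jnI2[OF _ _ _ jn_upper1] leq_jnI2[OF _ _ _ jn_upper2])
    then have "u (jn (jn x z) (jn y z)) \<le> u (jn (jn x y) (jn x z))"
       "u (jn (jn x z) (jn y z)) \<le> u (jn (jn x y) (jn y z))"
      using c by (auto intro!: valuation_mono[OF u] jn_closed)
    moreover have "u (jn (jn x y) (jn x z)) + u x \<le> u (jn x y) + u (jn x z)"
       "u (jn (jn x y) (jn y z)) + u y \<le> u (jn x y) + u (jn y z)"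
      using C c by (auto intro!: valuation_submod[OF u] simp: jn_upper1 jn_upper2)
    moreover have "u (jn x z) \<le> u (jn (jn x z) (jn y z))" "u (jn y z) \<le> u (jn (jn x z) (jn y z))"
      using c by (auto intro!: valuation_mono[OF u] jn_closed simp: jn_upper1 jn_upper2)
    ultimately have 1: "(jn x z, jn y z) \<in> ker u" using J c C xy by auto
    have "mt (mt x y) (mt x z) \<preceq> mt (mt x z) (mt y z)" "mt (mt x y) (mt y z) \<preceq> mt (mt x z) (mt y z)"
      using C c by (auto intro!: mt_greatest mt_closed leq_refl
          intro: mt_leqI1[OF _ _ _ mt_lower1] mt_leqI1[OF _ _ _ mt_lower2]
            mt_leqI2[OF _ _ _ mt_lower1] mt_leqI2[OF _ _ _ mt_lower2])
    then have "u (mt (mt x y) (mt x z)) \<le> u (mt (mt x z) (mt y z))"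
       "u (mt (mt x y) (mt y z)) \<le> u (mt (mt x z) (mt y z))"
      using c by (auto intro!: valuation_mono[OF u] mt_closed)
    moreover have "u (mt x y) + u (mt x z) \<le> u (mt (mt x y) (mt x z)) + u x"
       "u (mt x y) + u (mt y z) \<le> u (mt (mt x y) (mt y z)) + u y"
      using C c by (auto intro!: valuation_supermod[OF u] simp: mt_lower1 mt_lower2)
    moreover have "u (mt (mt x z) (mt y z)) \<le> u (mt x z)" "u (mt (mt x z) (mt y z)) \<le> u (mt y z)"
      using c by (auto intro!: valuation_mono[OF u] mt_closed simp: mt_lower1 mt_lower2)
    ultimately have "(mt x z, mt y z) \<in> ker u" using M c C xy by auto
    then show ?thesis using 1 by blast
  qed
  have "jn x x = x \<and> mt x x = x" if "x \<in> C" for x using leq_refl[OF that] leq_mt[OF that that] by simp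
  then have "refl_on C (ker u)" by (intro refl_onI) (simp add: ker_def)
  then have "equiv C (ker u)" using sub sym trans by (auto simp: equiv_def intro: transI)
  moreover have "(jn x z, jn y w) \<in> ker u \<and> (mt x z, mt y w) \<in> ker u"
    if "(x, y) \<in> ker u" "(z, w) \<in> ker u" for x y z w
  proof -
    have C: "x \<in> C" "y \<in> C" "z \<in> C" "w \<in> C" using that sub by auto
    have 1: "(jn x z, jn y z) \<in> ker u" "(mt x z, mt y z) \<in> ker u" using half[OF that(1) C(3)] by auto
    have 2: "(jn y z, jn y w) \<in> ker u" "(mt y z, mt y w) \<in> ker u"
      using half[OF that(2) C(2)] jn_comm[OF C(2) C(3)] jn_comm[OF C(2) C(4)]
        mt_comm[OF C(2) C(3)] mt_comm[OF C(2) C(4)] by auto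
    show ?thesis using trans[OF 1(1) 2(1)] trans[OF 1(2) 2(2)] by blast
  qed
  ultimately show ?thesis by (auto simp: cong2_def)
qed

lemma cong2_interval:
  assumes \<theta>: "cong2 D jn mt \<theta>" and D: "C \<subseteq> D" and C: "x \<in> C" "y \<in> C"
  shows "(x, y) \<in> \<theta> \<longleftrightarrow> (mt x y, jn x y) \<in> \<theta>"
proof (rule cong2_interval_iff[OF \<theta>])
  show "mt x x = x" "mt y y = y" using C leq_refl leq_mt by auto
  show "jn y (mt x y) = y" using C mt_lower2 mt_closed jn_comm by metis
qed (use C D in \<open>auto simp: leq_refl jn_absorb jn_upper1 jn_upper2 jn_closed mt_closed\<close>)

text \<open>Joining with \<open>c\<close> and meeting with \<open>b\<close> carry transposed
  intervals \<open>(a, b)\<close> and \<open>(c, d)\<close> onto each other. The congruence may live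
  on a larger \<open>D\<close>, since congruences of a union are examined on its stages.\<close>

lemma cong2_class:
  assumes \<theta>: "cong2 D jn mt \<theta>" and D: "C \<subseteq> D" and s: "s \<in> pclasses" "p \<in> s" "q \<in> s" "p \<in> \<theta>"
  shows "q \<in> \<theta>"
proof (rule class_induct[OF s(1-3), of "\<lambda>p. p \<in> \<theta>", OF s(4)])
  fix p q assume pq: "(p, q) \<in> transposes"
  obtain a b c d where e: "p = (a, b)" "q = (c, d)" by (cases p, cases q) auto
  then have C: "a \<in> C" "b \<in> C" "c \<in> C" "d \<in> C" "mt b c = a" "jn b c = d" using pq by (auto simp: transposes_def cov_def)
  have r: "(b, b) \<in> \<theta>" "(c, c) \<in> \<theta>" using \<theta> D C by (auto simp: cong2_def equiv_def refl_on_def)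
  have c: "\<And>a b c d. (a, b) \<in> \<theta> \<Longrightarrow> (c, d) \<in> \<theta> \<Longrightarrow> (jn a c, jn b d) \<in> \<theta> \<and> (mt a c, mt b d) \<in> \<theta>"
    using \<theta> by (auto simp: cong2_def)
  have "(jn a c, jn b c) \<in> \<theta>" if "(a, b) \<in> \<theta>" using c[OF that r(2)] by blast
  moreover have "(mt b c, mt b d) \<in> \<theta>" if "(c, d) \<in> \<theta>" using c[OF r(1) that] by blast
  moreover have "jn a c = c" "mt b d = b" using C mt_lower2 mt_absorb by auto
  ultimately show "p \<in> \<theta> \<longleftrightarrow> q \<in> \<theta>" using C e by auto
qed

text \<open>A congruence collapses an interval iff it collapses each step of a saturated chain, and
  the classes met by the chain are those whose ranks differ at the ends.\<close>

lemma cong2_interval_determined: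
  assumes \<theta>: "cong2 D jn mt \<theta>" and D: "C \<subseteq> D"
    and "a \<in> C" "b \<in> C" "a \<preceq> b"
  shows "(a, b) \<in> \<theta> \<longleftrightarrow> (\<forall>s\<in>pclasses. rk s a \<noteq> rk s b \<longrightarrow> rep s \<in> \<theta>)"
  using assms(3-5)
proof (induction rule: interval_induct)
  case (refl a)
  then show ?case using \<theta> D by (auto simp: cong2_def equiv_def refl_on_def)
next
  case (step a c b)
  have aC: "a \<in> C" "a \<preceq> c" "a \<preceq> b" using step by (auto simp: cov_def intro: leq_trans)
  have r: "\<And>x. x \<in> C \<Longrightarrow> (x, x) \<in> \<theta>" using \<theta> D by (auto simp: cong2_def equiv_def refl_on_def)
  have cc: "\<And>a b c d. (a, b) \<in> \<theta> \<Longrightarrow> (c, d) \<in> \<theta> \<Longrightarrow> (jn a c, jn b d) \<in> \<theta> \<and> (mt a c, mt b d) \<in> \<theta>"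
    and tr: "trans \<theta>" using \<theta> by (auto simp: cong2_def equiv_def)
  obtain s0 where s: "s0 \<in> pclasses" "(a, c) \<in> s0" using class_of step by blast
  have 1: "(a, b) \<in> \<theta> \<longleftrightarrow> (a, c) \<in> \<theta> \<and> (c, b) \<in> \<theta>"
  proof
    assume ab: "(a, b) \<in> \<theta>"
    have "(mt a c, mt b c) \<in> \<theta>" "(jn a c, jn b c) \<in> \<theta>" using cc[OF ab r[of c]] step by auto
    moreover have "mt a c = a" "mt b c = c" "jn a c = c" "jn b c = b"
      using aC step leq_mt mt_comm[of b c] jn_comm[of b c] by auto
    ultimately show "(a, c) \<in> \<theta> \<and> (c, b) \<in> \<theta>" by auto
  qed (use tr in \<open>auto dest: transD\<close>)
  have 2: "(a, c) \<in> \<theta> \<longleftrightarrow> rep s0 \<in> \<theta>"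
    using cong2_class[OF \<theta> D s(1)] rep[OF s(1)] s(2) by blast
  have 3: "rk s a \<noteq> rk s b \<longleftrightarrow> s = s0 \<or> rk s c \<noteq> rk s b" if "s \<in> pclasses" for s
  proof -
    have "rk s c \<le> rk s b" using valuation_mono[OF rk_valuation[OF that]] step by blast
    then show ?thesis using rk_cov[OF that step(1)] classes_unique[OF that s(1) _ s(2)] s by auto
  qed
  show ?case using 1 2 3 step.IH s(1) by blast
qed

lemma cong2_determined:
  assumes \<theta>: "cong2 D jn mt \<theta>" and D: "C \<subseteq> D" and C: "x \<in> C" "y \<in> C"
  shows "(x, y) \<in> \<theta> \<longleftrightarrow> (\<forall>s\<in>pclasses. (x, y) \<notin> ker (rk s) \<longrightarrow> rep s \<in> \<theta>)"
proof -
  have c: "mt x y \<in> C" "jn x y \<in> C" "mt x y \<preceq> jn x y"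
    using C by (meson mt_closed jn_closed mt_lower1 jn_upper1 leq_trans)+
  show ?thesis using cong2_interval[OF \<theta> D C] cong2_interval_determined[OF \<theta> D c] C
    by (auto simp: ker_def)
qed

lemma rep_in: "s \<in> pclasses \<Longrightarrow> rep s \<in> C \<times> C"
  using rep classes_mem[of s "fst (rep s)" "snd (rep s)"] by (auto simp: cov_def mem_Times_iff)

text \<open>Across a prime interval only the rank of its own class changes. This independence lets
  arbitrary sets of classes code congruences.\<close>

lemma rep_ker: "\<lbrakk>s \<in> pclasses; t \<in> pclasses\<rbrakk> \<Longrightarrow> rep s \<in> ker (rk t) \<longleftrightarrow> t \<noteq> s"
proof -
  assume st: "s \<in> pclasses" "t \<in> pclasses"
  obtain a b where ab: "rep s = (a, b)" by fastforce
  then have c: "cov a b" "(a, b) \<in> s" using rep[OF st(1)] classes_mem st by auto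
  then have "(a, b) \<in> ker (rk t) \<longleftrightarrow> (a, b) \<notin> t"
    using ker_cov_iff[of a b "rk t"] rk_cov[OF st(2) c(1)] by (auto simp: cov_def)
  then show ?thesis using ab c(2) classes_unique st by auto
qed

end


section \<open>Multiplicities for a pair of nested lattices\<close>

locale modular_pair =
  lo: finite_length_modular C jn mt + hi: finite_length_modular D jn mt
  for C D :: "'a set" and jn mt :: "'a \<Rightarrow> 'a \<Rightarrow> 'a" +
  assumes sub: "C \<subseteq> D"
begin

text \<open>The rank function of \<open>t\<close> restricts to a valuation on \<open>C\<close>, and
  this is its coefficient at \<open>s\<close>: the number of steps of class \<open>t\<close> in a
  saturated chain of \<open>D\<close> across an interval of class \<open>s\<close>.\<close>

definition mult :: "('a \<times> 'a) set \<Rightarrow> ('a \<times> 'a) set \<Rightarrow> nat" where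
  "mult s t = lo.coeff (hi.rk t) s"

lemma valuation_restrict: "hi.valuation u \<Longrightarrow> lo.valuation u"
  using sub unfolding lo.valuation_def hi.valuation_def by blast

lemma rk_expand:
  assumes "t \<in> hi.pclasses" "a \<in> C" "b \<in> C" "jn a b = b"
  shows "hi.rk t b = hi.rk t a + (\<Sum>s\<in>lo.pclasses. mult s t * (lo.rk s b - lo.rk s a))"
  unfolding mult_def
  by (rule lo.valuation_expand[OF valuation_restrict[OF hi.rk_valuation[OF assms(1)]] assms(2-4)])

lemma mult_eq:
  assumes "t \<in> hi.pclasses" "s \<in> lo.pclasses" "(a, b) \<in> s"
  shows "hi.rk t b = hi.rk t a + mult s t"
  unfolding mult_def
  by (rule lo.coeff_eq[OF valuation_restrict[OF hi.rk_valuation[OF assms(1)]] assms(2,3)])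

text \<open>A prime interval of \<open>C\<close> is still a proper interval of \<open>D\<close>, and
  the first step of a saturated chain across it has some class \<open>t\<close>.\<close>

lemma mult_pos:
  assumes "s \<in> lo.pclasses"
  shows "\<exists>t\<in>hi.pclasses. 0 < mult s t"
proof -
  obtain a b where ab: "(a, b) \<in> s" using lo.classes_ne assms by blast
  then have c: "a \<in> D" "b \<in> D" "jn a b = b" "a \<noteq> b"
    using lo.classes_mem[OF assms ab] sub by (auto simp: lo.cov_def)
  then obtain c where c': "hi.cov a c" "jn c b = b" using hi.ex_cover by blast
  obtain t where t: "t \<in> hi.pclasses" "(a, c) \<in> t" using hi.class_of c' by blast
  have "hi.rk t c \<le> hi.rk t b"
    using hi.valuation_mono[OF hi.rk_valuation[OF t(1)]] c c' by (auto simp: hi.cov_def)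
  then have "hi.rk t a < hi.rk t b" using hi.rk_cov[OF t(1) c'(1)] t(2) by simp
  then show ?thesis using mult_eq[OF t(1) assms ab] t(1) by auto
qed

text \<open>The growth of the rank of \<open>t\<close> is the sum of the growths of the ranks of the
  \<open>s\<close>, each multiplied by \<open>mult s t\<close>; a sum of natural numbers vanishes
  iff each term does.\<close>

lemma ker_restrict:
  assumes t: "t \<in> hi.pclasses" and C: "x \<in> C" "y \<in> C"
  shows "(x, y) \<in> hi.ker (hi.rk t) \<longleftrightarrow> (\<forall>s\<in>lo.pclasses. 0 < mult s t \<longrightarrow> (x, y) \<in> lo.ker (lo.rk s))"
proof -
  let ?a = "mt x y" and ?b = "jn x y"
  have c: "?a \<in> C" "?b \<in> C" "jn ?a ?b = ?b"
    using lo.mt_closed[OF C] lo.jn_closed[OF C] lo.leq_jnI1[OF _ C lo.mt_lower1[OF C]] by auto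
  have m: "lo.rk s ?a \<le> lo.rk s ?b" if "s \<in> lo.pclasses" for s
    using lo.valuation_mono[OF lo.rk_valuation[OF that] c] .
  have "hi.rk t ?b = hi.rk t ?a \<longleftrightarrow> (\<forall>s\<in>lo.pclasses. mult s t * (lo.rk s ?b - lo.rk s ?a) = 0)"
    using rk_expand[OF t c] lo.finite_classes by auto
  also have "\<dots> \<longleftrightarrow> (\<forall>s\<in>lo.pclasses. 0 < mult s t \<longrightarrow> lo.rk s ?b = lo.rk s ?a)"
    using m by (auto simp: le_antisym)
  finally show ?thesis using C sub by (auto simp: lo.ker_def hi.ker_def)
qed

text \<open>The sum is the growth of the rank of \<open>t\<close> from \<open>lo.bot\<close> to
  \<open>lo.top\<close>. It can fall short of the whole rank only if the bounds differ, and this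
  decides whether the ring homomorphisms preserve units.\<close>

lemma mult_rank:
  assumes t: "t \<in> hi.pclasses"
  shows "(\<Sum>s\<in>lo.pclasses. mult s t * lo.rk s lo.top) \<le> hi.rk t hi.top"
    and "\<lbrakk>lo.bot = hi.bot; lo.top = hi.top\<rbrakk> \<Longrightarrow>
      (\<Sum>s\<in>lo.pclasses. mult s t * lo.rk s lo.top) = hi.rk t hi.top"
proof -
  have e: "hi.rk t lo.top = hi.rk t lo.bot + (\<Sum>s\<in>lo.pclasses. mult s t * lo.rk s lo.top)"
    using rk_expand[OF t lo.bot(1) lo.top(1) lo.bot(2)[OF lo.top(1)]] lo.rk_bot by simp
  moreover have "hi.rk t lo.top \<le> hi.rk t hi.top"
    using hi.valuation_mono[OF hi.rk_valuation[OF t]] hi.top lo.top(1) sub by blast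
  ultimately show "(\<Sum>s\<in>lo.pclasses. mult s t * lo.rk s lo.top) \<le> hi.rk t hi.top" by simp
  show "(\<Sum>s\<in>lo.pclasses. mult s t * lo.rk s lo.top) = hi.rk t hi.top"
    if "lo.bot = hi.bot" "lo.top = hi.top" using e that hi.rk_bot[OF t] by simp
qed

end

text \<open>Across an interval of class \<open>s\<close> the rank of \<open>r\<close> is expanded
  over the classes of \<open>D\<close>, whose own growth there is \<open>CD.mult s t\<close>; so
  multiplicities compose like matrices.\<close>

lemma mult_mult:
  assumes CD: "modular_pair C D jn mt" and DE: "modular_pair D E jn mt" and CE: "modular_pair C E jn mt"
    and s: "s \<in> finite_length_modular.pclasses C jn mt" and r: "r \<in> finite_length_modular.pclasses E jn mt"
  shows "modular_pair.mult E jn s r =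
     (\<Sum>t\<in>finite_length_modular.pclasses D jn mt. modular_pair.mult D jn s t * modular_pair.mult E jn t r)"
proof -
  interpret CD: modular_pair C D jn mt by (rule CD)
  interpret DE: modular_pair D E jn mt by (rule DE)
  interpret CE: modular_pair C E jn mt by (rule CE)
  obtain a b where ab: "(a, b) \<in> s" using CD.lo.classes_ne s by blast
  have c: "a \<in> D" "b \<in> D" "jn a b = b"
    using CD.lo.classes_mem[OF s ab] CD.sub by (auto simp: CD.lo.cov_def)
  have "CE.mult s r = (\<Sum>t\<in>CD.hi.pclasses. DE.mult t r * (CD.hi.rk t b - CD.hi.rk t a))"
    using CE.mult_eq[OF r s ab] DE.rk_expand[OF r c] by simp
  also have "\<dots> = (\<Sum>t\<in>CD.hi.pclasses. CD.mult s t * DE.mult t r)"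
    by (intro sum.cong refl) (use CD.mult_eq[OF _ s ab] in simp)
  finally show ?thesis .
qed


section \<open>Construction of a ladder by columns\<close>

definition block_le :: "('a \<Rightarrow> nat \<Rightarrow> ('a \<times> nat) set) \<Rightarrow> 'a \<times> nat \<Rightarrow> 'a \<times> nat \<Rightarrow> bool" where
  "block_le f x y \<longleftrightarrow> (fst x = fst y \<and> snd x \<le> snd y) \<or> x \<in> f (fst y) (snd y)"

text \<open>The column of \<open>w\<close> is a copy of the natural numbers added to the earlier
  columns. With \<open>c\<close> increasing and cofinal in those, the elements below
  \<open>(w, n)\<close> are the \<open>(w, k)\<close> with \<open>k \<le> n\<close> and the
  principal ideal of \<open>c n\<close>, which is \<open>d n\<close>. The first alternative is the
  column that has none before it.\<close>

definition block_step :: "'a rel \<Rightarrow> ('a \<Rightarrow> nat \<Rightarrow> ('a \<times> nat) set) \<Rightarrow> 'a \<Rightarrow> (nat \<Rightarrow> ('a \<times> nat) set) \<Rightarrow> bool" where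
  "block_step r f w d \<longleftrightarrow> (let Q = underS r w \<times> UNIV in
     (Q = {} \<and> (\<forall>n. d n = {})) \<or>
     (\<exists>c. (\<forall>n. c n \<in> Q) \<and> (\<forall>n. block_le f (c n) (c (Suc n))) \<and>
        (\<forall>x\<in>Q. \<exists>n. block_le f x (c n)) \<and> (\<forall>n. d n = {x \<in> Q. block_le f x (c n)})))"

text \<open>\<open>A\<close> is an initial segment: these facts serve during the recursion, when
  \<open>f\<close> is known only below some \<open>w\<close>, and again for the complete
  \<open>f\<close>.\<close>

locale block_order =
  fixes r :: "'a rel" and f :: "'a \<Rightarrow> nat \<Rightarrow> ('a \<times> nat) set" and A :: "'a set"
  assumes wo: "Well_order r" and A_down: "\<And>w v. w \<in> A \<Longrightarrow> v \<in> underS r w \<Longrightarrow> v \<in> A"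
    and A_sub: "A \<subseteq> Field r"
    and step: "\<And>w. w \<in> A \<Longrightarrow> block_step r f w (f w)"
begin

lemma wf_r: "wf (r - Id)" using wo by (simp add: well_order_on_def)

lemma underS_r: "v \<in> underS r w \<longleftrightarrow> (v, w) \<in> r - Id"
  by (auto simp: underS_def)

lemma wf_induct_A [consumes 1, case_names less]: "w \<in> A \<Longrightarrow> (\<And>w. w \<in> A \<Longrightarrow> (\<And>v. v \<in> underS r w \<Longrightarrow> P v) \<Longrightarrow> P w) \<Longrightarrow> P w"
proof (induction w rule: wf_induct_rule[OF wf_r])
  case (1 w)
  then show ?case using underS_r A_down by meson
qed

lemma f_sub: "w \<in> A \<Longrightarrow> f w n \<subseteq> underS r w \<times> UNIV"
  using step[of w] by (auto simp: block_step_def Let_def)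

lemma le_fst: "\<lbrakk>block_le f x y; fst y \<in> A\<rbrakk> \<Longrightarrow> fst x = fst y \<or> fst x \<in> underS r (fst y)"
  using f_sub by (fastforce simp: block_le_def)

lemma le_in: "\<lbrakk>block_le f x y; fst y \<in> A\<rbrakk> \<Longrightarrow> fst x \<in> A"
  using le_fst A_down by metis

lemma underS_trans: "\<lbrakk>u \<in> underS r v; v \<in> underS r w\<rbrakk> \<Longrightarrow> u \<in> underS r w"
  using wo unfolding underS_def well_order_on_def linear_order_on_def partial_order_on_def
    preorder_on_def by (auto dest: transD antisymD)

lemma underS_irrefl: "u \<in> underS r v \<Longrightarrow> v \<notin> underS r u"
  using wo unfolding underS_def well_order_on_def linear_order_on_def partial_order_on_def
    preorder_on_def by (auto dest: antisymD)

lemma cases_A: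
  assumes "w \<in> A"
  obtains (empty) "underS r w = {}" "\<And>n. f w n = {}"
  | (chain) c where "\<And>n. fst (c n) \<in> underS r w" "\<And>n. block_le f (c n) (c (Suc n))"
      "\<And>x. fst x \<in> underS r w \<Longrightarrow> \<exists>n. block_le f x (c n)"
      "\<And>n. f w n = {x. fst x \<in> underS r w \<and> block_le f x (c n)}"
  using step[OF assms] unfolding block_step_def Let_def
  apply (elim disjE exE conjE)
  subgoal by auto
  subgoal premises p for c
  proof (rule p(2)[of c])
    show "fst (c n) \<in> underS r w" for n using p(3) by (metis mem_Times_iff)
    show "\<exists>n. block_le f x (c n)" if "fst x \<in> underS r w" for x 
      using p(5)[rule_format, of x] that by (simp add: mem_Times_iff)
    show "f w n = {x. fst x \<in> underS r w \<and> block_le f x (c n)}" for n using p(6) by (auto simp: mem_Times_iff)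
  qed (use p(4) in blast)
  done

text \<open>Induction on the column of the upper element. Within a column the sets
  \<open>f w n\<close> increase with \<open>n\<close>; for elements of earlier columns transitivity
  is inherited from below \<open>c n\<close>.\<close>

lemma le_trans_aux: "w \<in> A \<Longrightarrow> \<forall>x y n. block_le f x y \<and> block_le f y (w, n) \<longrightarrow> block_le f x (w, n)"
proof (induction w rule: wf_induct_A)
  case (less w)
  note 1 = less
  have mono: "f w m \<subseteq> f w n" if "m \<le> n" for m n
  proof -
    from 1(1) show ?thesis
    proof (cases rule: cases_A)
      case (chain c)
      have "f w m \<subseteq> f w (Suc m)" for m
      proof (rule subsetI)
        fix x assume "x \<in> f w m"
        then have x: "fst x \<in> underS r w" "block_le f x (c m)" using chain(4) by auto
        have "block_le f x (c (Suc m))"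
          using 1(2)[OF chain(1)[of "Suc m"], rule_format, of x "c m" "snd (c (Suc m))"]
            x(2) chain(2)[of m] by simp
        then show "x \<in> f w (Suc m)" using chain(4) x(1) by auto
      qed
      then show ?thesis using that by (rule lift_Suc_mono_le)
    qed auto
  qed
  show ?case
  proof (intro allI impI, elim conjE)
    fix x y n assume xy: "block_le f x y" and y: "block_le f y (w, n)"
    from 1(1) show "block_le f x (w, n)"
    proof (cases rule: cases_A)
      case empty
      then show ?thesis using xy y by (auto simp: block_le_def)
    next
      case (chain c)
      show ?thesis
      proof (cases "fst y = w")
        case True
        then have n: "snd y \<le> n" using y f_sub[OF 1(1), of n]
          by (auto simp: block_le_def underS_def mem_Times_iff)
        then show ?thesis using xy True mono[OF n] by (auto simp: block_le_def)
      next
        case False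
        then have yf: "fst y \<in> underS r w" "block_le f y (c n)"
          using y chain(4) by (auto simp: block_le_def)
        have "block_le f x (c n)" 
          using 1(2)[OF chain(1)[of n], rule_format, of x y "snd (c n)"] xy yf(2) by simp
        moreover have "fst x \<in> underS r w"
          using le_fst[OF xy] yf(1) A_down[OF 1(1)] underS_trans by metis
        ultimately show ?thesis using chain(4) by (auto simp: block_le_def)
      qed
    qed
  qed
qed

lemma le_trans: "\<lbrakk>block_le f x y; block_le f y z; fst z \<in> A\<rbrakk> \<Longrightarrow> block_le f x z"
  using le_trans_aux[of "fst z", rule_format, of x y "snd z"] by simp

lemma le_refl: "block_le f x x" by (simp add: block_le_def)

lemma le_antisym:
  assumes "block_le f x y" "block_le f y x" "fst x \<in> A" "fst y \<in> A"
  shows "x = y"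
proof -
  have e: "fst x = fst y"
    using le_fst[OF assms(1,4)] le_fst[OF assms(2,3)] underS_irrefl by metis
  moreover have "(a, k) \<notin> f a n" if "a \<in> A" for a k n
    using f_sub[OF that] by (auto simp: underS_def)
  ultimately have "snd x \<le> snd y" "snd y \<le> snd x"
    using assms by (auto simp: block_le_def) (metis prod.collapse)+
  then show ?thesis using e by (simp add: prod_eq_iff)
qed

lemma total_A: "\<lbrakk>v \<in> A; w \<in> A\<rbrakk> \<Longrightarrow> v = w \<or> v \<in> underS r w \<or> w \<in> underS r v"
  using wo A_sub unfolding underS_def well_order_on_def linear_order_on_def total_on_def by blast

text \<open>By cofinality \<open>x\<close> lies below some \<open>c n\<close>, so a sufficiently
  high element of the column of \<open>y\<close> is above both.\<close>

lemma le_directed_aux: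
  assumes "fst x \<in> underS r (fst y)" "fst y \<in> A"
  shows "\<exists>z. fst z \<in> A \<and> block_le f x z \<and> block_le f y z"
  using assms(2)
proof (cases rule: cases_A)
  case (chain c)
  obtain n where n: "block_le f x (c n)" using chain(3) assms by blast
  have "x \<in> f (fst y) n" using n chain(4) assms(1) by simp
  then have "block_le f x (fst y, n)" by (simp add: block_le_def)
  moreover have "block_le f (fst y, n) (fst y, max n (snd y))" "block_le f y (fst y, max n (snd y))"
    by (auto simp: block_le_def)
  ultimately show ?thesis using le_trans[of x "(fst y, n)" "(fst y, max n (snd y))"] assms(2)
    by (intro exI[of _ "(fst y, max n (snd y))"]) auto
qed (use assms in auto)

lemma le_directed:
  assumes "fst x \<in> A" "fst y \<in> A"
  shows "\<exists>z. fst z \<in> A \<and> block_le f x z \<and> block_le f y z"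
proof -
  consider "fst x = fst y" | "fst x \<in> underS r (fst y)" | "fst y \<in> underS r (fst x)"
    using total_A assms by blast
  then show ?thesis
  proof cases
    case 1
    then show ?thesis using assms by (intro exI[of _ "(fst x, max (snd x) (snd y))"]) (auto simp: block_le_def)
  qed (use le_directed_aux[of x y] le_directed_aux[of y x] assms in blast)+
qed

text \<open>Below \<open>(w, n)\<close> there are finitely many elements of its own column and at
  most one principal ideal of the earlier columns.\<close>

lemma le_finite_aux: "w \<in> A \<Longrightarrow> \<forall>n. finite {x. block_le f x (w, n)}"
proof (induction w rule: wf_induct_A)
  case (less w)
  note 1 = less
  show ?case
  proof
    fix n
    have e: "{x. block_le f x (w, n)} = {w} \<times> {..n} \<union> f w n"
      by (auto simp: block_le_def)
    have "finite (f w n)" using 1(1)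
    proof (cases rule: cases_A)
      case (chain c)
      then have "f w n \<subseteq> {x. block_le f x (c n)}" by auto
      moreover have "finite {x. block_le f x (c n)}" using 1(2)[OF chain(1)[of n], rule_format, of "snd (c n)"] by simp
      ultimately show ?thesis using finite_subset by blast
    qed auto
    then show "finite {x. block_le f x (w, n)}" using e by simp
  qed
qed

text \<open>For \<open>n = Suc m\<close> the elements strictly below \<open>(w, n)\<close> form the
  union of the principal ideals of \<open>(w, m)\<close> and \<open>c n\<close>, and these meet in
  that of \<open>c m\<close>. Where one principal ideal suffices, it plays all three parts.\<close>

lemma le_ladder:
  assumes "fst x \<in> A"
  shows "{y. block_le f y x \<and> y \<noteq> x} = {} \<or>
    (\<exists>y z u. fst y \<in> A \<and> fst z \<in> A \<and> fst u \<in> A \<and>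
       {a. block_le f a x \<and> a \<noteq> x} = {a. block_le f a y} \<union> {a. block_le f a z} \<and>
       {a. block_le f a y} \<inter> {a. block_le f a z} = {a. block_le f a u})"
proof -
  obtain w n where x: "x = (w, n)" by fastforce
  then have w: "w \<in> A" using assms by simp
  have wf: "(w, k) \<notin> f w n" for k n using f_sub[OF w] by (auto simp: underS_def)
  have below: "{a. block_le f a (w, k)} = {w} \<times> {..k} \<union> f w k" for k
    by (auto simp: block_le_def)
  have lt: "{a. block_le f a x \<and> a \<noteq> x} = {w} \<times> {..<n} \<union> f w n"
    using wf by (auto simp: block_le_def x)
  from w show ?thesis
  proof (cases rule: cases_A)
    case empty
    show ?thesis
    proof (cases n)
      case 0
      then show ?thesis using lt empty by auto
    next
      case (Suc m)
      have "{a. block_le f a x \<and> a \<noteq> x} = {a. block_le f a (w, m)}"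
        unfolding lt below using empty Suc by auto
      then show ?thesis using w by (intro disjI2 exI[of _ "(w, m)"]) auto
    qed
  next
    case (chain c)
    have cA: "fst (c k) \<in> A" for k using chain(1) A_down w by blast
    have fc: "f w k = {a. block_le f a (c k)}" for k
    proof -
      have "fst a \<in> underS r w" if "block_le f a (c k)" for a
        using le_fst[OF that cA] chain(1)[of k] underS_trans by metis
      then show ?thesis using chain(4) by auto
    qed
    show ?thesis
    proof (cases n)
      case 0
      then have "{a. block_le f a x \<and> a \<noteq> x} = {a. block_le f a (c 0)}" using lt fc by auto
      then show ?thesis using cA by (intro disjI2 exI[of _ "c 0"]) auto
    next
      case (Suc m)
      have s: "f w m \<subseteq> f w n" unfolding fc using le_trans[OF _ chain(2) cA] Suc by auto
      have 1: "{a. block_le f a x \<and> a \<noteq> x} = {a. block_le f a (w, m)} \<union> {a. block_le f a (c n)}"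
        unfolding lt below fc[symmetric] using Suc s by auto
      have 2: "{a. block_le f a (w, m)} \<inter> {a. block_le f a (c n)} = {a. block_le f a (c m)}"
        unfolding below fc[symmetric] using s wf by auto
      show ?thesis
        by (intro disjI2 exI[of _ "(w, m)"] exI[of _ "c n"] exI[of _ "c m"] conjI;
            (rule 1 | rule 2 | simp add: w cA))
    qed
  qed
qed

end

text \<open>Each term is chosen above the previous one and above the next element of an enumeration
  of \<open>Q\<close>.\<close>

lemma cofinal_sequence:
  fixes lq :: "'a \<Rightarrow> 'a \<Rightarrow> bool"
  assumes Q: "countable Q" "Q \<noteq> {}"
    and dir: "\<And>x y. \<lbrakk>x \<in> Q; y \<in> Q\<rbrakk> \<Longrightarrow> \<exists>z\<in>Q. lq x z \<and> lq y z"
  shows "\<exists>c::nat \<Rightarrow> 'a. (\<forall>n. c n \<in> Q) \<and> (\<forall>n. lq (c n) (c (Suc n))) \<and> (\<forall>x\<in>Q. \<exists>n. lq x (c n))"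
proof -
  define e where "e = from_nat_into Q"
  have e: "e n \<in> Q" for n using from_nat_into[OF Q(2)] e_def by simp
  obtain ub where ub: "\<And>x y. \<lbrakk>x \<in> Q; y \<in> Q\<rbrakk> \<Longrightarrow> ub x y \<in> Q \<and> lq x (ub x y) \<and> lq y (ub x y)"
    using dir by metis
  define c where "c = rec_nat (e 0) (\<lambda>n x. ub x (e n))"
  have c: "c n \<in> Q" for n by (induction n) (use e ub in \<open>auto simp: c_def\<close>)
  have "lq (c n) (c (Suc n))" "lq (e n) (c (Suc n))" for n
    using ub[OF c[of n] e[of n]] by (simp_all add: c_def)
  moreover have "\<exists>n. x = e n" if "x \<in> Q" for x
    using from_nat_into_surj[OF Q(1) that] e_def by metis
  ultimately show ?thesis using c by blast
qed

text \<open>In the cardinal order of \<open>W\<close> every proper initial segment is smaller than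
  \<open>W\<close>; here the bound \<open>aleph1\<close> makes the earlier columns
  countable.\<close>

lemma countable_underS:
  assumes W: "|W| \<le>o aleph1" and w: "w \<in> W"
  shows "countable (underS |W| w)"
proof -
  have "|underS |W| w| <o |W|" using card_of_underS[OF card_of_Card_order] w by (simp add: Field_card_of)
  then have "|underS |W| w| <o aleph1" using W ordLess_ordLeq_trans by blast
  then have "|underS |W| w| \<le>o natLeq"
    using cardSuc_ordLeq_ordLess[OF natLeq_Card_order card_of_Card_order] by blast
  then show ?thesis by (simp add: countable_card_le_natLeq)
qed

text \<open>Well-founded recursion over the cardinal order of \<open>W\<close>, choosing for each
  \<open>w\<close> a cofinal sequence in the countable directed set of earlier columns. Every
  element of \<open>W\<close> occurs as a first component, so that the indices below a given one can
  supply generators.\<close>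

theorem ladder_exists:
  fixes W :: "'a set"
  assumes W: "|W| \<le>o aleph1"
  shows "\<exists>lq :: 'a \<times> nat \<Rightarrow> 'a \<times> nat \<Rightarrow> bool.
     (\<forall>x y. fst y \<in> W \<and> lq x y \<longrightarrow> fst x \<in> W) \<and>
     (\<forall>x. lq x x) \<and>
     (\<forall>x y z. fst z \<in> W \<and> lq x y \<and> lq y z \<longrightarrow> lq x z) \<and>
     (\<forall>x y. fst x \<in> W \<and> fst y \<in> W \<and> lq x y \<and> lq y x \<longrightarrow> x = y) \<and>
     (\<forall>x. fst x \<in> W \<longrightarrow> finite {y. lq y x}) \<and>
     (\<forall>x y. fst x \<in> W \<and> fst y \<in> W \<longrightarrow> (\<exists>z. fst z \<in> W \<and> lq x z \<and> lq y z)) \<and>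
     (\<forall>x. fst x \<in> W \<longrightarrow> {y. lq y x \<and> y \<noteq> x} = {} \<or>
        (\<exists>y z u. fst y \<in> W \<and> fst z \<in> W \<and> fst u \<in> W \<and>
           {a. lq a x \<and> a \<noteq> x} = {a. lq a y} \<union> {a. lq a z} \<and> {a. lq a y} \<inter> {a. lq a z} = {a. lq a u}))"
proof -
  let ?r = "|W|"
  have wo: "Well_order ?r" and F: "Field ?r = W" by (rule card_of_Well_order, rule Field_card_of)
  have wfr: "wf (?r - Id)" using wo unfolding well_order_on_def by blast
  have u: "v \<in> underS ?r w \<longleftrightarrow> (v, w) \<in> ?r - Id" for v w by (auto simp: underS_def)
  have uW: "underS ?r w \<subseteq> W" for w using F by (auto simp: underS_def Field_def)
  have "\<exists>f. \<forall>w. w \<in> W \<longrightarrow> block_step ?r f w (f w)"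
  proof (rule dependent_wf_choice[OF wfr, of "\<lambda>f w d. w \<in> W \<longrightarrow> block_step ?r f w d"])
    \<comment> \<open>Dependent choice asks that the condition at \<open>w\<close> look at
      \<open>f\<close> only below \<open>w\<close>.\<close>
    fix f g w d assume eq: "\<And>z. (z, w) \<in> ?r - Id \<Longrightarrow> f z = (g z :: nat \<Rightarrow> ('a \<times> nat) set)"
    have "block_le f x y = block_le g x y" if "fst y \<in> underS ?r w" for x y
      using eq[of "fst y"] that u by (simp add: block_le_def)
    then have e: "c n \<in> underS ?r w \<times> UNIV \<Longrightarrow> block_le f x (c n) = block_le g x (c n)" for c :: "nat \<Rightarrow> _" and n x
      by (metis mem_Times_iff)
    have "block_step ?r f w d = block_step ?r g w d"
      unfolding block_step_def Let_def
      by (intro arg_cong2[of _ _ _ _ "(\<or>)"] refl arg_cong[of _ _ Ex] ext) (auto simp: e)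
    then show "(w \<in> W \<longrightarrow> block_step ?r f w d) = (w \<in> W \<longrightarrow> block_step ?r g w d)" by simp
  next
    fix w and f :: "'a \<Rightarrow> nat \<Rightarrow> ('a \<times> nat) set"
    assume IH: "\<And>y. (y, w) \<in> ?r - Id \<Longrightarrow> y \<in> W \<longrightarrow> block_step ?r f y (f y)"
    show "\<exists>d. w \<in> W \<longrightarrow> block_step ?r f w d"
    proof (cases "w \<in> W \<and> underS ?r w \<noteq> {}")
      case True
      interpret block_order ?r f "underS ?r w"
      proof
        show "v \<in> underS ?r w" if "w' \<in> underS ?r w" "v \<in> underS ?r w'" for w' v
          using that wo unfolding underS_def well_order_on_def linear_order_on_def
            partial_order_on_def preorder_on_def by (auto dest: transD antisymD)
        show "block_step ?r f w' (f w')" if "w' \<in> underS ?r w" for w'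
          using IH[of w'] that u uW by blast
      qed (use wo F uW in auto)
      let ?Q = "underS ?r w \<times> (UNIV :: nat set)"
      have "countable ?Q" using countable_underS[OF W] True by auto
      moreover have "?Q \<noteq> {}" using True by auto
      moreover have "\<exists>z\<in>?Q. block_le f x z \<and> block_le f y z" if "x \<in> ?Q" "y \<in> ?Q" for x y
        using le_directed[of x y] that by (auto simp: mem_Times_iff)
      ultimately obtain c where "\<forall>n. c n \<in> ?Q" "\<forall>n. block_le f (c n) (c (Suc n))" "\<forall>x\<in>?Q. \<exists>n. block_le f x (c n)"
        using cofinal_sequence[of ?Q "block_le f"] by auto
      then have "block_step ?r f w (\<lambda>n. {x \<in> ?Q. block_le f x (c n)})"
        unfolding block_step_def Let_def by blast
      then show ?thesis by blast
    next
      case False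
      then have "w \<in> W \<longrightarrow> block_step ?r f w (\<lambda>_. {})" by (auto simp: block_step_def)
      then show ?thesis by blast
    qed
  qed
  then obtain f where f: "\<And>w. w \<in> W \<Longrightarrow> block_step ?r f w (f w)" by blast
  interpret block_order ?r f W
    by unfold_locales (use wo F uW f in auto)
  have fin: "finite {y. block_le f y x}" if "fst x \<in> W" for x
    using le_finite_aux[OF that, rule_format, of "snd x"] by simp
  show ?thesis
    by (rule exI[of _ "block_le f"]) (intro conjI allI impI; (elim conjE)?;
      (rule le_ladder le_refl | blast intro: le_in le_trans le_antisym fin le_directed)?)
qed


text \<open>Composition follows the arrows: \<open>cmp f g\<close> is \<open>f\<close> and then
  \<open>g\<close>. Recursion is on the target \<open>x\<close>, whose proper lower segment consists
  of the ideals of \<open>y\<close> and \<open>z\<close>, meeting in that of \<open>u\<close>.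
  Arrows from \<open>y\<close> and \<open>z\<close> to \<open>x\<close> are chosen freely; the two
  resulting arrows from \<open>u\<close> differ by some \<open>a\<close> in \<open>M x x\<close>,
  and correcting one choice by \<open>a\<close> makes everything agree on the overlap.\<close>

lemma coherent_system:
  fixes lq :: "'i \<Rightarrow> 'i \<Rightarrow> bool" and M :: "'i \<Rightarrow> 'i \<Rightarrow> 'm set"
    and cmp :: "'m \<Rightarrow> 'm \<Rightarrow> 'm" and one :: "'i \<Rightarrow> 'm"
  assumes down: "\<And>i j. \<lbrakk>j \<in> I; lq i j\<rbrakk> \<Longrightarrow> i \<in> I"
    and rfl: "\<And>i. lq i i"
    and trns: "\<And>i j k. \<lbrakk>k \<in> I; lq i j; lq j k\<rbrakk> \<Longrightarrow> lq i k"
    and antis: "\<And>i j. \<lbrakk>i \<in> I; j \<in> I; lq i j; lq j i\<rbrakk> \<Longrightarrow> i = j"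
    and fin: "\<And>i. i \<in> I \<Longrightarrow> finite {j. lq j i}"
    and ladder: "\<And>x. x \<in> I \<Longrightarrow> {y. lq y x \<and> y \<noteq> x} = {} \<or>
       (\<exists>y z u. y \<in> I \<and> z \<in> I \<and> u \<in> I \<and> {a. lq a x \<and> a \<noteq> x} = {a. lq a y} \<union> {a. lq a z} \<and>
          {a. lq a y} \<inter> {a. lq a z} = {a. lq a u})"
    and one: "\<And>i. i \<in> I \<Longrightarrow> one i \<in> M i i"
    and cmp: "\<And>i j k f g. \<lbrakk>k \<in> I; lq i j; lq j k; f \<in> M i j; g \<in> M j k\<rbrakk> \<Longrightarrow> cmp f g \<in> M i k"
    and one_l: "\<And>i j f. \<lbrakk>j \<in> I; lq i j; f \<in> M i j\<rbrakk> \<Longrightarrow> cmp (one i) f = f"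
    and one_r: "\<And>i j f. \<lbrakk>j \<in> I; lq i j; f \<in> M i j\<rbrakk> \<Longrightarrow> cmp f (one j) = f"
    and assoc: "\<And>f g h. cmp (cmp f g) h = cmp f (cmp g h)"
    and ex: "\<And>i j. \<lbrakk>j \<in> I; lq i j\<rbrakk> \<Longrightarrow> M i j \<noteq> {}"
    and conj: "\<And>i j f g. \<lbrakk>j \<in> I; lq i j; f \<in> M i j; g \<in> M i j\<rbrakk> \<Longrightarrow> \<exists>a\<in>M j j. f = cmp g a"
  shows "\<exists>h. (\<forall>j\<in>I. \<forall>i. lq i j \<longrightarrow> h i j \<in> M i j) \<and>
     (\<forall>k\<in>I. \<forall>i j. lq i j \<and> lq j k \<longrightarrow> cmp (h i j) (h j k) = h i k) \<and> (\<forall>i\<in>I. h i i = one i)"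
proof -
  define R where "R = {(y, x). x \<in> I \<and> lq y x \<and> y \<noteq> x}"
  have "R \<subseteq> measure (\<lambda>x. card {j. lq j x})"
  proof (clarsimp simp: R_def)
    fix y x assume a: "x \<in> I" "lq y x" "y \<noteq> x"
    then have "{j. lq j y} \<subset> {j. lq j x}" using trns antis rfl down by blast
    then show "card {j. lq j y} < card {j. lq j x}" using fin[OF a(1)] by (rule psubset_card_mono[rotated])
  qed
  then have wf: "wf R" using wf_subset by blast
  \<comment> \<open>\<open>r i\<close> is the arrow from \<open>i\<close> to the new target
    \<open>x\<close>, while \<open>f j i\<close> is the arrow from \<open>i\<close> to an earlier
    target \<open>j\<close>.\<close>
  define P where "P = (\<lambda>f x r. x \<in> I \<longrightarrow> r x = one x \<and> (\<forall>i. lq i x \<longrightarrow> r i \<in> M i x) \<and>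
     (\<forall>i j. lq i j \<and> lq j x \<and> j \<noteq> x \<longrightarrow> cmp (f j i) (r j) = r i))"
  have "\<exists>f. \<forall>x. P f x (f x)"
  proof (rule dependent_wf_choice[OF wf, of P])
    fix f g :: "'i \<Rightarrow> 'i \<Rightarrow> 'm" and x r
    assume "\<And>z. (z, x) \<in> R \<Longrightarrow> f z = g z"
    then show "P f x r = P g x r" unfolding P_def R_def by auto
  next
    fix x and f :: "'i \<Rightarrow> 'i \<Rightarrow> 'm" assume IH: "\<And>y. (y, x) \<in> R \<Longrightarrow> P f y (f y)"
    show "\<exists>r. P f x r"
    proof (cases "x \<in> I")
      case x: True
      have H1: "f j j = one j" and H2: "lq i j \<Longrightarrow> f j i \<in> M i j"
        and H3: "lq i k \<Longrightarrow> lq k j \<Longrightarrow> cmp (f k i) (f j k) = f j i"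
        if j: "lq j x" "j \<noteq> x" for i j k
      proof -
        have p: "P f j (f j)" and jI: "j \<in> I" using IH j x down by (auto simp: R_def)
        then show 1: "f j j = one j" and 2: "lq i j \<Longrightarrow> f j i \<in> M i j" for i by (auto simp: P_def)
        show "lq i k \<Longrightarrow> lq k j \<Longrightarrow> cmp (f k i) (f j k) = f j i"
        proof (cases "k = j")
          case True
          then show "lq i k \<Longrightarrow> lq k j \<Longrightarrow> cmp (f k i) (f j k) = f j i"
            using 1 2 one_r jI by auto
        qed (use p jI in \<open>auto simp: P_def\<close>)
      qed
      consider "{y. lq y x \<and> y \<noteq> x} = {}" |
        y z u where "y \<in> I" "z \<in> I" "u \<in> I" "{a. lq a x \<and> a \<noteq> x} = {a. lq a y} \<union> {a. lq a z}"
          "{a. lq a y} \<inter> {a. lq a z} = {a. lq a u}"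
        using ladder[OF x] by blast
      then show ?thesis
      proof cases
        case 1
        then have "P f x (\<lambda>_. one x)" using one by (auto simp: P_def)
        then show ?thesis by blast
      next
        case (2 y z u)
        have below: "lq a x \<and> a \<noteq> x \<longleftrightarrow> lq a y \<or> lq a z" for a using 2(4) by blast
        have inter: "lq a y \<and> lq a z \<longleftrightarrow> lq a u" for a using 2(5) by blast
        have y: "lq y x" "y \<noteq> x" and z: "lq z x" "z \<noteq> x" using below rfl by auto
        have u: "lq u y" "lq u z" using inter rfl by auto
        obtain e1 e2' where e: "e1 \<in> M y x" "e2' \<in> M z x" using ex x y z by blast
        have "cmp (f y u) e1 \<in> M u x" "cmp (f z u) e2' \<in> M u x"
          using cmp[OF x u(1) y(1) H2[OF y u(1)] e(1)] cmp[OF x u(2) z(1) H2[OF z u(2)] e(2)] by auto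
        then obtain a where a: "a \<in> M x x" "cmp (f y u) e1 = cmp (cmp (f z u) e2') a"
          using conj[OF x] trns[OF x u(1) y(1)] by blast
        \<comment> \<open>The correction acts at the target, so the composites through
          \<open>z\<close> remain coherent.\<close>
        define e2 where "e2 = cmp e2' a"
        have e2: "e2 \<in> M z x" using cmp[OF x z(1) rfl e(2) a(1)] e2_def by simp
        have am: "cmp (f y u) e1 = cmp (f z u) e2" using a(2) assoc by (simp add: e2_def)
        define r where "r = (\<lambda>i. if i = x then one x else if lq i y then cmp (f y i) e1 else cmp (f z i) e2)"
        have ry: "r i = cmp (f y i) e1" if "lq i y" for i
          using that below by (auto simp: r_def)
        \<comment> \<open>On the overlap \<open>i\<close> lies below \<open>u\<close>, and both
          descriptions factor through the common arrow from \<open>u\<close> to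
          \<open>x\<close>.\<close>
        have rz: "r i = cmp (f z i) e2" if "lq i z" for i
        proof (cases "lq i y")
          case True
          then have iu: "lq i u" using inter that by blast
          have "cmp (f y i) e1 = cmp (f u i) (cmp (f y u) e1)" using H3[OF y iu u(1)] assoc by metis
          also have "\<dots> = cmp (f z i) e2" using am H3[OF z iu u(2)] assoc by metis
          finally show ?thesis using ry True by simp
        qed (use that below in \<open>auto simp: r_def\<close>)
        have "r i \<in> M i x" if "lq i x" for i
        proof (cases "i = x")
          case False
          then have "lq i y \<or> lq i z" using below[of i] that by blast
          then show ?thesis
            using ry rz cmp[OF x _ y(1) H2[OF y] e(1)] cmp[OF x _ z(1) H2[OF z] e2] by metis
        qed (use one x in \<open>simp add: r_def\<close>)
        moreover have "cmp (f j i) (r j) = r i" if ij: "lq i j" and jx: "lq j x" "j \<noteq> x" for i j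
        proof -
          consider "lq j y" | "lq j z" using below[of j] jx by blast
          then show ?thesis
          proof cases
            case 1
            then show ?thesis using ry[OF 1] ry[OF trns[OF 2(1) ij 1]] H3[OF y ij 1] assoc by metis
          next
            case b: 2
            then show ?thesis using rz[OF b] rz[OF trns[OF 2(2) ij b]] H3[OF z ij b] assoc by metis
          qed
        qed
        ultimately have "P f x r" by (auto simp: P_def r_def)
        then show ?thesis by blast
      qed
    qed (auto simp: P_def)
  qed
  then obtain f where f: "P f x (f x)" for x by blast
  define h where "h = (\<lambda>i j. f j i)"
  have 1: "h i j \<in> M i j" if "j \<in> I" "lq i j" for i j using f[of j] that by (auto simp: h_def P_def)
  have 2: "h i i = one i" if "i \<in> I" for i using f[of i] that by (auto simp: h_def P_def)
  have "cmp (h i j) (h j k) = h i k" if "k \<in> I" "lq i j" "lq j k" for i j k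
  proof (cases "j = k")
    case True
    then show ?thesis using one_r[OF that(1) _ 1] 2 that by simp
  next
    case False
    then show ?thesis using f[of k] that by (auto simp: h_def P_def)
  qed
  then show ?thesis using 1 2 by blast
qed

section \<open>Block diagonal embeddings as partial maps of matrix positions\<close>

type_synonym 's pos = "'s \<times> nat"

definition positions :: "'s set \<Rightarrow> ('s \<Rightarrow> nat) \<Rightarrow> 's pos set" where
  "positions S n = {(s, k). s \<in> S \<and> k < n s}"

definition same_block :: "'s set \<Rightarrow> ('s \<Rightarrow> nat) \<Rightarrow> ('s pos \<times> 's pos) set" where
  "same_block S n = {(p, q). p \<in> positions S n \<and> q \<in> positions S n \<and> fst p = fst q}"

text \<open>A homomorphism is coded backwards: the image has at \<open>(q, q')\<close> the source
  entry at \<open>e (q, q')\<close>, and zero where \<open>e\<close> is undefined. In turn the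
  conditions say that blocks, reversal of pairs and composition of pairs are respected, that the
  copy of one row extends uniquely to a copy of its whole block, and that block \<open>t\<close>
  contains \<open>m s t\<close> copies of block \<open>s\<close>. Copies carry no numbers, which
  keeps composition free of bookkeeping.\<close>

definition block_maps ::
    "'s set \<Rightarrow> ('s \<Rightarrow> nat) \<Rightarrow> 't set \<Rightarrow> ('t \<Rightarrow> nat) \<Rightarrow> ('s \<Rightarrow> 't \<Rightarrow> nat) \<Rightarrow>
      ('t pos \<times> 't pos \<rightharpoonup> 's pos \<times> 's pos) set" where
  "block_maps S n T n' m = {e.
     (\<forall>x y. e x = Some y \<longrightarrow> x \<in> same_block T n' \<and> y \<in> same_block S n) \<and>
     (\<forall>q q' p p'. e (q, q') = Some (p, p') \<longrightarrow> e (q', q) = Some (p', p)) \<and>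
     (\<forall>q q' q'' p p' p1 p''. e (q, q') = Some (p, p') \<and> e (q', q'') = Some (p1, p'') \<longrightarrow>
        p1 = p' \<and> e (q, q'') = Some (p, p'')) \<and>
     (\<forall>q p p'. e (q, q) = Some (p, p) \<and> (p, p') \<in> same_block S n \<longrightarrow>
        (\<exists>!q'. e (q, q') = Some (p, p'))) \<and>
     (\<forall>p\<in>positions S n. \<forall>t\<in>T. card {k. e ((t, k), (t, k)) = Some (p, p)} = m (fst p) t)}"

lemma block_mapsD:
  assumes "e \<in> block_maps S n T n' m"
  shows "e x = Some y \<Longrightarrow> x \<in> same_block T n'" "e x = Some y \<Longrightarrow> y \<in> same_block S n"
    "e (q, q') = Some (p, p') \<Longrightarrow> e (q', q) = Some (p', p)"
    "e (q, q') = Some (p, p') \<Longrightarrow> e (q', q'') = Some (p1, p'') \<Longrightarrow> p1 = p'"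
    "e (q, q') = Some (p, p') \<Longrightarrow> e (q', q'') = Some (p1, p'') \<Longrightarrow> e (q, q'') = Some (p, p'')"
    "e (q, q) = Some (p, p) \<Longrightarrow> (p, p') \<in> same_block S n \<Longrightarrow> \<exists>!q'. e (q, q') = Some (p, p')"
    "p \<in> positions S n \<Longrightarrow> t \<in> T \<Longrightarrow> card {k. e ((t, k), (t, k)) = Some (p, p)} = m (fst p) t"
proof -
  note a = assms[unfolded block_maps_def mem_Collect_eq]
  note a1 = a[THEN conjunct1] and a2 = a[THEN conjunct2, THEN conjunct1]
    and a3 = a[THEN conjunct2, THEN conjunct2, THEN conjunct1]
    and a4 = a[THEN conjunct2, THEN conjunct2, THEN conjunct2]
  show "e x = Some y \<Longrightarrow> x \<in> same_block T n'" "e x = Some y \<Longrightarrow> y \<in> same_block S n"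
    using a1 by blast+
  show "e (q, q') = Some (p, p') \<Longrightarrow> e (q', q) = Some (p', p)" using a2 by blast
  show "e (q, q') = Some (p, p') \<Longrightarrow> e (q', q'') = Some (p1, p'') \<Longrightarrow> p1 = p'"
    "e (q, q') = Some (p, p') \<Longrightarrow> e (q', q'') = Some (p1, p'') \<Longrightarrow> e (q, q'') = Some (p, p'')"
    using a3 by blast+
  show "e (q, q) = Some (p, p) \<Longrightarrow> (p, p') \<in> same_block S n \<Longrightarrow> \<exists>!q'. e (q, q') = Some (p, p')"
    using a4[THEN conjunct1] by blast
  show "p \<in> positions S n \<Longrightarrow> t \<in> T \<Longrightarrow> card {k. e ((t, k), (t, k)) = Some (p, p)} = m (fst p) t"
    using a4[THEN conjunct2] by blast
qed

lemma block_maps_position: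
  assumes "e \<in> block_maps S n T n' m" "e (q, q') = Some (p, p')"
  shows "fst q' = fst q" "fst q \<in> T" "snd q < n' (fst q)" "snd q' < n' (fst q)"
    "fst p' = fst p" "fst p \<in> S" "snd p < n (fst p)" "snd p' < n (fst p)"
  using block_mapsD(1,2)[OF assms] by (auto simp: same_block_def positions_def)

lemma block_maps_refl:
  assumes "e \<in> block_maps S n T n' m" "e (q, q') = Some (p, p')"
  shows "e (q, q) = Some (p, p)" "e (q', q') = Some (p', p')"
  using block_mapsD(5)[OF assms(1)] block_mapsD(3)[OF assms(1)] assms(2) by blast+

lemma block_maps_source:
  assumes e: "e \<in> block_maps S n T n' m" and "e (q, q') = Some (p, p')" "e (q, q'') = Some (p1, p'')"
  shows "p1 = p"
  using block_maps_refl[OF e assms(2)] block_maps_refl[OF e assms(3)] by simp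

lemma block_maps_unique:
  assumes e: "e \<in> block_maps S n T n' m" and 1: "e (q, q') = Some (p, p')" and 2: "e (q, q'') = Some (p, p')"
  shows "q' = q''"
  using block_mapsD(6)[OF e block_maps_refl(1)[OF e 1] block_mapsD(2)[OF e 1]] 1 2 by blast

text \<open>A copy of \<open>p\<close> in block \<open>u\<close> is a copy in \<open>u\<close> of a
  copy of \<open>p\<close> in some block \<open>t\<close>; counting such pairs gives the matrix
  product of the multiplicities.\<close>

lemma block_maps_comp:
  assumes e: "e \<in> block_maps S n T n' m" and e': "e' \<in> block_maps T n' U n'' m'"
    and fin: "finite T"
    and mm: "\<And>s u. \<lbrakk>s \<in> S; u \<in> U\<rbrakk> \<Longrightarrow> m'' s u = (\<Sum>t\<in>T. m s t * m' t u)"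
  shows "e \<circ>\<^sub>m e' \<in> block_maps S n U n'' m''"
proof -
  have c: "(e \<circ>\<^sub>m e') (q, q') = Some (p, p') \<longleftrightarrow> (\<exists>r r'. e' (q, q') = Some (r, r') \<and> e (r, r') = Some (p, p'))" for q q' p p'
    by (auto simp: map_comp_def split: option.splits)
  have c': "(e \<circ>\<^sub>m e') x = Some y \<longleftrightarrow> (\<exists>r. e' x = Some r \<and> e r = Some y)" for x y
    by (auto simp: map_comp_def split: option.splits)
  have 1: "\<exists>!q'. (e \<circ>\<^sub>m e') (q, q') = Some (p, p')"
    if a: "(e \<circ>\<^sub>m e') (q, q) = Some (p, p)" "(p, p') \<in> same_block S n" for q p p'
  proof -
    obtain r r1 where r: "e' (q, q) = Some (r, r1)" "e (r, r1) = Some (p, p)" using a(1) c by blast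
    have "r1 = r" using block_mapsD(4)[OF e' r(1) r(1)] by simp
    note r = r[unfolded this]
    obtain r' where r': "e (r, r') = Some (p, p')" using block_mapsD(6)[OF e r(2) a(2)] by blast
    obtain q' where q': "e' (q, q') = Some (r, r')"
      using block_mapsD(6)[OF e' r(1) block_mapsD(1)[OF e r']] by blast
    show ?thesis
    proof (rule ex1I[of _ q'])
      show "(e \<circ>\<^sub>m e') (q, q') = Some (p, p')" using r' q' c by blast
      fix q2 assume "(e \<circ>\<^sub>m e') (q, q2) = Some (p, p')"
      then obtain r2 r3 where r2: "e' (q, q2) = Some (r2, r3)" "e (r2, r3) = Some (p, p')" using c by blast
      have "r2 = r" using block_maps_source[OF e' r(1) r2(1)] .
      then have "r3 = r'" using block_maps_unique[OF e r'] r2(2) by simp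
      then show "q2 = q'" using block_maps_unique[OF e' q'] r2(1) \<open>r2 = r\<close> by simp
    qed
  qed
  have 2: "card {k. (e \<circ>\<^sub>m e') ((u, k), (u, k)) = Some (p, p)} = m'' (fst p) u"
    if p: "p \<in> positions S n" and u: "u \<in> U" for p u
  proof -
    \<comment> \<open>The positions of the middle ring at which \<open>p\<close> is copied.\<close>
    define Z where "Z = (SIGMA t:T. {l. e ((t, l), (t, l)) = Some (p, p)})"
    have Zpos: "r \<in> positions T n'" "e (r, r) = Some (p, p)" if "r \<in> Z" for r
  proof -
    show 1: "e (r, r) = Some (p, p)" using that by (auto simp: Z_def)
    show "r \<in> positions T n'" using block_mapsD(1)[OF e 1] by (simp add: same_block_def)
  qed
    have fl: "finite {l. e ((t, l), (t, l)) = Some (p, p)}" for t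
      by (rule finite_subset[of _ "{..<n' t}"]) (use block_maps_position(3)[OF e] in \<open>fastforce+\<close>)
    have fk: "finite {k. e' ((u, k), (u, k)) = Some (r, r)}" for r
      by (rule finite_subset[of _ "{..<n'' u}"]) (use block_maps_position(3)[OF e'] in \<open>fastforce+\<close>)
    have fZ: "finite Z" unfolding Z_def using fin fl by auto
    have "{k. (e \<circ>\<^sub>m e') ((u, k), (u, k)) = Some (p, p)} = (\<Union>r\<in>Z. {k. e' ((u, k), (u, k)) = Some (r, r)})"
    proof -
      have "(e \<circ>\<^sub>m e') (q, q) = Some (p, p) \<longleftrightarrow> (\<exists>r\<in>Z. e' (q, q) = Some (r, r))" for q
      proof
        assume "(e \<circ>\<^sub>m e') (q, q) = Some (p, p)"
        then obtain r r1 where r: "e' (q, q) = Some (r, r1)" "e (r, r1) = Some (p, p)" using c by blast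
        have "r1 = r" using block_mapsD(4)[OF e' r(1) r(1)] by simp
        then show "\<exists>r\<in>Z. e' (q, q) = Some (r, r)" using r block_mapsD(1)[OF e r(2)]
          by (intro bexI[of _ r]) (auto simp: Z_def same_block_def positions_def)
      qed (use Zpos c in blast)
      then show ?thesis by blast
    qed
    then have "card {k. (e \<circ>\<^sub>m e') ((u, k), (u, k)) = Some (p, p)} =
        (\<Sum>r\<in>Z. card {k. e' ((u, k), (u, k)) = Some (r, r)})"
      using fZ fk by (subst card_UN_disjoint[symmetric]) auto
    also have "\<dots> = (\<Sum>r\<in>Z. m' (fst r) u)"
      by (intro sum.cong refl) (use Zpos(1) block_mapsD(7)[OF e' _ u] in auto)
    also have "\<dots> = (\<Sum>t\<in>T. \<Sum>l\<in>{l. e ((t, l), (t, l)) = Some (p, p)}. m' t u)"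
      unfolding Z_def using fin fl by (subst sum.Sigma) (auto simp: case_prod_unfold)
    also have "\<dots> = (\<Sum>t\<in>T. m (fst p) t * m' t u)"
      using block_mapsD(7)[OF e p] by simp
    also have "\<dots> = m'' (fst p) u" using mm p u by (auto simp: positions_def)
    finally show ?thesis .
  qed
  show ?thesis unfolding block_maps_def mem_Collect_eq
    apply (intro conjI)
    subgoal using block_mapsD(1)[OF e'] block_mapsD(2)[OF e] c' by blast
    subgoal unfolding c using block_mapsD(3)[OF e'] block_mapsD(3)[OF e] by blast
    subgoal
    proof (intro allI impI, elim conjE)
      fix q q' q'' p p' p1 p''
      assume a: "(e \<circ>\<^sub>m e') (q, q') = Some (p, p')" "(e \<circ>\<^sub>m e') (q', q'') = Some (p1, p'')"
      obtain r r' where r: "e' (q, q') = Some (r, r')" "e (r, r') = Some (p, p')" using a(1) c by blast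
      obtain r1 r'' where r1: "e' (q', q'') = Some (r1, r'')" "e (r1, r'') = Some (p1, p'')" using a(2) c by blast
      have "r1 = r'" using block_mapsD(4)[OF e' r(1) r1(1)] .
      note r1 = r1[unfolded this]
      show "p1 = p' \<and> (e \<circ>\<^sub>m e') (q, q'') = Some (p, p'')"
        using block_mapsD(5)[OF e' r(1) r1(1)] block_mapsD(4,5)[OF e r(2) r1(2)] c by blast
    qed
    subgoal using 1 by blast
    subgoal using 2 by blast
    done
qed

text \<open>The label \<open>(s, l, r)\<close> on a row of block \<open>t\<close> means row
  \<open>l\<close> of copy number \<open>r\<close> of block \<open>s\<close>; a row with
  \<open>None\<close> belongs to no copy. This is the numbering that \<open>block_maps\<close>
  avoids.\<close>

definition labelling ::
    "'s set \<Rightarrow> ('s \<Rightarrow> nat) \<Rightarrow> 't set \<Rightarrow> ('t \<Rightarrow> nat) \<Rightarrow> ('s \<Rightarrow> 't \<Rightarrow> nat) \<Rightarrow>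
      ('t pos \<rightharpoonup> 's \<times> nat \<times> nat) \<Rightarrow> bool" where
  "labelling S n T n' m \<gamma> \<longleftrightarrow> (\<forall>t\<in>T.
     inj_on (\<lambda>k. \<gamma> (t, k)) {k. k < n' t \<and> \<gamma> (t, k) \<noteq> None} \<and>
     (\<lambda>k. \<gamma> (t, k)) ` {k. k < n' t \<and> \<gamma> (t, k) \<noteq> None} = Some ` {(s, l, r). s \<in> S \<and> l < n s \<and> r < m s t})"

definition label_map ::
    "'t set \<Rightarrow> ('t \<Rightarrow> nat) \<Rightarrow> ('t pos \<rightharpoonup> 's \<times> nat \<times> nat) \<Rightarrow> 't pos \<times> 't pos \<rightharpoonup> 's pos \<times> 's pos" where
  "label_map T n' \<gamma> = (\<lambda>(q, q'). if (q, q') \<in> same_block T n' then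
      (case (\<gamma> q, \<gamma> q') of (Some (s, l, r), Some (s', l', r')) \<Rightarrow>
         if s = s' \<and> r = r' then Some ((s, l), (s', l')) else None | _ \<Rightarrow> None) else None)"

lemma label_map_iff:
  "label_map T n' \<gamma> (q, q') = Some (p, p') \<longleftrightarrow> (q, q') \<in> same_block T n' \<and> fst p = fst p' \<and>
     (\<exists>r. \<gamma> q = Some (fst p, snd p, r) \<and> \<gamma> q' = Some (fst p', snd p', r))"
  by (cases p, cases p') (auto simp: label_map_def split: option.splits)

lemma label_map_in:
  assumes l: "labelling S n T n' m \<gamma>"
  shows "label_map T n' \<gamma> \<in> block_maps S n T n' m"
proof -
  have ran: "(s, k, r) \<in> {(s, l, r). s \<in> S \<and> l < n s \<and> r < m s t}" if "\<gamma> (t, j) = Some (s, k, r)" "t \<in> T" "j < n' t" for t j s k r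
  proof -
    have "Some (s, k, r) \<in> (\<lambda>k. \<gamma> (t, k)) ` {k. k < n' t \<and> \<gamma> (t, k) \<noteq> None}"
      using that by (intro image_eqI[of _ _ j]) auto
    then show ?thesis using l that(2) unfolding labelling_def by auto
  qed
  have sur: "\<exists>j<n' t. \<gamma> (t, j) = Some (s, k, r)" if "t \<in> T" "s \<in> S" "k < n s" "r < m s t" for t s k r
  proof -
    have "Some (s, k, r) \<in> Some ` {(s, l, r). s \<in> S \<and> l < n s \<and> r < m s t}" using that by auto
    then have "Some (s, k, r) \<in> (\<lambda>k. \<gamma> (t, k)) ` {k. k < n' t \<and> \<gamma> (t, k) \<noteq> None}"
      using l that(1) unfolding labelling_def by auto
    then show ?thesis by auto
  qed
  have inj: "j = j'" if "t \<in> T" "j < n' t" "j' < n' t" "\<gamma> (t, j) = \<gamma> (t, j')" "\<gamma> (t, j) \<noteq> None" for t j j'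
    using l that unfolding labelling_def inj_on_def by auto
  have card: "card {k. label_map T n' \<gamma> ((t, k), (t, k)) = Some (p, p)} = m (fst p) t"
    if p: "p \<in> positions S n" and t: "t \<in> T" for p t
  proof -
    obtain s l where sl: "p = (s, l)" "s \<in> S" "l < n s" using p by (auto simp: positions_def)
    have "\<exists>!j. j < n' t \<and> \<gamma> (t, j) = Some (s, l, r)" if "r < m s t" for r
      using sur[OF t sl(2,3) that] inj[OF t] by (metis option.distinct(1))
    then obtain J where J: "\<And>r. r < m s t \<Longrightarrow> J r < n' t \<and> \<gamma> (t, J r) = Some (s, l, r)" by metis
    have "bij_betw J {..<m s t} {k. label_map T n' \<gamma> ((t, k), (t, k)) = Some (p, p)}"
    proof (intro bij_betwI')
      fix x y assume "x \<in> {..<m s t}" "y \<in> {..<m s t}"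
      then show "(J x = J y) = (x = y)" 
        using J[of x] J[of y] by (metis lessThan_iff option.inject prod.inject)
    next
      fix x assume "x \<in> {..<m s t}"
      then show "J x \<in> {k. label_map T n' \<gamma> ((t, k), (t, k)) = Some (p, p)}"
        using J[of x] t by (auto simp: label_map_iff same_block_def positions_def sl(1))
    next
      fix y assume "y \<in> {k. label_map T n' \<gamma> ((t, k), (t, k)) = Some (p, p)}"
      then obtain r where r: "y < n' t" "\<gamma> (t, y) = Some (s, l, r)"
        by (auto simp: label_map_iff same_block_def positions_def sl(1))
      then have "r < m s t" using ran[OF r(2) t r(1)] by auto
      then show "\<exists>x\<in>{..<m s t}. y = J x" using J[of r] inj[OF t r(1), of "J r"] r by auto
    qed
    then have "card {..<m s t} = card {k. label_map T n' \<gamma> ((t, k), (t, k)) = Some (p, p)}"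
      by (rule bij_betw_same_card)
    then show ?thesis using sl(1) by simp
  qed
  have lift: "\<exists>!q'. label_map T n' \<gamma> (q, q') = Some (p, p')"
    if q: "label_map T n' \<gamma> (q, q) = Some (p, p)" and p: "(p, p') \<in> same_block S n" for q p p'
  proof -
    obtain t j where tj: "q = (t, j)" by fastforce
    obtain s l l' where sl: "p = (s, l)" "p' = (s, l')" "s \<in> S" "l' < n s"
      using p by (cases p, cases p') (auto simp: same_block_def positions_def)
    obtain r where r: "t \<in> T" "j < n' t" "\<gamma> (t, j) = Some (s, l, r)"
      using q by (auto simp: label_map_iff same_block_def positions_def tj sl)
    have "r < m s t" using ran[OF r(3,1,2)] by auto
    then obtain j' where j': "j' < n' t" "\<gamma> (t, j') = Some (s, l', r)" using sur[OF r(1) sl(3,4)] by auto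
    show ?thesis
    proof (rule ex1I[of _ "(t, j')"])
      show "label_map T n' \<gamma> (q, (t, j')) = Some (p, p')"
        using r j' by (auto simp: label_map_iff same_block_def positions_def tj sl)
      fix q' assume "label_map T n' \<gamma> (q, q') = Some (p, p')"
      then obtain j2 where "q' = (t, j2)" "j2 < n' t" "\<gamma> (t, j2) = Some (s, l', r)"
        using r by (cases q') (auto simp: label_map_iff same_block_def positions_def tj sl)
      then show "q' = (t, j')" using inj[OF r(1) j'(1), of j2] j'(2) by auto
    qed
  qed
  show ?thesis unfolding block_maps_def mem_Collect_eq
    apply (intro conjI)
    subgoal
    proof (intro allI impI)
      fix x y assume "label_map T n' \<gamma> x = Some y"
      moreover obtain q q' p p' where "x = (q, q')" "y = (p, p')" by (cases x, cases y) auto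
      ultimately show "x \<in> same_block T n' \<and> y \<in> same_block S n"
        using ran by (cases q, cases q', cases p, cases p')
          (fastforce simp: label_map_iff same_block_def positions_def)
    qed
    subgoal by (auto simp: label_map_iff same_block_def)
    subgoal by (auto simp: label_map_iff same_block_def prod_eq_iff)
    subgoal using lift by blast
    subgoal using card by blast
    done
qed

text \<open>The sum in \<open>le\<close> is the number of labels wanted in block \<open>t\<close>,
  so they can be placed injectively on its rows.\<close>

lemma labelling_exists:
  assumes fin: "finite S" and le: "\<And>t. t \<in> T \<Longrightarrow> (\<Sum>s\<in>S. m s t * n s) \<le> n' t"
  shows "\<exists>\<gamma>. labelling S n T n' m \<gamma>"
proof -
  define Y where "Y = (\<lambda>t. {(s, l, r). s \<in> S \<and> l < n s \<and> r < m s t})"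
  have Yt: "Y t = {(s, l, r). s \<in> S \<and> l < n s \<and> r < m s t}" for t by (simp add: Y_def)
  have Y: "Y t = (SIGMA s:S. {..<n s} \<times> {..<m s t})" for t by (auto simp: Y_def)
  have cY: "finite (Y t)" "card (Y t) = (\<Sum>s\<in>S. m s t * n s)" for t
    unfolding Y using fin by (auto simp: card_SigmaI card_cartesian_product mult.commute)
  have "\<exists>g. inj_on g (Y t) \<and> g ` Y t \<subseteq> {..<n' t}" if "t \<in> T" for t
    using card_le_inj[of "Y t" "{..<n' t}"] cY le[OF that] by auto
  then obtain g where g: "\<And>t. t \<in> T \<Longrightarrow> inj_on (g t) (Y t) \<and> g t ` Y t \<subseteq> {..<n' t}" by metis
  define \<gamma> where "\<gamma> = (\<lambda>(t, k). if k \<in> g t ` Y t then Some (the_inv_into (Y t) (g t) k) else None)"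
  have "labelling S n T n' m \<gamma>" unfolding labelling_def Yt[symmetric]
  proof (intro ballI conjI)
    fix t assume t: "t \<in> T"
    have d: "{k. k < n' t \<and> \<gamma> (t, k) \<noteq> None} = g t ` Y t"
      using g[OF t] by (auto simp del: not_None_eq simp: \<gamma>_def)
    have v: "\<gamma> (t, g t y) = Some y" if "y \<in> Y t" for y
      using g[OF t] that by (auto simp: \<gamma>_def the_inv_into_f_f)
    show "inj_on (\<lambda>k. \<gamma> (t, k)) {k. k < n' t \<and> \<gamma> (t, k) \<noteq> None}"
      unfolding d
    proof (rule inj_onI)
      fix x y assume "x \<in> g t ` Y t" "y \<in> g t ` Y t" and eq: "\<gamma> (t, x) = \<gamma> (t, y)"
      then obtain a b where "x = g t a" "a \<in> Y t" "y = g t b" "b \<in> Y t" by blast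
      then show "x = y" using v eq by simp
    qed
    show "(\<lambda>k. \<gamma> (t, k)) ` {k. k < n' t \<and> \<gamma> (t, k) \<noteq> None} = Some ` Y t"
      unfolding d image_image using v by (intro image_cong) auto
  qed
  then show ?thesis by blast
qed

text \<open>Copies of block \<open>s\<close> in block \<open>t\<close> are numbered through the
  positions at which row 0 of \<open>s\<close> is copied: each copy contains exactly one of these,
  its base. Two positions of a block lie in the same copy iff they have the same base.\<close>

lemma block_maps_labelling:
  assumes e: "e \<in> block_maps S n T n' m"
  shows "\<exists>\<gamma>. labelling S n T n' m \<gamma> \<and> e = label_map T n' \<gamma>"
proof -
  define F where "F = (\<lambda>s t. {k. e ((t, k), (t, k)) = Some ((s, 0), (s, 0))})"
  have fF: "finite (F s t)" for s t
    by (rule finite_subset[of _ "{..<n' t}"]) (use block_maps_position(3)[OF e] in \<open>(fastforce simp: F_def)+\<close>)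
  have "card (F s t) = m s t" if "s \<in> S" "0 < n s" "t \<in> T" for s t
    using block_mapsD(7)[OF e, of "(s, 0)" t] that by (simp add: F_def positions_def)
  \<comment> \<open>If \<open>n s = 0\<close> there is no row 0 and no label either, hence the
    restriction to \<open>0 < n s\<close>.\<close>
  then have "\<exists>b. bij_betw b (F s t) {..<m s t}" if "s \<in> S" "0 < n s" "t \<in> T" for s t
    using finite_same_card_bij[OF fF, of "{..<m s t}" s t] that by auto
  then obtain b where b: "\<And>s t. \<lbrakk>s \<in> S; 0 < n s; t \<in> T\<rbrakk> \<Longrightarrow> bij_betw (b s t) (F s t) {..<m s t}" by metis
  define base where "base = (\<lambda>q p. THE q0. e (q, q0) = Some (p, (fst p, 0)))"
  have base: "e (q, base q p) = Some (p, (fst p, 0))" if "e (q, q) = Some (p, p)" for q p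
  proof -
    have "(p, (fst p, 0)) \<in> same_block S n"
      using block_mapsD(2)[OF e that] by (auto simp: same_block_def positions_def)
    then have "\<exists>!q0. e (q, q0) = Some (p, (fst p, 0))" using block_mapsD(6)[OF e that] by blast
    then show ?thesis unfolding base_def by (rule theI')
  qed
  define \<gamma> where "\<gamma> = (\<lambda>q. case e (q, q) of None \<Rightarrow> None | Some (p, _) \<Rightarrow>
      Some (fst p, snd p, b (fst p) (fst q) (snd (base q p))))"
  have g: "\<gamma> q = Some (fst p, snd p, b (fst p) (fst q) (snd (base q p)))" if "e (q, q) = Some (p, p)" for q p
    using that by (simp add: \<gamma>_def)
  have gD: "e (q, q) = Some ((s, l), (s, l)) \<and> r = b s (fst q) (snd (base q (s, l)))"
    if gq: "\<gamma> q = Some (s, l, r)" for q s l r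
  proof -
    obtain p p' where p: "e (q, q) = Some (p, p')" using gq unfolding \<gamma>_def by (auto split: option.splits)
    then have "p' = p" using block_mapsD(4)[OF e p p] by simp
    then show ?thesis using gq p by (auto simp: \<gamma>_def)
  qed
  have sb: "fst q = fst q' \<and> fst q \<in> T \<and> snd q < n' (fst q) \<and> snd q' < n' (fst q) \<and> fst p = fst p' \<and>
      fst p \<in> S \<and> snd p < n (fst p) \<and> snd p' < n (fst p)"
    if "e (q, q') = Some (p, p')" for q q' p p'
    using block_mapsD(1,2)[OF e that] by (auto simp: same_block_def positions_def)
  have baseF: "base q p = (fst q, snd (base q p)) \<and> snd (base q p) \<in> F (fst p) (fst q)"
    if "e (q, q) = Some (p, p)" for q p
    using sb[OF base[OF that]] block_maps_refl(2)[OF e base[OF that]] by (auto simp: F_def prod_eq_iff)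
  \<comment> \<open>This is the description of \<open>label_map_iff\<close>, so
    \<open>e = label_map T n' \<gamma>\<close> will follow by extensionality.\<close>
  have key: "e (q, q') = Some (p, p') \<longleftrightarrow> (q, q') \<in> same_block T n' \<and> fst p = fst p' \<and>
     (\<exists>r. \<gamma> q = Some (fst p, snd p, r) \<and> \<gamma> q' = Some (fst p', snd p', r))" for q q' p p'
  proof
    assume a: "e (q, q') = Some (p, p')"
    note r = block_maps_refl[OF e a]
    have "e (q', base q p) = Some (p', (fst p', 0))"
      using block_mapsD(5)[OF e block_mapsD(3)[OF e a] base[OF r(1)]] sb[OF a] by simp
    then have "base q' p' = base q p" using block_maps_unique[OF e base[OF r(2)]] by simp
    then show "(q, q') \<in> same_block T n' \<and> fst p = fst p' \<and>
     (\<exists>r. \<gamma> q = Some (fst p, snd p, r) \<and> \<gamma> q' = Some (fst p', snd p', r))"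
      using g[OF r(1)] g[OF r(2)] sb[OF a] block_mapsD(1)[OF e a] by auto
  next
    assume a: "(q, q') \<in> same_block T n' \<and> fst p = fst p' \<and>
     (\<exists>r. \<gamma> q = Some (fst p, snd p, r) \<and> \<gamma> q' = Some (fst p', snd p', r))"
    then obtain r where r: "\<gamma> q = Some (fst p, snd p, r)" "\<gamma> q' = Some (fst p', snd p', r)" by blast
    have f: "fst q = fst q'" "fst p = fst p'" using a by (auto simp: same_block_def)
    have 1: "e (q, q) = Some (p, p)" "r = b (fst p) (fst q) (snd (base q p))"
      using gD[OF r(1)] by simp_all
    have 2: "e (q', q') = Some (p', p')" "r = b (fst p) (fst q) (snd (base q' p'))"
      using gD[OF r(2)] by (simp_all add: f)
    have "bij_betw (b (fst p) (fst q)) (F (fst p) (fst q)) {..<m (fst p) (fst q)}"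
      using sb[OF 1(1)] by (intro b) auto
    then have "snd (base q p) = snd (base q' p')"
      using baseF[OF 1(1)] baseF[OF 2(1)] 1(2) 2(2) f by (auto simp: bij_betw_def dest: inj_onD)
    then have "base q p = base q' p'" using baseF[OF 1(1)] baseF[OF 2(1)] f by metis
    then have "e (base q p, q') = Some ((fst p, 0), p')"
      using block_mapsD(3)[OF e base[OF 2(1)]] f by simp
    then show "e (q, q') = Some (p, p')" by (rule block_mapsD(5)[OF e base[OF 1(1)]])
  qed
  have "e = label_map T n' \<gamma>"
  proof (rule ext)
    fix x :: "'a pos \<times> 'a pos"
    obtain q q' where x: "x = (q, q')" by (cases x) auto
    have "e x = Some y \<longleftrightarrow> label_map T n' \<gamma> x = Some y" for y
      using key label_map_iff[of T n' \<gamma>] x by (cases y) auto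
    then show "e x = label_map T n' \<gamma> x" by (metis option.exhaust)
  qed
  moreover have "labelling S n T n' m \<gamma>" unfolding labelling_def
  proof (intro ballI conjI)
    fix t assume t: "t \<in> T"
    show "inj_on (\<lambda>k. \<gamma> (t, k)) {k. k < n' t \<and> \<gamma> (t, k) \<noteq> None}"
    proof (rule inj_onI)
      fix j j' assume j: "j \<in> {k. k < n' t \<and> \<gamma> (t, k) \<noteq> None}" "j' \<in> {k. k < n' t \<and> \<gamma> (t, k) \<noteq> None}"
        and eq: "\<gamma> (t, j) = \<gamma> (t, j')"
      then obtain s l r where r: "\<gamma> (t, j) = Some (s, l, r)" by auto
      have "((t, j), (t, j')) \<in> same_block T n'" using j t by (auto simp: same_block_def positions_def)
      then have "e ((t, j), (t, j')) = Some ((s, l), (s, l))" using key r eq by auto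
      moreover have "e ((t, j), (t, j)) = Some ((s, l), (s, l))" using gD[OF r] by simp
      ultimately show "j = j'" using block_maps_unique[OF e] by blast
    qed
    show "(\<lambda>k. \<gamma> (t, k)) ` {k. k < n' t \<and> \<gamma> (t, k) \<noteq> None} = Some ` {(s, l, r). s \<in> S \<and> l < n s \<and> r < m s t}"
    proof (intro equalityI subsetI)
      fix y assume "y \<in> (\<lambda>k. \<gamma> (t, k)) ` {k. k < n' t \<and> \<gamma> (t, k) \<noteq> None}"
      then obtain k s l r where k: "k < n' t" "y = Some (s, l, r)" "\<gamma> (t, k) = Some (s, l, r)" by auto
      have 1: "e ((t, k), (t, k)) = Some ((s, l), (s, l))" "r = b s t (snd (base (t, k) (s, l)))"
        using gD[OF k(3)] by auto
      have "bij_betw (b s t) (F s t) {..<m s t}" using sb[OF 1(1)] by (intro b) auto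
      then have "r < m s t" using 1(2) baseF[OF 1(1)] by (auto simp: bij_betw_def)
      then show "y \<in> Some ` {(s, l, r). s \<in> S \<and> l < n s \<and> r < m s t}" using k sb[OF 1(1)] by auto
    next
      fix y assume "y \<in> Some ` {(s, l, r). s \<in> S \<and> l < n s \<and> r < m s t}"
      then obtain s l r where y: "y = Some (s, l, r)" "s \<in> S" "l < n s" "r < m s t" by auto
      have "bij_betw (b s t) (F s t) {..<m s t}" using y t by (intro b) auto
      then have "r \<in> b s t ` F s t" using y(4) by (simp add: bij_betw_def)
      then obtain k0 where k0: "k0 \<in> F s t" "b s t k0 = r" by auto
      then have e0: "e ((t, k0), (t, k0)) = Some ((s, 0), (s, 0))" by (simp add: F_def)
      have "((s, 0), (s, l)) \<in> same_block S n" using y by (auto simp: same_block_def positions_def)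
      then obtain q where q: "e ((t, k0), q) = Some ((s, 0), (s, l))" using block_mapsD(6)[OF e e0] by blast
      obtain k where k: "q = (t, k)" "k < n' t" using sb[OF q] by (cases q) auto
      note q' = block_mapsD(3)[OF e q] and qq = block_maps_refl(2)[OF e q]
      have "base q (s, l) = (t, k0)" using block_maps_unique[OF e base[OF qq]] q' by simp
      then have "\<gamma> q = Some (s, l, r)" using g[OF qq] k k0 by simp
      then show "y \<in> (\<lambda>k. \<gamma> (t, k)) ` {k. k < n' t \<and> \<gamma> (t, k) \<noteq> None}"
        using k y(1) by (intro image_eqI[of _ _ k]) auto
    qed
  qed
  ultimately show ?thesis by blast
qed

text \<open>Matching equal labels gives a bijection between the labelled elements; the unlabelled
  ones are equally many on both sides because \<open>A\<close> is finite.\<close>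

lemma permutation_of_labels:
  assumes fin: "finite A" and f: "inj_on f {k\<in>A. f k \<noteq> None}" and g: "inj_on g {k\<in>A. g k \<noteq> None}"
    and eq: "f ` {k\<in>A. f k \<noteq> None} = g ` {k\<in>A. g k \<noteq> None}"
  shows "\<exists>\<omega>. bij_betw \<omega> A A \<and> (\<forall>k\<in>A. f k = g (\<omega> k))"
proof -
  let ?F = "{k\<in>A. f k \<noteq> None}" and ?G = "{k\<in>A. g k \<noteq> None}"
  define \<omega>1 where "\<omega>1 = the_inv_into ?G g \<circ> f"
  have "bij_betw (the_inv_into ?G g) (f ` ?F) ?G"
    using g eq by (intro bij_betw_the_inv_into) (simp add: bij_betw_def)
  then have b1: "bij_betw \<omega>1 ?F ?G" unfolding \<omega>1_def
    by (rule bij_betw_trans[rotated]) (use f in \<open>simp add: bij_betw_def\<close>)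
  have v1: "g (\<omega>1 k) = f k" if "k \<in> ?F" for k
  proof -
    have "f k \<in> g ` ?G" using that eq by blast
    then show ?thesis using f_the_inv_into_f[OF g] by (simp add: \<omega>1_def)
  qed
  have "card (A - ?F) = card (A - ?G)"
    using bij_betw_same_card[OF b1] fin by (subst (1 2) card_Diff_subset) auto
  then obtain \<omega>2 where b2: "bij_betw \<omega>2 (A - ?F) (A - ?G)"
    using finite_same_card_bij[of "A - ?F" "A - ?G"] fin by auto
  define \<omega> where "\<omega> = (\<lambda>k. if k \<in> ?F then \<omega>1 k else \<omega>2 k)"
  have "bij_betw \<omega> ?F ?G" using b1 by (rule bij_betw_cong[THEN iffD1, rotated]) (simp add: \<omega>_def)
  moreover have "bij_betw \<omega> (A - ?F) (A - ?G)"
    using b2 by (rule bij_betw_cong[THEN iffD1, rotated]) (auto simp: \<omega>_def)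
  ultimately have "bij_betw \<omega> (?F \<union> (A - ?F)) (?G \<union> (A - ?G))"
    by (rule bij_betw_combine) auto
  moreover have "?F \<union> (A - ?F) = A" "?G \<union> (A - ?G) = A" by auto
  ultimately have "bij_betw \<omega> A A" by simp
  moreover have "f k = g (\<omega> k)" if "k \<in> A" for k
  proof (cases "k \<in> ?F")
    case True
    then show ?thesis using v1 by (simp add: \<omega>_def)
  next
    case False
    then have "\<omega>2 k \<in> A - ?G" using b2 that by (auto simp: bij_betw_def)
    then show ?thesis using False that by (auto simp: \<omega>_def)
  qed
  ultimately show ?thesis by blast
qed

definition perm_map :: "'t set \<Rightarrow> ('t \<Rightarrow> nat) \<Rightarrow> ('t \<Rightarrow> nat \<Rightarrow> nat) \<Rightarrow> 't pos \<times> 't pos \<rightharpoonup> 't pos \<times> 't pos" where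
  "perm_map T n \<omega> = (\<lambda>(q, q'). if (q, q') \<in> same_block T n
     then Some ((fst q, \<omega> (fst q) (snd q)), (fst q', \<omega> (fst q') (snd q'))) else None)"

lemma perm_map_in:
  assumes \<omega>: "\<And>t. t \<in> T \<Longrightarrow> bij_betw (\<omega> t) {..<n t} {..<n t}"
    and m: "\<And>s t. \<lbrakk>s \<in> T; t \<in> T\<rbrakk> \<Longrightarrow> m s t = (if s = t then 1 else 0)"
  shows "perm_map T n \<omega> \<in> block_maps T n T n m"
proof -
  have i: "perm_map T n \<omega> (q, q') = Some (p, p') \<longleftrightarrow> (q, q') \<in> same_block T n \<and>
     p = (fst q, \<omega> (fst q) (snd q)) \<and> p' = (fst q', \<omega> (fst q') (snd q'))" for q q' p p'
    by (auto simp: perm_map_def)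
  have lt: "\<omega> t k < n t" if "t \<in> T" "k < n t" for t k
    using \<omega>[OF that(1)] that(2) by (auto simp: bij_betw_def)
  have ex: "\<exists>!k. k < n t \<and> \<omega> t k = l" if "t \<in> T" "l < n t" for t l
  proof -
    have "l \<in> \<omega> t ` {..<n t}" and inj: "inj_on (\<omega> t) {..<n t}"
      using \<omega>[OF that(1)] that(2) by (auto simp: bij_betw_def)
    then obtain k where "k < n t" "\<omega> t k = l" by auto
    then show ?thesis by (intro ex1I[of _ k]) (auto dest: inj_onD[OF inj])
  qed
  have card: "card {k. perm_map T n \<omega> ((t, k), (t, k)) = Some (p, p)} = m (fst p) t"
    if p: "p \<in> positions T n" and t: "t \<in> T" for p t
  proof (cases "fst p = t")
    case True
    then obtain l where l: "p = (t, l)" by (cases p) auto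
    have "l < n t" using p l by (auto simp: positions_def)
    then obtain k0 where k0: "k0 < n t \<and> \<omega> t k0 = l" "\<And>k. k < n t \<and> \<omega> t k = l \<Longrightarrow> k = k0"
      using ex[OF t] by blast
    have "perm_map T n \<omega> ((t, k), (t, k)) = Some (p, p) \<longleftrightarrow> k < n t \<and> \<omega> t k = l" for k
      using t by (auto simp: i l same_block_def positions_def)
    then have "perm_map T n \<omega> ((t, k), (t, k)) = Some (p, p) \<longleftrightarrow> k = k0" for k
      using k0 by blast
    then have "{k. perm_map T n \<omega> ((t, k), (t, k)) = Some (p, p)} = {k0}" by simp
    then show ?thesis using m True t by simp
  next
    case False
    then show ?thesis using m p t by (auto simp: i positions_def)
  qed
  have lift: "\<exists>!q'. perm_map T n \<omega> (q, q') = Some (p, p')"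
    if q: "perm_map T n \<omega> (q, q) = Some (p, p)" and p: "(p, p') \<in> same_block T n" for q p p'
  proof -
    obtain t k where tk: "q = (t, k)" "t \<in> T" "k < n t" "p = (t, \<omega> t k)"
      using q by (cases q) (auto simp: i same_block_def positions_def)
    obtain l where l: "p' = (t, l)" "l < n t" using p tk by (cases p') (auto simp: same_block_def positions_def)
    obtain k0 where k0: "k0 < n t \<and> \<omega> t k0 = l" "\<And>k. k < n t \<and> \<omega> t k = l \<Longrightarrow> k = k0"
      using ex[OF tk(2) l(2)] by blast
    have k: "perm_map T n \<omega> (q, (t', k')) = Some (p, p') \<longleftrightarrow> t' = t \<and> k' < n t \<and> \<omega> t k' = l" for t' k'
      using tk(2,3) by (auto simp: i tk(1,4) l(1) same_block_def positions_def)
    show ?thesis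
    proof (rule ex1I[of _ "(t, k0)"])
      show "perm_map T n \<omega> (q, (t, k0)) = Some (p, p')" using k k0(1) by blast
      show "q' = (t, k0)" if "perm_map T n \<omega> (q, q') = Some (p, p')" for q'
        using that k0(2) k[of "fst q'" "snd q'"] by (simp add: prod_eq_iff)
    qed
  qed
  show ?thesis unfolding block_maps_def mem_Collect_eq
    apply (intro conjI)
    subgoal using lt by (auto simp: perm_map_def same_block_def positions_def split: if_splits)
    subgoal by (auto simp: i same_block_def)
    subgoal by (auto simp: i same_block_def)
    subgoal using lift by blast
    subgoal using card by blast
    done
qed

text \<open>Labellings for the same multiplicities use the same labels in each block, so they differ
  by a permutation of its rows. This is the homogeneity required by
  \<open>coherent_system\<close>.\<close>

lemma block_maps_conjugate:
  assumes e: "e \<in> block_maps S n T n' m" and e': "e' \<in> block_maps S n T n' m"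
    and m': "\<And>s t. \<lbrakk>s \<in> T; t \<in> T\<rbrakk> \<Longrightarrow> m' s t = (if s = t then 1 else 0)"
  shows "\<exists>a\<in>block_maps T n' T n' m'. e = e' \<circ>\<^sub>m a"
proof -
  obtain \<gamma> where g: "labelling S n T n' m \<gamma>" "e = label_map T n' \<gamma>" using block_maps_labelling[OF e] by blast
  obtain \<delta> where d: "labelling S n T n' m \<delta>" "e' = label_map T n' \<delta>" using block_maps_labelling[OF e'] by blast
  have "\<exists>\<omega>. bij_betw \<omega> {..<n' t} {..<n' t} \<and> (\<forall>k\<in>{..<n' t}. \<gamma> (t, k) = \<delta> (t, \<omega> k))" if t: "t \<in> T" for t
    by (rule permutation_of_labels) (use g(1) d(1) t in \<open>auto simp: labelling_def\<close>)
  then obtain \<omega> where w: "\<And>t. t \<in> T \<Longrightarrow> bij_betw (\<omega> t) {..<n' t} {..<n' t} \<and> (\<forall>k\<in>{..<n' t}. \<gamma> (t, k) = \<delta> (t, \<omega> t k))" by metis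
  have lt: "\<omega> t k < n' t" if "t \<in> T" "k < n' t" for t k
    using w[OF that(1)] that(2) by (auto simp: bij_betw_def)
  have "e x = (e' \<circ>\<^sub>m perm_map T n' \<omega>) x" for x
  proof (cases "x \<in> same_block T n'")
    case True
    then obtain t k k' where x: "x = ((t, k), (t, k'))" "t \<in> T" "k < n' t" "k' < n' t"
      by (auto simp: same_block_def positions_def)
    have "\<gamma> (t, k) = \<delta> (t, \<omega> t k)" "\<gamma> (t, k') = \<delta> (t, \<omega> t k')" using w x by auto
    moreover have "((t, \<omega> t k), (t, \<omega> t k')) \<in> same_block T n'" using lt x by (auto simp: same_block_def positions_def)
    ultimately show ?thesis using True x by (simp add: g(2) d(2) perm_map_def label_map_def)
  next
    case False
    then show ?thesis by (cases x) (simp add: g(2) perm_map_def label_map_def)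
  qed
  then have "e = e' \<circ>\<^sub>m perm_map T n' \<omega>" by blast
  then show ?thesis using perm_map_in[of T \<omega> n' m'] w m' by blast
qed

text \<open>Block \<open>t\<close> has as many labels as rows, so no row is left unlabelled.\<close>

lemma block_maps_total:
  assumes e: "e \<in> block_maps S n T n' m" and fin: "finite S" and t: "t \<in> T" "k < n' t"
    and eq: "(\<Sum>s\<in>S. m s t * n s) = n' t"
  shows "e ((t, k), (t, k)) \<noteq> None"
proof -
  obtain \<gamma> where g: "labelling S n T n' m \<gamma>" "e = label_map T n' \<gamma>" using block_maps_labelling[OF e] by blast
  let ?D = "{k. k < n' t \<and> \<gamma> (t, k) \<noteq> None}"
  let ?Y = "{(s, l, r). s \<in> S \<and> l < n s \<and> r < m s t}"
  have Y: "?Y = (SIGMA s:S. {..<n s} \<times> {..<m s t})" by auto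
  have "card ?D = card ((\<lambda>k. \<gamma> (t, k)) ` ?D)"
    by (rule card_image[symmetric]) (use g(1) t in \<open>simp add: labelling_def\<close>)
  also have "(\<lambda>k. \<gamma> (t, k)) ` ?D = Some ` ?Y" using g(1) t by (auto simp: labelling_def)
  also have "card (Some ` ?Y) = card ?Y" by (simp add: card_image)
  also have "\<dots> = n' t" unfolding Y eq[symmetric] using fin by (auto simp: card_SigmaI card_cartesian_product mult.commute)
  finally have "?D = {..<n' t}" by (intro card_subset_eq) auto
  then have "\<gamma> (t, k) \<noteq> None" using t by auto
  then show ?thesis using t by (auto simp: g(2) label_map_def same_block_def positions_def)
qed


section \<open>Principal right ideals of regular rings\<close>

abbreviation rid :: "'a ring \<Rightarrow> 'a \<Rightarrow> 'a set" where
  "rid R a \<equiv> (\<lambda>x. a \<otimes>\<^bsub>R\<^esub> x) ` carrier R"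

locale nonunital =
  fixes R :: "'a ring" (structure)
  assumes nonunital_ring: "nonunital_ring R"

sublocale nonunital \<subseteq> abelian_group R
  using nonunital_ring by (simp add: nonunital_ring_def)

context nonunital
begin

lemma mult_closed [simp]: "\<lbrakk>x \<in> carrier R; y \<in> carrier R\<rbrakk> \<Longrightarrow> x \<otimes> y \<in> carrier R"
  and mult_assoc: "\<lbrakk>x \<in> carrier R; y \<in> carrier R; z \<in> carrier R\<rbrakk> \<Longrightarrow> (x \<otimes> y) \<otimes> z = x \<otimes> (y \<otimes> z)"
  and distr_l: "\<lbrakk>x \<in> carrier R; y \<in> carrier R; z \<in> carrier R\<rbrakk> \<Longrightarrow> (x \<oplus> y) \<otimes> z = x \<otimes> z \<oplus> y \<otimes> z"
  and distr_r: "\<lbrakk>x \<in> carrier R; y \<in> carrier R; z \<in> carrier R\<rbrakk> \<Longrightarrow> z \<otimes> (x \<oplus> y) = z \<otimes> x \<oplus> z \<otimes> y"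
  using nonunital_ring by (auto simp: nonunital_ring_def)

lemma mult_zero_r [simp]: "x \<in> carrier R \<Longrightarrow> x \<otimes> \<zero> = \<zero>"
  using distr_r[of \<zero> \<zero> x] add.l_cancel_one'[of "x \<otimes> \<zero>" "x \<otimes> \<zero>"] by simp

lemma mult_zero_l [simp]: "x \<in> carrier R \<Longrightarrow> \<zero> \<otimes> x = \<zero>"
  using distr_l[of \<zero> \<zero> x] add.l_cancel_one'[of "\<zero> \<otimes> x" "\<zero> \<otimes> x"] by simp

lemma mult_minus_r: "\<lbrakk>x \<in> carrier R; y \<in> carrier R\<rbrakk> \<Longrightarrow> x \<otimes> (\<ominus> y) = \<ominus> (x \<otimes> y)"
  using distr_r[of "\<ominus> y" y x] minus_equality[of "x \<otimes> (\<ominus> y)" "x \<otimes> y"] by (simp add: l_neg)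

lemma mult_minus_l: "\<lbrakk>x \<in> carrier R; y \<in> carrier R\<rbrakk> \<Longrightarrow> (\<ominus> x) \<otimes> y = \<ominus> (x \<otimes> y)"
  using distr_l[of "\<ominus> x" x y] minus_equality[of "(\<ominus> x) \<otimes> y" "x \<otimes> y"] by (simp add: l_neg)

lemma diff_distr_l: "\<lbrakk>x \<in> carrier R; y \<in> carrier R; z \<in> carrier R\<rbrakk> \<Longrightarrow> (x \<ominus> y) \<otimes> z = x \<otimes> z \<ominus> y \<otimes> z"
  by (simp add: minus_eq distr_l mult_minus_l)

lemma diff_distr_r: "\<lbrakk>x \<in> carrier R; y \<in> carrier R; z \<in> carrier R\<rbrakk> \<Longrightarrow> z \<otimes> (x \<ominus> y) = z \<otimes> x \<ominus> z \<otimes> y"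
  by (simp add: minus_eq distr_r mult_minus_r)

lemma diff_self [simp]: "x \<in> carrier R \<Longrightarrow> x \<ominus> x = \<zero>" by (simp add: minus_eq r_neg)
lemma diff_zero [simp]: "x \<in> carrier R \<Longrightarrow> x \<ominus> \<zero> = x" by (simp add: minus_eq)

lemma diff_add_cancel: "\<lbrakk>x \<in> carrier R; y \<in> carrier R\<rbrakk> \<Longrightarrow> y \<oplus> (x \<ominus> y) = x"
  by (simp add: minus_eq a_lcomm r_neg)

text \<open>McCoy's lemma: regularity of \<open>a - a z a\<close> lifts to \<open>a\<close>. With a
  unit the quasi-inverse would be \<open>z + (1 - z a) w (1 - a z)\<close>; here \<open>t\<close> is
  the factor \<open>(1 - z a) w\<close> written without the unit.\<close>

lemma mccoy:
  assumes a: "a \<in> carrier R" "z \<in> carrier R" "w \<in> carrier R"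
    and b: "b = a \<ominus> a \<otimes> z \<otimes> a" "b \<otimes> w \<otimes> b = b"
  shows "\<exists>y\<in>carrier R. a = a \<otimes> y \<otimes> a"
proof -
  define t where "t = w \<ominus> z \<otimes> a \<otimes> w"
  have t: "t \<in> carrier R" using a by (simp add: t_def)
  define y where "y = z \<oplus> (t \<ominus> t \<otimes> a \<otimes> z)"
  have y: "y \<in> carrier R" using a t by (simp add: y_def)
  have bw: "b \<otimes> w = a \<otimes> t"
    using a by (simp add: b(1) t_def diff_distr_l diff_distr_r mult_assoc)
  have "b = a \<otimes> t \<otimes> b" using bw b(2) by simp
  also have "\<dots> = a \<otimes> t \<otimes> a \<ominus> a \<otimes> t \<otimes> a \<otimes> z \<otimes> a"
    using a t by (simp add: b(1) diff_distr_r mult_assoc)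
  finally have "a \<otimes> t \<otimes> a \<ominus> a \<otimes> t \<otimes> a \<otimes> z \<otimes> a = b" by simp
  moreover have "a \<otimes> y \<otimes> a = a \<otimes> z \<otimes> a \<oplus> (a \<otimes> t \<otimes> a \<ominus> a \<otimes> t \<otimes> a \<otimes> z \<otimes> a)"
    using a t by (simp add: y_def distr_l distr_r diff_distr_l diff_distr_r mult_assoc)
  ultimately have "a \<otimes> y \<otimes> a = a" using diff_add_cancel[of a "a \<otimes> z \<otimes> a"] a b(1) by simp
  then show ?thesis using y by (intro bexI[of _ y]) simp_all
qed

end

locale regular = nonunital +
  assumes regular: "\<forall>a\<in>carrier R. \<exists>y\<in>carrier R. a = a \<otimes> y \<otimes> a"
begin

lemma regularE:
  assumes "a \<in> carrier R"
  obtains y where "y \<in> carrier R" "a = a \<otimes> y \<otimes> a"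
  using regular assms by auto

lemma rid_self: "a \<in> carrier R \<Longrightarrow> a \<in> rid R a"
proof -
  assume a: "a \<in> carrier R"
  then obtain y where "y \<in> carrier R" "a = a \<otimes> y \<otimes> a" by (rule regularE)
  then show ?thesis using a mult_assoc by (intro image_eqI[of _ _ "y \<otimes> a"]) auto
qed

lemma ridI: "\<lbrakk>x \<in> carrier R; a \<otimes> x = y\<rbrakk> \<Longrightarrow> y \<in> rid R a" by auto

lemma pri_iff: "U \<in> principal_right_ideals R \<longleftrightarrow> (\<exists>a\<in>carrier R. U = rid R a)"
  unfolding principal_right_ideals_def by (rule image_iff)

lemma pri_in: "a \<in> carrier R \<Longrightarrow> rid R a \<in> principal_right_ideals R"
  unfolding principal_right_ideals_def by (rule imageI)

lemma rid_sub: "a \<in> carrier R \<Longrightarrow> rid R a \<subseteq> carrier R" by auto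

lemma rid_subset_iff: "\<lbrakk>a \<in> carrier R; b \<in> carrier R\<rbrakk> \<Longrightarrow> rid R a \<subseteq> rid R b \<longleftrightarrow> a \<in> rid R b"
  using rid_self[of a] by (auto simp: mult_assoc)

lemma rid_closed:
  assumes b: "b \<in> carrier R"
  shows "\<zero> \<in> rid R b" "\<lbrakk>x \<in> rid R b; y \<in> rid R b\<rbrakk> \<Longrightarrow> x \<oplus> y \<in> rid R b"
    "\<lbrakk>x \<in> rid R b; y \<in> rid R b\<rbrakk> \<Longrightarrow> x \<ominus> y \<in> rid R b" "\<lbrakk>x \<in> rid R b; r \<in> carrier R\<rbrakk> \<Longrightarrow> x \<otimes> r \<in> rid R b"
proof -
  show "\<zero> \<in> rid R b" by (rule ridI[of \<zero>]) (use b in simp_all)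
  show "x \<oplus> y \<in> rid R b" if xy: "x \<in> rid R b" "y \<in> rid R b"
  proof -
    obtain p q where "p \<in> carrier R" "q \<in> carrier R" "x = b \<otimes> p" "y = b \<otimes> q" using xy by auto
    then show ?thesis by (intro ridI[of "p \<oplus> q"]) (use b in \<open>simp_all add: distr_r\<close>)
  qed
  show "x \<ominus> y \<in> rid R b" if xy: "x \<in> rid R b" "y \<in> rid R b"
  proof -
    obtain p q where "p \<in> carrier R" "q \<in> carrier R" "x = b \<otimes> p" "y = b \<otimes> q" using xy by auto
    then show ?thesis by (intro ridI[of "p \<ominus> q"]) (use b in \<open>simp_all add: diff_distr_r\<close>)
  qed
  show "x \<otimes> r \<in> rid R b" if xy: "x \<in> rid R b" "r \<in> carrier R"
  proof -
    obtain p where "p \<in> carrier R" "x = b \<otimes> p" using xy by auto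
    then show ?thesis by (intro ridI[of "p \<otimes> r"]) (use b xy in \<open>simp_all add: mult_assoc\<close>)
  qed
qed

definition idem :: "'a \<Rightarrow> bool" where "idem e \<longleftrightarrow> e \<in> carrier R \<and> e \<otimes> e = e"

text \<open>With \<open>a = a y a\<close> the product \<open>a y\<close> is idempotent and generates
  the same right ideal.\<close>

lemma idem_generator:
  assumes a: "a \<in> carrier R"
  shows "\<exists>e. idem e \<and> rid R e = rid R a"
proof -
  obtain y where y: "y \<in> carrier R" "a = a \<otimes> y \<otimes> a" using a by (rule regularE)
  have "idem (a \<otimes> y)" unfolding idem_def using a y by (metis mult_assoc mult_closed)
  moreover have "a \<otimes> y \<in> rid R a" "a \<in> rid R (a \<otimes> y)" using a y by auto
  ultimately show ?thesis using rid_subset_iff[of a "a \<otimes> y"] rid_subset_iff[of "a \<otimes> y" a] a y(1)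
    by (metis mult_closed subset_antisym)
qed

lemma idem_fix: "idem e \<Longrightarrow> x \<in> rid R e \<Longrightarrow> e \<otimes> x = x"
  by (auto simp: idem_def mult_assoc[symmetric])

lemma idem_mem: "idem e \<Longrightarrow> x \<in> carrier R \<Longrightarrow> e \<otimes> x = x \<Longrightarrow> x \<in> rid R e"
  by (rule ridI)

definition rsum :: "'a set \<Rightarrow> 'a set \<Rightarrow> 'a set" where
  "rsum U V = {x \<oplus> y | x y. x \<in> U \<and> y \<in> V}"

lemma rsum_eq_rid:
  assumes "a \<in> carrier R" "b \<in> carrier R" "c \<in> carrier R"
    "a \<in> rid R c" "b \<in> rid R c" "c \<in> rsum (rid R a) (rid R b)"
  shows "rid R c = rsum (rid R a) (rid R b)"
proof
  show "rsum (rid R a) (rid R b) \<subseteq> rid R c"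
  proof
    fix z assume "z \<in> rsum (rid R a) (rid R b)"
    then obtain x y where "z = x \<oplus> y" "x \<in> rid R a" "y \<in> rid R b" unfolding rsum_def by blast
    moreover have "rid R a \<subseteq> rid R c" "rid R b \<subseteq> rid R c"
      using rid_subset_iff[of a c] rid_subset_iff[of b c] assms by simp_all
    ultimately show "z \<in> rid R c" using rid_closed(2)[OF assms(3), of x y] by (simp only: subsetD)
  qed
  obtain x y where xy: "c = a \<otimes> x \<oplus> b \<otimes> y" "x \<in> carrier R" "y \<in> carrier R"
    using assms(6) by (auto simp: rsum_def)
  show "rid R c \<subseteq> rsum (rid R a) (rid R b)"
  proof
    fix z assume "z \<in> rid R c"
    then obtain r where r: "r \<in> carrier R" "z = c \<otimes> r" by auto
    then have "z = a \<otimes> (x \<otimes> r) \<oplus> b \<otimes> (y \<otimes> r)" using xy assms by (simp add: distr_l mult_assoc)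
    moreover have "a \<otimes> (x \<otimes> r) \<in> rid R a" "b \<otimes> (y \<otimes> r) \<in> rid R b"
      using xy r by (auto intro!: ridI[OF _ refl])
    ultimately show "z \<in> rsum (rid R a) (rid R b)" unfolding rsum_def by blast
  qed
qed

text \<open>If the generators are replaced by orthogonal idempotents \<open>e\<close> and
  \<open>f\<close>, then \<open>e + f\<close> generates the sum. The part \<open>b'\<close> of
  \<open>b\<close> outside \<open>eR\<close> yields an idempotent \<open>g\<close> with
  \<open>e g = 0\<close>, and subtracting \<open>g e\<close> from \<open>g\<close> makes it
  orthogonal to \<open>e\<close> on the other side as well.\<close>

lemma ex_rsum:
  assumes a: "a \<in> carrier R" and b: "b \<in> carrier R"
  shows "\<exists>c\<in>carrier R. rid R c = rsum (rid R a) (rid R b)"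
proof -
  obtain e where e: "idem e" "rid R e = rid R a" using idem_generator a by blast
  have eR: "e \<in> carrier R" "e \<otimes> e = e" using e(1) by (auto simp: idem_def)
  define b' where "b' = b \<ominus> e \<otimes> b"
  have b': "b' \<in> carrier R" "e \<otimes> b' = \<zero>" using b eR
    by (auto simp: b'_def diff_distr_r mult_assoc[symmetric])
  obtain u where u: "u \<in> carrier R" "b' = b' \<otimes> u \<otimes> b'" using b'(1) by (rule regularE)
  define g where "g = b' \<otimes> u"
  have g: "g \<in> carrier R" "g \<otimes> g = g" "e \<otimes> g = \<zero>" "g \<otimes> b' = b'"
    using b' u eR by (auto simp: g_def mult_assoc[symmetric])
  define f where "f = g \<ominus> g \<otimes> e"
  have fR: "f \<in> carrier R" using g eR by (simp add: f_def)
  have ef: "e \<otimes> f = \<zero>" using g eR by (simp add: f_def diff_distr_r mult_assoc[symmetric])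
  have fe: "f \<otimes> e = \<zero>" using g eR by (simp add: f_def diff_distr_l mult_assoc)
  have fg: "f \<otimes> g = g" using g eR by (simp add: f_def diff_distr_l mult_assoc)
  have gf: "g \<otimes> f = f" using g eR by (simp add: f_def diff_distr_r mult_assoc[symmetric])
  have ff: "f \<otimes> f = f"
  proof -
    have "f \<otimes> g \<otimes> f = f \<otimes> (g \<otimes> f)" using g(1) fR by (intro mult_assoc)
    then show ?thesis by (simp only: fg gf)
  qed
  define c where "c = e \<oplus> f"
  have c: "c \<in> carrier R" using eR fR by (simp add: c_def)
  have ce: "c \<otimes> e = e" using eR fR fe by (simp add: c_def distr_l)
  have cf: "c \<otimes> f = f" using eR fR ef ff by (simp add: c_def distr_l)
  have e_in: "e \<in> rid R c" by (rule ridI[OF eR(1) ce])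
  have f_in: "f \<in> rid R c" by (rule ridI[OF fR cf])
  have "g \<in> rid R f" by (rule ridI[OF g(1) fg])
  then have "b' \<in> rid R f" using g(4) rid_closed(4)[OF fR _ b'(1)] by metis
  then have "b' \<in> rid R c" using f_in rid_subset_iff fR c by blast
  moreover have "e \<otimes> b \<in> rid R c" using rid_closed(4)[OF c e_in b] .
  ultimately have "e \<otimes> b \<oplus> b' \<in> rid R c" using rid_closed(2)[OF c] by blast
  then have bc: "b \<in> rid R c" using diff_add_cancel b eR by (simp add: b'_def)
  have ac: "a \<in> rid R c" using e e_in rid_self[OF a] rid_subset_iff[of e c] eR c by blast
  have "c \<in> rsum (rid R a) (rid R b)"
  proof -
    have "f = b' \<otimes> (u \<otimes> f)" using gf b' u fR by (simp add: g_def mult_assoc)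
    also have "\<dots> = b \<otimes> (u \<otimes> f) \<ominus> e \<otimes> (b \<otimes> (u \<otimes> f))"
      using b eR u fR by (simp add: b'_def diff_distr_l mult_assoc)
    finally have f: "f = b \<otimes> (u \<otimes> f) \<ominus> e \<otimes> (b \<otimes> (u \<otimes> f))" .
    let ?v = "b \<otimes> (u \<otimes> f)"
    have v: "?v \<in> carrier R" using b u fR by simp
    have "c = (e \<ominus> e \<otimes> ?v) \<oplus> ?v" unfolding c_def using f v eR
      by (metis a_assoc a_comm add.m_lcomm minus_eq a_inv_closed mult_closed)
    moreover have "e \<ominus> e \<otimes> ?v \<in> rid R e" using eR v by (intro rid_closed(3) idem_mem e(1)) (auto simp: mult_assoc[symmetric])
    moreover have "?v \<in> rid R b" using b u fR by auto
    ultimately show ?thesis unfolding rsum_def using e(2) by blast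
  qed
  then show ?thesis using rsum_eq_rid[OF a b c ac bc] c by blast
qed

text \<open>An element of \<open>fR\<close> lies in \<open>eR\<close> iff
  \<open>h = (1 - e) f\<close> kills it, and \<open>f - f u h\<close> generates the elements so
  killed. An explicit formula has the advantage of being carried over by ring homomorphisms.\<close>

lemma rid_inter_formula:
  assumes e: "idem e" and f: "idem f" and u: "u \<in> carrier R"
    and h: "h = f \<ominus> e \<otimes> f" and huh: "h \<otimes> u \<otimes> h = h"
  shows "rid R (f \<ominus> f \<otimes> u \<otimes> h) = rid R e \<inter> rid R f"
proof -
  have eR: "e \<in> carrier R" "e \<otimes> e = e" and fR: "f \<in> carrier R" "f \<otimes> f = f"
    using e f by (auto simp: idem_def)
  have hR: "h \<in> carrier R" using eR fR h by simp
  define d where "d = f \<ominus> f \<otimes> u \<otimes> h"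
  have dR: "d \<in> carrier R" using fR u hR by (simp add: d_def)
  have fd: "f \<otimes> d = d" using fR u hR by (simp add: d_def diff_distr_r mult_assoc[symmetric])
  have ed: "e \<otimes> d = d"
  proof -
    have "d \<ominus> e \<otimes> d = (f \<ominus> e \<otimes> f) \<otimes> d"
      using eR fR dR fd by (simp add: diff_distr_l mult_assoc)
    also have "\<dots> = h \<otimes> d" using h by simp
    also have "\<dots> = h \<otimes> f \<ominus> h \<otimes> f \<otimes> u \<otimes> h"
      using hR fR u by (simp add: d_def diff_distr_r mult_assoc)
    also have "h \<otimes> f = h" using h eR fR by (simp add: diff_distr_l mult_assoc)
    finally have "d \<ominus> e \<otimes> d = \<zero>" using huh hR by simp
    then have "e \<otimes> d \<oplus> \<zero> = d" using diff_add_cancel[of d "e \<otimes> d"] dR eR by simp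
    then show ?thesis using dR eR by simp
  qed
  have "x \<in> rid R d" if "x \<in> rid R e" "x \<in> rid R f" for x
  proof -
    have xR: "x \<in> carrier R" using that(1) rid_sub[OF eR(1)] by (rule subsetD[rotated])
    have x: "e \<otimes> x = x" "f \<otimes> x = x" by (rule idem_fix[OF e that(1)], rule idem_fix[OF f that(2)])
    have "h \<otimes> x = \<zero>" using h x xR eR fR by (simp add: diff_distr_l mult_assoc)
    then have "d \<otimes> x = x" using x xR fR u hR by (simp add: d_def diff_distr_l mult_assoc)
    then show ?thesis by (rule ridI[OF xR])
  qed
  then have 1: "rid R e \<inter> rid R f \<subseteq> rid R d" by (meson IntD1 IntD2 subsetI)
  have "d \<in> rid R e" "d \<in> rid R f" using idem_mem[OF e dR ed] idem_mem[OF f dR fd] .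
  then have "rid R d \<subseteq> rid R e" "rid R d \<subseteq> rid R f"
    using rid_subset_iff[OF dR eR(1)] rid_subset_iff[OF dR fR(1)] by simp_all
  then have "rid R d \<subseteq> rid R e \<inter> rid R f" by (rule Int_greatest)
  then show ?thesis unfolding d_def[symmetric] using 1 by (rule subset_antisym)
qed

lemma ex_rinter:
  assumes "a \<in> carrier R" "b \<in> carrier R"
  shows "\<exists>c\<in>carrier R. rid R c = rid R a \<inter> rid R b"
proof -
  obtain e f where e: "idem e" "rid R e = rid R a" and f: "idem f" "rid R f = rid R b"
    using idem_generator assms by metis
  have "f \<ominus> e \<otimes> f \<in> carrier R" using e f by (simp add: idem_def)
  then obtain u where "u \<in> carrier R" "f \<ominus> e \<otimes> f = (f \<ominus> e \<otimes> f) \<otimes> u \<otimes> (f \<ominus> e \<otimes> f)" by (rule regularE)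
  then show ?thesis using rid_inter_formula[OF e(1) f(1), of u "f \<ominus> e \<otimes> f"] e f
    by (intro bexI[of _ "f \<ominus> f \<otimes> u \<otimes> (f \<ominus> e \<otimes> f)"]) (auto simp: idem_def)
qed

text \<open>For idempotent generators \<open>e\<close> and \<open>f\<close>, the element
  \<open>f - e f\<close> generates a complement, since \<open>e\<close> kills it from the
  left.\<close>

lemma ex_complement:
  assumes a: "a \<in> carrier R" and b: "b \<in> carrier R" and ab: "rid R a \<subseteq> rid R b"
  shows "\<exists>w\<in>carrier R. rid R a \<inter> rid R w = {\<zero>} \<and> rid R b = rsum (rid R a) (rid R w)"
proof -
  obtain e f where e: "idem e" "rid R e = rid R a" and f: "idem f" "rid R f = rid R b"
    using idem_generator a b by metis
  have eR: "e \<in> carrier R" "e \<otimes> e = e" and fR: "f \<in> carrier R" "f \<otimes> f = f"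
    using e f by (auto simp: idem_def)
  have "e \<in> rid R a" using rid_self[OF eR(1)] by (simp only: e(2))
  then have ef: "e \<in> rid R f" using ab by (simp only: f(2) subsetD)
  then have fe: "f \<otimes> e = e" by (rule idem_fix[OF f(1)])
  define w where "w = f \<ominus> e \<otimes> f"
  have wR: "w \<in> carrier R" using eR fR by (simp add: w_def)
  have ew: "e \<otimes> w = \<zero>" using eR fR by (simp add: w_def diff_distr_r mult_assoc[symmetric])
  have "x = \<zero>" if xe: "x \<in> rid R e" and xw: "x \<in> rid R w" for x
  proof -
    obtain y where y: "y \<in> carrier R" "x = w \<otimes> y" using xw by (rule imageE)
    have "x = e \<otimes> x" using idem_fix[OF e(1) xe] by (rule sym)
    also have "\<dots> = \<zero>" using y ew eR wR by (simp add: mult_assoc[symmetric])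
    finally show ?thesis .
  qed
  then have 1: "rid R e \<inter> rid R w = {\<zero>}" using rid_closed(1) eR wR by blast
  have "w \<in> rid R f" using fR eR fe wR by (intro idem_mem f(1)) (simp_all add: w_def diff_distr_r mult_assoc[symmetric])
  moreover have "f \<in> rsum (rid R e) (rid R w)"
  proof -
    have "f = e \<otimes> f \<oplus> w" using diff_add_cancel eR fR by (simp add: w_def)
    then show ?thesis using rid_self[OF wR] fR unfolding rsum_def by blast
  qed
  ultimately have "rid R f = rsum (rid R e) (rid R w)" using rsum_eq_rid[OF eR(1) wR fR(1) ef] by blast
  then show ?thesis using 1 e f wR by metis
qed

lemma rsum_upper:
  assumes a: "a \<in> carrier R" and b: "b \<in> carrier R"
  shows "rid R a \<subseteq> rsum (rid R a) (rid R b)" "rid R b \<subseteq> rsum (rid R a) (rid R b)"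
proof -
  show "rid R a \<subseteq> rsum (rid R a) (rid R b)"
  proof
    fix x assume "x \<in> rid R a"
    moreover then have "x = x \<oplus> \<zero>" using a by auto
    ultimately show "x \<in> rsum (rid R a) (rid R b)" using rid_closed(1)[OF b] unfolding rsum_def by blast
  qed
  show "rid R b \<subseteq> rsum (rid R a) (rid R b)"
  proof
    fix x assume "x \<in> rid R b"
    moreover then have "x = \<zero> \<oplus> x" using b by auto
    ultimately show "x \<in> rsum (rid R a) (rid R b)" using rid_closed(1)[OF a] unfolding rsum_def by blast
  qed
qed

lemma LL_join:
  assumes a: "a \<in> carrier R" and b: "b \<in> carrier R"
  shows "ljoin (LL R) (rid R a) (rid R b) = rsum (rid R a) (rid R b)"
  unfolding LL_def
proof (rule ljoin_incl)
  show "rid R a \<in> principal_right_ideals R" "rid R b \<in> principal_right_ideals R"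
    by (rule pri_in[OF a], rule pri_in[OF b])
  obtain c where c: "c \<in> carrier R" "rid R c = rsum (rid R a) (rid R b)" using ex_rsum[OF a b] by (rule bexE)
  then show "rsum (rid R a) (rid R b) \<in> principal_right_ideals R" unfolding pri_iff by metis
  show "rid R a \<subseteq> rsum (rid R a) (rid R b)" "rid R b \<subseteq> rsum (rid R a) (rid R b)"
    by (rule rsum_upper[OF a b])+
  fix Y assume Y: "Y \<in> principal_right_ideals R" "rid R a \<subseteq> Y" "rid R b \<subseteq> Y"
  then obtain c where "c \<in> carrier R" "Y = rid R c" unfolding pri_iff by blast
  then have add: "\<And>x y. x \<in> Y \<Longrightarrow> y \<in> Y \<Longrightarrow> x \<oplus> y \<in> Y" using rid_closed(2) by blast
  show "rsum (rid R a) (rid R b) \<subseteq> Y"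
  proof
    fix z assume "z \<in> rsum (rid R a) (rid R b)"
    then obtain x y where "z = x \<oplus> y" "x \<in> rid R a" "y \<in> rid R b" unfolding rsum_def by blast
    then show "z \<in> Y" using add[of x y] Y(2,3) by (simp only: subsetD)
  qed
qed

lemma LL_meet:
  assumes a: "a \<in> carrier R" and b: "b \<in> carrier R"
  shows "lmeet (LL R) (rid R a) (rid R b) = rid R a \<inter> rid R b"
  unfolding LL_def
proof (rule lmeet_incl)
  show "rid R a \<in> principal_right_ideals R" "rid R b \<in> principal_right_ideals R"
    by (rule pri_in[OF a], rule pri_in[OF b])
  obtain c where c: "c \<in> carrier R" "rid R c = rid R a \<inter> rid R b" using ex_rinter[OF a b] by (rule bexE)
  then show "rid R a \<inter> rid R b \<in> principal_right_ideals R" unfolding pri_iff by metis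
qed auto

lemma rid_zero: "rid R \<zero> = {\<zero>}" by auto

lemma LL_zero: "opn (LL R) Zero [] = {\<zero>}"
  unfolding LL_def
proof (rule bottom_incl)
  show "{\<zero>} \<in> principal_right_ideals R" unfolding pri_iff using rid_zero by (intro bexI[of _ \<zero>]) auto
  show "{\<zero>} \<subseteq> Y" if "Y \<in> principal_right_ideals R" for Y
    using that rid_closed(1) unfolding pri_iff by auto
qed

text \<open>A left unit is enough to make the whole ring a principal right ideal, hence the greatest
  one.\<close>

definition left_unit :: "'a \<Rightarrow> bool" where
  "left_unit u \<longleftrightarrow> u \<in> carrier R \<and> (\<forall>x\<in>carrier R. u \<otimes> x = x)"

lemma LL_one: "left_unit u \<Longrightarrow> opn (LL R) One [] = rid R u"
proof -
  assume u: "left_unit u"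
  then have "rid R u = carrier R" by (auto simp: left_unit_def image_iff)
  moreover have "rid R u \<in> principal_right_ideals R" using u by (intro pri_in) (simp add: left_unit_def)
  ultimately show ?thesis unfolding LL_def
    by (intro top_incl) (auto simp: principal_right_ideals_def)
qed

end

section \<open>Lattice signatures and maps induced by ring homomorphisms\<close>

definition lat_sig :: "lat_op similarity \<Rightarrow> bool" where
  "lat_sig \<sigma> \<longleftrightarrow> \<sigma> \<in> {lattice_sig, lattice0_sig, lattice01_sig}"

lemma lat_sig_cases:
  assumes "lat_sig \<sigma>" "\<sigma> f = Some (length xs)"
  obtains x y where "f = Join" "xs = [x, y]" | x y where "f = Meet" "xs = [x, y]"
    | "f = Zero" "xs = []" "Zero \<in> dom \<sigma>" | "f = One" "xs = []" "One \<in> dom \<sigma>"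
proof -
  have "f = Join \<and> length xs = 2 \<or> f = Meet \<and> length xs = 2 \<or> f = Zero \<and> xs = [] \<and> Zero \<in> dom \<sigma> \<or>
      f = One \<and> xs = [] \<and> One \<in> dom \<sigma>"
    using assms by (auto simp: lat_sig_def lattice_sig_def lattice0_sig_def lattice01_sig_def split: if_splits)
  then show ?thesis using that by (auto simp: numeral_2_eq_2 length_Suc_conv)
qed

text \<open>A constant is related to itself by reflexivity, so the three lattice signatures lead to
  the same congruences.\<close>

lemma congruence_iff_cong2:
  assumes s: "lat_sig \<sigma>" and A: "is_algebra \<sigma> L"
  shows "congruence \<sigma> L \<theta> \<longleftrightarrow> cong2 (carrier L) (ljoin L) (lmeet L) \<theta>"
proof
  have sj: "\<sigma> Join = Some 2" "\<sigma> Meet = Some 2"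
    using s by (auto simp: lat_sig_def lattice_sig_def lattice0_sig_def lattice01_sig_def)
  assume c: "congruence \<sigma> L \<theta>"
  show "cong2 (carrier L) (ljoin L) (lmeet L) \<theta>" unfolding cong2_def
    using c congruenceD(5)[OF c, of _ "[_, _]" "[_, _]"] sj by (auto simp: congruence_def)
next
  assume c: "cong2 (carrier L) (ljoin L) (lmeet L) \<theta>"
  have "(opn L f xs, opn L f ys) \<in> \<theta>" if f: "\<sigma> f = Some (length xs)" and xy: "list_all2 (\<lambda>x y. (x, y) \<in> \<theta>) xs ys" for f xs ys
    using s f
  proof (cases rule: lat_sig_cases)
    case 3
    then have "opn L f xs \<in> carrier L" "ys = []" using A f xy by (auto simp: is_algebra_def)
    then show ?thesis using 3 c by (auto simp: cong2_def equiv_def refl_on_def)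
  next
    case 4
    then have "opn L f xs \<in> carrier L" "ys = []" using A f xy by (auto simp: is_algebra_def)
    then show ?thesis using 4 c by (auto simp: cong2_def equiv_def refl_on_def)
  qed (use c xy in \<open>auto simp: cong2_def list_all2_Cons1\<close>)
  then show "congruence \<sigma> L \<theta>" using c by (auto simp: congruence_def cong2_def)
qed

lemma (in regular) LL_algebra:
  assumes s: "lat_sig \<tau>" and u: "One \<in> dom \<tau> \<Longrightarrow> \<exists>u. left_unit u"
  shows "is_algebra \<tau> (LL R)"
proof -
  have C: "carrier (LL R) = principal_right_ideals R" by (simp add: LL_def)
  have "opn (LL R) f xs \<in> carrier (LL R)" if f: "\<tau> f = Some (length xs)" and xs: "set xs \<subseteq> carrier (LL R)" for f xs
    using s f
  proof (cases rule: lat_sig_cases)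
    case (1 x y)
    then obtain a b where ab: "a \<in> carrier R" "b \<in> carrier R" "x = rid R a" "y = rid R b"
      using xs C by (auto simp: principal_right_ideals_def)
    obtain c where c: "c \<in> carrier R" "rid R c = rsum (rid R a) (rid R b)" using ex_rsum[OF ab(1,2)] by (rule bexE)
    have "opn (LL R) f xs = rid R c" by (simp only: 1 ab(3,4) LL_join[OF ab(1,2)] c(2))
    then show ?thesis unfolding C using pri_in[OF c(1)] by simp
  next
    case (2 x y)
    then obtain a b where ab: "a \<in> carrier R" "b \<in> carrier R" "x = rid R a" "y = rid R b"
      using xs C by (auto simp: principal_right_ideals_def)
    obtain c where c: "c \<in> carrier R" "rid R c = rid R a \<inter> rid R b" using ex_rinter[OF ab(1,2)] by (rule bexE)
    have "opn (LL R) f xs = rid R c" by (simp only: 2 ab(3,4) LL_meet[OF ab(1,2)] c(2))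
    then show ?thesis unfolding C using pri_in[OF c(1)] by simp
  next
    case 3
    then show ?thesis using LL_zero rid_zero unfolding C pri_iff by (intro bexI[of _ \<zero>]) auto
  next
    case 4
    then obtain v where "left_unit v" using u by blast
    then show ?thesis using 4 LL_one pri_in[of v] unfolding C left_unit_def by simp
  qed
  moreover have "carrier (LL R) \<noteq> {}" unfolding C principal_right_ideals_def by auto
  ultimately show ?thesis unfolding is_algebra_def by blast
qed

locale regular_hom = R: regular R + R': regular R' for R :: "'a ring" and R' :: "'c ring" +
  fixes \<phi> :: "'a \<Rightarrow> 'c"
  assumes hom_closed: "x \<in> carrier R \<Longrightarrow> \<phi> x \<in> carrier R'"
    and hom_add: "\<lbrakk>x \<in> carrier R; y \<in> carrier R\<rbrakk> \<Longrightarrow> \<phi> (x \<oplus>\<^bsub>R\<^esub> y) = \<phi> x \<oplus>\<^bsub>R'\<^esub> \<phi> y"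
    and hom_mult: "\<lbrakk>x \<in> carrier R; y \<in> carrier R\<rbrakk> \<Longrightarrow> \<phi> (x \<otimes>\<^bsub>R\<^esub> y) = \<phi> x \<otimes>\<^bsub>R'\<^esub> \<phi> y"
begin

lemma hom_zero: "\<phi> \<zero>\<^bsub>R\<^esub> = \<zero>\<^bsub>R'\<^esub>"
  using hom_add[of "\<zero>\<^bsub>R\<^esub>" "\<zero>\<^bsub>R\<^esub>"] hom_closed[of "\<zero>\<^bsub>R\<^esub>"] R'.add.l_cancel_one' by fastforce

lemma hom_minus:
  assumes "x \<in> carrier R" "y \<in> carrier R"
  shows "\<phi> (x \<ominus>\<^bsub>R\<^esub> y) = \<phi> x \<ominus>\<^bsub>R'\<^esub> \<phi> y"
proof -
  have "\<phi> (\<ominus>\<^bsub>R\<^esub> y) = \<ominus>\<^bsub>R'\<^esub> \<phi> y"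
    using hom_add[of "\<ominus>\<^bsub>R\<^esub> y" y] assms R'.minus_equality hom_closed hom_zero by (simp add: R.l_neg)
  then show ?thesis using assms hom_add[of x "\<ominus>\<^bsub>R\<^esub> y"] by (simp add: R.minus_eq R'.minus_eq)
qed

lemma hom_rid_mono:
  assumes "a \<in> carrier R" "b \<in> carrier R" "a \<in> rid R b"
  shows "\<phi> a \<in> rid R' (\<phi> b)"
  using assms hom_mult hom_closed by auto

lemma hom_rid_eq:
  assumes "a \<in> carrier R" "b \<in> carrier R" "rid R a = rid R b"
  shows "rid R' (\<phi> a) = rid R' (\<phi> b)"
proof -
  have "a \<in> rid R b" "b \<in> rid R a" using assms R.rid_self by auto
  then have "\<phi> a \<in> rid R' (\<phi> b)" "\<phi> b \<in> rid R' (\<phi> a)" using hom_rid_mono assms by auto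
  then show ?thesis using R'.rid_subset_iff hom_closed assms by (metis subset_antisym)
qed

lemma hom_rsum:
  assumes abc: "a \<in> carrier R" "b \<in> carrier R" "c \<in> carrier R" and e: "rid R c = R.rsum (rid R a) (rid R b)"
  shows "rid R' (\<phi> c) = R'.rsum (rid R' (\<phi> a)) (rid R' (\<phi> b))"
proof (rule R'.rsum_eq_rid)
  have ac: "a \<in> rid R c" "b \<in> rid R c"
    using R.rid_self[OF abc(1)] R.rid_self[OF abc(2)] R.rsum_upper[OF abc(1,2)] by (simp_all only: e subsetD)
  show "\<phi> a \<in> rid R' (\<phi> c)" "\<phi> b \<in> rid R' (\<phi> c)"
    by (rule hom_rid_mono[OF abc(1,3) ac(1)], rule hom_rid_mono[OF abc(2,3) ac(2)])
  have "c \<in> R.rsum (rid R a) (rid R b)" using R.rid_self[OF abc(3)] by (simp only: e)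
  then obtain x y where "c = a \<otimes>\<^bsub>R\<^esub> x \<oplus>\<^bsub>R\<^esub> b \<otimes>\<^bsub>R\<^esub> y" "x \<in> carrier R" "y \<in> carrier R" by (auto simp: R.rsum_def)
  then have "\<phi> c = \<phi> a \<otimes>\<^bsub>R'\<^esub> \<phi> x \<oplus>\<^bsub>R'\<^esub> \<phi> b \<otimes>\<^bsub>R'\<^esub> \<phi> y" "\<phi> x \<in> carrier R'" "\<phi> y \<in> carrier R'"
    using hom_add hom_mult hom_closed abc by auto
  then show "\<phi> c \<in> R'.rsum (rid R' (\<phi> a)) (rid R' (\<phi> b))" unfolding R'.rsum_def by blast
qed (use hom_closed abc in auto)

text \<open>Intersections survive because \<open>rid_inter_formula\<close> uses only ring operations
  and a quasi-inverse \<open>u\<close>, whose defining equation the homomorphism carries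
  over.\<close>

lemma hom_rinter:
  assumes abc: "a \<in> carrier R" "b \<in> carrier R" "c \<in> carrier R" and e: "rid R c = rid R a \<inter> rid R b"
  shows "rid R' (\<phi> c) = rid R' (\<phi> a) \<inter> rid R' (\<phi> b)"
proof -
  obtain e f where e': "R.idem e" "rid R e = rid R a" and f': "R.idem f" "rid R f = rid R b"
    using R.idem_generator abc by metis
  have eR: "e \<in> carrier R" "f \<in> carrier R" using e' f' by (auto simp: R.idem_def)
  define h where "h = f \<ominus>\<^bsub>R\<^esub> e \<otimes>\<^bsub>R\<^esub> f"
  have h: "h \<in> carrier R" using eR by (simp add: h_def)
  then obtain u where u: "u \<in> carrier R" "h = h \<otimes>\<^bsub>R\<^esub> u \<otimes>\<^bsub>R\<^esub> h" by (rule R.regularE)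
  define d where "d = f \<ominus>\<^bsub>R\<^esub> f \<otimes>\<^bsub>R\<^esub> u \<otimes>\<^bsub>R\<^esub> h"
  have d: "d \<in> carrier R" using eR u h by (simp add: d_def)
  have "rid R d = rid R e \<inter> rid R f"
    unfolding d_def by (rule R.rid_inter_formula[OF e'(1) f'(1) u(1) h_def]) (use u in simp)
  then have "rid R c = rid R d" by (simp only: e e'(2) f'(2))
  then have 1: "rid R' (\<phi> c) = rid R' (\<phi> d)" by (rule hom_rid_eq[OF abc(3) d])
  have "rid R' (\<phi> f \<ominus>\<^bsub>R'\<^esub> \<phi> f \<otimes>\<^bsub>R'\<^esub> \<phi> u \<otimes>\<^bsub>R'\<^esub> \<phi> h) = rid R' (\<phi> e) \<inter> rid R' (\<phi> f)"
  proof (rule R'.rid_inter_formula)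
    show "R'.idem (\<phi> e)" "R'.idem (\<phi> f)"
      using e' f' hom_mult[of e e] hom_mult[of f f] hom_closed by (auto simp: R.idem_def R'.idem_def)
    show "\<phi> h = \<phi> f \<ominus>\<^bsub>R'\<^esub> \<phi> e \<otimes>\<^bsub>R'\<^esub> \<phi> f" using eR by (simp add: h_def hom_minus hom_mult)
    show "\<phi> h \<otimes>\<^bsub>R'\<^esub> \<phi> u \<otimes>\<^bsub>R'\<^esub> \<phi> h = \<phi> h" using u h by (metis R.mult_closed hom_mult)
  qed (use u hom_closed in auto)
  moreover have "\<phi> d = \<phi> f \<ominus>\<^bsub>R'\<^esub> \<phi> f \<otimes>\<^bsub>R'\<^esub> \<phi> u \<otimes>\<^bsub>R'\<^esub> \<phi> h"
    using eR u h by (simp add: d_def hom_minus hom_mult)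
  moreover have "rid R' (\<phi> e) = rid R' (\<phi> a)" "rid R' (\<phi> f) = rid R' (\<phi> b)"
    by (rule hom_rid_eq[OF eR(1) abc(1) e'(2)], rule hom_rid_eq[OF eR(2) abc(2) f'(2)])
  ultimately show ?thesis using 1 by simp
qed

text \<open>With \<open>b = b y b\<close> the element \<open>b y\<close> acts as identity on
  \<open>bR\<close>, so membership of \<open>a\<close> is the equation \<open>b y a = a\<close>; in
  the target \<open>\<phi> y\<close> is a quasi-inverse of \<open>\<phi> b\<close>.\<close>

lemma hom_rid_iff:
  assumes ab: "a \<in> carrier R" "b \<in> carrier R" "y \<in> carrier R" and b: "b = b \<otimes>\<^bsub>R\<^esub> y \<otimes>\<^bsub>R\<^esub> b"
  shows "\<phi> a \<in> rid R' (\<phi> b) \<longleftrightarrow> \<phi> (b \<otimes>\<^bsub>R\<^esub> y \<otimes>\<^bsub>R\<^esub> a) = \<phi> a"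
proof
  assume "\<phi> a \<in> rid R' (\<phi> b)"
  then obtain r where r: "\<phi> a = \<phi> b \<otimes>\<^bsub>R'\<^esub> r" "r \<in> carrier R'" by (rule imageE)
  have "\<phi> (b \<otimes>\<^bsub>R\<^esub> y \<otimes>\<^bsub>R\<^esub> a) = \<phi> (b \<otimes>\<^bsub>R\<^esub> y \<otimes>\<^bsub>R\<^esub> b) \<otimes>\<^bsub>R'\<^esub> r"
    using ab r hom_closed by (simp add: hom_mult R'.mult_assoc)
  then show "\<phi> (b \<otimes>\<^bsub>R\<^esub> y \<otimes>\<^bsub>R\<^esub> a) = \<phi> a" using b r(1) by simp
next
  assume e: "\<phi> (b \<otimes>\<^bsub>R\<^esub> y \<otimes>\<^bsub>R\<^esub> a) = \<phi> a"
  show "\<phi> a \<in> rid R' (\<phi> b)"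
    by (rule R'.ridI[of "\<phi> (y \<otimes>\<^bsub>R\<^esub> a)"]) (use e ab hom_closed in \<open>simp_all add: hom_mult R'.mult_assoc\<close>)
qed

text \<open>By \<open>hom_rid_eq\<close> the image does not depend on the generator chosen.\<close>

definition LL_map :: "'a set \<Rightarrow> 'c set" where
  "LL_map U = rid R' (\<phi> (SOME a. a \<in> carrier R \<and> rid R a = U))"

lemma LL_map_rid: "a \<in> carrier R \<Longrightarrow> LL_map (rid R a) = rid R' (\<phi> a)"
  unfolding LL_map_def
  using someI_ex[of "\<lambda>b. b \<in> carrier R \<and> rid R b = rid R a"] hom_rid_eq[of _ a] by blast

lemma LL_map_hom:
  assumes s: "lat_sig \<tau>"
    and u: "One \<in> dom \<tau> \<Longrightarrow> \<exists>u. R.left_unit u \<and> R'.left_unit (\<phi> u)"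
  shows "hom_on \<tau> (carrier (LL R)) (LL R) (LL R') LL_map"
proof -
  have C: "carrier (LL R) = principal_right_ideals R" by (simp add: LL_def)
  have alg: "is_algebra \<tau> (LL R)" using R.LL_algebra[OF s] u by blast
  have "LL_map (opn (LL R) f xs) = opn (LL R') f (map LL_map xs)"
    if f: "\<tau> f = Some (length xs)" and xs: "set xs \<subseteq> carrier (LL R)" for f xs
    using s f
  proof (cases rule: lat_sig_cases)
    case (1 x y)
    then obtain a b where ab: "a \<in> carrier R" "b \<in> carrier R" "x = rid R a" "y = rid R b"
      using xs C by (auto simp: principal_right_ideals_def)
    obtain c where c: "c \<in> carrier R" "rid R c = R.rsum (rid R a) (rid R b)" using R.ex_rsum[OF ab(1) ab(2)] by (rule bexE)
    have "ljoin (LL R) x y = rid R c" by (simp only: R.LL_join[OF ab(1,2)] ab(3,4) c(2))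
    moreover have "ljoin (LL R') (LL_map x) (LL_map y) = rid R' (\<phi> c)"
      using R'.LL_join[of "\<phi> a" "\<phi> b"] hom_closed ab hom_rsum[OF ab(1,2) c] LL_map_rid by simp
    ultimately show ?thesis using 1 LL_map_rid[OF c(1)] by simp
  next
    case (2 x y)
    then obtain a b where ab: "a \<in> carrier R" "b \<in> carrier R" "x = rid R a" "y = rid R b"
      using xs C by (auto simp: principal_right_ideals_def)
    obtain c where c: "c \<in> carrier R" "rid R c = rid R a \<inter> rid R b" using R.ex_rinter[OF ab(1) ab(2)] by (rule bexE)
    have "lmeet (LL R) x y = rid R c" by (simp only: R.LL_meet[OF ab(1,2)] ab(3,4) c(2))
    moreover have "lmeet (LL R') (LL_map x) (LL_map y) = rid R' (\<phi> c)"
      using R'.LL_meet[of "\<phi> a" "\<phi> b"] hom_closed ab hom_rinter[OF ab(1,2) c] LL_map_rid by simp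
    ultimately show ?thesis using 2 LL_map_rid[OF c(1)] by simp
  next
    case 3
    have "LL_map (rid R \<zero>\<^bsub>R\<^esub>) = rid R' \<zero>\<^bsub>R'\<^esub>" using LL_map_rid[of "\<zero>\<^bsub>R\<^esub>"] hom_zero by simp
    then show ?thesis using 3 R.LL_zero R'.LL_zero R.rid_zero R'.rid_zero by simp
  next
    case 4
    then obtain v where v: "R.left_unit v" "R'.left_unit (\<phi> v)" using u by blast
    then have "LL_map (rid R v) = rid R' (\<phi> v)" by (intro LL_map_rid) (simp add: R.left_unit_def)
    then show ?thesis using 4 R.LL_one[OF v(1)] R'.LL_one[OF v(2)] by simp
  qed
  then show ?thesis using alg unfolding hom_on_def is_algebra_def by blast
qed

text \<open>Membership is an equation by \<open>hom_rid_iff\<close>, and an injective homomorphism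
  reflects equations.\<close>

lemma LL_map_inj:
  assumes inj: "inj_on \<phi> (carrier R)"
  shows "inj_on LL_map (carrier (LL R))"
proof -
  have key: "a \<in> rid R b" if ab: "a \<in> carrier R" "b \<in> carrier R" "\<phi> a \<in> rid R' (\<phi> b)" for a b
  proof -
    obtain y where y: "y \<in> carrier R" "b = b \<otimes>\<^bsub>R\<^esub> y \<otimes>\<^bsub>R\<^esub> b" using ab(2) by (rule R.regularE)
    have "\<phi> (b \<otimes>\<^bsub>R\<^esub> y \<otimes>\<^bsub>R\<^esub> a) = \<phi> a" using hom_rid_iff[OF ab(1,2) y] ab(3) by simp
    then have "b \<otimes>\<^bsub>R\<^esub> y \<otimes>\<^bsub>R\<^esub> a = a" using inj ab y(1) by (auto dest: inj_onD)
    then have "a = b \<otimes>\<^bsub>R\<^esub> (y \<otimes>\<^bsub>R\<^esub> a)" using ab y(1) by (simp add: R.mult_assoc)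
    then show ?thesis using ab y(1) by (intro R.ridI[of "y \<otimes>\<^bsub>R\<^esub> a"]) auto
  qed
  show ?thesis
  proof (rule inj_onI)
    fix U V assume "U \<in> carrier (LL R)" "V \<in> carrier (LL R)" and eq: "LL_map U = LL_map V"
    then obtain a b where ab: "a \<in> carrier R" "b \<in> carrier R" "U = rid R a" "V = rid R b"
      by (auto simp: LL_def principal_right_ideals_def)
    then have e: "rid R' (\<phi> a) = rid R' (\<phi> b)" using eq LL_map_rid by simp
    have "\<phi> a \<in> rid R' (\<phi> b)" using R'.rid_self[OF hom_closed[OF ab(1)]] by (simp only: e)
    moreover have "\<phi> b \<in> rid R' (\<phi> a)" using R'.rid_self[OF hom_closed[OF ab(2)]] by (simp only: e)
    ultimately have "a \<in> rid R b" "b \<in> rid R a" using key ab(1,2) by blast+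
    then show "U = V" using ab R.rid_subset_iff by (metis subset_antisym)
  qed
qed

end

context regular
begin

text \<open>Sums and right multiples generate ideals below joins of collapsed ones. A left multiple
  need not, so the collapse is carried over to it by perspectivity. Thus collapsed elements form a
  two-sided ideal, which links lattice congruences to the ring.\<close>

lemma LL_cong_ideal:
  assumes \<theta>: "cong2 (carrier (LL R)) (ljoin (LL R)) (lmeet (LL R)) \<theta>"
  shows "\<lbrakk>a \<in> carrier R; r \<in> carrier R; ({\<zero>}, rid R a) \<in> \<theta>\<rbrakk> \<Longrightarrow> ({\<zero>}, rid R (a \<otimes> r)) \<in> \<theta>"
    and "\<lbrakk>a \<in> carrier R; r \<in> carrier R; ({\<zero>}, rid R a) \<in> \<theta>\<rbrakk> \<Longrightarrow> ({\<zero>}, rid R (r \<otimes> a)) \<in> \<theta>"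
    and "\<lbrakk>a \<in> carrier R; b \<in> carrier R; ({\<zero>}, rid R a) \<in> \<theta>; ({\<zero>}, rid R b) \<in> \<theta>\<rbrakk> \<Longrightarrow> ({\<zero>}, rid R (a \<oplus> b)) \<in> \<theta>"
proof -
  have eqv: "equiv (carrier (LL R)) \<theta>" using \<theta> by (simp add: cong2_def)
  have C: "rid R a \<in> carrier (LL R)" if "a \<in> carrier R" for a
    using that by (auto simp: LL_def principal_right_ideals_def)
  have r: "(rid R a, rid R a) \<in> \<theta>" if "a \<in> carrier R" for a
    using eqv C[OF that] by (auto simp: equiv_def refl_on_def)
  have j: "(rsum (rid R a) (rid R c), rsum (rid R b) (rid R d)) \<in> \<theta>"
    and m: "(rid R a \<inter> rid R c, rid R b \<inter> rid R d) \<in> \<theta>"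
    if "(rid R a, rid R b) \<in> \<theta>" "(rid R c, rid R d) \<in> \<theta>" "a \<in> carrier R" "b \<in> carrier R" "c \<in> carrier R" "d \<in> carrier R" for a b c d
  proof -
    have "(ljoin (LL R) (rid R a) (rid R c), ljoin (LL R) (rid R b) (rid R d)) \<in> \<theta> \<and>
       (lmeet (LL R) (rid R a) (rid R c), lmeet (LL R) (rid R b) (rid R d)) \<in> \<theta>"
      using \<theta> that unfolding cong2_def by blast
    then show "(rsum (rid R a) (rid R c), rsum (rid R b) (rid R d)) \<in> \<theta>" "(rid R a \<inter> rid R c, rid R b \<inter> rid R d) \<in> \<theta>"
      using LL_join LL_meet that by auto
  qed
  have z: "{\<zero>} \<inter> rid R a = {\<zero>}" "rsum {\<zero>} (rid R a) = rid R a" if "a \<in> carrier R" for a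
  proof -
    show "{\<zero>} \<inter> rid R a = {\<zero>}" using rid_closed(1)[OF that] by (simp only: Int_insert_left_if1 Int_empty_left)
    have "\<zero> \<oplus> y = y" if "y \<in> U" "U \<subseteq> carrier R" for y U using that by auto
    then have "rsum {\<zero>} U = U" if "U \<subseteq> carrier R" for U using that unfolding rsum_def by force
    then show "rsum {\<zero>} (rid R a) = rid R a" using rid_sub[OF that] .
  qed
  have down: "({\<zero>}, rid R b) \<in> \<theta>" if "({\<zero>}, rid R a) \<in> \<theta>" "a \<in> carrier R" "b \<in> carrier R" "rid R b \<subseteq> rid R a" for a b
  proof -
    have "({\<zero>} \<inter> rid R b, rid R a \<inter> rid R b) \<in> \<theta>"
      by (rule m[of \<zero> a b b, unfolded rid_zero, OF that(1) r[OF that(3)] zero_closed that(2,3,3)])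
    then show ?thesis using z(1)[OF that(3)] that(4) by (simp add: Int_absorb1)
  qed
  have jn: "({\<zero>}, rsum (rid R a) (rid R b)) \<in> \<theta>" if "({\<zero>}, rid R a) \<in> \<theta>" "({\<zero>}, rid R b) \<in> \<theta>" "a \<in> carrier R" "b \<in> carrier R" for a b
    using j[of \<zero> a \<zero> b, unfolded rid_zero, OF that(1,2) zero_closed that(3) zero_closed that(4)]
      z(2)[OF zero_closed, unfolded rid_zero] by (simp only:)
  have sub: "rid R (a \<oplus> b) \<subseteq> rsum (rid R a) (rid R b)" if ab: "a \<in> carrier R" "b \<in> carrier R" for a b
  proof -
    obtain c where c: "c \<in> carrier R" "rid R c = rsum (rid R a) (rid R b)" using ex_rsum[OF ab(1) ab(2)] by (rule bexE)
    have "a \<oplus> b \<in> rid R c" unfolding c(2) rsum_def using rid_self ab by blast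
    then show ?thesis using rid_subset_iff[of "a \<oplus> b" c] c ab by simp
  qed
  have add: "({\<zero>}, rid R (a \<oplus> b)) \<in> \<theta>" if "({\<zero>}, rid R a) \<in> \<theta>" "({\<zero>}, rid R b) \<in> \<theta>" and ab: "a \<in> carrier R" "b \<in> carrier R" for a b
  proof -
    obtain c where c: "c \<in> carrier R" "rid R c = rsum (rid R a) (rid R b)" using ex_rsum[OF ab(1) ab(2)] by (rule bexE)
    then show ?thesis using down[of c "a \<oplus> b"] jn[of a b] sub[OF ab] that by simp
  qed
  then show "\<lbrakk>a \<in> carrier R; b \<in> carrier R; ({\<zero>}, rid R a) \<in> \<theta>; ({\<zero>}, rid R b) \<in> \<theta>\<rbrakk> \<Longrightarrow> ({\<zero>}, rid R (a \<oplus> b)) \<in> \<theta>" .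
  have right: "({\<zero>}, rid R (a \<otimes> r)) \<in> \<theta>" if "a \<in> carrier R" "r \<in> carrier R" "({\<zero>}, rid R a) \<in> \<theta>" for a r
  proof -
    have ar: "a \<otimes> r \<in> carrier R" using that by simp
    have "rid R (a \<otimes> r) \<subseteq> rid R a" using rid_subset_iff[OF ar that(1)] ridI[OF that(2) refl] by simp
    then show ?thesis by (rule down[OF that(3,1) ar])
  qed
  then show "\<lbrakk>a \<in> carrier R; r \<in> carrier R; ({\<zero>}, rid R a) \<in> \<theta>\<rbrakk> \<Longrightarrow> ({\<zero>}, rid R (a \<otimes> r)) \<in> \<theta>" .
  show "({\<zero>}, rid R (r \<otimes> a)) \<in> \<theta>" if aR: "a \<in> carrier R" and rR: "r \<in> carrier R" and a: "({\<zero>}, rid R a) \<in> \<theta>"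
  proof -
    obtain e where e: "idem e" "rid R e = rid R a" using idem_generator aR by blast
    have eR: "e \<in> carrier R" "e \<otimes> e = e" using e(1) by (auto simp: idem_def)
    have eN: "({\<zero>}, rid R e) \<in> \<theta>" using a e by simp
    \<comment> \<open>\<open>v = (1 - e) r e\<close> generates an ideal meeting \<open>eR\<close> trivially, and \<open>(e + v)R\<close> is a common complement.\<close>
    define v where "v = r \<otimes> e \<ominus> e \<otimes> (r \<otimes> e)"
    have vR: "v \<in> carrier R" using eR rR by (simp add: v_def)
    have ev: "e \<otimes> v = \<zero>" using eR rR by (simp add: v_def diff_distr_r mult_assoc[symmetric])
    have ve: "v \<otimes> e = v" using eR rR by (simp add: v_def diff_distr_l mult_assoc)
    define g where "g = e \<oplus> v"
    have gR: "g \<in> carrier R" using eR vR by (simp add: g_def)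
    have trivial: "rid R g \<inter> rid R v = {\<zero>}"
    proof -
      have "x = \<zero>" if x: "x \<in> rid R g" "x \<in> rid R v" for x
      proof -
        obtain p q where pq: "p \<in> carrier R" "q \<in> carrier R" "x = g \<otimes> p" "x = v \<otimes> q" using x by auto
        have "e \<otimes> x = e \<otimes> p" using pq eR vR ev by (simp add: g_def distr_r mult_assoc[symmetric])
        moreover have "e \<otimes> x = \<zero>" using pq(2,4) eR vR ev by (simp add: mult_assoc[symmetric])
        ultimately have ep: "e \<otimes> p = \<zero>" by simp
        have "x = e \<otimes> p \<oplus> v \<otimes> e \<otimes> p" using pq eR vR ve by (simp add: g_def distr_l)
        also have "\<dots> = \<zero>" using ep pq(1) eR vR by (simp add: mult_assoc)
        finally show ?thesis .
      qed
      then show ?thesis using rid_closed(1) gR vR by blast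
    qed
    obtain c where c: "c \<in> carrier R" "rid R c = rsum (rid R e) (rid R g)" using ex_rsum[OF eR(1) gR] by (rule bexE)
    \<comment> \<open>Adding the collapsed \<open>eR\<close> does not change \<open>gR\<close>
      modulo \<open>\<theta>\<close>. Since \<open>vR\<close> lies in the sum and meets
      \<open>gR\<close> trivially, meeting with \<open>vR\<close> shows that it is collapsed
      too.\<close>
    have "(rsum {\<zero>} (rid R g), rsum (rid R e) (rid R g)) \<in> \<theta>"
      by (rule j[of \<zero> e g g, unfolded rid_zero, OF eN r[OF gR] zero_closed eR(1) gR gR])
    then have gc: "(rid R g, rid R c) \<in> \<theta>" using z(2)[OF gR] c by simp
    have "v \<in> rid R c"
    proof -
      have "\<ominus> e \<in> rid R e" using eR by (intro idem_mem e(1)) (simp_all add: mult_minus_r)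
      moreover have "v = (\<ominus> e) \<oplus> g" using eR vR by (simp add: g_def a_assoc[symmetric] l_neg)
      ultimately show ?thesis unfolding c(2) rsum_def using rid_self[OF gR] by blast
    qed
    then have vc: "rid R v \<subseteq> rid R c" using rid_subset_iff vR c by blast
    have "(rid R g \<inter> rid R v, rid R c \<inter> rid R v) \<in> \<theta>" using m[OF gc r[OF vR]] gR c vR by simp
    then have vN: "({\<zero>}, rid R v) \<in> \<theta>" using trivial vc by (simp add: Int_absorb1)
    have re: "e \<otimes> (r \<otimes> e) \<oplus> v = r \<otimes> e" using diff_add_cancel eR rR by (simp add: v_def)
    have reR: "r \<otimes> e \<in> carrier R" using eR rR by simp
    have reN: "({\<zero>}, rid R (r \<otimes> e)) \<in> \<theta>"
      using add[OF right[OF eR(1) reR eN] vN mult_closed[OF eR(1) reR] vR] by (simp only: re)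
    have "r \<otimes> a = r \<otimes> e \<otimes> a" using idem_fix[OF e(1), of a] rid_self[OF aR] e(2) eR rR aR by (simp add: mult_assoc)
    then show ?thesis using right[OF _ aR reN] eR rR by simp
  qed
qed

end


section \<open>Block matrix rings\<close>

locale subfield_set =
  fixes P :: "'f::field set"
  assumes sf0: "0 \<in> P" and sf1: "1 \<in> P"
    and sf_add: "\<lbrakk>x \<in> P; y \<in> P\<rbrakk> \<Longrightarrow> x + y \<in> P" and sf_mult: "\<lbrakk>x \<in> P; y \<in> P\<rbrakk> \<Longrightarrow> x * y \<in> P"
    and sf_minus: "x \<in> P \<Longrightarrow> - x \<in> P" and sf_inv: "x \<in> P \<Longrightarrow> inverse x \<in> P"
begin

lemma sf_sum: "(\<And>x. x \<in> A \<Longrightarrow> f x \<in> P) \<Longrightarrow> sum f A \<in> P"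
  by (induction A rule: infinite_finite_induct) (auto simp: sf0 sf_add)

end

definition bmult :: "'s set \<Rightarrow> ('s \<Rightarrow> nat) \<Rightarrow> ('s pos \<times> 's pos \<Rightarrow> 'f::field) \<Rightarrow> ('s pos \<times> 's pos \<Rightarrow> 'f) \<Rightarrow> 's pos \<times> 's pos \<Rightarrow> 'f" where
  "bmult S n a b = (\<lambda>(p, q). \<Sum>r\<in>positions S n. a (p, r) * b (r, q))"

text \<open>The product of full matrix rings over \<open>P\<close>, realized as block diagonal
  matrices over one set of positions, so that homomorphisms can be given by maps of
  positions.\<close>

definition block_ring :: "'f set \<Rightarrow> 's set \<Rightarrow> ('s \<Rightarrow> nat) \<Rightarrow> ('s pos \<times> 's pos \<Rightarrow> 'f::field) ring" where
  "block_ring P S n = \<lparr>carrier = {a. \<forall>x. a x \<in> P \<and> (x \<notin> same_block S n \<longrightarrow> a x = 0)},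
     mult = bmult S n, one = (\<lambda>(p, q). if p = q \<and> p \<in> positions S n then 1 else 0),
     zero = (\<lambda>_. 0), add = (\<lambda>a b x. a x + b x)\<rparr>"

definition bunit :: "'f \<Rightarrow> 's pos \<Rightarrow> 's pos \<Rightarrow> 's pos \<times> 's pos \<Rightarrow> 'f::field" where
  "bunit c p q = (\<lambda>x. if x = (p, q) then c else 0)"

definition bhom :: "('t pos \<times> 't pos \<rightharpoonup> 's pos \<times> 's pos) \<Rightarrow> ('s pos \<times> 's pos \<Rightarrow> 'f::field) \<Rightarrow> 't pos \<times> 't pos \<Rightarrow> 'f" where
  "bhom e a = (\<lambda>x. case e x of None \<Rightarrow> 0 | Some y \<Rightarrow> a y)"

text \<open>The projection to block \<open>s\<close> followed by its inclusion, which makes it an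
  endomorphism of the same ring.\<close>

definition brestrict :: "'s \<Rightarrow> ('s pos \<times> 's pos \<Rightarrow> 'f::field) \<Rightarrow> 's pos \<times> 's pos \<Rightarrow> 'f" where
  "brestrict s a = (\<lambda>x. if fst (fst x) = s then a x else 0)"

lemma finite_positions: "finite S \<Longrightarrow> finite (positions S n)"
proof -
  assume "finite S"
  moreover have "positions S n = (SIGMA s:S. {..<n s})" by (auto simp: positions_def)
  ultimately show ?thesis by simp
qed

locale block_matrices = subfield_set P for P :: "'f::field set" +
  fixes S :: "'s set" and n :: "'s \<Rightarrow> nat"
  assumes fin: "finite S"
begin

abbreviation "B \<equiv> block_ring P S n"

lemma B_carrier: "a \<in> carrier B \<longleftrightarrow> (\<forall>x. a x \<in> P) \<and> (\<forall>x. x \<notin> same_block S n \<longrightarrow> a x = 0)"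
  by (auto simp: block_ring_def)

lemma B_simps [simp]: "a \<otimes>\<^bsub>B\<^esub> b = bmult S n a b" "a \<oplus>\<^bsub>B\<^esub> b = (\<lambda>x. a x + b x)" "\<zero>\<^bsub>B\<^esub> = (\<lambda>_. 0)"
  by (simp_all add: block_ring_def)

lemma B_in: "a \<in> carrier B \<Longrightarrow> a x \<in> P"
  unfolding B_carrier by blast

lemma B_zero: "a \<in> carrier B \<Longrightarrow> x \<notin> same_block S n \<Longrightarrow> a x = 0"
  unfolding B_carrier by blast

lemma B_nz: "\<lbrakk>a \<in> carrier B; a (p, q) \<noteq> 0\<rbrakk> \<Longrightarrow> p \<in> positions S n \<and> q \<in> positions S n \<and> fst p = fst q"
proof -
  assume "a \<in> carrier B" "a (p, q) \<noteq> 0"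
  then have "(p, q) \<in> same_block S n" unfolding B_carrier by blast
  then show ?thesis by (simp add: same_block_def)
qed

lemma bmult_closed: "\<lbrakk>a \<in> carrier B; b \<in> carrier B\<rbrakk> \<Longrightarrow> bmult S n a b \<in> carrier B"
proof -
  assume ab: "a \<in> carrier B" "b \<in> carrier B"
  have "bmult S n a b (p, q) = 0" if "(p, q) \<notin> same_block S n" for p q
  proof -
    have "a (p, r) * b (r, q) = 0" for r
    proof (rule ccontr)
      assume "a (p, r) * b (r, q) \<noteq> 0"
      then have "a (p, r) \<noteq> 0" "b (r, q) \<noteq> 0" by simp_all
      then show False using B_nz[OF ab(1), of p r] B_nz[OF ab(2), of r q] that by (simp add: same_block_def)
    qed
    then show ?thesis unfolding bmult_def prod.case by (intro sum.neutral) blast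
  qed
  moreover have "bmult S n a b (p, q) \<in> P" for p q
    unfolding bmult_def prod.case by (intro sf_sum sf_mult B_in ab)
  ultimately show ?thesis by (auto simp: B_carrier)
qed

lemma bmult_assoc: "bmult S n (bmult S n a b) c = bmult S n a (bmult S n b c)"
proof -
  have "(\<Sum>r\<in>positions S n. (\<Sum>t\<in>positions S n. a (p, t) * b (t, r)) * c (r, q)) =
     (\<Sum>t\<in>positions S n. a (p, t) * (\<Sum>r\<in>positions S n. b (t, r) * c (r, q)))" for p q
    by (simp add: sum_distrib_left sum_distrib_right mult.assoc) (rule sum.swap)
  then show ?thesis by (auto simp: bmult_def)
qed

lemma B_nonunital: "nonunital_ring B"
proof -
  have "abelian_group B"
  proof (rule abelian_groupI)
    show "\<exists>y\<in>carrier B. y \<oplus>\<^bsub>B\<^esub> x = \<zero>\<^bsub>B\<^esub>" if "x \<in> carrier B" for x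
      using that by (intro bexI[of _ "\<lambda>z. - x z"]) (auto simp: B_carrier sf_minus)
  qed (auto simp: B_carrier sf0 sf_add add.assoc add.commute)
  then show ?thesis unfolding nonunital_ring_def
    using bmult_closed bmult_assoc
    by (auto simp: bmult_def distrib_right distrib_left sum.distrib)
qed

sublocale N: nonunital B
  by unfold_locales (rule B_nonunital)

lemma B_uminus: "a \<in> carrier B \<Longrightarrow> \<ominus>\<^bsub>B\<^esub> a = (\<lambda>x. - a x)"
  by (rule N.minus_equality) (auto simp: B_carrier sf_minus)

lemma B_minus: "\<lbrakk>a \<in> carrier B; b \<in> carrier B\<rbrakk> \<Longrightarrow> a \<ominus>\<^bsub>B\<^esub> b = (\<lambda>x. a x - b x)"
  by (simp add: N.minus_eq B_uminus)

lemma bunit_in: "\<lbrakk>c \<in> P; (p, q) \<in> same_block S n\<rbrakk> \<Longrightarrow> bunit c p q \<in> carrier B"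
  by (auto simp: B_carrier bunit_def sf0)

lemma bunit_mult:
  assumes "q \<in> positions S n"
  shows "bmult S n (bunit c p q) a = (\<lambda>(x, y). if x = p then c * a (q, y) else 0)"
proof (rule ext)
  fix z :: "'s pos \<times> 's pos"
  obtain x y where z: "z = (x, y)" by (cases z)
  have "bmult S n (bunit c p q) a (x, y) = (\<Sum>r\<in>positions S n. if r = q then (if x = p then c * a (q, y) else 0) else 0)"
    unfolding bmult_def bunit_def by (simp only: prod.case) (intro sum.cong; auto)
  also have "\<dots> = (if x = p then c * a (q, y) else 0)" using assms finite_positions[OF fin] by simp
  finally show "bmult S n (bunit c p q) a z = (case z of (x, y) \<Rightarrow> if x = p then c * a (q, y) else 0)"
    by (simp add: z)
qed

lemma mult_bunit:
  assumes "p \<in> positions S n"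
  shows "bmult S n a (bunit c p q) = (\<lambda>(x, y). if y = q then a (x, p) * c else 0)"
proof (rule ext)
  fix z :: "'s pos \<times> 's pos"
  obtain x y where z: "z = (x, y)" by (cases z)
  have "bmult S n a (bunit c p q) (x, y) = (\<Sum>r\<in>positions S n. if r = p then (if y = q then a (x, p) * c else 0) else 0)"
    unfolding bmult_def bunit_def by (simp only: prod.case) (intro sum.cong; auto)
  also have "\<dots> = (if y = q then a (x, p) * c else 0)" using assms finite_positions[OF fin] by simp
  finally show "bmult S n a (bunit c p q) z = (case z of (x, y) \<Rightarrow> if y = q then a (x, p) * c else 0)"
    by (simp add: z)
qed

text \<open>Induction on the number of nonzero rows, with \<open>mccoy\<close> as the step.\<close>

lemma B_regular_aux:
  "a \<in> carrier B \<Longrightarrow> card {p. \<exists>q. a (p, q) \<noteq> 0} = k \<Longrightarrow> \<exists>y\<in>carrier B. a = bmult S n (bmult S n a y) a"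
proof (induction k arbitrary: a rule: less_induct)
  case (less k)
  have fr: "finite {p. \<exists>q. a (p, q) \<noteq> 0}"
    by (rule finite_subset[OF _ finite_positions[OF fin]]) (use B_nz[OF less(2)] in blast)
  show ?case
  proof (cases "\<exists>p q. a (p, q) \<noteq> 0")
    case False
    then have "a = (\<lambda>_. 0)" by auto
    then show ?thesis using less(2) by (intro bexI[of _ a]) (auto simp: bmult_def)
  next
    case True
    \<comment> \<open>Subtracting \<open>a z a\<close>, where \<open>z\<close> inverts the entry at \<open>(p, q)\<close>, clears row \<open>p\<close>.\<close>
    then obtain p q where pq: "a (p, q) \<noteq> 0" by blast
    note pos = B_nz[OF less(2) pq]
    define c where "c = inverse (a (p, q))"
    define z where "z = bunit c q p"
    have zB: "z \<in> carrier B" unfolding z_def c_def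
      using B_in[OF less(2)] pos by (intro bunit_in sf_inv) (simp_all add: same_block_def)
    define b where "b = a \<ominus>\<^bsub>B\<^esub> a \<otimes>\<^bsub>B\<^esub> z \<otimes>\<^bsub>B\<^esub> a"
    have bB: "b \<in> carrier B" unfolding b_def using less(2) zB by (intro N.minus_closed N.mult_closed)
    have "bmult S n (bmult S n a z) a (x, y) = a (x, q) * c * a (p, y)" for x y
    proof -
      have "bmult S n a z = (\<lambda>(x, y). if y = p then a (x, q) * c else 0)"
        unfolding z_def using pos by (intro mult_bunit) auto
      then have "bmult S n (bmult S n a z) a (x, y) =
          (\<Sum>r\<in>positions S n. if r = p then a (x, q) * c * a (p, y) else 0)"
        unfolding bmult_def by (simp only: prod.case) (intro sum.cong; auto)
      then show ?thesis using pos finite_positions[OF fin] by simp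
    qed
    moreover have "b = (\<lambda>x. a x - bmult S n (bmult S n a z) a x)"
      unfolding b_def using less(2) zB bmult_closed by (simp add: B_minus)
    ultimately have b: "b (x, y) = a (x, y) - a (x, q) * c * a (p, y)" for x y by simp
    have "{x. \<exists>y. b (x, y) \<noteq> 0} \<subseteq> {x. \<exists>y. a (x, y) \<noteq> 0} - {p}"
    proof
      fix x assume "x \<in> {x. \<exists>y. b (x, y) \<noteq> 0}"
      then obtain y where y: "b (x, y) \<noteq> 0" by blast
      then have "x \<noteq> p" using pq by (auto simp: b c_def)
      moreover have "a (x, y) \<noteq> 0 \<or> a (x, q) \<noteq> 0" using y unfolding b by (cases "a (x, q) = 0") auto
      ultimately show "x \<in> {x. \<exists>y. a (x, y) \<noteq> 0} - {p}" by blast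
    qed
    then have "{x. \<exists>y. b (x, y) \<noteq> 0} \<subset> {x. \<exists>y. a (x, y) \<noteq> 0}" using pq by blast
    then have "card {x. \<exists>y. b (x, y) \<noteq> 0} < k" using psubset_card_mono[OF fr] less(3) by simp
    then obtain w where w: "w \<in> carrier B" "b = bmult S n (bmult S n b w) b" using less(1)[OF _ bB refl] by blast
    have "\<exists>y\<in>carrier B. a = a \<otimes>\<^bsub>B\<^esub> y \<otimes>\<^bsub>B\<^esub> a"
      by (rule N.mccoy[OF less(2) zB w(1) b_def]) (use w(2) in simp)
    then show ?thesis by simp
  qed
qed

sublocale regular B
proof unfold_locales
  show "\<forall>a\<in>carrier B. \<exists>y\<in>carrier B. a = a \<otimes>\<^bsub>B\<^esub> y \<otimes>\<^bsub>B\<^esub> a"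
    unfolding B_simps using B_regular_aux[OF _ refl] by (rule ballI)
qed

lemma brestrict_in: "a \<in> carrier B \<Longrightarrow> brestrict s a \<in> carrier B"
  by (auto simp: B_carrier brestrict_def sf0)

lemma brestrict_mult:
  assumes "a \<in> carrier B" "b \<in> carrier B"
  shows "brestrict s (bmult S n a b) = bmult S n (brestrict s a) (brestrict s b)"
proof (rule ext)
  fix z :: "'s pos \<times> 's pos"
  obtain x y where z: "z = (x, y)" by (cases z)
  have "(if fst x = s then a (x, r) * b (r, y) else 0) = brestrict s a (x, r) * brestrict s b (r, y)" for r
    using B_nz[OF assms(1), of x r] by (cases "a (x, r) = 0") (auto simp: brestrict_def)
  then have "(\<Sum>r\<in>positions S n. brestrict s a (x, r) * brestrict s b (r, y)) =
      (\<Sum>r\<in>positions S n. if fst x = s then a (x, r) * b (r, y) else 0)"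
    by (intro sum.cong refl) (simp only:)
  then show "brestrict s (bmult S n a b) z = bmult S n (brestrict s a) (brestrict s b) z"
    by (simp add: z brestrict_def bmult_def)
qed

sublocale restrict: regular_hom B B "brestrict s" for s
  by unfold_locales (auto simp: brestrict_in brestrict_mult, auto simp: brestrict_def)

end

text \<open>In the product over the target a summation index \<open>q'\<close> contributes only if
  it lies in the same copy of a block as \<open>q\<close>, and the positions of that copy correspond
  bijectively to those of the source block.\<close>

lemma bhom_mult:
  fixes e :: "'t pos \<times> 't pos \<rightharpoonup> 's pos \<times> 's pos"
  assumes e: "e \<in> block_maps S n T n' m" and S: "block_matrices P S" and T: "block_matrices P T"
    and a: "a \<in> carrier (block_ring P S n)" and b: "b \<in> carrier (block_ring P S n)"
  shows "bhom e (bmult S n a b) = bmult T n' (bhom e a) (bhom e b)"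
proof (rule ext)
  interpret S: block_matrices P S n by (rule S)
  interpret T: block_matrices P T n' by (rule T)
  fix x :: "'t pos \<times> 't pos"
  obtain q q'' where x: "x = (q, q'')" by (cases x) auto
  let ?t = "\<lambda>q'. bhom e a (q, q') * bhom e b (q', q'')"
  have R: "bmult T n' (bhom e a) (bhom e b) x = (\<Sum>q'\<in>positions T n'. ?t q')" by (simp add: x bmult_def)
  show "bhom e (bmult S n a b) x = bmult T n' (bhom e a) (bhom e b) x"
  proof (cases "e (q, q'')")
    case None
    have "?t q' = 0" for q'
    proof (rule ccontr)
      assume "?t q' \<noteq> 0"
      then obtain y z where "e (q, q') = Some y" "e (q', q'') = Some z"
        by (auto simp: bhom_def split: option.splits)
      then show False using block_mapsD(5)[OF e, of q q' "fst y" "snd y" q'' "fst z" "snd z"] None by simp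
    qed
    then have "(\<Sum>q'\<in>positions T n'. ?t q') = 0" by (intro sum.neutral) blast
    then have "bmult T n' (bhom e a) (bhom e b) x = 0" using R by (simp only:)
    moreover have "bhom e (bmult S n a b) x = 0" using None by (simp add: x bhom_def)
    ultimately show ?thesis by (simp only:)
  next
    case (Some y)
    obtain p p'' where y: "y = (p, p'')" by (cases y) auto
    note s = Some[unfolded y]
    note qq = block_maps_refl(1)[OF e s]
    have "(\<Sum>q'\<in>positions T n'. ?t q') = (\<Sum>q'\<in>{q'. e (q, q') \<noteq> None}. ?t q')"
    proof (rule sum.mono_neutral_right)
      show "finite (positions T n')" using finite_positions T.fin by blast
      show "{q'. e (q, q') \<noteq> None} \<subseteq> positions T n'"
      proof
        fix q' assume "q' \<in> {q'. e (q, q') \<noteq> None}"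
        then obtain y where "e (q, q') = Some y" by blast
        then show "q' \<in> positions T n'" using block_mapsD(1)[OF e] by (fastforce simp: same_block_def)
      qed
      have "?t q' = 0" if "e (q, q') = None" for q' using that by (simp add: bhom_def)
      then show "\<forall>q'\<in>positions T n' - {q'. e (q, q') \<noteq> None}. ?t q' = 0" by blast
    qed
    \<comment> \<open>The lifting condition of \<open>block_maps\<close> provides the inverse of the
      reindexing: each \<open>p'\<close> in the block of \<open>p\<close> comes from a unique
      \<open>q'\<close>.\<close>
    also have "\<dots> = (\<Sum>p'\<in>{p'. (p, p') \<in> same_block S n}. a (p, p') * b (p', p''))"
    proof (rule sum.reindex_bij_witness[of _ "\<lambda>p'. THE q'. e (q, q') = Some (p, p')" "\<lambda>q'. snd (the (e (q, q')))"])
      fix q' assume "q' \<in> {q'. e (q, q') \<noteq> None}"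
      then obtain p1 p' where p1: "e (q, q') = Some (p1, p')" by auto
      then have p': "e (q, q') = Some (p, p')" using block_maps_source[OF e s p1] by simp
      show "(THE q'a. e (q, q'a) = Some (p, snd (the (e (q, q'))))) = q'"
        unfolding p' option.sel snd_conv
      proof (rule the_equality)
        show "q1 = q'" if "e (q, q1) = Some (p, p')" for q1
          by (rule block_maps_unique[OF e that p'])
      qed (rule p')
      show "snd (the (e (q, q'))) \<in> {p'. (p, p') \<in> same_block S n}" using block_mapsD(2)[OF e p'] p' by simp
      have "e (q', q'') = Some (p', p'')" by (rule block_mapsD(5)[OF e block_mapsD(3)[OF e p'] s])
      then show "a (p, snd (the (e (q, q')))) * b (snd (the (e (q, q'))), p'') = ?t q'"
        using p' by (simp add: bhom_def)
    next
      fix p' assume "p' \<in> {p'. (p, p') \<in> same_block S n}"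
      then have "\<exists>!q'. e (q, q') = Some (p, p')" using block_mapsD(6)[OF e qq] by blast
      then have t: "e (q, THE q'. e (q, q') = Some (p, p')) = Some (p, p')" by (rule theI')
      show "snd (the (e (q, THE q'. e (q, q') = Some (p, p')))) = p'"
        "(THE q'. e (q, q') = Some (p, p')) \<in> {q'. e (q, q') \<noteq> None}" unfolding mem_Collect_eq t by auto
    qed
    also have "\<dots> = (\<Sum>p'\<in>positions S n. a (p, p') * b (p', p''))"
    proof (rule sum.mono_neutral_left)
      show "finite (positions S n)" using finite_positions S.fin by blast
      show "{p'. (p, p') \<in> same_block S n} \<subseteq> positions S n" by (simp add: same_block_def subset_iff)
      have "a (p, p') * b (p', p'') = 0" if "(p, p') \<notin> same_block S n" for p'
        using S.B_zero[OF a that] by simp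
      then show "\<forall>p'\<in>positions S n - {p'. (p, p') \<in> same_block S n}. a (p, p') * b (p', p'') = 0" by blast
    qed
    finally show ?thesis using R s by (simp add: x bhom_def bmult_def)
  qed
qed

lemma bhom_regular_hom:
  fixes e :: "'t pos \<times> 't pos \<rightharpoonup> 's pos \<times> 's pos"
  assumes e: "e \<in> block_maps S n T n' m" and S: "block_matrices P S" and T: "block_matrices P T"
  shows "regular_hom (block_ring P S n) (block_ring P T n') (bhom e)"
proof -
  interpret S: block_matrices P S n by (rule S)
  interpret T: block_matrices P T n' by (rule T)
  show ?thesis
  proof
    show "bhom e a \<in> carrier T.B" if "a \<in> carrier S.B" for a
      using that block_mapsD(1)[OF e] S.sf0 by (fastforce simp: S.B_carrier T.B_carrier bhom_def split: option.splits)
    show "bhom e (a \<otimes>\<^bsub>S.B\<^esub> b) = bhom e a \<otimes>\<^bsub>T.B\<^esub> bhom e b" if "a \<in> carrier S.B" "b \<in> carrier S.B" for a b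
      using bhom_mult[OF e S T that] by simp
  qed (auto simp: bhom_def split: option.splits)
qed

lemma bhom_comp: "bhom e' (bhom e a) = bhom (e \<circ>\<^sub>m e') a"
  by (auto simp: bhom_def map_comp_def split: option.splits)

text \<open>Block \<open>t\<close> of the image is assembled from copies of those blocks
  \<open>s\<close> with \<open>0 < m s t\<close>, and each of these occurs in full.\<close>

lemma bhom_block_zero:
  fixes e :: "'t pos \<times> 't pos \<rightharpoonup> 's pos \<times> 's pos"
  assumes e: "e \<in> block_maps S n T n' m" and S: "block_matrices P S"
    and a: "a \<in> carrier (block_ring P S n)" and t: "t \<in> T"
  shows "brestrict t (bhom e a) = (\<lambda>_. 0) \<longleftrightarrow> (\<forall>s\<in>S. 0 < m s t \<longrightarrow> brestrict s a = (\<lambda>_. 0))"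
proof
  interpret S: block_matrices P S n by (rule S)
  assume z: "brestrict t (bhom e a) = (\<lambda>_. 0)"
  show "\<forall>s\<in>S. 0 < m s t \<longrightarrow> brestrict s a = (\<lambda>_. 0)"
  proof (intro ballI impI ext, rule ccontr)
    fix s x assume s: "s \<in> S" "0 < m s t" and nz: "brestrict s a x \<noteq> 0"
    obtain p p' where x: "x = (p, p')" by (cases x) auto
    have p: "fst p = s" "a (p, p') \<noteq> 0" using nz by (auto simp: x brestrict_def split: if_splits)
    note pos = S.B_nz[OF a p(2)]
    have "card {k. e ((t, k), (t, k)) = Some (p, p)} = m s t" using block_mapsD(7)[OF e _ t] pos p(1) by blast
    then obtain k where k: "e ((t, k), (t, k)) = Some (p, p)" using s(2) by (metis (mono_tags, lifting) card.empty empty_Collect_eq less_numeral_extra(3))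
    have "(p, p') \<in> same_block S n" using pos by (simp add: same_block_def)
    then obtain q' where "e ((t, k), q') = Some (p, p')" using block_mapsD(6)[OF e k] by blast
    then have "brestrict t (bhom e a) ((t, k), q') = a (p, p')" by (simp add: brestrict_def bhom_def)
    then show False using z p(2) by simp
  qed
next
  assume z: "\<forall>s\<in>S. 0 < m s t \<longrightarrow> brestrict s a = (\<lambda>_. 0)"
  show "brestrict t (bhom e a) = (\<lambda>_. 0)"
  proof (rule ext, rule ccontr)
    fix x assume nz: "brestrict t (bhom e a) x \<noteq> 0"
    then obtain q q' p p' where x: "x = (q, q')" "fst q = t" "e (q, q') = Some (p, p')" "a (p, p') \<noteq> 0"
      by (cases x) (auto simp: brestrict_def bhom_def split: if_splits option.splits)
    have pp: "p \<in> positions S n" "fst p \<in> S" using block_maps_position(6)[OF e x(3)] block_mapsD(2)[OF e x(3)] by (auto simp: same_block_def)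
    have "e ((t, snd q), (t, snd q)) = Some (p, p)" using block_maps_refl(1)[OF e x(3)] x(2) by (metis prod.collapse)
    moreover have "finite {k. e ((t, k), (t, k)) = Some (p, p)}"
      by (rule finite_subset[of _ "{..<n' t}"]) (use block_maps_position(3)[OF e] in \<open>fastforce+\<close>)
    ultimately have "0 < card {k. e ((t, k), (t, k)) = Some (p, p)}" by (auto simp: card_gt_0_iff)
    then have "0 < m (fst p) t" using block_mapsD(7)[OF e pp(1) t] by simp
    then have "brestrict (fst p) a (p, p') = 0" using z pp(2) by simp
    then show False using x(4) by (simp add: brestrict_def)
  qed
qed

section \<open>The column space of a block\<close>

context block_matrices
begin

definition act :: "'s \<Rightarrow> ('s pos \<times> 's pos \<Rightarrow> 'f) \<Rightarrow> (nat \<Rightarrow> 'f) \<Rightarrow> nat \<Rightarrow> 'f" where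
  "act s a v = (\<lambda>k. if k < n s then \<Sum>l<n s. a ((s, k), (s, l)) * v l else 0)"

lemma act_mult:
  assumes "s \<in> S" "a \<in> carrier B"
  shows "act s (bmult S n a b) v = act s a (act s b v)"
proof (rule ext)
  fix k
  have "bmult S n a b ((s, k), (s, l)) = (\<Sum>j<n s. a ((s, k), (s, j)) * b ((s, j), (s, l)))" if "k < n s" "l < n s" for l
  proof -
    have "(\<Sum>r\<in>positions S n. a ((s, k), r) * b (r, (s, l))) = (\<Sum>r\<in>{s} \<times> {..<n s}. a ((s, k), r) * b (r, (s, l)))"
      by (rule sum.mono_neutral_right)
        (use finite_positions[OF fin] B_nz[OF assms(2)] assms(1) in \<open>fastforce simp: positions_def\<close>)+
    also have "\<dots> = (\<Sum>j<n s. a ((s, k), (s, j)) * b ((s, j), (s, l)))"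
      by (rule sum.reindex_bij_witness[of _ "\<lambda>j. (s, j)" snd]) auto
    finally show ?thesis by (simp add: bmult_def)
  qed
  moreover have "(\<Sum>l<n s. (\<Sum>j<n s. a ((s, k), (s, j)) * b ((s, j), (s, l))) * v l) =
     (\<Sum>j<n s. a ((s, k), (s, j)) * (\<Sum>l<n s. b ((s, j), (s, l)) * v l))"
    by (simp add: sum_distrib_left sum_distrib_right mult.assoc) (rule sum.swap)
  ultimately show "act s (bmult S n a b) v k = act s a (act s b v) k" by (simp add: act_def)
qed

lemma act_add: "act s (\<lambda>x. a x + b x) v = act s a v + act s b v"
  by (auto simp: act_def sum.distrib distrib_right)

lemma act_diff: "act s (\<lambda>x. a x - b x) v = act s a v - act s b v"
  by (auto simp: act_def sum_subtractf left_diff_distrib)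

lemma act_v_add: "act s a (v + w) = act s a v + act s a w"
  by (auto simp: act_def sum.distrib distrib_left)

lemma act_zero: "act s a 0 = 0" by (auto simp: act_def)

lemma act_scale: "act s a (fscale c v) = fscale c (act s a v)"
  by (auto simp: act_def fscale_def sum_distrib_left mult.left_commute)

text \<open>Vectors have coordinates in the whole field while matrix entries lie in the subfield
  \<open>P\<close>; this is the passage from right ideals over \<open>P\<close> to subspaces over
  the field.\<close>

definition colspace :: "'s \<Rightarrow> ('s pos \<times> 's pos \<Rightarrow> 'f) \<Rightarrow> (nat \<Rightarrow> 'f) set" where
  "colspace s a = range (act s a)"

lemma colspace_in: "colspace s a \<in> carrier (Sub_pow TYPE('f) (n s))"
proof -
  have "fun_space.subspace (colspace s a)"
    unfolding fun_space.subspace_def colspace_def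
    using act_zero[of s a] by (auto simp: act_v_add[symmetric] act_scale[symmetric] intro: range_eqI[OF sym])
  then show ?thesis by (auto simp: Sub_pow_def colspace_def act_def)
qed

lemma colspace_mono:
  assumes s: "s \<in> S" and "a \<in> carrier B" "b \<in> carrier B" "a \<in> rid B b"
  shows "colspace s a \<subseteq> colspace s b"
  using assms by (auto simp: colspace_def act_mult)

lemma colspace_rsum:
  assumes s: "s \<in> S" and abc: "a \<in> carrier B" "b \<in> carrier B" "c \<in> carrier B" and e: "rid B c = rsum (rid B a) (rid B b)"
  shows "colspace s c = {v + w | v w. v \<in> colspace s a \<and> w \<in> colspace s b}"
proof
  have "a \<in> rid B c" "b \<in> rid B c"
    using rid_self[OF abc(1)] rid_self[OF abc(2)] rsum_upper[OF abc(1,2)] by (simp_all only: e subsetD)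
  then have "colspace s a \<subseteq> colspace s c" "colspace s b \<subseteq> colspace s c" using colspace_mono[OF s] abc by blast+
  moreover have "v + w \<in> colspace s c" if "v \<in> colspace s c" "w \<in> colspace s c" for v w
    using that by (auto simp: colspace_def act_v_add[symmetric])
  ultimately show "{v + w | v w. v \<in> colspace s a \<and> w \<in> colspace s b} \<subseteq> colspace s c" by blast
  have "c \<in> rsum (rid B a) (rid B b)" using rid_self[OF abc(3)] by (simp only: e)
  then obtain x y where "c = (\<lambda>z. bmult S n a x z + bmult S n b y z)" "x \<in> carrier B" "y \<in> carrier B"
    by (auto simp: rsum_def)
  then have "act s c v = act s a (act s x v) + act s b (act s y v)" for v
    using abc by (simp add: act_add act_mult[OF s])
  then show "colspace s c \<subseteq> {v + w | v w. v \<in> colspace s a \<and> w \<in> colspace s b}"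
    by (auto simp: colspace_def)
qed

lemma colspace_eq:
  assumes "s \<in> S" "a \<in> carrier B" "b \<in> carrier B" "rid B a = rid B b"
  shows "colspace s a = colspace s b"
proof -
  have "a \<in> rid B b" "b \<in> rid B a" using rid_self[OF assms(2)] rid_self[OF assms(3)] assms(4) by simp_all
  then show ?thesis using colspace_mono assms by (meson subset_antisym)
qed

lemma colspace_idem:
  assumes "s \<in> S" "idem e"
  shows "v \<in> colspace s e \<longleftrightarrow> act s e v = v"
proof -
  have "act s e (act s e w) = act s e w" for w
    using assms act_mult[OF assms(1), of e e w] by (simp add: idem_def)
  then show ?thesis unfolding colspace_def by (metis rangeE rangeI)
qed

text \<open>The element \<open>d\<close> of \<open>rid_inter_formula\<close> now acts on vectors: a
  vector fixed by \<open>e\<close> and \<open>f\<close> is killed by \<open>h\<close>, hence fixed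
  by \<open>d\<close>.\<close>

lemma colspace_rinter:
  assumes s: "s \<in> S" and abc: "a \<in> carrier B" "b \<in> carrier B" "c \<in> carrier B" and ee: "rid B c = rid B a \<inter> rid B b"
  shows "colspace s c = colspace s a \<inter> colspace s b"
proof -
  obtain e f where e': "idem e" "rid B e = rid B a" and f': "idem f" "rid B f = rid B b"
    using idem_generator abc by metis
  have eR: "e \<in> carrier B" "f \<in> carrier B" using e' f' by (auto simp: idem_def)
  define h where "h = f \<ominus>\<^bsub>B\<^esub> e \<otimes>\<^bsub>B\<^esub> f"
  have h: "h \<in> carrier B" unfolding h_def using eR by (intro N.minus_closed N.mult_closed)
  then obtain u where u: "u \<in> carrier B" "h = h \<otimes>\<^bsub>B\<^esub> u \<otimes>\<^bsub>B\<^esub> h" by (rule regularE)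
  define d where "d = f \<ominus>\<^bsub>B\<^esub> f \<otimes>\<^bsub>B\<^esub> u \<otimes>\<^bsub>B\<^esub> h"
  have d: "d \<in> carrier B" unfolding d_def using eR u h by (intro N.minus_closed N.mult_closed)
  have "rid B d = rid B e \<inter> rid B f"
    unfolding d_def by (rule rid_inter_formula[OF e'(1) f'(1) u(1) h_def]) (use u in simp)
  then have ab: "rid B d = rid B a \<inter> rid B b" and cd: "rid B c = rid B d" by (simp_all only: ee e'(2) f'(2))
  have ah: "act s h v = act s f v - act s e (act s f v)" for v
    unfolding h_def using eR bmult_closed[OF eR] by (simp add: B_minus act_diff act_mult[OF s])
  have ad: "act s d v = act s f v - act s f (act s u (act s h v))" for v
    unfolding d_def using eR u h bmult_closed by (simp add: B_minus act_diff act_mult[OF s])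
  have "d \<in> rid B a" "d \<in> rid B b" using rid_self[OF d] unfolding ab by simp_all
  then have "colspace s d \<subseteq> colspace s a \<inter> colspace s b" using colspace_mono[OF s d] abc by blast
  moreover have "v \<in> colspace s d" if "v \<in> colspace s a" "v \<in> colspace s b" for v
  proof -
    have "act s e v = v" "act s f v = v"
      using that colspace_idem[OF s] colspace_eq[OF s eR(1) abc(1) e'(2)] colspace_eq[OF s eR(2) abc(2) f'(2)] e'(1) f'(1) by auto
    then have "act s d v = v" using ah[of v] ad[of v] by (simp add: act_zero)
    then show ?thesis unfolding colspace_def by (metis rangeI)
  qed
  ultimately show ?thesis using colspace_eq[OF s abc(3) d cd] by blast
qed

text \<open>With \<open>b = b y b\<close> the matrix \<open>b y\<close> fixes the column spaces of
  \<open>b\<close>, hence those of \<open>a\<close>; testing on unit vectors gives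
  \<open>b y a = a\<close>.\<close>

lemma colspace_inj:
  assumes ab: "a \<in> carrier B" "b \<in> carrier B" and sub: "\<And>s. s \<in> S \<Longrightarrow> colspace s a \<subseteq> colspace s b"
  shows "a \<in> rid B b"
proof -
  obtain y where y: "y \<in> carrier B" "b = b \<otimes>\<^bsub>B\<^esub> y \<otimes>\<^bsub>B\<^esub> b" using ab(2) by (rule regularE)
  let ?c = "bmult S n (bmult S n b y) a"
  have bb: "act s b v = act s (bmult S n b y) (act s b v)" if "s \<in> S" for s v
    using act_mult[OF that, of "bmult S n b y" b v] y ab bmult_closed by simp
  have stable: "act s ?c v = act s a v" if s: "s \<in> S" for s v
  proof -
    obtain w where w: "act s a v = act s b w" using sub[OF s] by (auto simp: colspace_def)
    have "act s ?c v = act s (bmult S n b y) (act s b w)" using act_mult[OF s] bmult_closed ab y(1) w by simp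
    then show ?thesis using bb[OF s] w by simp
  qed
  have cB: "?c \<in> carrier B" using ab y bmult_closed by simp
  have entry: "act s d (\<lambda>j. if j = l then 1 else 0) k = d ((s, k), (s, l))" if "k < n s" "l < n s" for s k l d
  proof -
    have "(\<Sum>j<n s. d ((s, k), (s, j)) * (if j = l then 1 else 0)) = (\<Sum>j<n s. if j = l then d ((s, k), (s, l)) else 0)"
      by (intro sum.cong) auto
    then show ?thesis using that by (simp add: act_def)
  qed
  have "?c x = a x" for x
  proof (cases "x \<in> same_block S n")
    case True
    then obtain s k l where x: "x = ((s, k), (s, l))" "s \<in> S" "k < n s" "l < n s" by (auto simp: same_block_def positions_def)
    then show ?thesis using stable[OF x(2)] entry[OF x(3,4)] by metis
  next
    case False
    then show ?thesis using cB ab(1) by (metis B_carrier)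
  qed
  then have "b \<otimes>\<^bsub>B\<^esub> (y \<otimes>\<^bsub>B\<^esub> a) = a" using bmult_assoc[of b y a] by auto
  then show ?thesis using ab y by (intro ridI[of "y \<otimes>\<^bsub>B\<^esub> a"]) (simp_all only: N.mult_closed)
qed

end


section \<open>Operations of subspace lattices, and complements under ring homomorphisms\<close>

lemma subpow_join:
  assumes "X \<in> carrier (Sub_pow TYPE('f::field) k)" "Y \<in> carrier (Sub_pow TYPE('f) k)"
  shows "ljoin (Sub_pow TYPE('f) k) X Y = {v + w | v w. v \<in> X \<and> w \<in> Y}"
  unfolding Sub_pow_def
proof (rule ljoin_incl)
  have X: "fun_space.subspace X" "\<And>v i. v \<in> X \<Longrightarrow> i \<ge> k \<Longrightarrow> v i = 0"
    and Y: "fun_space.subspace Y" "\<And>v i. v \<in> Y \<Longrightarrow> i \<ge> k \<Longrightarrow> v i = 0" using assms by (auto simp: Sub_pow_def)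
  note sX = fun_space.subspace_0[OF X(1)] and sY = fun_space.subspace_0[OF Y(1)]
  show "{v + w | v w. v \<in> X \<and> w \<in> Y} \<in> {U. fun_space.subspace U \<and> U \<subseteq> {v. \<forall>i\<ge>k. v i = 0}}"
    using fun_space.subspace_sums[OF X(1) Y(1)] by (auto simp: X(2) Y(2))
  show "X \<subseteq> {v + w | v w. v \<in> X \<and> w \<in> Y}"
  proof
    fix v assume "v \<in> X"
    moreover have "v = v + 0" by simp
    ultimately show "v \<in> {v + w | v w. v \<in> X \<and> w \<in> Y}" using sY by blast
  qed
  show "Y \<subseteq> {v + w | v w. v \<in> X \<and> w \<in> Y}"
  proof
    fix v assume "v \<in> Y"
    moreover have "v = 0 + v" by simp
    ultimately show "v \<in> {v + w | v w. v \<in> X \<and> w \<in> Y}" using sX by blast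
  qed
  show "{v + w | v w. v \<in> X \<and> w \<in> Y} \<subseteq> Z"
    if "Z \<in> {U. fun_space.subspace U \<and> U \<subseteq> {v. \<forall>i\<ge>k. v i = 0}}" "X \<subseteq> Z" "Y \<subseteq> Z" for Z
    using that fun_space.subspace_add by blast
qed (use assms in \<open>simp_all add: Sub_pow_def\<close>)

lemma subpow_meet:
  assumes "X \<in> carrier (Sub_pow TYPE('f::field) k)" "Y \<in> carrier (Sub_pow TYPE('f) k)"
  shows "lmeet (Sub_pow TYPE('f) k) X Y = X \<inter> Y"
  unfolding Sub_pow_def
  by (rule lmeet_incl) (use assms fun_space.subspace_inter in \<open>auto simp: Sub_pow_def\<close>)

lemma subpow_zero: "opn (Sub_pow TYPE('f::field) k) Zero [] = {0}"
  unfolding Sub_pow_def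
  by (rule bottom_incl) (auto simp: fun_space.subspace_single_0 fun_space.subspace_0)

lemma subpow_one: "opn (Sub_pow TYPE('f::field) k) One [] = {v. \<forall>i\<ge>k. v i = 0}"
  unfolding Sub_pow_def
  by (rule top_incl) (auto simp: fun_space.subspace_def fscale_def)

lemma (in regular) rsum_absorb:
  assumes "x \<in> carrier R" "y \<in> carrier R" "rid R x \<subseteq> rid R y"
  shows "rsum (rid R y) (rid R x) = rid R y" "rsum (rid R x) (rid R y) = rid R y"
proof -
  have x: "x \<in> rid R y" using rid_subset_iff[OF assms(1,2)] assms(3) by simp
  have y: "y \<in> rsum (rid R y) (rid R x)" "y \<in> rsum (rid R x) (rid R y)"
    using rsum_upper(1)[OF assms(2,1)] rsum_upper(2)[OF assms(1,2)] rid_self[OF assms(2)] by (simp_all only: subsetD)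
  show "rsum (rid R y) (rid R x) = rid R y"
    by (rule rsum_eq_rid[OF assms(2,1,2) rid_self[OF assms(2)] x y(1), symmetric])
  show "rsum (rid R x) (rid R y) = rid R y"
    by (rule rsum_eq_rid[OF assms(1,2,2) x rid_self[OF assms(2)] y(2), symmetric])
qed

context regular_hom
begin

text \<open>The interval from \<open>aR\<close> to \<open>bR\<close> is transposed to the one from
  zero to \<open>wR\<close>. Stating this for images lets one complement serve in every homomorphic
  image.\<close>

lemma complement_cong:
  assumes abw: "a \<in> carrier R" "b \<in> carrier R" "w \<in> carrier R"
    and triv: "rid R a \<inter> rid R w = {\<zero>\<^bsub>R\<^esub>}" and b: "rid R b = R.rsum (rid R a) (rid R w)"
    and \<theta>: "cong2 (carrier (LL R')) (ljoin (LL R')) (lmeet (LL R')) \<theta>"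
  shows "(rid R' (\<phi> a), rid R' (\<phi> b)) \<in> \<theta> \<longleftrightarrow> ({\<zero>\<^bsub>R'\<^esub>}, rid R' (\<phi> w)) \<in> \<theta>"
proof -
  let ?a = "\<phi> a" and ?b = "\<phi> b" and ?w = "\<phi> w"
  have C: "?a \<in> carrier R'" "?b \<in> carrier R'" "?w \<in> carrier R'" using hom_closed abw by auto
  have "rid R' (\<phi> \<zero>\<^bsub>R\<^esub>) = rid R' ?a \<inter> rid R' ?w"
    by (rule hom_rinter[OF abw(1,3) R.zero_closed]) (simp only: R.rid_zero triv)
  then have triv': "rid R' ?a \<inter> rid R' ?w = {\<zero>\<^bsub>R'\<^esub>}" by (simp only: hom_zero R'.rid_zero)
  have b': "rid R' ?b = R'.rsum (rid R' ?a) (rid R' ?w)" by (rule hom_rsum[OF abw(1,3,2) b])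
  have wb: "rid R' ?w \<subseteq> rid R' ?b" unfolding b' by (rule R'.rsum_upper(2)[OF C(1,3)])
  have in_LL: "rid R' x \<in> carrier (LL R')" if "x \<in> carrier R'" for x
    using R'.pri_in[OF that] by (simp add: LL_def)
  note r = cong2D(1)[OF \<theta> in_LL] and c = cong2D(5)[OF \<theta>]
  show ?thesis
  proof
    assume "(rid R' ?a, rid R' ?b) \<in> \<theta>"
    then have "(lmeet (LL R') (rid R' ?a) (rid R' ?w), lmeet (LL R') (rid R' ?b) (rid R' ?w)) \<in> \<theta>"
      using c[OF _ r[OF C(3)]] by blast
    then have "(rid R' ?a \<inter> rid R' ?w, rid R' ?b \<inter> rid R' ?w) \<in> \<theta>"
      by (simp only: R'.LL_meet[OF C(1,3)] R'.LL_meet[OF C(2,3)])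
    moreover have "rid R' ?b \<inter> rid R' ?w = rid R' ?w" using wb by (rule Int_absorb1)
    ultimately show "({\<zero>\<^bsub>R'\<^esub>}, rid R' ?w) \<in> \<theta>" by (simp only: triv')
  next
    assume "({\<zero>\<^bsub>R'\<^esub>}, rid R' ?w) \<in> \<theta>"
    then have "(rid R' \<zero>\<^bsub>R'\<^esub>, rid R' ?w) \<in> \<theta>" by (simp only: R'.rid_zero)
    then have "(ljoin (LL R') (rid R' ?a) (rid R' \<zero>\<^bsub>R'\<^esub>), ljoin (LL R') (rid R' ?a) (rid R' ?w)) \<in> \<theta>"
      using c[OF r[OF C(1)]] by blast
    then have "(R'.rsum (rid R' ?a) (rid R' \<zero>\<^bsub>R'\<^esub>), rid R' ?b) \<in> \<theta>"
      by (simp only: R'.LL_join[OF C(1) R'.zero_closed] R'.LL_join[OF C(1,3)] b')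
    moreover have "rid R' \<zero>\<^bsub>R'\<^esub> \<subseteq> rid R' ?a"
      unfolding R'.rid_zero using R'.rid_closed(1)[OF C(1)] by (simp only: empty_subsetI insert_subset simp_thms)
    ultimately show "(rid R' ?a, rid R' ?b) \<in> \<theta>"
      using R'.rsum_absorb(1)[OF R'.zero_closed C(1)] by (simp only:)
  qed
qed

text \<open>By \<open>hom_rid_iff\<close> both inclusions are equations, written here as the
  vanishing of the images of two fixed elements of \<open>R\<close>; vanishing can be tested block
  by block.\<close>

lemma hom_rid_eq_iff:
  assumes ab: "a \<in> carrier R" "b \<in> carrier R" and y: "y \<in> carrier R" "b = b \<otimes>\<^bsub>R\<^esub> y \<otimes>\<^bsub>R\<^esub> b"
    and z: "z \<in> carrier R" "a = a \<otimes>\<^bsub>R\<^esub> z \<otimes>\<^bsub>R\<^esub> a"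
  shows "rid R' (\<phi> a) = rid R' (\<phi> b) \<longleftrightarrow>
    \<phi> (b \<otimes>\<^bsub>R\<^esub> y \<otimes>\<^bsub>R\<^esub> a \<ominus>\<^bsub>R\<^esub> a) = \<zero>\<^bsub>R'\<^esub> \<and> \<phi> (a \<otimes>\<^bsub>R\<^esub> z \<otimes>\<^bsub>R\<^esub> b \<ominus>\<^bsub>R\<^esub> b) = \<zero>\<^bsub>R'\<^esub>"
proof -
  have C: "\<phi> a \<in> carrier R'" "\<phi> b \<in> carrier R'" using hom_closed ab by auto
  have eq0: "\<phi> (x \<ominus>\<^bsub>R\<^esub> v) = \<zero>\<^bsub>R'\<^esub> \<longleftrightarrow> \<phi> x = \<phi> v" if "x \<in> carrier R" "v \<in> carrier R" for x v
  proof
    assume "\<phi> (x \<ominus>\<^bsub>R\<^esub> v) = \<zero>\<^bsub>R'\<^esub>"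
    then show "\<phi> x = \<phi> v"
      using R'.diff_add_cancel[of "\<phi> x" "\<phi> v"] hom_closed that by (simp add: hom_minus)
  qed (use that hom_closed in \<open>simp add: hom_minus\<close>)
  have "rid R' (\<phi> a) = rid R' (\<phi> b) \<longleftrightarrow> \<phi> a \<in> rid R' (\<phi> b) \<and> \<phi> b \<in> rid R' (\<phi> a)"
    using R'.rid_subset_iff[OF C] R'.rid_subset_iff[OF C(2,1)] by (metis subset_antisym order_refl)
  also have "\<dots> \<longleftrightarrow> \<phi> (b \<otimes>\<^bsub>R\<^esub> y \<otimes>\<^bsub>R\<^esub> a) = \<phi> a \<and> \<phi> (a \<otimes>\<^bsub>R\<^esub> z \<otimes>\<^bsub>R\<^esub> b) = \<phi> b"
    by (simp only: hom_rid_iff[OF ab y] hom_rid_iff[OF ab(2,1) z])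
  finally show ?thesis using eq0 ab y(1) z(1) by simp
qed

end

lemma regular_hom_comp:
  assumes "regular_hom R R' \<phi>" "regular_hom R' R'' \<psi>"
  shows "regular_hom R R'' (\<psi> \<circ> \<phi>)"
proof -
  interpret f: regular_hom R R' \<phi> by (rule assms)
  interpret g: regular_hom R' R'' \<psi> by (rule assms)
  show ?thesis
    by unfold_locales (simp_all add: f.hom_closed g.hom_closed f.hom_add g.hom_add f.hom_mult g.hom_mult)
qed

section \<open>Direct limits of block matrix rings\<close>

text \<open>\<open>\<eta> i a\<close> names, in the universe, the class of \<open>a\<close> in the
  direct limit, and \<open>\<eta>_eq\<close> is all that is required of these names. Positivity of
  some multiplicity in every row makes the maps between stages injective.\<close>

locale matricial_system = subfield_set P for P :: "'f::field set" +
  fixes I :: "'i set" and lq :: "'i \<Rightarrow> 'i \<Rightarrow> bool" and S :: "'i \<Rightarrow> 's set" and n :: "'i \<Rightarrow> 's \<Rightarrow> nat"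
    and m :: "'i \<Rightarrow> 'i \<Rightarrow> 's \<Rightarrow> 's \<Rightarrow> nat"
    and h :: "'i \<Rightarrow> 'i \<Rightarrow> 's pos \<times> 's pos \<rightharpoonup> 's pos \<times> 's pos"
    and \<eta> :: "'i \<Rightarrow> ('s pos \<times> 's pos \<Rightarrow> 'f) \<Rightarrow> 'u"
  assumes I_ne: "I \<noteq> {}" and lq_refl: "\<And>i. lq i i"
    and lq_trans: "\<And>i j k. \<lbrakk>k \<in> I; lq i j; lq j k\<rbrakk> \<Longrightarrow> lq i k"
    and I_directed: "\<And>i j. \<lbrakk>i \<in> I; j \<in> I\<rbrakk> \<Longrightarrow> \<exists>k\<in>I. lq i k \<and> lq j k"
    and fin_S: "\<And>i. i \<in> I \<Longrightarrow> finite (S i)"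
    and n_pos: "\<And>i s. \<lbrakk>i \<in> I; s \<in> S i\<rbrakk> \<Longrightarrow> 0 < n i s"
    and m_pos: "\<And>i j s. \<lbrakk>i \<in> I; j \<in> I; lq i j; s \<in> S i\<rbrakk> \<Longrightarrow> \<exists>t\<in>S j. 0 < m i j s t"
    and h_in: "\<And>i j. \<lbrakk>i \<in> I; j \<in> I; lq i j\<rbrakk> \<Longrightarrow> h i j \<in> block_maps (S i) (n i) (S j) (n j) (m i j)"
    and h_comp: "\<And>i j k. \<lbrakk>k \<in> I; lq i j; lq j k\<rbrakk> \<Longrightarrow> h i j \<circ>\<^sub>m h j k = h i k"
    and \<eta>_eq: "\<And>i j a b. \<lbrakk>i \<in> I; j \<in> I; a \<in> carrier (block_ring P (S i) (n i)); b \<in> carrier (block_ring P (S j) (n j))\<rbrakk> \<Longrightarrow>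
       \<eta> i a = \<eta> j b \<longleftrightarrow> (\<exists>k\<in>I. lq i k \<and> lq j k \<and> bhom (h i k) a = bhom (h j k) b)"
begin

abbreviation "Bi i \<equiv> block_ring P (S i) (n i)"

lemma bm: "i \<in> I \<Longrightarrow> block_matrices P (S i)"
  by unfold_locales (rule fin_S)

lemma bm_regular: "i \<in> I \<Longrightarrow> regular (Bi i)"
proof -
  assume "i \<in> I"
  then interpret block_matrices P "S i" "n i" by (rule bm)
  show "regular (Bi i)" by (rule regular_axioms)
qed

lemma h_hom: "\<lbrakk>i \<in> I; j \<in> I; lq i j\<rbrakk> \<Longrightarrow> regular_hom (Bi i) (Bi j) (bhom (h i j))"
  by (rule bhom_regular_hom[OF h_in]) (auto intro: bm)

text \<open>By \<open>m_pos\<close> every block of stage \<open>i\<close> is copied into some block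
  of stage \<open>j\<close>, so a difference with image zero has only zero blocks.\<close>

lemma h_inj:
  assumes ij: "i \<in> I" "j \<in> I" "lq i j" and ab: "a \<in> carrier (Bi i)" "b \<in> carrier (Bi i)"
    and eq: "bhom (h i j) a = bhom (h i j) b"
  shows "a = b"
proof -
  interpret block_matrices P "S i" "n i" by (rule bm[OF ij(1)])
  interpret f: regular_hom "Bi i" "Bi j" "bhom (h i j)" by (rule h_hom[OF ij])
  interpret j: block_matrices P "S j" "n j" by (rule bm[OF ij(2)])
  let ?d = "a \<ominus>\<^bsub>Bi i\<^esub> b"
  have d: "?d \<in> carrier (Bi i)" using ab by (rule N.minus_closed)
  have "bhom (h i j) ?d = (\<lambda>_. 0)" using f.hom_minus[OF ab] eq f.hom_closed[OF ab(2)] by simp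
  then have "brestrict t (bhom (h i j) ?d) = (\<lambda>_. 0)" for t by (auto simp: brestrict_def)
  then have z: "brestrict s ?d = (\<lambda>_. 0)" if "s \<in> S i" for s
    using bhom_block_zero[OF h_in[OF ij] bm[OF ij(1)] d] m_pos[OF ij that] that by blast
  have "?d x = 0" for x
  proof (cases "x \<in> same_block (S i) (n i)")
    case True
    then have "fst (fst x) \<in> S i" by (auto simp: same_block_def positions_def)
    from fun_cong[OF z[OF this], of x] show ?thesis by (simp add: brestrict_def)
  qed (rule B_zero[OF d])
  then show ?thesis using B_minus[OF ab] by (auto simp: fun_eq_iff)
qed

text \<open>By \<open>h_comp\<close> the map is idempotent, and an injective idempotent map is the
  identity.\<close>

lemma h_id: "i \<in> I \<Longrightarrow> a \<in> carrier (Bi i) \<Longrightarrow> bhom (h i i) a = a"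
proof -
  assume i: "i \<in> I" and a: "a \<in> carrier (Bi i)"
  interpret f: regular_hom "Bi i" "Bi i" "bhom (h i i)" by (rule h_hom[OF i i lq_refl])
  have "bhom (h i i) (bhom (h i i) a) = bhom (h i i) a"
    using h_comp[OF i lq_refl lq_refl] by (simp add: bhom_comp)
  then show ?thesis using h_inj[OF i i lq_refl f.hom_closed[OF a] a] by simp
qed

lemma h_trans: "\<lbrakk>k \<in> I; lq i j; lq j k\<rbrakk> \<Longrightarrow> bhom (h j k) (bhom (h i j) a) = bhom (h i k) a"
  by (simp add: bhom_comp h_comp)

lemma h_closed: "\<lbrakk>i \<in> I; j \<in> I; lq i j; a \<in> carrier (Bi i)\<rbrakk> \<Longrightarrow> bhom (h i j) a \<in> carrier (Bi j)"
proof -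
  assume a: "i \<in> I" "j \<in> I" "lq i j" "a \<in> carrier (Bi i)"
  interpret f: regular_hom "Bi i" "Bi j" "bhom (h i j)" by (rule h_hom[OF a(1-3)])
  show ?thesis by (rule f.hom_closed[OF a(4)])
qed

lemma \<eta>_h: "\<lbrakk>i \<in> I; j \<in> I; lq i j; a \<in> carrier (Bi i)\<rbrakk> \<Longrightarrow> \<eta> j (bhom (h i j) a) = \<eta> i a"
  using \<eta>_eq[of j i "bhom (h i j) a" a] h_closed[of i j a] h_id[of j "bhom (h i j) a"] lq_refl[of j] by auto

lemma \<eta>_inj: "\<lbrakk>i \<in> I; a \<in> carrier (Bi i); b \<in> carrier (Bi i); \<eta> i a = \<eta> i b\<rbrakk> \<Longrightarrow> a = b"
proof -
  assume a: "i \<in> I" "a \<in> carrier (Bi i)" "b \<in> carrier (Bi i)" "\<eta> i a = \<eta> i b"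
  then obtain k where "k \<in> I" "lq i k" "bhom (h i k) a = bhom (h i k) b"
    using \<eta>_eq[OF a(1,1,2,3)] by blast
  then show ?thesis using h_inj[OF a(1) _ _ a(2,3)] by blast
qed

text \<open>An operation of the direct limit is computed at any stage that contains both arguments;
  \<open>limit_op_eq\<close> shows independence of the stage.\<close>

definition limit_op :: "(('s pos \<times> 's pos \<Rightarrow> 'f) \<Rightarrow> ('s pos \<times> 's pos \<Rightarrow> 'f) \<Rightarrow> 'i \<Rightarrow> 's pos \<times> 's pos \<Rightarrow> 'f) \<Rightarrow> 'u \<Rightarrow> 'u \<Rightarrow> 'u" where
  "limit_op f x y = (SOME z. \<exists>i\<in>I. \<exists>a\<in>carrier (Bi i). \<exists>b\<in>carrier (Bi i). x = \<eta> i a \<and> y = \<eta> i b \<and> z = \<eta> i (f a b i))"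

definition A :: "'u ring" where
  "A = \<lparr>carrier = (\<Union>i\<in>I. \<eta> i ` carrier (Bi i)), mult = limit_op (\<lambda>a b i. bmult (S i) (n i) a b),
    one = undefined, zero = \<eta> (SOME i. i \<in> I) (\<lambda>_. 0), add = limit_op (\<lambda>a b i x. a x + b x)\<rparr>"

lemma limit_op_eq:
  assumes f: "\<And>i j a b. \<lbrakk>i \<in> I; j \<in> I; lq i j; a \<in> carrier (Bi i); b \<in> carrier (Bi i)\<rbrakk> \<Longrightarrow>
      f a b i \<in> carrier (Bi i) \<and> bhom (h i j) (f a b i) = f (bhom (h i j) a) (bhom (h i j) b) j"
    and i: "i \<in> I" and a: "a \<in> carrier (Bi i)" "b \<in> carrier (Bi i)"
  shows "limit_op f (\<eta> i a) (\<eta> i b) = \<eta> i (f a b i)"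
  unfolding limit_op_def
proof (rule some_equality)
  fix z assume "\<exists>j\<in>I. \<exists>a'\<in>carrier (Bi j). \<exists>b'\<in>carrier (Bi j). \<eta> i a = \<eta> j a' \<and> \<eta> i b = \<eta> j b' \<and> z = \<eta> j (f a' b' j)"
  then obtain j a' b' where j: "j \<in> I" "a' \<in> carrier (Bi j)" "b' \<in> carrier (Bi j)"
    "\<eta> i a = \<eta> j a'" "\<eta> i b = \<eta> j b'" "z = \<eta> j (f a' b' j)" by blast
  obtain k where k: "k \<in> I" "lq i k" "lq j k" using I_directed i j by blast
  have "bhom (h i k) a = bhom (h j k) a'"
    by (rule \<eta>_inj[OF k(1)]) (use h_closed \<eta>_h i j k a in auto)
  moreover have "bhom (h i k) b = bhom (h j k) b'"
    by (rule \<eta>_inj[OF k(1)]) (use h_closed \<eta>_h i j k a in auto)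
  ultimately have "bhom (h i k) (f a b i) = bhom (h j k) (f a' b' j)"
    using f[OF i k(1,2) a] f[OF j(1) k(1,3) j(2,3)] by simp
  then show "z = \<eta> i (f a b i)"
    using \<eta>_h[OF i k(1,2)] \<eta>_h[OF j(1) k(1,3)] f[OF i k(1,2) a] f[OF j(1) k(1,3) j(2,3)] j(6) by metis
qed (use i a in blast)

lemma A_carrier: "x \<in> carrier A \<longleftrightarrow> (\<exists>i\<in>I. \<exists>a\<in>carrier (Bi i). x = \<eta> i a)"
  by (auto simp: A_def)

lemma A_mult: "\<lbrakk>i \<in> I; a \<in> carrier (Bi i); b \<in> carrier (Bi i)\<rbrakk> \<Longrightarrow> \<eta> i a \<otimes>\<^bsub>A\<^esub> \<eta> i b = \<eta> i (a \<otimes>\<^bsub>Bi i\<^esub> b)"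
proof -
  assume i: "i \<in> I" "a \<in> carrier (Bi i)" "b \<in> carrier (Bi i)"
  have "limit_op (\<lambda>a b i. bmult (S i) (n i) a b) (\<eta> i a) (\<eta> i b) = \<eta> i (bmult (S i) (n i) a b)"
  proof (rule limit_op_eq[OF _ i])
    fix i j a b assume i: "i \<in> I" "j \<in> I" "lq i j" "a \<in> carrier (Bi i)" "b \<in> carrier (Bi i)"
    interpret block_matrices P "S i" "n i" by (rule bm[OF i(1)])
    show "bmult (S i) (n i) a b \<in> carrier (Bi i) \<and>
      bhom (h i j) (bmult (S i) (n i) a b) = bmult (S j) (n j) (bhom (h i j) a) (bhom (h i j) b)"
      using bmult_closed[OF i(4,5)] bhom_mult[OF h_in[OF i(1-3)] bm[OF i(1)] bm[OF i(2)] i(4,5)] by blast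
  qed
  then show ?thesis by (simp add: A_def block_ring_def)
qed

lemma A_add: "\<lbrakk>i \<in> I; a \<in> carrier (Bi i); b \<in> carrier (Bi i)\<rbrakk> \<Longrightarrow> \<eta> i a \<oplus>\<^bsub>A\<^esub> \<eta> i b = \<eta> i (a \<oplus>\<^bsub>Bi i\<^esub> b)"
proof -
  assume i: "i \<in> I" "a \<in> carrier (Bi i)" "b \<in> carrier (Bi i)"
  have "limit_op (\<lambda>a b i x. a x + b x) (\<eta> i a) (\<eta> i b) = \<eta> i (\<lambda>x. a x + b x)"
  proof (rule limit_op_eq[OF _ i, where f = "\<lambda>a b i x. a x + b x"])
    fix i j a b assume i: "i \<in> I" "j \<in> I" "lq i j" "a \<in> carrier (Bi i)" "b \<in> carrier (Bi i)"
    show "(\<lambda>x. a x + b x) \<in> carrier (Bi i) \<and>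
      bhom (h i j) (\<lambda>x. a x + b x) = (\<lambda>x. bhom (h i j) a x + bhom (h i j) b x)"
      using i(4,5) by (auto simp: block_ring_def sf_add bhom_def split: option.splits)
  qed
  then show ?thesis by (simp add: A_def block_ring_def)
qed

lemma zero_in: "(\<lambda>_. 0) \<in> carrier (Bi i)" by (simp add: block_ring_def sf0)

lemma A_zero: "i \<in> I \<Longrightarrow> \<zero>\<^bsub>A\<^esub> = \<eta> i (\<lambda>_. 0)"
proof -
  assume i: "i \<in> I"
  define j where "j = (SOME i. i \<in> I)"
  have j: "j \<in> I" unfolding j_def using I_ne some_in_eq by blast
  obtain k where k: "k \<in> I" "lq i k" "lq j k" using I_directed i j by blast
  have "bhom e (\<lambda>_. 0) = (\<lambda>_. 0 :: 'f)" for e :: "'s pos \<times> 's pos \<rightharpoonup> 's pos \<times> 's pos"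
    by (auto simp: bhom_def split: option.splits)
  then show ?thesis using \<eta>_h[OF i k(1,2) zero_in] \<eta>_h[OF j k(1,3) zero_in] by (simp add: A_def j_def)
qed

lemma A_common:
  assumes "finite X" "X \<subseteq> carrier A"
  shows "\<exists>k\<in>I. X \<subseteq> \<eta> k ` carrier (Bi k)"
  using assms
proof (induction X rule: finite_induct)
  case empty
  then show ?case using I_ne by auto
next
  case (insert x X)
  then obtain i j a where ij: "i \<in> I" "X \<subseteq> \<eta> i ` carrier (Bi i)" "j \<in> I" "a \<in> carrier (Bi j)" "x = \<eta> j a"
    unfolding A_def by auto
  then obtain k where k: "k \<in> I" "lq i k" "lq j k" using I_directed by blast
  have "\<eta> i ` carrier (Bi i) \<subseteq> \<eta> k ` carrier (Bi k)"
    using \<eta>_h[OF ij(1) k(1,2)] h_closed[OF ij(1) k(1,2)] by (metis image_eqI image_subsetI)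
  moreover have "x \<in> \<eta> k ` carrier (Bi k)"
    using \<eta>_h[OF ij(3) k(1,3) ij(4)] h_closed[OF ij(3) k(1,3) ij(4)] ij(5) by (metis image_eqI)
  ultimately have "insert x X \<subseteq> \<eta> k ` carrier (Bi k)" using ij(2) by (meson insert_subset subset_trans)
  then show ?case using k(1) by (rule bexI)
qed

lemma A_regular: "regular A"
proof -
  have op: "nonunital (Bi i)" if "i \<in> I" for i using bm_regular[OF that] by (simp add: regular_def)
  have in_A: "\<eta> i a \<in> carrier A" if "i \<in> I" "a \<in> carrier (Bi i)" for i a using that A_carrier by blast
  have ag: "abelian_group A"
  proof (rule abelian_groupI)
    fix x y assume xy: "x \<in> carrier A" "y \<in> carrier A"
    then obtain i a b where i: "i \<in> I" "a \<in> carrier (Bi i)" "b \<in> carrier (Bi i)" "x = \<eta> i a" "y = \<eta> i b"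
      using A_common[of "{x, y}"] by auto
    interpret nonunital "Bi i" by (rule op[OF i(1)])
    show "x \<oplus>\<^bsub>A\<^esub> y \<in> carrier A" using A_add[OF i(1-3)] i in_A a_closed by simp
    show "x \<oplus>\<^bsub>A\<^esub> y = y \<oplus>\<^bsub>A\<^esub> x" using A_add[OF i(1-3)] A_add[OF i(1,3,2)] i a_comm by simp
    fix z assume "z \<in> carrier A"
    then obtain j a b c where j: "j \<in> I" "a \<in> carrier (Bi j)" "b \<in> carrier (Bi j)" "c \<in> carrier (Bi j)"
      "x = \<eta> j a" "y = \<eta> j b" "z = \<eta> j c" using A_common[of "{x, y, z}"] xy by auto
    interpret j: nonunital "Bi j" by (rule op[OF j(1)])
    show "x \<oplus>\<^bsub>A\<^esub> y \<oplus>\<^bsub>A\<^esub> z = x \<oplus>\<^bsub>A\<^esub> (y \<oplus>\<^bsub>A\<^esub> z)"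
      using j by (simp only: A_add j.a_closed j.a_assoc)
  next
    obtain i where i: "i \<in> I" using I_ne by blast
    show "\<zero>\<^bsub>A\<^esub> \<in> carrier A" using A_zero[OF i] in_A[OF i zero_in] by simp
    fix x assume "x \<in> carrier A"
    then obtain i a where i: "i \<in> I" "a \<in> carrier (Bi i)" "x = \<eta> i a" using A_carrier by blast
    interpret nonunital "Bi i" by (rule op[OF i(1)])
    have z: "\<zero>\<^bsub>A\<^esub> = \<eta> i \<zero>\<^bsub>Bi i\<^esub>" using A_zero[OF i(1)] by (simp add: block_ring_def)
    show "\<zero>\<^bsub>A\<^esub> \<oplus>\<^bsub>A\<^esub> x = x" unfolding z i(3) using A_add[OF i(1) zero_closed i(2)] l_zero[OF i(2)] by simp
    show "\<exists>y\<in>carrier A. y \<oplus>\<^bsub>A\<^esub> x = \<zero>\<^bsub>A\<^esub>" unfolding z i(3)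
      using A_add[OF i(1) a_inv_closed[OF i(2)] i(2)] l_neg[OF i(2)] in_A[OF i(1) a_inv_closed[OF i(2)]] by metis
  qed
  have cl: "x \<otimes>\<^bsub>A\<^esub> y \<in> carrier A" if xy: "x \<in> carrier A" "y \<in> carrier A" for x y
  proof -
    obtain i a b where i: "i \<in> I" "a \<in> carrier (Bi i)" "b \<in> carrier (Bi i)" "x = \<eta> i a" "y = \<eta> i b"
      using A_common[of "{x, y}"] xy by auto
    interpret nonunital "Bi i" by (rule op[OF i(1)])
    show ?thesis using A_mult[OF i(1-3)] i in_A mult_closed by simp
  qed
  have al: "(x \<otimes>\<^bsub>A\<^esub> y) \<otimes>\<^bsub>A\<^esub> z = x \<otimes>\<^bsub>A\<^esub> (y \<otimes>\<^bsub>A\<^esub> z) \<and>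
        (x \<oplus>\<^bsub>A\<^esub> y) \<otimes>\<^bsub>A\<^esub> z = x \<otimes>\<^bsub>A\<^esub> z \<oplus>\<^bsub>A\<^esub> y \<otimes>\<^bsub>A\<^esub> z \<and>
        z \<otimes>\<^bsub>A\<^esub> (x \<oplus>\<^bsub>A\<^esub> y) = z \<otimes>\<^bsub>A\<^esub> x \<oplus>\<^bsub>A\<^esub> z \<otimes>\<^bsub>A\<^esub> y"
    if xyz: "x \<in> carrier A" "y \<in> carrier A" "z \<in> carrier A" for x y z
  proof -
    obtain j a b c where j: "j \<in> I" "a \<in> carrier (Bi j)" "b \<in> carrier (Bi j)" "c \<in> carrier (Bi j)"
      "x = \<eta> j a" "y = \<eta> j b" "z = \<eta> j c" using A_common[of "{x, y, z}"] xyz by auto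
    interpret j: nonunital "Bi j" by (rule op[OF j(1)])
    show ?thesis using j by (simp only: A_add A_mult j.a_closed j.mult_closed j.mult_assoc j.distr_l j.distr_r)
  qed
  have nu: "nonunital_ring A" unfolding nonunital_ring_def
    apply (rule conjI[OF ag])
    apply (rule conjI)
    subgoal using cl by (intro ballI)
    subgoal using al by (intro ballI)
    done
  have reg: "\<exists>y\<in>carrier A. x = x \<otimes>\<^bsub>A\<^esub> y \<otimes>\<^bsub>A\<^esub> x" if xA: "x \<in> carrier A" for x
  proof -
    obtain i a where i: "i \<in> I" "a \<in> carrier (Bi i)" "x = \<eta> i a"
      using xA unfolding A_carrier by (elim bexE)
    interpret regular "Bi i" by (rule bm_regular[OF i(1)])
    obtain y where y: "y \<in> carrier (Bi i)" "a = a \<otimes>\<^bsub>Bi i\<^esub> y \<otimes>\<^bsub>Bi i\<^esub> a" using i(2) by (rule regularE)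
    have "x = x \<otimes>\<^bsub>A\<^esub> \<eta> i y \<otimes>\<^bsub>A\<^esub> x"
      unfolding i(3) using A_mult[OF i(1,2) y(1)] A_mult[OF i(1) mult_closed[OF i(2) y(1)] i(2)] y(2) by simp
    then show ?thesis using in_A[OF i(1) y(1)] by blast
  qed
  show ?thesis unfolding regular_def nonunital_def regular_axioms_def using nu reg by (intro conjI ballI)
qed

sublocale A: regular A by (rule A_regular)

lemma \<eta>_hom: "i \<in> I \<Longrightarrow> regular_hom (Bi i) A (\<eta> i)"
  unfolding regular_hom_def regular_hom_axioms_def
  using bm_regular A_regular A_mult A_add A_carrier by (intro conjI allI impI) (simp_all only:, blast)

definition stage :: "'i \<Rightarrow> 'u set set" where
  "stage i = {rid A (\<eta> i a) | a. a \<in> carrier (Bi i)}"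

lemma stageI: "a \<in> carrier (Bi i) \<Longrightarrow> rid A (\<eta> i a) \<in> stage i"
  unfolding stage_def by blast

lemma stageE: "U \<in> stage i \<Longrightarrow> (\<And>a. a \<in> carrier (Bi i) \<Longrightarrow> U = rid A (\<eta> i a) \<Longrightarrow> thesis) \<Longrightarrow> thesis"
  unfolding stage_def by blast

text \<open>The kernel of the projection to block \<open>s\<close>, on the copy of the lattice of
  \<open>Bi i\<close> inside the limit. It corresponds to the kernel of a rank function on the
  lattice side.\<close>

definition block_cong :: "'i \<Rightarrow> 's \<Rightarrow> ('u set \<times> 'u set) set" where
  "block_cong i s = {(rid A (\<eta> i a), rid A (\<eta> i b)) | a b. a \<in> carrier (Bi i) \<and> b \<in> carrier (Bi i) \<and>
     rid (Bi i) (brestrict s a) = rid (Bi i) (brestrict s b)}"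

text \<open>A matrix unit generates its block as a two-sided ideal and vanishes in all other blocks,
  which makes it the witness for \<open>s\<close>; \<open>n_pos\<close> ensures that position 0
  exists.\<close>

definition corner :: "'i \<Rightarrow> 's \<Rightarrow> 's pos \<times> 's pos \<Rightarrow> 'f" where
  "corner i s = bunit 1 (s, 0) (s, 0)"

text \<open>The map \<open>\<eta> i\<close> is injective, so distinct right ideals of a stage stay
  distinct in the limit. Functions of an ideal in a stage may therefore be defined through a
  generator.\<close>

lemma stage_rid_eq:
  assumes i: "i \<in> I" and ab: "a \<in> carrier (Bi i)" "b \<in> carrier (Bi i)" and eq: "rid A (\<eta> i a) = rid A (\<eta> i b)"
  shows "rid (Bi i) a = rid (Bi i) b"
proof -
  interpret f: regular_hom "Bi i" A "\<eta> i" by (rule \<eta>_hom[OF i])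
  have "inj_on f.LL_map (carrier (LL (Bi i)))"
    by (rule f.LL_map_inj) (use \<eta>_inj[OF i] in \<open>auto intro: inj_onI\<close>)
  moreover have "f.LL_map (rid (Bi i) a) = f.LL_map (rid (Bi i) b)"
    using eq by (simp only: f.LL_map_rid[OF ab(1)] f.LL_map_rid[OF ab(2)])
  moreover have "rid (Bi i) a \<in> carrier (LL (Bi i))" "rid (Bi i) b \<in> carrier (LL (Bi i))"
    using f.R.pri_in[OF ab(1)] f.R.pri_in[OF ab(2)] by (simp_all add: LL_def)
  ultimately show ?thesis by (simp only: inj_onD)
qed

lemma block_cong_iff:
  assumes i: "i \<in> I" and ab: "a \<in> carrier (Bi i)" "b \<in> carrier (Bi i)"
  shows "(rid A (\<eta> i a), rid A (\<eta> i b)) \<in> block_cong i s \<longleftrightarrow>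
     rid (Bi i) (brestrict s a) = rid (Bi i) (brestrict s b)"
proof
  interpret block_matrices P "S i" "n i" by (rule bm[OF i])
  assume "(rid A (\<eta> i a), rid A (\<eta> i b)) \<in> block_cong i s"
  then obtain a' b' where a': "a' \<in> carrier (Bi i)" "b' \<in> carrier (Bi i)"
     "rid A (\<eta> i a) = rid A (\<eta> i a')" "rid A (\<eta> i b) = rid A (\<eta> i b')"
     "rid (Bi i) (brestrict s a') = rid (Bi i) (brestrict s b')"
    unfolding block_cong_def by blast
  show "rid (Bi i) (brestrict s a) = rid (Bi i) (brestrict s b)"
    using restrict.hom_rid_eq[OF ab(1) a'(1) stage_rid_eq[OF i ab(1) a'(1,3)]]
      restrict.hom_rid_eq[OF ab(2) a'(2) stage_rid_eq[OF i ab(2) a'(2,4)]] a'(5) by (simp only:)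
qed (use ab in \<open>unfold block_cong_def, blast\<close>)

lemma stage_join:
  assumes i: "i \<in> I" and ab: "a \<in> carrier (Bi i)" "b \<in> carrier (Bi i)"
  obtains c where "c \<in> carrier (Bi i)" "rid (Bi i) c = regular.rsum (Bi i) (rid (Bi i) a) (rid (Bi i) b)"
    "ljoin (LL A) (rid A (\<eta> i a)) (rid A (\<eta> i b)) = rid A (\<eta> i c)"
    "rid A (\<eta> i c) = A.rsum (rid A (\<eta> i a)) (rid A (\<eta> i b))"
proof -
  interpret f: regular_hom "Bi i" A "\<eta> i" by (rule \<eta>_hom[OF i])
  obtain c where c: "c \<in> carrier (Bi i)" "rid (Bi i) c = f.R.rsum (rid (Bi i) a) (rid (Bi i) b)"
    using f.R.ex_rsum[OF ab] by (rule bexE)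
  show ?thesis
    by (rule that[OF c]) (simp_all only: A.LL_join[OF f.hom_closed[OF ab(1)] f.hom_closed[OF ab(2)]] f.hom_rsum[OF ab c])
qed

lemma stage_meet:
  assumes i: "i \<in> I" and ab: "a \<in> carrier (Bi i)" "b \<in> carrier (Bi i)"
  obtains c where "c \<in> carrier (Bi i)" "rid (Bi i) c = rid (Bi i) a \<inter> rid (Bi i) b"
    "lmeet (LL A) (rid A (\<eta> i a)) (rid A (\<eta> i b)) = rid A (\<eta> i c)"
    "rid A (\<eta> i c) = rid A (\<eta> i a) \<inter> rid A (\<eta> i b)"
proof -
  interpret f: regular_hom "Bi i" A "\<eta> i" by (rule \<eta>_hom[OF i])
  obtain c where c: "c \<in> carrier (Bi i)" "rid (Bi i) c = rid (Bi i) a \<inter> rid (Bi i) b"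
    using f.R.ex_rinter[OF ab] by (rule bexE)
  show ?thesis
    by (rule that[OF c]) (simp_all only: A.LL_meet[OF f.hom_closed[OF ab(1)] f.hom_closed[OF ab(2)]] f.hom_rinter[OF ab c])
qed

lemma block_cong_cong:
  assumes i: "i \<in> I"
  shows "cong2 (stage i) (ljoin (LL A)) (lmeet (LL A)) (block_cong i s)"
proof -
  interpret block_matrices P "S i" "n i" by (rule bm[OF i])
  have sub: "block_cong i s \<subseteq> stage i \<times> stage i" unfolding block_cong_def stage_def by blast
  have "refl_on (stage i) (block_cong i s)"
    by (rule refl_onI) (auto simp: stage_def block_cong_def)
  moreover have "sym (block_cong i s)" by (rule symI) (unfold block_cong_def, blast)
  moreover have "trans (block_cong i s)"
  proof (rule transI)
    fix U V W assume UV: "(U, V) \<in> block_cong i s" and VW: "(V, W) \<in> block_cong i s"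
    have st: "U \<in> stage i" "V \<in> stage i" "W \<in> stage i" using subsetD[OF sub UV] subsetD[OF sub VW] by simp_all
    obtain a where a: "a \<in> carrier (Bi i)" "U = rid A (\<eta> i a)" using st(1) by (rule stageE)
    obtain b where b: "b \<in> carrier (Bi i)" "V = rid A (\<eta> i b)" using st(2) by (rule stageE)
    obtain c where c: "c \<in> carrier (Bi i)" "W = rid A (\<eta> i c)" using st(3) by (rule stageE)
    note abc = a(1) b(1) c(1) and e = a(2) b(2) c(2)
    show "(U, W) \<in> block_cong i s"
      using UV VW unfolding e block_cong_iff[OF i abc(1,2)] block_cong_iff[OF i abc(2,3)] block_cong_iff[OF i abc(1,3)]
      by (rule trans)
  qed
  moreover have "(ljoin (LL A) U U', ljoin (LL A) V V') \<in> block_cong i s \<and> (lmeet (LL A) U U', lmeet (LL A) V V') \<in> block_cong i s"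
    if UV: "(U, V) \<in> block_cong i s" and UV': "(U', V') \<in> block_cong i s" for U V U' V'
  proof -
    have st: "U \<in> stage i" "V \<in> stage i" "U' \<in> stage i" "V' \<in> stage i"
      using subsetD[OF sub UV] subsetD[OF sub UV'] by simp_all
    obtain a where a: "a \<in> carrier (Bi i)" "U = rid A (\<eta> i a)" using st(1) by (rule stageE)
    obtain b where b: "b \<in> carrier (Bi i)" "V = rid A (\<eta> i b)" using st(2) by (rule stageE)
    obtain a' where a': "a' \<in> carrier (Bi i)" "U' = rid A (\<eta> i a')" using st(3) by (rule stageE)
    obtain b' where b': "b' \<in> carrier (Bi i)" "V' = rid A (\<eta> i b')" using st(4) by (rule stageE)
    note ab = a(1) b(1) a'(1) b'(1) and e = a(2) b(2) a'(2) b'(2)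
    have r: "rid (Bi i) (brestrict s a) = rid (Bi i) (brestrict s b)" "rid (Bi i) (brestrict s a') = rid (Bi i) (brestrict s b')"
      using UV UV' unfolding e block_cong_iff[OF i ab(1,2)] block_cong_iff[OF i ab(3,4)] .
    obtain c where c: "c \<in> carrier (Bi i)" "rid (Bi i) c = rsum (rid (Bi i) a) (rid (Bi i) a')" "ljoin (LL A) U U' = rid A (\<eta> i c)"
      unfolding e by (rule stage_join[OF i ab(1,3)])
    obtain d where d: "d \<in> carrier (Bi i)" "rid (Bi i) d = rsum (rid (Bi i) b) (rid (Bi i) b')" "ljoin (LL A) V V' = rid A (\<eta> i d)"
      unfolding e by (rule stage_join[OF i ab(2,4)])
    have 1: "rid (Bi i) (brestrict s c) = rid (Bi i) (brestrict s d)"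
      by (simp only: restrict.hom_rsum[OF ab(1,3) c(1,2)] restrict.hom_rsum[OF ab(2,4) d(1,2)] r)
    obtain c' where c': "c' \<in> carrier (Bi i)" "rid (Bi i) c' = rid (Bi i) a \<inter> rid (Bi i) a'" "lmeet (LL A) U U' = rid A (\<eta> i c')"
      unfolding e by (rule stage_meet[OF i ab(1,3)])
    obtain d' where d': "d' \<in> carrier (Bi i)" "rid (Bi i) d' = rid (Bi i) b \<inter> rid (Bi i) b'" "lmeet (LL A) V V' = rid A (\<eta> i d')"
      unfolding e by (rule stage_meet[OF i ab(2,4)])
    have 2: "rid (Bi i) (brestrict s c') = rid (Bi i) (brestrict s d')"
      by (simp only: restrict.hom_rinter[OF ab(1,3) c'(1,2)] restrict.hom_rinter[OF ab(2,4) d'(1,2)] r)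
    show ?thesis unfolding c(3) d(3) c'(3) d'(3) block_cong_iff[OF i c(1) d(1)] block_cong_iff[OF i c'(1) d'(1)]
      using 1 2 by blast
  qed
  ultimately show ?thesis using sub unfolding cong2_def equiv_def by (intro conjI allI impI) (simp_all only:)
qed

lemma stage_mono: "\<lbrakk>i \<in> I; j \<in> I; lq i j\<rbrakk> \<Longrightarrow> stage i \<subseteq> stage j"
proof
  fix U assume ij: "i \<in> I" "j \<in> I" "lq i j" and "U \<in> stage i"
  then obtain a where a: "a \<in> carrier (Bi i)" "U = rid A (\<eta> i a)" unfolding stage_def by blast
  then have "U = rid A (\<eta> j (bhom (h i j) a))" by (simp only: \<eta>_h[OF ij a(1)])
  then show "U \<in> stage j" using h_closed[OF ij a(1)] unfolding stage_def by blast
qed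

text \<open>Equality of two ideals in a block is the vanishing of \<open>?d1\<close> and
  \<open>?d2\<close> there, and \<open>bhom_block_zero\<close> tells when these vanish in block
  \<open>t\<close> of the later stage.\<close>

lemma block_cong_restrict:
  assumes ij: "i \<in> I" "j \<in> I" "lq i j" and t: "t \<in> S j" and UV: "U \<in> stage i" "V \<in> stage i"
  shows "(U, V) \<in> block_cong j t \<longleftrightarrow> (\<forall>s\<in>S i. 0 < m i j s t \<longrightarrow> (U, V) \<in> block_cong i s)"
proof -
  interpret i: block_matrices P "S i" "n i" by (rule bm[OF ij(1)])
  interpret j: block_matrices P "S j" "n j" by (rule bm[OF ij(2)])
  obtain a where a: "a \<in> carrier (Bi i)" "U = rid A (\<eta> i a)" using UV(1) by (rule stageE)
  obtain b where b: "b \<in> carrier (Bi i)" "V = rid A (\<eta> i b)" using UV(2) by (rule stageE)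
  note ab = a(1) b(1) and e = a(2) b(2)
  have e': "U = rid A (\<eta> j (bhom (h i j) a))" "V = rid A (\<eta> j (bhom (h i j) b))"
    by (simp_all only: e \<eta>_h[OF ij ab(1)] \<eta>_h[OF ij ab(2)])
  obtain y where y: "y \<in> carrier (Bi i)" "b = b \<otimes>\<^bsub>Bi i\<^esub> y \<otimes>\<^bsub>Bi i\<^esub> b" using ab(2) by (rule i.regularE)
  obtain z where z: "z \<in> carrier (Bi i)" "a = a \<otimes>\<^bsub>Bi i\<^esub> z \<otimes>\<^bsub>Bi i\<^esub> a" using ab(1) by (rule i.regularE)
  let ?d1 = "b \<otimes>\<^bsub>Bi i\<^esub> y \<otimes>\<^bsub>Bi i\<^esub> a \<ominus>\<^bsub>Bi i\<^esub> a" and ?d2 = "a \<otimes>\<^bsub>Bi i\<^esub> z \<otimes>\<^bsub>Bi i\<^esub> b \<ominus>\<^bsub>Bi i\<^esub> b"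
  have d: "?d1 \<in> carrier (Bi i)" "?d2 \<in> carrier (Bi i)"
    using ab y z by (auto intro!: i.N.minus_closed i.N.mult_closed simp del: i.B_simps)
  interpret c: regular_hom "Bi i" "Bi j" "brestrict t \<circ> bhom (h i j)"
    by (rule regular_hom_comp[OF h_hom[OF ij] j.restrict.regular_hom_axioms])
  have zero: "\<zero>\<^bsub>Bi k\<^esub> = (\<lambda>_. 0)" for k by (simp add: block_ring_def)
  have L: "(U, V) \<in> block_cong j t \<longleftrightarrow> brestrict t (bhom (h i j) ?d1) = (\<lambda>_. 0) \<and> brestrict t (bhom (h i j) ?d2) = (\<lambda>_. 0)"
    unfolding e' block_cong_iff[OF ij(2) h_closed[OF ij ab(1)] h_closed[OF ij ab(2)]]
    using c.hom_rid_eq_iff[OF ab y z] by (simp only: comp_apply zero)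
  have R: "(U, V) \<in> block_cong i s \<longleftrightarrow> brestrict s ?d1 = (\<lambda>_. 0) \<and> brestrict s ?d2 = (\<lambda>_. 0)" for s
    unfolding e block_cong_iff[OF ij(1) ab] using i.restrict.hom_rid_eq_iff[OF ab y z] by (simp only: zero)
  show ?thesis unfolding L R
    using bhom_block_zero[OF h_in[OF ij] bm[OF ij(1)] d(1) t] bhom_block_zero[OF h_in[OF ij] bm[OF ij(1)] d(2) t] by blast
qed

lemma corner_in: "\<lbrakk>i \<in> I; s \<in> S i\<rbrakk> \<Longrightarrow> corner i s \<in> carrier (Bi i)"
proof -
  assume a: "i \<in> I" "s \<in> S i"
  interpret block_matrices P "S i" "n i" by (rule bm[OF a(1)])
  show ?thesis unfolding corner_def using a n_pos[OF a] sf1 by (intro bunit_in) (auto simp: same_block_def positions_def)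
qed

text \<open>Collapsed elements form a two-sided ideal by \<open>LL_cong_ideal\<close>. Matrix units
  on both sides turn a nonzero entry in block \<open>s\<close> into the corner of \<open>s\<close>;
  conversely each entry is a two-sided multiple of the corner of its block, and \<open>w\<close> is
  the sum of its entries.\<close>

lemma ideal_iff_corners:
  assumes \<theta>: "cong2 (carrier (LL A)) (ljoin (LL A)) (lmeet (LL A)) \<theta>"
    and i: "i \<in> I" and w: "w \<in> carrier (Bi i)"
  shows "({\<zero>\<^bsub>A\<^esub>}, rid A (\<eta> i w)) \<in> \<theta> \<longleftrightarrow>
    (\<forall>s\<in>S i. brestrict s w \<noteq> (\<lambda>_. 0) \<longrightarrow> ({\<zero>\<^bsub>A\<^esub>}, rid A (\<eta> i (corner i s))) \<in> \<theta>)"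
proof -
  interpret block_matrices P "S i" "n i" by (rule bm[OF i])
  interpret f: regular_hom "Bi i" A "\<eta> i" by (rule \<eta>_hom[OF i])
  let ?N = "\<lambda>x. ({\<zero>\<^bsub>A\<^esub>}, rid A (\<eta> i x)) \<in> \<theta>"
  have N_sand: "?N (a \<otimes>\<^bsub>B\<^esub> x \<otimes>\<^bsub>B\<^esub> b)" if "?N x" "x \<in> carrier B" "a \<in> carrier B" "b \<in> carrier B" for a b x
  proof -
    have "({\<zero>\<^bsub>A\<^esub>}, rid A (\<eta> i a \<otimes>\<^bsub>A\<^esub> \<eta> i x)) \<in> \<theta>"
      by (rule A.LL_cong_ideal(2)[OF \<theta> f.hom_closed[OF that(2)] f.hom_closed[OF that(3)] that(1)])
    then have "({\<zero>\<^bsub>A\<^esub>}, rid A (\<eta> i a \<otimes>\<^bsub>A\<^esub> \<eta> i x \<otimes>\<^bsub>A\<^esub> \<eta> i b)) \<in> \<theta>"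
      by (rule A.LL_cong_ideal(1)[OF \<theta> A.mult_closed[OF f.hom_closed[OF that(3)] f.hom_closed[OF that(2)]]
            f.hom_closed[OF that(4)]])
    moreover have "\<eta> i a \<otimes>\<^bsub>A\<^esub> \<eta> i x \<otimes>\<^bsub>A\<^esub> \<eta> i b = \<eta> i (a \<otimes>\<^bsub>B\<^esub> x \<otimes>\<^bsub>B\<^esub> b)"
      using that N.mult_closed by (simp only: f.hom_mult)
    ultimately show ?thesis by (simp only:)
  qed
  have N_add: "?N (\<lambda>z. x z + y z)" if "?N x" "?N y" "x \<in> carrier B" "y \<in> carrier B" for x y
    using A.LL_cong_ideal(3)[OF \<theta> f.hom_closed[OF that(3)] f.hom_closed[OF that(4)] that(1,2)]
      f.hom_add[OF that(3,4)] by (simp only: B_simps)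
  have N0: "?N (\<lambda>_. 0)"
  proof -
    have "{\<zero>\<^bsub>A\<^esub>} \<in> carrier (LL A)" using A.pri_in[OF A.zero_closed] by (simp only: LL_def carrier_incl_lattice A.rid_zero)
    then have "({\<zero>\<^bsub>A\<^esub>}, {\<zero>\<^bsub>A\<^esub>}) \<in> \<theta>" by (rule cong2D(1)[OF \<theta>])
    then show ?thesis by (simp only: A_zero[OF i, symmetric] A.rid_zero)
  qed
  \<comment> \<open>Matrix units on both sides isolate the entry at \<open>(p, q)\<close>, scale it
    and move it to \<open>(p', q')\<close>.\<close>
  have move: "bunit (c * w (p, q) * d) p' q' = bunit c p' p \<otimes>\<^bsub>B\<^esub> w \<otimes>\<^bsub>B\<^esub> bunit d q q'"
    if "p \<in> positions (S i) (n i)" "q \<in> positions (S i) (n i)" for c d p q p' q' and w :: "'s pos \<times> 's pos \<Rightarrow> 'f"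
    unfolding B_simps mult_bunit[OF that(2)] bunit_mult[OF that(1)] by (auto simp: bunit_def fun_eq_iff)
  show ?thesis
  proof
    assume N: "?N w"
    show "\<forall>s\<in>S i. brestrict s w \<noteq> (\<lambda>_. 0) \<longrightarrow> ?N (corner i s)"
    proof (intro ballI impI)
      fix s assume s: "s \<in> S i" and nz: "brestrict s w \<noteq> (\<lambda>_. 0)"
      obtain x where "brestrict s w x \<noteq> 0" using nz by (meson ext)
      then obtain p q where pq: "w (p, q) \<noteq> 0" "fst p = s"
        by (cases x) (auto simp: brestrict_def split: if_splits)
      note pos = B_nz[OF w pq(1)]
      have s0: "(s, 0) \<in> positions (S i) (n i)" using s n_pos[OF i s] by (simp add: positions_def)
      have "corner i s = bunit (inverse (w (p, q)) * w (p, q) * 1) (s, 0) (s, 0)"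
        using pq(1) by (simp add: corner_def)
      also have "\<dots> = bunit (inverse (w (p, q))) (s, 0) p \<otimes>\<^bsub>B\<^esub> w \<otimes>\<^bsub>B\<^esub> bunit 1 q (s, 0)"
        by (rule move) (use pos in auto)
      finally have e: "corner i s = bunit (inverse (w (p, q))) (s, 0) p \<otimes>\<^bsub>B\<^esub> w \<otimes>\<^bsub>B\<^esub> bunit 1 q (s, 0)" .
      have "bunit (inverse (w (p, q))) (s, 0) p \<in> carrier B" "bunit 1 q (s, 0) \<in> carrier B"
        using pos s0 pq(2) sf_inv[OF B_in[OF w, of "(p, q)"]] sf1 by (auto intro!: bunit_in simp: same_block_def)
      then show "?N (corner i s)" unfolding e using N_sand[OF N w] by blast
    qed
  next
    assume c: "\<forall>s\<in>S i. brestrict s w \<noteq> (\<lambda>_. 0) \<longrightarrow> ?N (corner i s)"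
    have unit: "bunit (w x) (fst x) (snd x) \<in> carrier B \<and> ?N (bunit (w x) (fst x) (snd x))" for x
    proof (cases "w x = 0")
      case True
      then have "bunit (w x) (fst x) (snd x) = (\<lambda>_. 0)" by (auto simp: bunit_def)
      then show ?thesis using N0 zero_in by simp
    next
      case False
      obtain p q where x: "x = (p, q)" by (cases x)
      note pos = B_nz[OF w False[unfolded x]]
      have s: "fst p \<in> S i" using pos by (auto simp: positions_def)
      have s0: "(fst p, 0) \<in> positions (S i) (n i)" using s n_pos[OF i s] by (simp add: positions_def)
      have "brestrict (fst p) w x \<noteq> 0" using False by (simp add: x brestrict_def)
      then have "brestrict (fst p) w \<noteq> (\<lambda>_. 0)" by auto
      then have N: "?N (corner i (fst p))" using c s by blast
      have e: "bunit (w x) p q = bunit (w x) p (fst p, 0) \<otimes>\<^bsub>B\<^esub> corner i (fst p) \<otimes>\<^bsub>B\<^esub> bunit 1 (fst p, 0) q"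
        using move[OF s0 s0, of "w x" "corner i (fst p)" 1 p q] by (simp add: corner_def bunit_def)
      have "bunit (w x) p (fst p, 0) \<in> carrier B" "bunit 1 (fst p, 0) q \<in> carrier B" "bunit (w x) p q \<in> carrier B"
        using pos s0 B_in[OF w, of x] sf1 by (auto intro!: bunit_in simp: same_block_def)
      then show ?thesis using N_sand[OF N corner_in[OF i s]] e x by simp
    qed
    \<comment> \<open>The entries are added one at a time: \<open>w\<close> is first cut down to a
      finite set \<open>X\<close> of positions.\<close>
    have main: "(\<lambda>x. if x \<in> X then w x else 0) \<in> carrier B \<and> ?N (\<lambda>x. if x \<in> X then w x else 0)" if "finite X" for X
      using that
    proof (induction X rule: finite_induct)
      case empty
      then show ?case using N0 zero_in by simp
    next
      case (insert x X)
      have e: "(\<lambda>y. if y \<in> insert x X then w y else 0) = (\<lambda>y. (if y \<in> X then w y else 0) + bunit (w x) (fst x) (snd x) y)"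
        using insert(2) by (auto simp: bunit_def fun_eq_iff)
      have "(\<lambda>y. (if y \<in> X then w y else 0) + bunit (w x) (fst x) (snd x) y) \<in> carrier B"
        using N.a_closed[of "\<lambda>y. if y \<in> X then w y else 0" "bunit (w x) (fst x) (snd x)"] insert(3) unit[of x] by simp
      then show ?case unfolding e using N_add insert(3) unit[of x] by blast
    qed
    have F: "finite (positions (S i) (n i) \<times> positions (S i) (n i))" using finite_positions[OF fin] by simp
    have e: "(\<lambda>x. if x \<in> positions (S i) (n i) \<times> positions (S i) (n i) then w x else 0) = w"
    proof (rule ext)
      fix x show "(if x \<in> positions (S i) (n i) \<times> positions (S i) (n i) then w x else 0) = w x"
        using B_zero[OF w, of x] by (cases x) (auto simp: same_block_def)
    qed
    show "?N w" using main[OF F, THEN conjunct2] by (simp only: e)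
  qed
qed

lemma Id_on_cong2: "(\<And>x y. \<lbrakk>x \<in> C; y \<in> C\<rbrakk> \<Longrightarrow> jn x y \<in> C \<and> mt x y \<in> C) \<Longrightarrow> cong2 C jn mt (Id_on C)"
  unfolding cong2_def by (auto simp: equiv_def refl_on_def sym_def trans_def)

lemma corner_block_cong:
  assumes i: "i \<in> I" and s: "s \<in> S i"
  shows "({\<zero>\<^bsub>A\<^esub>}, rid A (\<eta> i (corner i s))) \<in> block_cong i t \<longleftrightarrow> t \<noteq> s"
proof -
  interpret block_matrices P "S i" "n i" by (rule bm[OF i])
  have z: "{\<zero>\<^bsub>A\<^esub>} = rid A (\<eta> i (\<lambda>_. 0))" by (simp only: A_zero[OF i, symmetric] A.rid_zero)
  have r0: "brestrict t (\<lambda>_. 0) = (\<lambda>_. 0 :: 'f)" for t :: 's by (auto simp: brestrict_def)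
  have rc: "brestrict t (corner i s) = (if t = s then corner i s else (\<lambda>_. 0))" for t
    by (auto simp: brestrict_def corner_def bunit_def fun_eq_iff)
  have "corner i s ((s, 0), (s, 0)) \<noteq> 0" by (simp add: corner_def bunit_def)
  then have nz: "corner i s \<noteq> (\<lambda>_. 0)" by auto
  have rz: "rid B (\<lambda>_. 0) = {\<lambda>_. 0}" using rid_zero by simp
  have ne: "rid B (corner i s) \<noteq> {\<lambda>_. 0}"
  proof
    assume "rid B (corner i s) = {\<lambda>_. 0}"
    then have "corner i s \<in> {\<lambda>_. 0}" using rid_self[OF corner_in[OF i s]] by (simp only:)
    then show False using nz by simp
  qed
  show ?thesis
  proof (cases "t = s")
    case True
    show ?thesis unfolding z block_cong_iff[OF i zero_in corner_in[OF i s]] r0 rc True rz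
      using ne[symmetric] by (simp only: if_True simp_thms)
  next
    case False
    then show ?thesis unfolding z block_cong_iff[OF i zero_in corner_in[OF i s]] r0 rc
      by (simp only: if_False simp_thms)
  qed
qed

text \<open>A pair is replaced by the interval from its meet to its join, the interval by a
  complement \<open>w\<close> of its lower end, and \<open>w\<close> by the corners of the blocks in
  which it does not vanish.\<close>

lemma stage_determined:
  assumes \<theta>: "cong2 (carrier (LL A)) (ljoin (LL A)) (lmeet (LL A)) \<theta>"
    and i: "i \<in> I" and UV: "U \<in> stage i" "V \<in> stage i"
  shows "(U, V) \<in> \<theta> \<longleftrightarrow> (\<forall>s\<in>S i. (U, V) \<notin> block_cong i s \<longrightarrow> ({\<zero>\<^bsub>A\<^esub>}, rid A (\<eta> i (corner i s))) \<in> \<theta>)"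
proof -
  interpret block_matrices P "S i" "n i" by (rule bm[OF i])
  interpret f: regular_hom "Bi i" A "\<eta> i" by (rule \<eta>_hom[OF i])
  have LL: "stage i \<subseteq> carrier (LL A)" unfolding stage_def LL_def using A.pri_in f.hom_closed by auto
  obtain a where a: "a \<in> carrier B" "U = rid A (\<eta> i a)" using UV(1) by (rule stageE)
  obtain b where b: "b \<in> carrier B" "V = rid A (\<eta> i b)" using UV(2) by (rule stageE)
  note ab = a(1) b(1) and e = a(2) b(2)
  obtain c where c: "c \<in> carrier B" "rid B c = rid B a \<inter> rid B b" "lmeet (LL A) U V = rid A (\<eta> i c)" "rid A (\<eta> i c) = U \<inter> V"
    unfolding e by (rule stage_meet[OF i ab])
  obtain d where d: "d \<in> carrier B" "rid B d = rsum (rid B a) (rid B b)" "ljoin (LL A) U V = rid A (\<eta> i d)" "rid A (\<eta> i d) = A.rsum U V"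
    unfolding e by (rule stage_join[OF i ab])
  have hc: "\<eta> i a \<in> carrier A" "\<eta> i b \<in> carrier A" "\<eta> i c \<in> carrier A" "\<eta> i d \<in> carrier A"
    using f.hom_closed ab c(1) d(1) by auto
  have jn: "ljoin (LL A) (rid A y) (rid A x) = rid A y" "ljoin (LL A) (rid A x) (rid A y) = rid A y"
      "lmeet (LL A) (rid A x) (rid A y) = rid A x"
    if "x \<in> carrier A" "y \<in> carrier A" "rid A x \<subseteq> rid A y" for x y
    using A.LL_join[OF that(2,1)] A.LL_join[OF that(1,2)] A.rsum_absorb[OF that] A.LL_meet[OF that(1,2)] that(3)
    by (simp_all only: Int_absorb2)
  have interval: "(U, V) \<in> \<theta>' \<longleftrightarrow> (rid A (\<eta> i c), rid A (\<eta> i d)) \<in> \<theta>'"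
    if \<theta>': "cong2 D (ljoin (LL A)) (lmeet (LL A)) \<theta>'" "stage i \<subseteq> D" for \<theta>' D
  proof -
    have st: "rid A (\<eta> i c) \<in> stage i" "rid A (\<eta> i d) \<in> stage i" by (rule stageI[OF c(1)], rule stageI[OF d(1)])
    have "rid A (\<eta> i c) \<subseteq> U" "rid A (\<eta> i c) \<subseteq> V" unfolding c(4) by (rule Int_lower1, rule Int_lower2)
    moreover have "U \<subseteq> rid A (\<eta> i d)" "V \<subseteq> rid A (\<eta> i d)" unfolding d(4) e by (rule A.rsum_upper[OF hc(1,2)])+
    ultimately have "(U, V) \<in> \<theta>' \<longleftrightarrow> (lmeet (LL A) U V, ljoin (LL A) U V) \<in> \<theta>'"
      unfolding e by (intro cong2_interval_iff[OF \<theta>'(1)])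
        (use UV st \<theta>'(2) jn hc in \<open>auto simp only: c(3)[unfolded e] d(3)[unfolded e] e subsetD order_refl\<close>)
    then show ?thesis by (simp only: c(3) d(3))
  qed
  have cd: "rid B c \<subseteq> rid B d" using rsum_upper(1)[OF ab] unfolding c(2) d(2) by (rule le_infI1)
  obtain w where w: "w \<in> carrier B" "rid B c \<inter> rid B w = {\<zero>\<^bsub>B\<^esub>}" "rid B d = rsum (rid B c) (rid B w)"
    using ex_complement[OF c(1) d(1) cd] by metis
  have 1: "(U, V) \<in> \<theta> \<longleftrightarrow> ({\<zero>\<^bsub>A\<^esub>}, rid A (\<eta> i w)) \<in> \<theta>"
    unfolding interval[OF \<theta> LL] by (rule f.complement_cong[OF c(1) d(1) w \<theta>])
  have alg: "is_algebra lattice_sig (LL B)" by (rule LL_algebra) (auto simp: lat_sig_def lattice_sig_def)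
  \<comment> \<open>With equality as the congruence, \<open>complement_cong\<close> for the
    projection to block \<open>s\<close> says that the ends of the interval agree there iff
    \<open>w\<close> vanishes there.\<close>
  have id: "cong2 (carrier (LL B)) (ljoin (LL B)) (lmeet (LL B)) (Id_on (carrier (LL B)))"
  proof (rule Id_on_cong2)
    fix x y assume "x \<in> carrier (LL B)" "y \<in> carrier (LL B)"
    then show "ljoin (LL B) x y \<in> carrier (LL B) \<and> lmeet (LL B) x y \<in> carrier (LL B)"
      using alg unfolding is_algebra_def
      by (auto simp: lattice_sig_def dest!: spec[of _ Join] spec[of _ Meet] spec[of _ "[x, y]"])
  qed
  have 2: "(U, V) \<notin> block_cong i s \<longleftrightarrow> brestrict s w \<noteq> (\<lambda>_. 0)" for s
  proof -
    have rr: "brestrict s x \<in> carrier B" if "x \<in> carrier B" for x using that by (rule brestrict_in)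
    have inLL: "rid B x \<in> carrier (LL B)" if "x \<in> carrier B" for x using pri_in[OF that] by (simp add: LL_def)
    have "(U, V) \<in> block_cong i s \<longleftrightarrow> rid B (brestrict s c) = rid B (brestrict s d)"
      unfolding interval[OF block_cong_cong[OF i] order_refl] by (rule block_cong_iff[OF i c(1) d(1)])
    also have "\<dots> \<longleftrightarrow> (rid B (brestrict s c), rid B (brestrict s d)) \<in> Id_on (carrier (LL B))"
      using inLL[OF rr[OF c(1)]] by (simp only: Id_on_iff) blast
    also have "\<dots> \<longleftrightarrow> ({\<zero>\<^bsub>B\<^esub>}, rid B (brestrict s w)) \<in> Id_on (carrier (LL B))"
      by (rule restrict.complement_cong[OF c(1) d(1) w id])
    also have "\<dots> \<longleftrightarrow> rid B (brestrict s w) = {\<lambda>_. 0}"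
      using inLL[OF rr[OF w(1)]] by (simp only: Id_on_iff B_simps) metis
    also have "\<dots> \<longleftrightarrow> brestrict s w = (\<lambda>_. 0)"
    proof
      assume "rid B (brestrict s w) = {\<lambda>_. 0}"
      then show "brestrict s w = (\<lambda>_. 0)" using rid_self[OF rr[OF w(1)]] by (simp only: singleton_iff)
    next
      assume "brestrict s w = (\<lambda>_. 0)"
      then show "rid B (brestrict s w) = {\<lambda>_. 0}" using rid_zero by simp
    qed
    finally show ?thesis by blast
  qed
  show ?thesis unfolding 1 2 by (rule ideal_iff_corners[OF \<theta> i w(1)])
qed

text \<open>If the multiplicities come from a lattice, the data \<open>I\<close>, \<open>lq\<close>,
  \<open>S\<close> and \<open>0 < m i j s t\<close> are the same on both sides, so both congruence
  lattices are coded by the same \<open>system_ideals\<close>.\<close>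

lemma LL_congruence_system:
  "congruence_system (carrier (LL A)) (ljoin (LL A)) (lmeet (LL A)) I lq stage S (\<lambda>i j s t. 0 < m i j s t)
     block_cong (\<lambda>i s. ({\<zero>\<^bsub>A\<^esub>}, rid A (\<eta> i (corner i s))))"
proof
  show "carrier (LL A) = (\<Union>i\<in>I. stage i)"
    unfolding LL_def principal_right_ideals_def stage_def by (auto simp: A_def)
  fix i assume i: "i \<in> I"
  show "ljoin (LL A) x y \<in> stage i" if xy: "x \<in> stage i" "y \<in> stage i" for x y
  proof -
    obtain a where a: "a \<in> carrier (Bi i)" "x = rid A (\<eta> i a)" using xy(1) by (rule stageE)
    obtain b where b: "b \<in> carrier (Bi i)" "y = rid A (\<eta> i b)" using xy(2) by (rule stageE)
    note ab = a(1) b(1) and e = a(2) b(2)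
    obtain c where "c \<in> carrier (Bi i)" "ljoin (LL A) x y = rid A (\<eta> i c)" unfolding e by (rule stage_join[OF i ab])
    then show ?thesis using stageI by simp
  qed
  show "lmeet (LL A) x y \<in> stage i" if xy: "x \<in> stage i" "y \<in> stage i" for x y
  proof -
    obtain a where a: "a \<in> carrier (Bi i)" "x = rid A (\<eta> i a)" using xy(1) by (rule stageE)
    obtain b where b: "b \<in> carrier (Bi i)" "y = rid A (\<eta> i b)" using xy(2) by (rule stageE)
    note ab = a(1) b(1) and e = a(2) b(2)
    obtain c where "c \<in> carrier (Bi i)" "lmeet (LL A) x y = rid A (\<eta> i c)" unfolding e by (rule stage_meet[OF i ab])
    then show ?thesis using stageI by simp
  qed
  show "({\<zero>\<^bsub>A\<^esub>}, rid A (\<eta> i (corner i s))) \<in> stage i \<times> stage i" if "s \<in> S i" for s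
  proof -
    have "{\<zero>\<^bsub>A\<^esub>} = rid A (\<eta> i (\<lambda>_. 0))" by (simp only: A_zero[OF i, symmetric] A.rid_zero)
    then have "{\<zero>\<^bsub>A\<^esub>} \<in> stage i" using stageI[OF zero_in] by (simp only:)
    then show ?thesis using stageI[OF corner_in[OF i that]] by (rule SigmaI)
  qed
  show "({\<zero>\<^bsub>A\<^esub>}, rid A (\<eta> i (corner i s))) \<in> block_cong i t \<longleftrightarrow> t \<noteq> s" if "s \<in> S i" for s t
    by (rule corner_block_cong[OF i that])
  show "cong2 (stage i) (ljoin (LL A)) (lmeet (LL A)) (block_cong i s)" for s by (rule block_cong_cong[OF i])
next
  fix \<theta> i U V assume "cong2 (carrier (LL A)) (ljoin (LL A)) (lmeet (LL A)) \<theta>" "i \<in> I" "U \<in> stage i" "V \<in> stage i"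
  then show "(U, V) \<in> \<theta> \<longleftrightarrow> (\<forall>s\<in>S i. (U, V) \<notin> block_cong i s \<longrightarrow> ({\<zero>\<^bsub>A\<^esub>}, rid A (\<eta> i (corner i s))) \<in> \<theta>)"
    by (rule stage_determined)
qed (use I_ne I_directed stage_mono block_cong_restrict in auto)

end


section \<open>Identities of the limit lattice\<close>

lemma (in block_matrices) one_in: "\<one>\<^bsub>B\<^esub> \<in> carrier B"
  by (auto simp: block_ring_def same_block_def sf0 sf1)

lemma (in block_matrices) one_mult: "a \<in> carrier B \<Longrightarrow> \<one>\<^bsub>B\<^esub> \<otimes>\<^bsub>B\<^esub> a = a"
proof (rule ext)
  fix z :: "'s pos \<times> 's pos" assume a: "a \<in> carrier B"
  obtain x y where z: "z = (x, y)" by (cases z)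
  have "(\<one>\<^bsub>B\<^esub> \<otimes>\<^bsub>B\<^esub> a) z = (\<Sum>r\<in>positions S n. if r = x then (if x \<in> positions S n then a (x, y) else 0) else 0)"
    unfolding B_simps bmult_def z prod.case by (intro sum.cong) (auto simp: block_ring_def)
  also have "\<dots> = (if x \<in> positions S n then a (x, y) else 0)" using finite_positions[OF fin] by simp
  also have "\<dots> = a z" using B_zero[OF a, of "(x, y)"] by (auto simp: z same_block_def)
  finally show "(\<one>\<^bsub>B\<^esub> \<otimes>\<^bsub>B\<^esub> a) z = a z" .
qed

context matricial_system
begin

definition unital :: bool where
  "unital \<longleftrightarrow> (\<forall>i\<in>I. \<forall>j\<in>I. lq i j \<longrightarrow> bhom (h i j) \<one>\<^bsub>Bi i\<^esub> = \<one>\<^bsub>Bi j\<^esub>)"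

lemma unital_left_unit:
  assumes u: "unital" and i: "i \<in> I"
  shows "A.left_unit (\<eta> i \<one>\<^bsub>Bi i\<^esub>)"
  unfolding A.left_unit_def
proof (intro conjI ballI)
  interpret block_matrices P "S i" "n i" by (rule bm[OF i])
  show "\<eta> i \<one>\<^bsub>Bi i\<^esub> \<in> carrier A" using one_in i A_carrier by blast
  fix x assume "x \<in> carrier A"
  then obtain j a where j: "j \<in> I" "a \<in> carrier (Bi j)" "x = \<eta> j a" unfolding A_carrier by (elim bexE)
  obtain k where k: "k \<in> I" "lq i k" "lq j k" using I_directed[OF i j(1)] by blast
  interpret k: block_matrices P "S k" "n k" by (rule bm[OF k(1)])
  have 1: "\<eta> i \<one>\<^bsub>Bi i\<^esub> = \<eta> k \<one>\<^bsub>Bi k\<^esub>"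
    using \<eta>_h[OF i k(1,2) one_in] u i k unfolding unital_def by simp
  have hc: "bhom (h j k) a \<in> carrier (Bi k)" by (rule h_closed[OF j(1) k(1,3) j(2)])
  have 2: "x = \<eta> k (bhom (h j k) a)" using \<eta>_h[OF j(1) k(1,3) j(2)] j(3) by simp
  show "\<eta> i \<one>\<^bsub>Bi i\<^esub> \<otimes>\<^bsub>A\<^esub> x = x"
    unfolding 1 2 A_mult[OF k(1) k.one_in hc] k.one_mult[OF hc] by (rule refl)
qed

lemma LL_A_algebra:
  assumes "lat_sig \<tau>" "One \<in> dom \<tau> \<Longrightarrow> unital"
  shows "is_algebra \<tau> (LL A)"
  by (rule A.LL_algebra[OF assms(1)]) (use assms(2) unital_left_unit I_ne in blast)

text \<open>The values of finitely many variables lie in one stage, where the column spaces of the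
  blocks \<open>s\<close> give homomorphisms to subspace lattices that jointly separate
  points.\<close>

lemma LL_A_satisfies:
  assumes \<tau>: "lat_sig \<tau>" and un: "One \<in> dom \<tau> \<Longrightarrow> unital"
    and ok: "trm_ok \<tau> u" "trm_ok \<tau> v"
    and sat: "\<And>i s. \<lbrakk>i \<in> I; s \<in> S i\<rbrakk> \<Longrightarrow> satisfies (Sub_pow TYPE('f) (n i s)) (u, v)"
  shows "satisfies (LL A) (u, v)"
proof (rule satisfies_by_homs[OF ok])
  fix \<rho> :: "nat \<Rightarrow> 'u set" assume \<rho>: "range \<rho> \<subseteq> carrier (LL A)"
  interpret Q: congruence_system "carrier (LL A)" "ljoin (LL A)" "lmeet (LL A)" I lq stage S
    "\<lambda>i j s t. 0 < m i j s t" block_cong "\<lambda>i s. ({\<zero>\<^bsub>A\<^esub>}, rid A (\<eta> i (corner i s)))"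
    by (rule LL_congruence_system)
  have "finite (\<rho> ` (tvars u \<union> tvars v))" using finite_tvars by blast
  moreover have "\<rho> ` (tvars u \<union> tvars v) \<subseteq> carrier (LL A)" using \<rho> by blast
  ultimately obtain i where i: "i \<in> I" and \<rho>i: "\<rho> ` (tvars u \<union> tvars v) \<subseteq> stage i"
    using Q.common_index by meson
  interpret block_matrices P "S i" "n i" by (rule bm[OF i])
  interpret f: regular_hom "Bi i" A "\<eta> i" by (rule \<eta>_hom[OF i])
  \<comment> \<open>\<open>stage_rid_eq\<close> and \<open>colspace_eq\<close> make this independent
    of the generator chosen.\<close>
  define \<kappa> where "\<kappa> = (\<lambda>s U. colspace s (SOME a. a \<in> carrier B \<and> rid A (\<eta> i a) = U))"
  have \<kappa>: "\<kappa> s (rid A (\<eta> i a)) = colspace s a" if s: "s \<in> S i" and a: "a \<in> carrier B" for s a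
  proof -
    let ?b = "SOME b. b \<in> carrier B \<and> rid A (\<eta> i b) = rid A (\<eta> i a)"
    have b: "?b \<in> carrier B \<and> rid A (\<eta> i ?b) = rid A (\<eta> i a)"
      by (rule someI[of "\<lambda>b. b \<in> carrier B \<and> rid A (\<eta> i b) = rid A (\<eta> i a)" a]) (use a in blast)
    have "rid B ?b = rid B a" by (rule stage_rid_eq[OF i b[THEN conjunct1] a b[THEN conjunct2]])
    then show ?thesis unfolding \<kappa>_def by (rule colspace_eq[OF s b[THEN conjunct1] a])
  qed
  have op: "opn (LL A) g xs \<in> stage i \<and>
      (\<forall>s\<in>S i. \<kappa> s (opn (LL A) g xs) = opn (Sub_pow TYPE('f) (n i s)) g (map (\<kappa> s) xs))"
    if g: "\<tau> g = Some (length xs)" and xs: "set xs \<subseteq> stage i" for g xs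
    using \<tau> g
  proof (cases rule: lat_sig_cases)
    case (1 x y)
    have x: "x \<in> stage i" and y: "y \<in> stage i" using xs 1 by auto
    obtain a where a: "a \<in> carrier (Bi i)" "x = rid A (\<eta> i a)" using x by (rule stageE)
    obtain b where b: "b \<in> carrier (Bi i)" "y = rid A (\<eta> i b)" using y by (rule stageE)
    obtain c where c: "c \<in> carrier B" "rid B c = rsum (rid B a) (rid B b)" "ljoin (LL A) x y = rid A (\<eta> i c)"
      unfolding a(2) b(2) by (rule stage_join[OF i a(1) b(1)])
    have "\<kappa> s (ljoin (LL A) x y) = ljoin (Sub_pow TYPE('f) (n i s)) (\<kappa> s x) (\<kappa> s y)" if s: "s \<in> S i" for s
    proof -
      have "\<kappa> s (ljoin (LL A) x y) = colspace s c" unfolding c(3) by (rule \<kappa>[OF s c(1)])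
      moreover have "\<kappa> s x = colspace s a" unfolding a(2) by (rule \<kappa>[OF s a(1)])
      moreover have "\<kappa> s y = colspace s b" unfolding b(2) by (rule \<kappa>[OF s b(1)])
      ultimately show ?thesis
        by (simp only: subpow_join[OF colspace_in colspace_in] colspace_rsum[OF s a(1) b(1) c(1,2)])
    qed
    then show ?thesis using 1 c(3) stageI[OF c(1)] by simp
  next
    case (2 x y)
    have x: "x \<in> stage i" and y: "y \<in> stage i" using xs 2 by auto
    obtain a where a: "a \<in> carrier (Bi i)" "x = rid A (\<eta> i a)" using x by (rule stageE)
    obtain b where b: "b \<in> carrier (Bi i)" "y = rid A (\<eta> i b)" using y by (rule stageE)
    obtain c where c: "c \<in> carrier B" "rid B c = rid B a \<inter> rid B b" "lmeet (LL A) x y = rid A (\<eta> i c)"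
      unfolding a(2) b(2) by (rule stage_meet[OF i a(1) b(1)])
    have "\<kappa> s (lmeet (LL A) x y) = lmeet (Sub_pow TYPE('f) (n i s)) (\<kappa> s x) (\<kappa> s y)" if s: "s \<in> S i" for s
    proof -
      have "\<kappa> s (lmeet (LL A) x y) = colspace s c" unfolding c(3) by (rule \<kappa>[OF s c(1)])
      moreover have "\<kappa> s x = colspace s a" unfolding a(2) by (rule \<kappa>[OF s a(1)])
      moreover have "\<kappa> s y = colspace s b" unfolding b(2) by (rule \<kappa>[OF s b(1)])
      ultimately show ?thesis
        by (simp only: subpow_meet[OF colspace_in colspace_in] colspace_rinter[OF s a(1) b(1) c(1,2)])
    qed
    then show ?thesis using 2 c(3) stageI[OF c(1)] by simp
  next
    case 3
    have z: "opn (LL A) Zero [] = rid A (\<eta> i (\<lambda>_. 0))"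
      by (simp only: A.LL_zero A_zero[OF i, symmetric] A.rid_zero)
    have "act s (\<lambda>_. 0) v = 0" for s v by (auto simp: act_def)
    then have "colspace s (\<lambda>_. 0) = {0}" for s by (auto simp: colspace_def)
    then show ?thesis unfolding 3 z using \<kappa>[OF _ zero_in] stageI[OF zero_in] by (simp add: subpow_zero)
  next
    case 4
    have z: "opn (LL A) One [] = rid A (\<eta> i \<one>\<^bsub>B\<^esub>)"
      by (rule A.LL_one[OF unital_left_unit[OF un[OF 4(3)] i]])
    have "colspace s \<one>\<^bsub>B\<^esub> = {v. \<forall>k\<ge>n i s. v k = 0}" if s: "s \<in> S i" for s
    proof -
      have a: "act s \<one>\<^bsub>B\<^esub> v = (\<lambda>k. if k < n i s then v k else 0)" for v
      proof (rule ext)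
        fix k
        have "(\<Sum>l<n i s. \<one>\<^bsub>B\<^esub> ((s, k), (s, l)) * v l) = (\<Sum>l<n i s. if l = k then v k else 0)" if "k < n i s"
          using that s by (intro sum.cong) (auto simp: block_ring_def positions_def)
        then show "act s \<one>\<^bsub>B\<^esub> v k = (if k < n i s then v k else 0)" by (simp add: act_def)
      qed
      have "v \<in> colspace s \<one>\<^bsub>B\<^esub>" if "\<forall>k\<ge>n i s. v k = 0" for v
      proof -
        have "act s \<one>\<^bsub>B\<^esub> v = v" using that unfolding a by (auto simp: fun_eq_iff)
        then show ?thesis unfolding colspace_def by (intro range_eqI[of _ _ v]) simp
      qed
      then have "{v. \<forall>k\<ge>n i s. v k = 0} \<subseteq> colspace s \<one>\<^bsub>B\<^esub>" by blast
      moreover have "colspace s \<one>\<^bsub>B\<^esub> \<subseteq> {v. \<forall>k\<ge>n i s. v k = 0}" unfolding colspace_def a by auto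
      ultimately show ?thesis by blast
    qed
    then show ?thesis unfolding 4 z using \<kappa>[OF _ one_in] stageI[OF one_in] by (simp add: subpow_one)
  qed
  have inj: "x = y" if x: "x \<in> stage i" and y: "y \<in> stage i" and eq: "\<And>s. s \<in> S i \<Longrightarrow> \<kappa> s x = \<kappa> s y" for x y
  proof -
    obtain a where a: "a \<in> carrier (Bi i)" "x = rid A (\<eta> i a)" using x by (rule stageE)
    obtain b where b: "b \<in> carrier (Bi i)" "y = rid A (\<eta> i b)" using y by (rule stageE)
    have e: "colspace s a = colspace s b" if s: "s \<in> S i" for s
      using eq[OF s] unfolding a(2) b(2) \<kappa>[OF s a(1)] \<kappa>[OF s b(1)] .
    have "a \<in> rid B b" "b \<in> rid B a"
      by (rule colspace_inj[OF a(1) b(1)], simp add: e, rule colspace_inj[OF b(1) a(1)], simp add: e)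
    then have "rid B a = rid B b"
      using rid_subset_iff[OF a(1) b(1)] rid_subset_iff[OF b(1) a(1)] by (metis subset_antisym)
    then show ?thesis unfolding a(2) b(2) by (rule f.hom_rid_eq[OF a(1) b(1)])
  qed
  let ?\<Phi> = "\<lambda>\<phi> Bm. \<exists>s\<in>S i. \<phi> = \<kappa> s \<and> Bm = Sub_pow TYPE('f) (n i s)"
  show "\<exists>D (\<Phi> :: ('u set \<Rightarrow> (nat \<Rightarrow> 'f) set) \<Rightarrow> ((nat \<Rightarrow> 'f) set, lat_op) ualg \<Rightarrow> bool). D \<noteq> {} \<and> \<rho> ` (tvars u \<union> tvars v) \<subseteq> D \<and>
      (\<forall>\<phi> Bm. \<Phi> \<phi> Bm \<longrightarrow> hom_on \<tau> D (LL A) Bm \<phi> \<and> \<phi> ` D \<subseteq> carrier Bm \<and> satisfies Bm (u, v)) \<and>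
      (\<forall>x\<in>D. \<forall>y\<in>D. (\<forall>\<phi> Bm. \<Phi> \<phi> Bm \<longrightarrow> \<phi> x = \<phi> y) \<longrightarrow> x = y) \<and> hom_on \<tau> D (LL A) (LL A) (\<lambda>x. x)"
  proof (rule exI[of _ "stage i"], rule exI[of _ ?\<Phi>], intro conjI allI ballI impI)
    show "stage i \<noteq> {}" using stageI[OF zero_in] by blast
    show "hom_on \<tau> (stage i) (LL A) (LL A) (\<lambda>x. x)" using op unfolding hom_on_def by simp
    show "\<rho> ` (tvars u \<union> tvars v) \<subseteq> stage i" by (rule \<rho>i)
    show "x = y" if "x \<in> stage i" "y \<in> stage i" "\<forall>\<phi> Bm. ?\<Phi> \<phi> Bm \<longrightarrow> \<phi> x = \<phi> y" for x y
      using inj[OF that(1,2)] that(3) by blast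
  next
    fix \<phi> and Bm :: "((nat \<Rightarrow> 'f) set, lat_op) ualg" assume "?\<Phi> \<phi> Bm"
    then obtain s where s: "s \<in> S i" "\<phi> = \<kappa> s" "Bm = Sub_pow TYPE('f) (n i s)" by blast
    show "hom_on \<tau> (stage i) (LL A) Bm \<phi>" unfolding hom_on_def s(2,3) using op s(1) by blast
    show "satisfies Bm (u, v)" unfolding s(3) by (rule sat[OF i s(1)])
    show "\<phi> ` stage i \<subseteq> carrier Bm"
    proof
      fix X assume "X \<in> \<phi> ` stage i"
      then obtain U where U: "U \<in> stage i" "X = \<phi> U" by (elim imageE)
      obtain a where a: "a \<in> carrier (Bi i)" "U = rid A (\<eta> i a)" using U(1) by (rule stageE)
      show "X \<in> carrier Bm" unfolding U(2) s(2,3) a(2) \<kappa>[OF s(1) a(1)] by (rule colspace_in)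
    qed
  qed
qed

end

lemma subpow_satisfies_le:
  assumes \<tau>: "lat_sig \<tau>" and ok: "trm_ok \<tau> u" "trm_ok \<tau> v" and le: "k \<le> n"
    and sat: "satisfies (Sub_pow TYPE('f::field) n) (u, v)"
  shows "satisfies (Sub_pow TYPE('f) k) (u, v)"
proof -
  let ?n = "Sub_pow TYPE('f) n" and ?k = "Sub_pow TYPE('f) k"
  define F where "F = {v :: nat \<Rightarrow> 'f. \<forall>i\<ge>k. v i = 0}"
  define tr where "tr = (\<lambda>(v :: nat \<Rightarrow> 'f) i. if i < k then v i else 0)"
  have tr_add: "tr (v + w) = tr v + tr w" for v w by (auto simp: tr_def)
  have tr_F: "tr v \<in> F" for v by (simp add: F_def tr_def)
  have tr_id: "v \<in> F \<Longrightarrow> tr v = v" for v by (auto simp: F_def tr_def fun_eq_iff)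
  \<comment> \<open>The subspaces of \<open>F\<^sup>n\<close> compatible with the coordinate projection onto \<open>F\<^sup>k\<close> form a bounded
    sublattice of which the subspaces of \<open>F\<^sup>k\<close> are a homomorphic image.\<close>
  define D where "D = {U \<in> carrier ?n. \<forall>v\<in>U. tr v \<in> U}"
  have Fs: "fun_space.subspace F" by (auto simp: F_def fun_space.subspace_def fscale_def)
  have sub: "fun_space.subspace U" if "U \<in> D" for U using that by (simp add: D_def Sub_pow_def)
  have car: "U \<in> carrier ?n" if "U \<in> D" for U using that by (simp add: D_def)
  have phi: "U \<inter> F \<in> carrier ?k" if "U \<in> D" for U
    using fun_space.subspace_inter[OF sub[OF that] Fs] by (auto simp: Sub_pow_def F_def)
  have hom: "hom_on \<tau> D ?n ?k (\<lambda>U. U \<inter> F)"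
    unfolding hom_on_def
  proof (intro allI impI, elim conjE)
    fix g xs assume g: "\<tau> g = Some (length xs)" and xs: "set xs \<subseteq> D"
    show "opn ?n g xs \<in> D \<and> opn ?n g xs \<inter> F = opn ?k g (map (\<lambda>U. U \<inter> F) xs)"
      using \<tau> g
    proof (cases rule: lat_sig_cases)
      case (1 X Y)
      have XY: "X \<in> D" "Y \<in> D" using xs 1 by auto
      let ?Z = "{v + w | v w. v \<in> X \<and> w \<in> Y}"
      have j: "opn ?n g xs = ?Z" using 1 subpow_join[OF car[OF XY(1)] car[OF XY(2)]] by simp
      have "fun_space.subspace ?Z" by (rule fun_space.subspace_sums[OF sub[OF XY(1)] sub[OF XY(2)]])
      moreover have "?Z \<subseteq> {v. \<forall>i\<ge>n. v i = 0}"
      proof clarify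
        fix v w and i :: nat assume "v \<in> X" "w \<in> Y" "n \<le> i"
        then have "v i = 0" "w i = 0" using car[OF XY(1)] car[OF XY(2)] by (auto simp: Sub_pow_def)
        then show "(v + w) i = 0" by simp
      qed
      moreover have "tr z \<in> ?Z" if "z \<in> ?Z" for z
        using that XY tr_add unfolding D_def by blast
      ultimately have ZD: "?Z \<in> D" by (simp add: D_def Sub_pow_def)
      have "?Z \<inter> F = {v + w | v w. v \<in> X \<inter> F \<and> w \<in> Y \<inter> F}"
      proof
        show "?Z \<inter> F \<subseteq> {v + w | v w. v \<in> X \<inter> F \<and> w \<in> Y \<inter> F}"
        proof
          fix z assume z: "z \<in> ?Z \<inter> F"
          then obtain v w where vw: "z = v + w" "v \<in> X" "w \<in> Y" by blast
          have "z = tr v + tr w" using tr_id[of z] z vw(1) tr_add by simp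
          moreover have "tr v \<in> X \<inter> F" "tr w \<in> Y \<inter> F" using vw XY tr_F by (auto simp: D_def)
          ultimately show "z \<in> {v + w | v w. v \<in> X \<inter> F \<and> w \<in> Y \<inter> F}" by blast
        qed
        show "{v + w | v w. v \<in> X \<inter> F \<and> w \<in> Y \<inter> F} \<subseteq> ?Z \<inter> F"
          using fun_space.subspace_add[OF Fs] by blast
      qed
      then have "?Z \<inter> F = ljoin ?k (X \<inter> F) (Y \<inter> F)" by (simp only: subpow_join[OF phi[OF XY(1)] phi[OF XY(2)]])
      then show ?thesis using j ZD 1 by simp
    next
      case (2 X Y)
      have XY: "X \<in> D" "Y \<in> D" using xs 2 by auto
      have j: "opn ?n g xs = X \<inter> Y" using 2 subpow_meet[OF car[OF XY(1)] car[OF XY(2)]] by simp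
      have "X \<inter> Y \<in> D" using XY fun_space.subspace_inter[OF sub[OF XY(1)] sub[OF XY(2)]] by (auto simp: D_def Sub_pow_def)
      moreover have "X \<inter> Y \<inter> F = lmeet ?k (X \<inter> F) (Y \<inter> F)"
        unfolding subpow_meet[OF phi[OF XY(1)] phi[OF XY(2)]] by blast
      ultimately show ?thesis using j 2 by simp
    next
      case 3
      have "tr 0 = 0" by (auto simp: tr_def)
      then have "{0} \<in> D" by (auto simp: D_def Sub_pow_def fun_space.subspace_single_0)
      moreover have "{0} \<inter> F = {0}" by (auto simp: F_def)
      ultimately show ?thesis unfolding 3 by (simp add: subpow_zero)
    next
      case 4
      have "{v. \<forall>i\<ge>n. v i = 0} \<in> D" using le by (auto simp: D_def Sub_pow_def tr_def fun_space.subspace_def fscale_def)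
      moreover have "{v. \<forall>i\<ge>n. v i = 0} \<inter> F = F" using le by (auto simp: F_def)
      ultimately show ?thesis unfolding 4 by (simp add: subpow_one F_def)
    qed
  qed
  show ?thesis unfolding satisfies_def fst_conv snd_conv
  proof (intro allI impI)
    fix \<rho> :: "nat \<Rightarrow> (nat \<Rightarrow> 'f) set" assume r: "range \<rho> \<subseteq> carrier ?k"
    have D: "\<rho> i \<in> D \<and> \<rho> i = \<rho> i \<inter> F" for i
    proof -
      have i: "\<rho> i \<in> carrier ?k" using r by blast
      then have sF: "\<rho> i \<subseteq> F" by (auto simp: Sub_pow_def F_def)
      then have "\<forall>v\<in>\<rho> i. tr v \<in> \<rho> i" using tr_id by (metis subsetD)
      then show ?thesis using i sF le by (auto simp: D_def Sub_pow_def)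
    qed
    then have "range \<rho> \<subseteq> carrier ?n" using car by blast
    then have "trm_value ?n \<rho> u = trm_value ?n \<rho> v" using sat by (simp add: satisfies_def)
    moreover have "trm_value ?n \<rho> u \<inter> F = trm_value ?k \<rho> u"
      using trm_value_hom[OF hom ok(1), of \<rho> \<rho>] D by blast
    moreover have "trm_value ?n \<rho> v \<inter> F = trm_value ?k \<rho> v"
      using trm_value_hom[OF hom ok(2), of \<rho> \<rho>] D by blast
    ultimately show "trm_value ?k \<rho> u = trm_value ?k \<rho> v" by metis
  qed
qed

section \<open>The prime field and the size of the limit\<close>

lemma ex_countable_subfield: "\<exists>P :: 'f::field set. subfield_set P \<and> countable P"
proof -
  define P where "P = range (\<lambda>(a, b). of_int a * inverse (of_int b) :: 'f)"
  have I: "of_int a * inverse (of_int b) \<in> P" for a b unfolding P_def by (rule range_eqI[of _ _ "(a, b)"]) simp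
  \<comment> \<open>\<open>P\<close> is the prime field. As \<open>inverse 0 = 0\<close>, a fraction
    whose denominator vanishes in the field equals 0/1, so a nonzero denominator can be assumed;
    this matters in positive characteristic.\<close>
  have E: "\<exists>a b. x = of_int a * inverse (of_int b) \<and> (of_int b :: 'f) \<noteq> 0" if "x \<in> P" for x
  proof -
    obtain a b where ab: "x = of_int a * inverse (of_int b)" using \<open>x \<in> P\<close> by (auto simp: P_def)
    show ?thesis
    proof (cases "(of_int b :: 'f) = 0")
      case True
      then have "x = of_int 0 * inverse (of_int 1)" using ab by simp
      moreover have "(of_int 1 :: 'f) \<noteq> 0" by simp
      ultimately show ?thesis by blast
    qed (use ab in blast)
  qed
  have "subfield_set P"
  proof
    show "0 \<in> P" using I[of 0 1] by simp
    show "1 \<in> P" using I[of 1 1] by simp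
    fix x assume x: "x \<in> P"
    then obtain a b where ab: "x = of_int a * inverse (of_int b)" "(of_int b :: 'f) \<noteq> 0" using E by blast
    show "- x \<in> P" using I[of "-a" b] ab by simp
    show "inverse x \<in> P" using I[of b a] ab by (simp add: mult.commute)
    fix y assume "y \<in> P"
    then obtain c d where cd: "y = of_int c * inverse (of_int d)" "(of_int d :: 'f) \<noteq> 0" using E by blast
    have "x + y = of_int (a * d + c * b) * inverse (of_int (b * d))" using ab cd by (simp add: field_simps)
    then show "x + y \<in> P" using I by metis
    have "x * y = of_int (a * c) * inverse (of_int (b * d))" using ab cd by (simp add: field_simps)
    then show "x * y \<in> P" using I by metis
  qed
  moreover have "countable P" unfolding P_def by (rule countable_image) simp
  ultimately show ?thesis by blast
qed

text \<open>An element is determined by its entries at finitely many positions.\<close>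

lemma countable_block_ring:
  assumes "finite S" "countable P"
  shows "countable (carrier (block_ring P S n :: ('s pos \<times> 's pos \<Rightarrow> 'f::field) ring))"
proof -
  have "finite (positions S n \<times> positions S n)" using finite_positions[OF assms(1)] by simp
  then obtain l where l: "set l = positions S n \<times> positions S n" using finite_list by blast
  let ?C = "carrier (block_ring P S n :: ('s pos \<times> 's pos \<Rightarrow> 'f) ring)"
  have "inj_on (\<lambda>a. map a l) ?C"
  proof (rule inj_onI, rule ext)
    fix a b x assume a: "a \<in> ?C" and b: "b \<in> ?C" and eq: "map a l = map b l"
    show "a x = b x"
    proof (cases "x \<in> set l")
      case False
      then have nx: "x \<notin> same_block S n" using l by (auto simp: same_block_def)
      have z: "c x = 0" if "c \<in> ?C" for c :: "'s pos \<times> 's pos \<Rightarrow> 'f"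
        using that nx unfolding block_ring_def partial_object.select_convs mem_Collect_eq by blast
      show ?thesis using z[OF a] z[OF b] by simp
    qed (use eq in auto)
  qed
  moreover have "(\<lambda>a. map a l) ` ?C \<subseteq> lists P" by (auto simp: block_ring_def)
  then have "countable ((\<lambda>a. map a l) ` ?C)" using countable_lists[OF assms(2)] countable_subset by blast
  ultimately show ?thesis using countable_image_inj_on by blast
qed

lemma aleph1_Field: "\<not> finite (Field aleph1)" "Card_order aleph1"
  using cardSuc_finite[OF natLeq_Card_order] cardSuc_Card_order[OF natLeq_Card_order]
  by (simp_all add: Field_natLeq)

lemma countable_le_aleph1: "countable X \<Longrightarrow> |X| \<le>o aleph1"
  using countable_card_le_natLeq[of X] cardSuc_ordLeq[OF natLeq_Card_order] ordLeq_transitive by blast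

lemma aleph1_le_uncountable:
  assumes "uncountable (UNIV :: 'u set)"
  shows "aleph1 \<le>o |UNIV :: 'u set|"
proof -
  have "\<not> |UNIV :: 'u set| \<le>o natLeq" using assms countable_card_le_natLeq by blast
  then have "natLeq <o |UNIV :: 'u set|"
    using not_ordLeq_iff_ordLess[OF natLeq_Well_order card_of_Well_order] by blast
  then show ?thesis using cardSuc_least[OF natLeq_Card_order card_of_Card_order] by blast
qed

text \<open>The direct limit is a quotient of the disjoint union of the stages. A class is named by
  encoding one chosen member, so a universe as large as the disjoint union is enough.\<close>

lemma ex_limit_embedding:
  fixes lq :: "'i \<Rightarrow> 'i \<Rightarrow> bool" and h :: "'i \<Rightarrow> 'i \<Rightarrow> 's pos \<times> 's pos \<rightharpoonup> 's pos \<times> 's pos"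
    and C :: "'i \<Rightarrow> ('s pos \<times> 's pos \<Rightarrow> 'f::field) set"
  assumes card: "|Sigma I C| \<le>o |UNIV :: 'u set|"
    and lq_refl: "\<And>i. lq i i" and lq_trans: "\<And>i j k. \<lbrakk>k \<in> I; lq i j; lq j k\<rbrakk> \<Longrightarrow> lq i k"
    and directed: "\<And>i j. \<lbrakk>i \<in> I; j \<in> I\<rbrakk> \<Longrightarrow> \<exists>k\<in>I. lq i k \<and> lq j k"
    and h_comp: "\<And>i j k. \<lbrakk>k \<in> I; lq i j; lq j k\<rbrakk> \<Longrightarrow> h i j \<circ>\<^sub>m h j k = h i k"
  shows "\<exists>\<eta> :: 'i \<Rightarrow> ('s pos \<times> 's pos \<Rightarrow> 'f) \<Rightarrow> 'u. \<forall>i\<in>I. \<forall>j\<in>I. \<forall>a\<in>C i. \<forall>b\<in>C j.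
    \<eta> i a = \<eta> j b \<longleftrightarrow> (\<exists>k\<in>I. lq i k \<and> lq j k \<and> bhom (h i k) a = bhom (h j k) b)"
proof -
  obtain enc :: "'i \<times> ('s pos \<times> 's pos \<Rightarrow> 'f) \<Rightarrow> 'u" where enc: "inj_on enc (Sigma I C)"
    using card card_of_ordLeq[of "Sigma I C" "UNIV :: 'u set"] by blast
  define r where "r = {((i, a), (j, b)). i \<in> I \<and> j \<in> I \<and> a \<in> C i \<and> b \<in> C j \<and>
     (\<exists>k\<in>I. lq i k \<and> lq j k \<and> bhom (h i k) a = bhom (h j k) b)}"
  have tr: "trans r"
  proof (rule transI)
    fix x y z assume xy: "(x, y) \<in> r" and yz: "(y, z) \<in> r"
    obtain i a where x: "x = (i, a)" by (cases x)
    obtain j b where y: "y = (j, b)" by (cases y)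
    obtain l c where z: "z = (l, c)" by (cases z)
    obtain k where k: "k \<in> I" "lq i k" "lq j k" "bhom (h i k) a = bhom (h j k) b" using xy by (auto simp: r_def x y)
    obtain k' where k': "k' \<in> I" "lq j k'" "lq l k'" "bhom (h j k') b = bhom (h l k') c" using yz by (auto simp: r_def y z)
    obtain p where p: "p \<in> I" "lq k p" "lq k' p" using directed k(1) k'(1) by blast
    have t: "bhom (h q p) (bhom (h i' q) a') = bhom (h i' p) a'" if "lq i' q" "lq q p" for i' q a'
      by (simp add: bhom_comp h_comp[OF p(1) that])
    have "bhom (h i p) a = bhom (h l p) c"
      using t[OF k(2) p(2), of a] t[OF k(3) p(2), of b] t[OF k'(2) p(3), of b] t[OF k'(3) p(3), of c] k(4) k'(4) by metis
    moreover have "lq i p" "lq l p" using lq_trans p k k' by blast+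
    ultimately show "(x, z) \<in> r" using xy yz p(1) by (auto simp: r_def x y z)
  qed
  have "refl_on (Sigma I C) r" by (rule refl_onI) (auto simp: r_def intro: lq_refl)
  moreover have "sym r" by (rule symI) (auto simp: r_def)
  moreover have "r \<subseteq> Sigma I C \<times> Sigma I C" by (auto simp: r_def)
  ultimately have eqv: "equiv (Sigma I C) r" using tr by (auto simp: equiv_def)
  define rep where "rep = (\<lambda>x. SOME y. y \<in> r `` {x})"
  have rep: "(x, rep x) \<in> r" if "x \<in> Sigma I C" for x
    using someI[of "\<lambda>y. y \<in> r `` {x}" x] eqv that by (auto simp: rep_def equiv_def refl_on_def)
  have rep_eq: "rep x = rep y \<longleftrightarrow> (x, y) \<in> r" if "x \<in> Sigma I C" "y \<in> Sigma I C" for x y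
  proof
    assume e: "rep x = rep y"
    have "(rep y, y) \<in> r" using rep[OF that(2)] eqv by (auto simp: equiv_def dest: symD)
    then show "(x, y) \<in> r" using transD[OF tr rep[OF that(1)]] e by simp
  next
    assume "(x, y) \<in> r"
    then have "r `` {x} = r `` {y}" using equiv_class_eq[OF eqv] by blast
    then show "rep x = rep y" unfolding rep_def by (simp only:)
  qed
  have rin: "rep x \<in> Sigma I C" if "x \<in> Sigma I C" for x using rep[OF that] eqv by (auto simp: equiv_def)
  have "enc (rep (i, a)) = enc (rep (j, b)) \<longleftrightarrow> (\<exists>k\<in>I. lq i k \<and> lq j k \<and> bhom (h i k) a = bhom (h j k) b)"
    if "i \<in> I" "j \<in> I" "a \<in> C i" "b \<in> C j" for i j a b
  proof -
    have s: "(i, a) \<in> Sigma I C" "(j, b) \<in> Sigma I C" using that by auto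
    have "enc (rep (i, a)) = enc (rep (j, b)) \<longleftrightarrow> ((i, a), (j, b)) \<in> r"
      using inj_on_eq_iff[OF enc rin[OF s(1)] rin[OF s(2)]] rep_eq[OF s] by simp
    then show ?thesis using that by (simp add: r_def)
  qed
  then show ?thesis by (intro exI[of _ "\<lambda>i a. enc (rep (i, a))"]) blast
qed


section \<open>Small subalgebras with the same compact congruences\<close>

lemma card_lists_le_aleph1:
  assumes X: "|X| \<le>o aleph1"
  shows "|lists X| \<le>o aleph1"
proof -
  have n: "|{l \<in> lists X. length l = k}| \<le>o aleph1" for k
  proof (induction k)
    case 0
    have "{l \<in> lists X. length l = 0} = {[]}" by auto
    then show ?case by (simp add: countable_le_aleph1)
  next
    case (Suc k)
    have "{l \<in> lists X. length l = Suc k} \<subseteq> (\<lambda>(x, l). x # l) ` (X \<times> {l \<in> lists X. length l = k})"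
      by (auto simp: length_Suc_conv image_iff)
    then have "|{l \<in> lists X. length l = Suc k}| \<le>o |(\<lambda>(x, l). x # l) ` (X \<times> {l \<in> lists X. length l = k})|"
      by (rule card_of_mono1)
    moreover have "|(\<lambda>(x, l). x # l) ` (X \<times> {l \<in> lists X. length l = k})| \<le>o |X \<times> {l \<in> lists X. length l = k}|"
      by (rule card_of_image)
    moreover have "|X \<times> {l \<in> lists X. length l = k}| \<le>o aleph1"
      by (rule card_of_Times_ordLeq_infinite_Field[OF aleph1_Field(1) X Suc aleph1_Field(2)])
    ultimately show ?case by (rule ordLeq_transitive[OF ordLeq_transitive])
  qed
  have "lists X = (\<Union>k. {l \<in> lists X. length l = k})" by auto
  moreover have "|\<Union>k. {l \<in> lists X. length l = k}| \<le>o aleph1"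
    by (rule card_of_UNION_ordLeq_infinite_Field[OF aleph1_Field(1) aleph1_Field(2)])
      (auto intro: n countable_le_aleph1)
  ultimately show ?thesis by simp
qed

text \<open>Countably many closure steps suffice, because the entries of a list from the union all
  occur at some finite step; each step adds at most \<open>aleph1\<close> elements.\<close>

lemma ex_closed_superset:
  fixes F :: "'a list \<Rightarrow> 'a set"
  assumes X: "X \<subseteq> C" "|X| \<le>o aleph1" and F: "\<And>l. l \<in> lists C \<Longrightarrow> finite (F l) \<and> F l \<subseteq> C"
  shows "\<exists>M. X \<subseteq> M \<and> M \<subseteq> C \<and> |M| \<le>o aleph1 \<and> (\<forall>l\<in>lists M. F l \<subseteq> M)"
proof -
  define step where "step = (\<lambda>Y. Y \<union> (\<Union>l\<in>lists Y. F l))"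
  define Z where "Z = (\<lambda>k. (step ^^ k) X)"
  have Z: "Z 0 = X" "Z (Suc k) = Z k \<union> (\<Union>l\<in>lists (Z k). F l)" for k by (simp_all add: Z_def step_def)
  have ZC: "Z k \<subseteq> C \<and> |Z k| \<le>o aleph1" for k
  proof (induction k)
    case (Suc k)
    have l: "l \<in> lists C" if "l \<in> lists (Z k)" for l using Suc that by auto
    have "|\<Union>l\<in>lists (Z k). F l| \<le>o aleph1"
      by (rule card_of_UNION_ordLeq_infinite_Field[OF aleph1_Field card_lists_le_aleph1])
        (use Suc F l in \<open>auto intro!: countable_le_aleph1 intro: countable_finite\<close>)
    then have "|Z (Suc k)| \<le>o aleph1" unfolding Z
      using Suc by (intro card_of_Un_ordLeq_infinite_Field[OF aleph1_Field(1) _ _ aleph1_Field(2)]) auto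
    moreover have "Z (Suc k) \<subseteq> C" unfolding Z using Suc F l by blast
    ultimately show ?case by blast
  qed (use X Z in simp)
  have inc: "Z j \<subseteq> Z k" if "j \<le> k" for j k
    by (rule lift_Suc_mono_le[OF _ that]) (simp add: Z)
  define M where "M = (\<Union>k. Z k)"
  have "F l \<subseteq> M" if l: "l \<in> lists M" for l
  proof -
    have "\<exists>k. set xs \<subseteq> Z k" if "set xs \<subseteq> M" for xs
      using that
    proof (induction xs)
      case (Cons x xs)
      then obtain j k where "set xs \<subseteq> Z j" "x \<in> Z k" by (auto simp: M_def)
      then have "set (x # xs) \<subseteq> Z (max j k)" using inc[of j "max j k"] inc[of k "max j k"] by auto
      then show ?case by blast
    qed simp
    from this[of l] l obtain k where "set l \<subseteq> Z k" unfolding in_lists_conv_set by blast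
    then have "l \<in> lists (Z k)" by auto
    then have "F l \<subseteq> Z (Suc k)" unfolding Z by blast
    then show ?thesis unfolding M_def by blast
  qed
  moreover have "|M| \<le>o aleph1" unfolding M_def
    by (rule card_of_UNION_ordLeq_infinite_Field[OF aleph1_Field]) (use ZC in \<open>auto intro: countable_le_aleph1\<close>)
  moreover have "X \<subseteq> M" unfolding M_def using Z(1) by blast
  moreover have "M \<subseteq> C" unfolding M_def using ZC by blast
  ultimately show ?thesis by blast
qed

abbreviation sub_algebra :: "('a, 'o) ualg \<Rightarrow> 'a set \<Rightarrow> ('a, 'o) ualg" where
  "sub_algebra A M \<equiv> \<lparr>carrier = M, opn = opn A\<rparr>"

lemma sub_algebra_is_algebra: "subuniverse \<sigma> A M \<Longrightarrow> M \<noteq> {} \<Longrightarrow> is_algebra \<sigma> (sub_algebra A M)"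
  by (simp add: is_algebra_def subuniverse_def)

lemma trm_value_sub_algebra: "trm_value (sub_algebra A M) \<rho> t = trm_value A \<rho> t"
  by (induction t) (simp_all cong: map_cong)

lemma models_sub_algebra:
  "\<lbrakk>A \<in> models \<sigma> E; subuniverse \<sigma> A M; M \<noteq> {}\<rbrakk> \<Longrightarrow> sub_algebra A M \<in> models \<sigma> E"
  unfolding models_def satisfies_def
  using sub_algebra_is_algebra[of \<sigma> A M] by (auto simp: trm_value_sub_algebra subuniverse_def)

text \<open>A derivation of \<open>(x, y)\<close> from \<open>Y\<close> uses finitely many elements.
  Derivations are avoided: the pairs that have a finite witness set form a congruence containing
  \<open>Y\<close>, which therefore includes the generated one.\<close>

lemma Cg_finite_witness:
  assumes A: "is_algebra \<sigma> A" and Y: "Y \<subseteq> carrier A \<times> carrier A" and xy: "(x, y) \<in> Cg \<sigma> A Y"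
  shows "\<exists>F. finite F \<and> F \<subseteq> carrier A \<and>
    (\<forall>M. subuniverse \<sigma> A M \<and> F \<subseteq> M \<and> Y \<subseteq> M \<times> M \<longrightarrow> (x, y) \<in> Cg \<sigma> (sub_algebra A M) Y)"
proof -
  define w where "w = (\<lambda>F x y. finite F \<and> F \<subseteq> carrier A \<and>
    (\<forall>M. subuniverse \<sigma> A M \<and> F \<subseteq> M \<and> Y \<subseteq> M \<times> M \<longrightarrow> (x, y) \<in> Cg \<sigma> (sub_algebra A M) Y))"
  define \<theta> where "\<theta> = {(x, y). x \<in> carrier A \<and> y \<in> carrier A \<and> (\<exists>F. w F x y)}"
  have cgM: "congruence \<sigma> (sub_algebra A M) (Cg \<sigma> (sub_algebra A M) Y)"
    if "subuniverse \<sigma> A M" "x \<in> M" "Y \<subseteq> M \<times> M" for M x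
    by (rule Cg_congruence[OF sub_algebra_is_algebra]) (use that in auto)
  have wI: "w F x y" if "finite F" "F \<subseteq> carrier A"
    "\<And>M. \<lbrakk>subuniverse \<sigma> A M; F \<subseteq> M; Y \<subseteq> M \<times> M\<rbrakk> \<Longrightarrow> (x, y) \<in> Cg \<sigma> (sub_algebra A M) Y" for F x y
    using that by (simp add: w_def)
  have wD: "finite F" "F \<subseteq> carrier A" "\<lbrakk>subuniverse \<sigma> A M; F \<subseteq> M; Y \<subseteq> M \<times> M\<rbrakk> \<Longrightarrow> (x, y) \<in> Cg \<sigma> (sub_algebra A M) Y"
    if "w F x y" for F x y M using that by (simp_all add: w_def)
  have "congruence \<sigma> A \<theta>"
  proof (rule congruenceI)
    show "\<theta> \<subseteq> carrier A \<times> carrier A" by (auto simp: \<theta>_def)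
    show "(x, x) \<in> \<theta>" if x: "x \<in> carrier A" for x
    proof -
      have "w {x} x x" by (rule wI) (use x cgM congruenceD(2) in fastforce)+
      then show ?thesis using x by (auto simp: \<theta>_def)
    qed
    show "(y, x) \<in> \<theta>" if xy: "(x, y) \<in> \<theta>" for x y
    proof -
      obtain F where F: "w F x y" "x \<in> carrier A" "y \<in> carrier A" using xy by (auto simp: \<theta>_def)
      have "w (insert x F) y x"
        by (rule wI) (use wD[OF F(1)] F congruenceD(3)[OF cgM[of _ x]] in auto)
      then show ?thesis using F by (auto simp: \<theta>_def)
    qed
    show "(x, z) \<in> \<theta>" if xy: "(x, y) \<in> \<theta>" and yz: "(y, z) \<in> \<theta>" for x y z
    proof -
      obtain F where F: "w F x y" "x \<in> carrier A" "y \<in> carrier A" using xy by (auto simp: \<theta>_def)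
      obtain G where G: "w G y z" "z \<in> carrier A" using yz by (auto simp: \<theta>_def)
      have "w (insert x (F \<union> G)) x z"
      proof (rule wI)
        fix M assume M: "subuniverse \<sigma> A M" "insert x (F \<union> G) \<subseteq> M" "Y \<subseteq> M \<times> M"
        show "(x, z) \<in> Cg \<sigma> (sub_algebra A M) Y"
          by (rule congruenceD(4)[OF cgM[of _ x], of M x y z]) (use M wD(3)[OF F(1)] wD(3)[OF G(1)] in auto)
      qed (use wD[OF F(1)] wD[OF G(1)] F in auto)
      then show ?thesis using F G by (auto simp: \<theta>_def)
    qed
    fix f xs ys assume f: "\<sigma> f = Some (length xs)" and l: "list_all2 (\<lambda>x y. (x, y) \<in> \<theta>) xs ys"
    have len: "length xs = length ys" using l by (rule list_all2_lengthD)
    have "\<forall>k<length xs. \<exists>F. w F (xs ! k) (ys ! k)" using l by (auto simp: \<theta>_def list_all2_conv_all_nth)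
    then obtain G where G: "\<And>k. k < length xs \<Longrightarrow> w (G k) (xs ! k) (ys ! k)" by metis
    have xA: "set xs \<subseteq> carrier A" "set ys \<subseteq> carrier A" using l by (auto simp: \<theta>_def list_all2_conv_all_nth in_set_conv_nth)
    then have oA: "opn A f xs \<in> carrier A" "opn A f ys \<in> carrier A"
      using A f len unfolding is_algebra_def by metis+
    \<comment> \<open>Including a value in the witness set keeps \<open>M\<close> nonempty, as
      \<open>cgM\<close> demands an element of \<open>M\<close>.\<close>
    let ?F = "insert (opn A f xs) (\<Union>k<length xs. G k)"
    have "w ?F (opn A f xs) (opn A f ys)"
    proof (rule wI)
      show "finite ?F" "?F \<subseteq> carrier A" using wD(1,2)[OF G] oA by auto
      fix M assume M: "subuniverse \<sigma> A M" "?F \<subseteq> M" "Y \<subseteq> M \<times> M"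
      have "list_all2 (\<lambda>x y. (x, y) \<in> Cg \<sigma> (sub_algebra A M) Y) xs ys"
        unfolding list_all2_conv_all_nth
      proof (intro conjI allI impI, rule len)
        fix k assume k: "k < length xs"
        have "G k \<subseteq> M" using M(2) k by auto
        then show "(xs ! k, ys ! k) \<in> Cg \<sigma> (sub_algebra A M) Y" by (rule wD(3)[OF G[OF k] M(1) _ M(3)])
      qed
      then show "(opn A f xs, opn A f ys) \<in> Cg \<sigma> (sub_algebra A M) Y"
        using congruenceD(5)[OF cgM[OF M(1) _ M(3)] f, of "opn A f xs" ys] M(2) by simp
    qed
    then show "(opn A f xs, opn A f ys) \<in> \<theta>" using oA by (auto simp: \<theta>_def)
  qed
  note \<theta>_cong = this
  have "Y \<subseteq> \<theta>"
  proof
    fix p assume p: "p \<in> Y"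
    have "w {} (fst p) (snd p)" by (rule wI) (use p in \<open>auto intro: hull_inc\<close>)
    then show "p \<in> \<theta>" using Y p by (auto simp: \<theta>_def)
  qed
  then have "Cg \<sigma> A Y \<subseteq> \<theta>" using \<theta>_cong by (rule hull_minimal)
  then have "(x, y) \<in> \<theta>" using xy by (rule subsetD)
  then show ?thesis unfolding \<theta>_def w_def by (elim CollectE case_prodE Pair_inject) simp
qed

text \<open>A Loewenheim-Skolem argument: \<open>X\<close> is closed under the operations and under
  finite witness sets for pairs in generated congruences. Each list of elements raises only finitely
  many such demands.\<close>

lemma ex_small_subalgebra:
  assumes A: "is_algebra \<sigma> A" and sg: "finite (dom \<sigma>)" and X: "X \<subseteq> carrier A" "|X| \<le>o aleph1"
  shows "\<exists>M. subuniverse \<sigma> A M \<and> X \<subseteq> M \<and> |M| \<le>o aleph1 \<and>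
    (\<forall>Y x y. finite Y \<and> Y \<subseteq> M \<times> M \<and> x \<in> M \<and> y \<in> M \<and> (x, y) \<in> Cg \<sigma> A Y \<longrightarrow> (x, y) \<in> Cg \<sigma> (sub_algebra A M) Y)"
proof -
  define w where "w = (\<lambda>x y Y. SOME F. finite F \<and> F \<subseteq> carrier A \<and>
    (\<forall>M. subuniverse \<sigma> A M \<and> F \<subseteq> M \<and> Y \<subseteq> M \<times> M \<longrightarrow> (x, y) \<in> Cg \<sigma> (sub_algebra A M) Y))"
  have w: "finite (w x y Y) \<and> w x y Y \<subseteq> carrier A \<and>
    (\<forall>M. subuniverse \<sigma> A M \<and> w x y Y \<subseteq> M \<and> Y \<subseteq> M \<times> M \<longrightarrow> (x, y) \<in> Cg \<sigma> (sub_algebra A M) Y)"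
    if "Y \<subseteq> carrier A \<times> carrier A" "(x, y) \<in> Cg \<sigma> A Y" for x y Y
    unfolding w_def by (rule someI_ex[OF Cg_finite_witness[OF A that]])
  define Q where "Q = (\<lambda>l. {(x, y, Y). x \<in> set l \<and> y \<in> set l \<and> Y \<subseteq> set l \<times> set l \<and> (x, y) \<in> Cg \<sigma> A Y})"
  define F where "F = (\<lambda>l. {opn A f l | f. \<sigma> f = Some (length l)} \<union> (\<Union>(x, y, Y)\<in>Q l. w x y Y))"
  have "finite (F l) \<and> F l \<subseteq> carrier A" if l: "l \<in> lists (carrier A)" for l
  proof -
    have "{opn A f l | f. \<sigma> f = Some (length l)} \<subseteq> (\<lambda>f. opn A f l) ` dom \<sigma>" by auto
    then have 1: "finite {opn A f l | f. \<sigma> f = Some (length l)}" using sg finite_subset by blast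
    have 2: "{opn A f l | f. \<sigma> f = Some (length l)} \<subseteq> carrier A" using A l unfolding is_algebra_def by auto
    have "Q l \<subseteq> set l \<times> set l \<times> Pow (set l \<times> set l)" by (auto simp: Q_def)
    then have 3: "finite (Q l)" by (rule finite_subset) simp
    have 4: "finite (w x y Y) \<and> w x y Y \<subseteq> carrier A" if "(x, y, Y) \<in> Q l" for x y Y
      using w[of Y x y] that l by (auto simp: Q_def)
    have "(case q of (x, y, Y) \<Rightarrow> finite (w x y Y) \<and> w x y Y \<subseteq> carrier A)" if "q \<in> Q l" for q
      using 4 that by (cases q) simp
    then have "finite (\<Union>(x, y, Y)\<in>Q l. w x y Y)" "(\<Union>(x, y, Y)\<in>Q l. w x y Y) \<subseteq> carrier A"
      using 3 by fastforce+
    then show ?thesis using 1 2 by (simp add: F_def)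
  qed
  from ex_closed_superset[OF X this] obtain M where
    M0: "X \<subseteq> M \<and> M \<subseteq> carrier A \<and> |M| \<le>o aleph1 \<and> (\<forall>l\<in>lists M. F l \<subseteq> M)"
    by (rule exE)
  then have M: "X \<subseteq> M" "M \<subseteq> carrier A" "|M| \<le>o aleph1" "\<And>l. l \<in> lists M \<Longrightarrow> F l \<subseteq> M" by simp_all
  have s: "subuniverse \<sigma> A M" unfolding subuniverse_def
  proof (intro conjI allI impI, rule M(2))
    fix f xs assume a: "\<sigma> f = Some (length xs) \<and> set xs \<subseteq> M"
    then have "opn A f xs \<in> F xs" by (auto simp: F_def)
    then show "opn A f xs \<in> M" using M(4)[of xs] a by auto
  qed
  moreover have "(x, y) \<in> Cg \<sigma> (sub_algebra A M) Y"
    if a: "finite Y" "Y \<subseteq> M \<times> M" "x \<in> M" "y \<in> M" "(x, y) \<in> Cg \<sigma> A Y" for Y x y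
  proof -
    have "finite ({x, y} \<union> fst ` Y \<union> snd ` Y)" using a(1) by simp
    from finite_list[OF this] obtain l where l: "set l = {x, y} \<union> fst ` Y \<union> snd ` Y" by (rule exE)
    have "fst ` Y \<subseteq> M" "snd ` Y \<subseteq> M" using a(2) by auto
    then have "l \<in> lists M" using a(3,4) by (simp add: lists_eq_set l)
    have "Y \<subseteq> set l \<times> set l" unfolding l by force
    then have "(x, y, Y) \<in> Q l" unfolding Q_def using a(5) by (simp add: l)
    then have "w x y Y \<subseteq> F l" unfolding F_def by (intro le_supI2 UN_upper[of "(x, y, Y)", THEN order_trans[rotated]]) simp_all
    then have "w x y Y \<subseteq> M" using M(4)[OF \<open>l \<in> lists M\<close>] by blast
    moreover have "Y \<subseteq> carrier A \<times> carrier A" using a(2) M(2) by blast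
    ultimately show ?thesis using w[OF _ a(5)] s a(2) by simp
  qed
  ultimately show ?thesis using M(1,3) by (intro exI[of _ M] conjI allI impI) simp_all
qed

lemma congruence_restrict:
  assumes "congruence \<sigma> A \<theta>" "subuniverse \<sigma> A M"
  shows "congruence \<sigma> (sub_algebra A M) (\<theta> \<inter> M \<times> M)"
proof (rule congruenceI)
  fix f xs ys assume f: "\<sigma> f = Some (length xs)" and l: "list_all2 (\<lambda>x y. (x, y) \<in> \<theta> \<inter> M \<times> M) xs ys"
  have "list_all2 (\<lambda>x y. (x, y) \<in> \<theta>) xs ys" using l by (auto intro: list_all2_mono)
  then have 1: "(opn A f xs, opn A f ys) \<in> \<theta>" by (rule congruenceD(5)[OF assms(1) f])
  have "set xs \<subseteq> M" "set ys \<subseteq> M" "length ys = length xs"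
    using l by (auto simp: list_all2_conv_all_nth in_set_conv_nth)
  then have "opn A f xs \<in> M" "opn A f ys \<in> M" using assms(2) f unfolding subuniverse_def by metis+
  then show "(opn (sub_algebra A M) f xs, opn (sub_algebra A M) f ys) \<in> \<theta> \<inter> M \<times> M" using 1 by simp
next
  show "(x, z) \<in> \<theta> \<inter> M \<times> M" if "(x, y) \<in> \<theta> \<inter> M \<times> M" "(y, z) \<in> \<theta> \<inter> M \<times> M" for x y z
    using that congruenceD(4)[OF assms(1)] by blast
qed (use congruenceD(2,3)[OF assms(1)] assms(2) in \<open>auto simp: subuniverse_def\<close>)

text \<open>\<open>M\<close> is made to contain generators of every compact congruence of
  \<open>A\<close>, so none is lost. Closure under witnesses makes the finitely generated
  congruences of \<open>M\<close> the traces of those generated in \<open>A\<close>, so the order is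
  reflected.\<close>

lemma small_subalgebra_fg:
  assumes A: "is_algebra \<sigma> A" and sg: "finite (dom \<sigma>)" and card: "|fg_congruences \<sigma> A| \<le>o aleph1"
  shows "\<exists>M h. subuniverse \<sigma> A M \<and> M \<noteq> {} \<and> |M| \<le>o aleph1 \<and>
    order_iso h (fg_congruences \<sigma> (sub_algebra A M)) (fg_congruences \<sigma> A)"
proof -
  have "\<forall>\<theta>\<in>fg_congruences \<sigma> A. \<exists>X. finite X \<and> X \<subseteq> carrier A \<times> carrier A \<and> \<theta> = Cg \<sigma> A X"
    by (auto simp: fg_congruences_def)
  then obtain G where G: "\<And>\<theta>. \<theta> \<in> fg_congruences \<sigma> A \<Longrightarrow> finite (G \<theta>) \<and> G \<theta> \<subseteq> carrier A \<times> carrier A \<and> \<theta> = Cg \<sigma> A (G \<theta>)" by metis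
  obtain c where c: "c \<in> carrier A" using A by (auto simp: is_algebra_def)
  \<comment> \<open>The element \<open>c\<close> keeps \<open>M\<close> nonempty.\<close>
  define X where "X = {c} \<union> (\<Union>\<theta>\<in>fg_congruences \<sigma> A. fst ` G \<theta> \<union> snd ` G \<theta>)"
  have X: "X \<subseteq> carrier A" using c G by (fastforce simp: X_def)
  have "|X| \<le>o aleph1" unfolding X_def
  proof (rule card_of_Un_ordLeq_infinite_Field[OF aleph1_Field(1) _ _ aleph1_Field(2)])
    show "|\<Union>\<theta>\<in>fg_congruences \<sigma> A. fst ` G \<theta> \<union> snd ` G \<theta>| \<le>o aleph1"
      by (rule card_of_UNION_ordLeq_infinite_Field[OF aleph1_Field card])
        (use G in \<open>auto intro!: countable_le_aleph1 countable_finite\<close>)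
  qed (simp add: countable_le_aleph1)
  from ex_small_subalgebra[OF A sg X this] obtain M where M0: "subuniverse \<sigma> A M \<and> X \<subseteq> M \<and> |M| \<le>o aleph1 \<and>
    (\<forall>Y x y. finite Y \<and> Y \<subseteq> M \<times> M \<and> x \<in> M \<and> y \<in> M \<and> (x, y) \<in> Cg \<sigma> A Y \<longrightarrow> (x, y) \<in> Cg \<sigma> (sub_algebra A M) Y)"
    by (rule exE)
  then have M: "subuniverse \<sigma> A M" "X \<subseteq> M" "|M| \<le>o aleph1" by simp_all
  have cl: "(x, y) \<in> Cg \<sigma> (sub_algebra A M) Y" if "finite Y" "Y \<subseteq> M \<times> M" "x \<in> M" "y \<in> M" "(x, y) \<in> Cg \<sigma> A Y" for Y x y
    using M0[THEN conjunct2, THEN conjunct2, THEN conjunct2, rule_format, of Y x y] that by simp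
  have Mne: "M \<noteq> {}" using M(2) by (auto simp: X_def)
  have MA: "M \<subseteq> carrier A" using M(1) by (simp add: subuniverse_def)
  let ?M = "sub_algebra A M"
  have Malg: "is_algebra \<sigma> ?M" by (rule sub_algebra_is_algebra[OF M(1) Mne])
  have incl: "Cg \<sigma> ?M Y \<subseteq> Cg \<sigma> A Z \<inter> M \<times> M \<longleftrightarrow> Y \<subseteq> Cg \<sigma> A Z"
    if "Y \<subseteq> M \<times> M" "Z \<subseteq> M \<times> M" for Y Z
  proof -
    have "Z \<subseteq> carrier A \<times> carrier A" using that MA by blast
    then show ?thesis using Cg_least[OF congruence_restrict[OF Cg_congruence[OF A] M(1)], of Z Y] that by blast
  qed
  have mono: "Cg \<sigma> ?M Y \<subseteq> Cg \<sigma> ?M Z \<longleftrightarrow> Cg \<sigma> A Y \<subseteq> Cg \<sigma> A Z"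
    if Y: "finite Y" "Y \<subseteq> M \<times> M" and Z: "finite Z" "Z \<subseteq> M \<times> M" for Y Z
  proof -
    have cA: "congruence \<sigma> A (Cg \<sigma> A Z)" using Cg_congruence[OF A] Z MA by blast
    have cM: "congruence \<sigma> ?M (Cg \<sigma> ?M Z)" using Cg_congruence[OF Malg] Z by simp
    have "Cg \<sigma> A Z \<inter> M \<times> M \<subseteq> Cg \<sigma> ?M Z" using cl[OF Z] by auto
    moreover have "Cg \<sigma> ?M Z \<subseteq> Cg \<sigma> A Z" using incl[OF Z(2) Z(2)] hull_subset[of Z "congruence \<sigma> A"] by blast
    ultimately have "Y \<subseteq> Cg \<sigma> ?M Z \<longleftrightarrow> Y \<subseteq> Cg \<sigma> A Z" using Y(2) by blast
    then show ?thesis using Cg_least[OF cA] Cg_least[OF cM] by simp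
  qed
  have eqv: "Cg \<sigma> ?M Y = Cg \<sigma> ?M Z \<longleftrightarrow> Cg \<sigma> A Y = Cg \<sigma> A Z"
    if Y: "finite Y" "Y \<subseteq> M \<times> M" and Z: "finite Z" "Z \<subseteq> M \<times> M" for Y Z
    unfolding set_eq_subset mono[OF Y Z] mono[OF Z Y] by (rule refl)
  define h where "h = (\<lambda>\<theta>. Cg \<sigma> A (SOME Y. finite Y \<and> Y \<subseteq> M \<times> M \<and> \<theta> = Cg \<sigma> ?M Y))"
  have h: "h (Cg \<sigma> ?M Y) = Cg \<sigma> A Y" if Y: "finite Y" "Y \<subseteq> M \<times> M" for Y
  proof -
    let ?Z = "SOME Z. finite Z \<and> Z \<subseteq> M \<times> M \<and> Cg \<sigma> ?M Y = Cg \<sigma> ?M Z"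
    have Z: "finite ?Z \<and> ?Z \<subseteq> M \<times> M \<and> Cg \<sigma> ?M Y = Cg \<sigma> ?M ?Z"
      by (rule someI[of "\<lambda>Z. finite Z \<and> Z \<subseteq> M \<times> M \<and> Cg \<sigma> ?M Y = Cg \<sigma> ?M Z" Y]) (use Y in simp)
    note e = eqv[OF Y Z[THEN conjunct1] Z[THEN conjunct2, THEN conjunct1], THEN iffD1, OF Z[THEN conjunct2, THEN conjunct2]]
    show ?thesis unfolding h_def by (rule e[symmetric])
  qed
  have fgM: "fg_congruences \<sigma> ?M = {Cg \<sigma> ?M Y | Y. finite Y \<and> Y \<subseteq> M \<times> M}" by (simp add: fg_congruences_def)
  have fgE: "\<exists>Y. a = Cg \<sigma> ?M Y \<and> finite Y \<and> Y \<subseteq> M \<times> M" if "a \<in> fg_congruences \<sigma> ?M" for a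
    using that unfolding fgM by (rule CollectD)
  have "order_iso h (fg_congruences \<sigma> ?M) (fg_congruences \<sigma> A)"
    unfolding order_iso_def
  proof (intro conjI ballI bij_betw_imageI)
    show "a \<subseteq> b \<longleftrightarrow> h a \<subseteq> h b" if ab: "a \<in> fg_congruences \<sigma> ?M" "b \<in> fg_congruences \<sigma> ?M" for a b
    proof -
      obtain Y Z where YZ: "finite Y" "Y \<subseteq> M \<times> M" "finite Z" "Z \<subseteq> M \<times> M" "a = Cg \<sigma> ?M Y" "b = Cg \<sigma> ?M Z"
        using fgE[OF ab(1)] fgE[OF ab(2)] by (elim exE conjE)
      show ?thesis unfolding YZ(5,6) h[OF YZ(1,2)] h[OF YZ(3,4)] by (rule mono[OF YZ(1-4)])
    qed
    show "inj_on h (fg_congruences \<sigma> ?M)"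
    proof (rule inj_onI)
      fix a b assume ab: "a \<in> fg_congruences \<sigma> ?M" "b \<in> fg_congruences \<sigma> ?M" and e: "h a = h b"
      obtain Y Z where YZ: "finite Y" "Y \<subseteq> M \<times> M" "finite Z" "Z \<subseteq> M \<times> M" "a = Cg \<sigma> ?M Y" "b = Cg \<sigma> ?M Z"
        using fgE[OF ab(1)] fgE[OF ab(2)] by (elim exE conjE)
      have "Cg \<sigma> A Y = Cg \<sigma> A Z" using e unfolding YZ(5,6) h[OF YZ(1,2)] h[OF YZ(3,4)] .
      then show "a = b" unfolding YZ(5,6) eqv[OF YZ(1-4)] .
    qed
    show "h ` fg_congruences \<sigma> ?M = fg_congruences \<sigma> A"
    proof
      show "h ` fg_congruences \<sigma> ?M \<subseteq> fg_congruences \<sigma> A"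
      proof
        fix \<theta> assume "\<theta> \<in> h ` fg_congruences \<sigma> ?M"
        then obtain Y where Y: "finite Y" "Y \<subseteq> M \<times> M" "\<theta> = h (Cg \<sigma> ?M Y)"
          using fgE by (elim imageE) (metis (no_types))
        have e: "\<theta> = Cg \<sigma> A Y" using Y(3) h[OF Y(1,2)] by (simp only:)
        have "Y \<subseteq> carrier A \<times> carrier A" using Y(2) MA by auto
        with Y(1) e show "\<theta> \<in> fg_congruences \<sigma> A"
          unfolding fg_congruences_def by (intro CollectI exI[of _ Y] conjI)
      qed
      show "fg_congruences \<sigma> A \<subseteq> h ` fg_congruences \<sigma> ?M"
      proof
        fix \<theta> assume t: "\<theta> \<in> fg_congruences \<sigma> A"
        have "G \<theta> \<subseteq> X \<times> X" using t by (force simp: X_def)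
        then have "finite (G \<theta>)" "G \<theta> \<subseteq> M \<times> M" "\<theta> = Cg \<sigma> A (G \<theta>)" using G[OF t] M(2) by auto
        then have "\<theta> = h (Cg \<sigma> ?M (G \<theta>))" "Cg \<sigma> ?M (G \<theta>) \<in> fg_congruences \<sigma> ?M"
          unfolding fgM by (simp only: h, intro CollectI exI[of _ "G \<theta>"] conjI refl)
        then show "\<theta> \<in> h ` fg_congruences \<sigma> ?M" by (rule image_eqI)
      qed
    qed
  qed
  then show ?thesis using M(1,3) Mne by blast
qed

text \<open>A lattice of right ideals has sets of ring elements as its members; this moves it into
  the universe over which the classes of algebras range.\<close>

lemma transport_algebra:
  fixes A :: "('a, 'o) ualg" and g :: "'a \<Rightarrow> 'u"
  assumes A: "A \<in> models \<sigma> E" and E: "E \<subseteq> identities \<sigma>" and g: "inj_on g (carrier A)"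
  shows "\<exists>B h. B \<in> models \<sigma> E \<and> order_iso h (congruences \<sigma> A) (congruences \<sigma> (B :: ('u, 'o) ualg))"
proof -
  let ?C = "carrier A"
  define k where "k = the_inv_into ?C g"
  have kg: "k (g x) = x" if "x \<in> ?C" for x using the_inv_into_f_f[OF g that] by (simp add: k_def)
  define B where "B = \<lparr>carrier = g ` ?C, opn = \<lambda>f xs. g (opn A f (map k xs))\<rparr>"
  have C: "carrier B = g ` ?C" by (simp add: B_def)
  have alg: "is_algebra \<sigma> A" and sat: "\<And>e. e \<in> E \<Longrightarrow> satisfies A e" using A by (auto simp: models_def)
  have kB: "k y \<in> ?C" "g (k y) = y" if "y \<in> carrier B" for y using that kg by (auto simp: C)
  have cl: "opn A f (map k xs) \<in> ?C" if "\<sigma> f = Some (length xs)" "set xs \<subseteq> carrier B" for f xs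
  proof -
    have "set (map k xs) \<subseteq> ?C" "\<sigma> f = Some (length (map k xs))" using kB(1) that by auto
    then show ?thesis using alg unfolding is_algebra_def by blast
  qed
  have algB: "is_algebra \<sigma> B" unfolding is_algebra_def
    using alg cl by (auto simp: B_def is_algebra_def)
  have hom: "hom_on \<sigma> (carrier B) B A k" unfolding hom_on_def
  proof (intro allI impI, elim conjE)
    fix f xs assume a: "\<sigma> f = Some (length xs)" "set xs \<subseteq> carrier B"
    have "opn B f xs = g (opn A f (map k xs))" by (simp add: B_def)
    then show "opn B f xs \<in> carrier B \<and> k (opn B f xs) = opn A f (map k xs)"
      using cl[OF a] kg[OF cl[OF a]] by (auto simp: C)
  qed
  have "satisfies B e" if e: "e \<in> E" for e
    unfolding satisfies_def
  proof (intro allI impI)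
    fix \<rho> :: "nat \<Rightarrow> 'u" assume r: "range \<rho> \<subseteq> carrier B"
    have ok: "trm_ok \<sigma> (fst e)" "trm_ok \<sigma> (snd e)" using e E by (auto simp: identities_def)
    have v: "trm_value B \<rho> t \<in> carrier B \<and> k (trm_value B \<rho> t) = trm_value A (k \<circ> \<rho>) t" if "trm_ok \<sigma> t" for t
      by (rule trm_value_hom[OF hom that]) (use r in auto)
    have "range (k \<circ> \<rho>) \<subseteq> ?C" using r kB by auto
    then have "trm_value A (k \<circ> \<rho>) (fst e) = trm_value A (k \<circ> \<rho>) (snd e)" using sat[OF e] by (simp add: satisfies_def)
    then show "trm_value B \<rho> (fst e) = trm_value B \<rho> (snd e)" using v[OF ok(1)] v[OF ok(2)] kB(2) by metis
  qed
  then have Bm: "B \<in> models \<sigma> E" using algB by (simp add: models_def)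
  define h where "h = (\<lambda>\<theta>. map_prod g g ` \<theta>)"
  have h_iff: "(g x, g y) \<in> h \<theta> \<longleftrightarrow> (x, y) \<in> \<theta>" if "x \<in> ?C" "y \<in> ?C" "\<theta> \<subseteq> ?C \<times> ?C" for x y \<theta>
  proof
    assume "(g x, g y) \<in> h \<theta>"
    then obtain a b where ab: "(a, b) \<in> \<theta>" "g x = g a" "g y = g b" by (auto simp: h_def)
    then have "x = a" "y = b" using g that by (auto dest: inj_onD)
    then show "(x, y) \<in> \<theta>" using ab by simp
  qed (auto simp: h_def intro: rev_image_eqI)
  have h_sub: "h \<theta> \<subseteq> carrier B \<times> carrier B" if "\<theta> \<subseteq> ?C \<times> ?C" for \<theta> using that by (auto simp: h_def C)
  have h_cong: "congruence \<sigma> B (h \<theta>)" if \<theta>: "congruence \<sigma> A \<theta>" for \<theta>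
  proof (rule congruenceI)
    note sub = congruenceD(1)[OF \<theta>]
    show "h \<theta> \<subseteq> carrier B \<times> carrier B" by (rule h_sub[OF sub])
    show "(x, x) \<in> h \<theta>" if "x \<in> carrier B" for x using that congruenceD(2)[OF \<theta>] h_iff[OF _ _ sub] by (auto simp: C)
    show "(y, x) \<in> h \<theta>" if "(x, y) \<in> h \<theta>" for x y using that congruenceD(3)[OF \<theta>] by (auto simp: h_def intro: rev_image_eqI)
    show "(x, z) \<in> h \<theta>" if xy: "(x, y) \<in> h \<theta>" "(y, z) \<in> h \<theta>" for x y z
    proof -
      have "x \<in> g ` ?C" "y \<in> g ` ?C" "z \<in> g ` ?C" using h_sub[OF sub] xy by (auto simp: C)
      then obtain a b c where abc: "a \<in> ?C" "b \<in> ?C" "c \<in> ?C" "x = g a" "y = g b" "z = g c" by (elim imageE)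
      then show ?thesis using xy h_iff[OF _ _ sub] congruenceD(4)[OF \<theta>] by metis
    qed
    fix f xs ys assume f: "\<sigma> f = Some (length xs)" and l: "list_all2 (\<lambda>x y. (x, y) \<in> h \<theta>) xs ys"
    have len: "length ys = length xs" using l by (simp add: list_all2_lengthD)
    have xB: "set xs \<subseteq> carrier B" "set ys \<subseteq> carrier B"
    proof -
      have D: "x \<in> carrier B \<and> y \<in> carrier B" if "(x, y) \<in> h \<theta>" for x y using h_sub[OF sub] that by auto
      have "set xs \<subseteq> carrier B \<and> set ys \<subseteq> carrier B"
        by (rule list_all2_induct[OF l]) (simp_all add: D)
      then show "set xs \<subseteq> carrier B" "set ys \<subseteq> carrier B" by simp_all
    qed
    have kk: "(k x, k y) \<in> \<theta>" if "(x, y) \<in> h \<theta>" for x y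
      using h_iff[OF kB(1) kB(1) sub, of x y] that h_sub[OF sub] kB(2) by auto
    have "list_all2 (\<lambda>x y. (x, y) \<in> \<theta>) (map k xs) (map k ys)"
      using l by (auto simp: list_all2_map1 list_all2_map2 intro: list_all2_mono[OF _ kk])
    then have "(opn A f (map k xs), opn A f (map k ys)) \<in> \<theta>" using congruenceD(5)[OF \<theta>, of f "map k xs"] f by simp
    then show "(opn B f xs, opn B f ys) \<in> h \<theta>" by (auto simp: B_def h_def intro: rev_image_eqI)
  qed
  have "order_iso h (congruences \<sigma> A) (congruences \<sigma> B)" unfolding order_iso_def
  proof (intro conjI ballI bij_betw_imageI)
    show mono: "a \<subseteq> b \<longleftrightarrow> h a \<subseteq> h b" if ab: "a \<in> congruences \<sigma> A" "b \<in> congruences \<sigma> A" for a b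
    proof
      assume ss: "h a \<subseteq> h b"
      have s: "a \<subseteq> ?C \<times> ?C" "b \<subseteq> ?C \<times> ?C" using ab congruenceD(1) by blast+
      show "a \<subseteq> b"
      proof clarify
        fix x y assume xy: "(x, y) \<in> a"
        then have c: "x \<in> ?C" "y \<in> ?C" using s by auto
        then show "(x, y) \<in> b" using h_iff[OF c s(1)] h_iff[OF c s(2)] xy ss by blast
      qed
    qed (auto simp: h_def)
    show "inj_on h (congruences \<sigma> A)"
      using mono by (intro inj_onI) (metis order_refl subset_antisym)
    show "h ` congruences \<sigma> A = congruences \<sigma> B"
    proof
      show "h ` congruences \<sigma> A \<subseteq> congruences \<sigma> B" using h_cong by blast
      show "congruences \<sigma> B \<subseteq> h ` congruences \<sigma> A"
      proof
        fix \<beta> assume b: "\<beta> \<in> congruences \<sigma> B"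
        then have bc: "congruence \<sigma> B \<beta>" by simp
        define \<alpha> where "\<alpha> = {(x, y). x \<in> ?C \<and> y \<in> ?C \<and> (g x, g y) \<in> \<beta>}"
        have "h \<alpha> = \<beta>"
        proof
          show "\<beta> \<subseteq> h \<alpha>"
          proof clarify
            fix x y assume xy: "(x, y) \<in> \<beta>"
            then have c: "x \<in> carrier B" "y \<in> carrier B" using congruenceD(1)[OF bc] by auto
            have "(k x, k y) \<in> \<alpha>" using kB[OF c(1)] kB[OF c(2)] xy by (simp add: \<alpha>_def)
            then show "(x, y) \<in> h \<alpha>" using kB(2)[OF c(1)] kB(2)[OF c(2)] by (force simp: h_def)
          qed
        qed (auto simp: h_def \<alpha>_def)
        moreover have "congruence \<sigma> A \<alpha>"
        proof (rule congruenceI)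
          show "(x, x) \<in> \<alpha>" if "x \<in> ?C" for x using that congruenceD(2)[OF bc] by (auto simp: \<alpha>_def C)
          show "(x, z) \<in> \<alpha>" if "(x, y) \<in> \<alpha>" "(y, z) \<in> \<alpha>" for x y z
            using that congruenceD(4)[OF bc] by (auto simp: \<alpha>_def)
          fix f xs ys assume f: "\<sigma> f = Some (length xs)" and l: "list_all2 (\<lambda>x y. (x, y) \<in> \<alpha>) xs ys"
          have len: "length ys = length xs" using l by (simp add: list_all2_lengthD)
          have xC: "set xs \<subseteq> ?C" "set ys \<subseteq> ?C" using l by (auto simp: \<alpha>_def list_all2_conv_all_nth in_set_conv_nth)
          have "list_all2 (\<lambda>x y. (x, y) \<in> \<beta>) (map g xs) (map g ys)"
            using l by (auto simp: list_all2_map1 list_all2_map2 \<alpha>_def intro: list_all2_mono)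
          then have 1: "(opn B f (map g xs), opn B f (map g ys)) \<in> \<beta>" using congruenceD(5)[OF bc, of f "map g xs"] f by simp
          have m: "map k (map g zs) = zs" if "set zs \<subseteq> ?C" for zs using that kg by (induction zs) auto
          have o: "opn A f xs \<in> ?C" "opn A f ys \<in> ?C" using alg f len xC unfolding is_algebra_def by metis+
          show "(opn A f xs, opn A f ys) \<in> \<alpha>" using 1 o m[OF xC(1)] m[OF xC(2)] by (simp add: \<alpha>_def B_def)
        qed (use congruenceD(3)[OF bc] in \<open>auto simp: \<alpha>_def\<close>)
        ultimately show "\<beta> \<in> h ` congruences \<sigma> A" by blast
      qed
    qed
  qed
  then show ?thesis using Bm by blast
qed


section \<open>Simple quotients\<close>

text \<open>The quotient by the kernel of \<open>rk s\<close> is carried by chosen representatives,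
  so as to stay in the same type. A congruence above the kernel is decided by whether it collapses
  \<open>rep s\<close>, which gives simplicity. On the quotient \<open>rk s\<close> is strictly
  increasing, which bounds chains, and a chain of \<open>K\<close> that realizes every value of
  \<open>rk s\<close> provides the length claimed.\<close>

lemma simple_quotient:
  fixes K :: "('a, lat_op) ualg"
  assumes K: "K \<in> models \<sigma> E" and E: "E \<subseteq> identities \<sigma>" and sg: "lat_sig \<sigma>"
    and fl: "finite_length_modular (carrier K) (ljoin K) (lmeet K)"
    and s: "s \<in> finite_length_modular.pclasses (carrier K) (ljoin K) (lmeet K)"
  shows "\<exists>Q :: ('a, lat_op) ualg. Q \<in> models \<sigma> E \<and> simple_algebra \<sigma> Q \<and> finite_length Q \<and>
    enat (finite_length_modular.rk (carrier K) (ljoin K) s (finite_length_modular.top (carrier K) (ljoin K))) \<le> lh Q"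
proof -
  let ?C = "carrier K"
  interpret finite_length_modular ?C "ljoin K" "lmeet K" by (rule fl)
  have alg: "is_algebra \<sigma> K" and sat: "\<And>e. e \<in> E \<Longrightarrow> satisfies K e" using K by (auto simp: models_def)
  define \<kappa> where "\<kappa> = ker (rk s)"
  note val = rk_valuation[OF s]
  have cg: "congruence \<sigma> K \<kappa>" unfolding congruence_iff_cong2[OF sg alg] \<kappa>_def by (rule ker_cong[OF val])
  define r where "r = (\<lambda>x. SOME y. (x, y) \<in> \<kappa>)"
  have xr: "(x, r x) \<in> \<kappa>" if "x \<in> ?C" for x unfolding r_def by (rule someI) (rule congruenceD(2)[OF cg that])
  have rC: "r x \<in> ?C" if "x \<in> ?C" for x using xr[OF that] congruenceD(1)[OF cg] by auto
  have r_eq: "r x = r y \<longleftrightarrow> (x, y) \<in> \<kappa>" if "x \<in> ?C" "y \<in> ?C" for x y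
  proof
    assume e: "r x = r y"
    have "(r x, y) \<in> \<kappa>" unfolding e by (rule congruenceD(3)[OF cg xr[OF that(2)]])
    then show "(x, y) \<in> \<kappa>" by (rule congruenceD(4)[OF cg xr[OF that(1)]])
  next
    assume a: "(x, y) \<in> \<kappa>"
    have "(x, z) \<in> \<kappa> \<longleftrightarrow> (y, z) \<in> \<kappa>" for z
      using congruenceD(4)[OF cg a, of z] congruenceD(4)[OF cg congruenceD(3)[OF cg a], of z] by blast
    then show "r x = r y" by (simp add: r_def)
  qed
  have rr: "r (r x) = r x" if "x \<in> ?C" for x using r_eq[OF that rC[OF that]] xr[OF that] by simp
  define Q where "Q = \<lparr>carrier = r ` ?C, opn = \<lambda>f xs. r (opn K f xs)\<rparr>"
  have QC: "carrier Q = r ` ?C" and Qo: "opn Q f xs = r (opn K f xs)" for f xs by (simp_all add: Q_def)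
  have sub: "carrier Q \<subseteq> ?C" using rC by (auto simp: QC)
  have rQ: "r u = u" if "u \<in> carrier Q" for u using that rr by (auto simp: QC)
  have Kcl: "opn K f xs \<in> ?C" if "\<sigma> f = Some (length xs)" "set xs \<subseteq> ?C" for f xs
    using alg that unfolding is_algebra_def by blast
  have hom: "hom_on \<sigma> ?C K Q r" unfolding hom_on_def
  proof (intro allI impI, elim conjE)
    fix f xs assume a: "\<sigma> f = Some (length xs)" "set xs \<subseteq> ?C"
    have "list_all2 (\<lambda>x y. (x, y) \<in> \<kappa>) xs (map r xs)" using a(2) xr by (auto simp: list_all2_map2 list_all2_same)
    then have "(opn K f xs, opn K f (map r xs)) \<in> \<kappa>" by (rule congruenceD(5)[OF cg a(1)])
    moreover have "set (map r xs) \<subseteq> ?C" "\<sigma> f = Some (length (map r xs))" using a rC by auto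
    ultimately show "opn K f xs \<in> ?C \<and> r (opn K f xs) = opn Q f (map r xs)"
      using r_eq[OF Kcl[OF a] Kcl[of f "map r xs"]] Kcl[OF a] by (simp add: Qo)
  qed
  have "opn Q f xs \<in> carrier Q" if "\<sigma> f = Some (length xs)" "set xs \<subseteq> carrier Q" for f xs
    using Kcl[OF that(1)] that(2) sub unfolding Qo QC by blast
  then have Qalg: "is_algebra \<sigma> Q" using nonempty by (auto simp: is_algebra_def QC)
  have "satisfies Q e" if e: "e \<in> E" for e
    unfolding satisfies_def
  proof (intro allI impI)
    fix \<rho> :: "nat \<Rightarrow> 'a" assume \<rho>: "range \<rho> \<subseteq> carrier Q"
    have ok: "trm_ok \<sigma> (fst e)" "trm_ok \<sigma> (snd e)" using e E by (auto simp: identities_def)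
    have \<rho>k: "\<rho> k \<in> ?C \<and> \<rho> k = r (\<rho> k)" for k
    proof -
      have "\<rho> k \<in> carrier Q" using \<rho> by (simp add: image_subset_iff)
      then show ?thesis using rQ[of "\<rho> k"] subsetD[OF sub, of "\<rho> k"] by simp
    qed
    have v: "r (trm_value K \<rho> t) = trm_value Q \<rho> t" if "trm_ok \<sigma> t" for t
      using trm_value_hom[OF hom that, of \<rho> \<rho>] \<rho>k by blast
    have "range \<rho> \<subseteq> ?C" using \<rho>k by auto
    then have "trm_value K \<rho> (fst e) = trm_value K \<rho> (snd e)" using sat[OF e] by (simp add: satisfies_def)
    then show "trm_value Q \<rho> (fst e) = trm_value Q \<rho> (snd e)" using v[OF ok(1)] v[OF ok(2)] by metis
  qed
  then have QV: "Q \<in> models \<sigma> E" using Qalg by (simp add: models_def)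
  obtain a b where ab: "rep s = (a, b)" by (cases "rep s")
  have abC: "a \<in> ?C" "b \<in> ?C" using rep_in[OF s] ab by auto
  have ab\<kappa>: "(a, b) \<notin> \<kappa>" using rep_ker[OF s s] ab by (simp add: \<kappa>_def)
  have full: "\<theta>' = Id_on (carrier Q) \<or> \<theta>' = carrier Q \<times> carrier Q" if \<theta>': "congruence \<sigma> Q \<theta>'" for \<theta>'
  proof -
    define \<theta> where "\<theta> = {(x, y). x \<in> ?C \<and> y \<in> ?C \<and> (r x, r y) \<in> \<theta>'}"
    have rin: "x \<in> ?C \<Longrightarrow> r x \<in> carrier Q" for x by (simp add: QC)
    have "congruence \<sigma> K \<theta>"
    proof (rule congruenceI)
      fix f xs ys assume f: "\<sigma> f = Some (length xs)" and l: "list_all2 (\<lambda>x y. (x, y) \<in> \<theta>) xs ys"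
      have len: "length ys = length xs" using l by (simp add: list_all2_lengthD)
      have "set xs \<subseteq> ?C \<and> set ys \<subseteq> ?C" by (rule list_all2_induct[OF l]) (simp_all add: \<theta>_def)
      then have C: "set xs \<subseteq> ?C" "set ys \<subseteq> ?C" by simp_all
      have fy: "\<sigma> f = Some (length ys)" using f len by simp
      have "list_all2 (\<lambda>x y. (x, y) \<in> \<theta>') (map r xs) (map r ys)"
        using l by (simp add: list_all2_conv_all_nth \<theta>_def)
      then have "(opn Q f (map r xs), opn Q f (map r ys)) \<in> \<theta>'"
        using congruenceD(5)[OF \<theta>', of f "map r xs"] f by simp
      moreover have "r (opn K f xs) = opn Q f (map r xs)" "r (opn K f ys) = opn Q f (map r ys)"
        using hom f fy C unfolding hom_on_def by blast+
      ultimately show "(opn K f xs, opn K f ys) \<in> \<theta>" using Kcl[OF f C(1)] Kcl[OF fy C(2)] by (simp add: \<theta>_def)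
    next
      show "\<theta> \<subseteq> ?C \<times> ?C" by (auto simp: \<theta>_def)
      show "(x, x) \<in> \<theta>" if "x \<in> ?C" for x using congruenceD(2)[OF \<theta>' rin[OF that]] that by (simp add: \<theta>_def)
      show "(y, x) \<in> \<theta>" if "(x, y) \<in> \<theta>" for x y
        using congruenceD(3)[OF \<theta>', of "r x" "r y"] that by (simp add: \<theta>_def)
      show "(x, z) \<in> \<theta>" if "(x, y) \<in> \<theta>" "(y, z) \<in> \<theta>" for x y z
        using congruenceD(4)[OF \<theta>', of "r x" "r y" "r z"] that by (simp add: \<theta>_def)
    qed
    then have c2: "cong2 ?C (ljoin K) (lmeet K) \<theta>" by (simp only: congruence_iff_cong2[OF sg alg])
    have repK: "rep t \<in> \<theta>" if t: "t \<in> pclasses" "t \<noteq> s" for t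
    proof -
      obtain c d where cd: "rep t = (c, d)" by (cases "rep t")
      have C: "c \<in> ?C" "d \<in> ?C" using rep_in[OF t(1)] cd by auto
      have "(c, d) \<in> \<kappa>" using rep_ker[OF t(1) s] t(2) cd by (simp add: \<kappa>_def)
      then show ?thesis using C r_eq[OF C] congruenceD(2)[OF \<theta>' rin[OF C(2)]] by (simp add: cd \<theta>_def)
    qed
    \<comment> \<open>The representatives of all classes other than \<open>s\<close> are already
      collapsed by \<open>\<kappa>\<close>, so only \<open>rep s\<close> is left to decide.\<close>
    have det: "(x, y) \<in> \<theta> \<longleftrightarrow> (x, y) \<in> \<kappa> \<or> rep s \<in> \<theta>" if "x \<in> ?C" "y \<in> ?C" for x y
      using cong2_determined[OF c2 order_refl that] repK s unfolding \<kappa>_def by blast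
    have \<theta>Q: "(u, v) \<in> \<theta>' \<longleftrightarrow> (u, v) \<in> \<theta>" if "u \<in> carrier Q" "v \<in> carrier Q" for u v
      using that rQ sub by (auto simp: \<theta>_def)
    have \<kappa>Q: "(u, v) \<in> \<kappa> \<longleftrightarrow> u = v" if "u \<in> carrier Q" "v \<in> carrier Q" for u v
      using r_eq[of u v] rQ[OF that(1)] rQ[OF that(2)] that sub by auto
    have "(u, v) \<in> \<theta>' \<longleftrightarrow> u = v \<or> rep s \<in> \<theta>" if "u \<in> carrier Q" "v \<in> carrier Q" for u v
      using \<theta>Q[OF that] \<kappa>Q[OF that] det[of u v] that sub by blast
    then show ?thesis using congruenceD(1)[OF \<theta>'] by (cases "rep s \<in> \<theta>") (auto simp: Id_on_def)
  qed
  have "Id_on (carrier Q) \<noteq> carrier Q \<times> carrier Q"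
  proof
    assume e: "Id_on (carrier Q) = carrier Q \<times> carrier Q"
    have "(r a, r b) \<in> carrier Q \<times> carrier Q" using abC by (simp add: QC)
    then have "r a = r b" unfolding e[symmetric] by auto
    then show False using ab\<kappa> r_eq[OF abC] by simp
  qed
  moreover have "congruence \<sigma> Q (Id_on (carrier Q))"
  proof (rule congruenceI)
    fix f xs ys assume f: "\<sigma> f = Some (length xs)" and l: "list_all2 (\<lambda>x y. (x, y) \<in> Id_on (carrier Q)) xs ys"
    have "xs = ys \<and> set xs \<subseteq> carrier Q" by (rule list_all2_induct[OF l]) auto
    then show "(opn Q f xs, opn Q f ys) \<in> Id_on (carrier Q)" using Qalg f unfolding is_algebra_def by blast
  qed auto
  ultimately have simple: "simple_algebra \<sigma> Q"
    unfolding simple_algebra_def using full congruence_full[OF Qalg] by blast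
  have lleQ: "rk s u \<le> rk s v \<and> (rk s u = rk s v \<longrightarrow> u = v)" if uv: "u \<in> carrier Q" "v \<in> carrier Q" "lle Q u v" for u v
  proof -
    have C: "u \<in> ?C" "v \<in> ?C" using uv sub by auto
    note j = jn_closed[OF C]
    have "r (ljoin K u v) = r v" using uv rQ[OF uv(2)] by (simp add: Qo)
    then have "(ljoin K u v, v) \<in> \<kappa>" using r_eq[OF j C(2)] by simp
    then have e: "rk s (ljoin K u v) = rk s v" using ker_iff_jn[OF val j C(2)] by (simp add: \<kappa>_def)
    then have 1: "rk s u \<le> rk s v" using valuation_mono[OF val C(1) j jn_upper1[OF C]] by simp
    have "u = v" if "rk s u = rk s v"
    proof -
      have "(u, v) \<in> \<kappa>" using e that ker_iff_jn[OF val C] by (simp add: \<kappa>_def)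
      then show ?thesis using r_eq[OF C] rQ uv by simp
    qed
    then show ?thesis using 1 by blast
  qed
  have "lh Q \<le> enat (rk s top)" unfolding lh_def
  proof (rule Sup_least, elim CollectE exE conjE)
    fix e k X assume X: "e = enat k" "X \<subseteq> carrier Q" "finite X" "card X = k + 1" "\<forall>x\<in>X. \<forall>y\<in>X. lle Q x y \<or> lle Q y x"
    have "inj_on (rk s) X"
    proof (rule inj_onI)
      fix x y assume xy: "x \<in> X" "y \<in> X" "rk s x = rk s y"
      then have "x \<in> carrier Q" "y \<in> carrier Q" "lle Q x y \<or> lle Q y x" using X(2,5) by auto
      then show "x = y" using lleQ[of x y] lleQ[of y x] xy(3) by metis
    qed
    moreover have "rk s ` X \<subseteq> {..rk s top}" using valuation_mono[OF val _ top(1) top(2)] X(2) sub by auto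
    ultimately have "card X \<le> card {..rk s top}" using card_inj_on_le by blast
    then show "e \<le> enat (rk s top)" using X(1,4) by simp
  qed
  then have fin: "lh Q < \<infinity>" by (metis enat_ord_simps(4) infinity_ileE not_infinity_eq)
  \<comment> \<open>Along a saturated chain a step outside class \<open>s\<close> adds no element to
    \<open>X\<close>, so that \<open>rk s\<close> is injective on \<open>X\<close> and takes every
    value in between.\<close>
  have "\<exists>X\<subseteq>?C. finite X \<and> card X = rk s b - rk s a + 1 \<and> inj_on (rk s) X \<and> (\<forall>x\<in>X. ljoin K a x = x) \<and>
      (\<forall>x\<in>X. \<forall>y\<in>X. ljoin K x y = y \<or> ljoin K y x = x)"
    if "a \<in> ?C" "b \<in> ?C" "ljoin K a b = b" for a b
    using that
  proof (induction rule: interval_induct)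
    case (refl a)
    then show ?case by (intro exI[of _ "{a}"]) (simp add: leq_refl)
  next
    case (step a c b)
    then have aC: "a \<in> ?C" "ljoin K a c = c" by (auto simp: cov_def)
    from step.IH obtain X where X: "X \<subseteq> ?C" "finite X" "card X = rk s b - rk s c + 1" "inj_on (rk s) X"
      "\<And>x. x \<in> X \<Longrightarrow> ljoin K c x = x" "\<And>x y. x \<in> X \<Longrightarrow> y \<in> X \<Longrightarrow> ljoin K x y = y \<or> ljoin K y x = x" by blast
    have ax: "ljoin K a x = x" if "x \<in> X" for x
      by (rule leq_trans[OF aC(1) step.hyps(2) _ aC(2) X(5)[OF that]]) (use that X(1) in blast)
    have cb: "rk s c \<le> rk s b" using valuation_mono[OF val step.hyps(2,3,4)] .
    show ?case
    proof (cases "rk s c = rk s a")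
      case True
      then show ?thesis using X ax by (intro exI[of _ X]) simp
    next
      case False
      then have ca: "rk s c = Suc (rk s a)" using rk_cov[OF s step.hyps(1)] by (simp split: if_splits)
      have cx: "rk s c \<le> rk s x" if "x \<in> X" for x
        by (rule valuation_mono[OF val step.hyps(2) _ X(5)[OF that]]) (use that X(1) in blast)
      have ni: "rk s a \<notin> rk s ` X" using cx ca by fastforce
      then have na: "a \<notin> X" by blast
      show ?thesis
      proof (intro exI[of _ "insert a X"] conjI)
        show "card (insert a X) = rk s b - rk s a + 1" using X(2,3) na ca cb by simp
        show "inj_on (rk s) (insert a X)" using X(4) ni na by simp
        show "\<forall>x\<in>insert a X. \<forall>y\<in>insert a X. ljoin K x y = y \<or> ljoin K y x = x"
          using X(6) ax leq_refl[OF aC(1)] by blast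
        show "\<forall>x\<in>insert a X. ljoin K a x = x" using ax leq_refl[OF aC(1)] by blast
      qed (use X aC in auto)
    qed
  qed
  from this[OF bot(1) top(1) bot(2)[OF top(1)]] obtain X where X: "X \<subseteq> ?C" "finite X" "card X = rk s top + 1"
    "inj_on (rk s) X" "\<And>x y. x \<in> X \<Longrightarrow> y \<in> X \<Longrightarrow> ljoin K x y = y \<or> ljoin K y x = x"
    using rk_bot[OF s] by auto
  have "inj_on r X"
  proof (rule inj_onI)
    fix x y assume xy: "x \<in> X" "y \<in> X" "r x = r y"
    have C: "x \<in> ?C" "y \<in> ?C" using xy X(1) by auto
    have k: "(x, y) \<in> ker (rk s)" using xy r_eq[OF C] by (simp add: \<kappa>_def)
    then have "rk s x = rk s y" using ker_iff_jn[OF val C] by simp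
    then show "x = y" using X(4) xy by (auto dest: inj_onD)
  qed
  then have "card (r ` X) = rk s top + 1" using X(3) by (simp add: card_image)
  moreover have "lle Q (r x) (r y)" if "x \<in> X" "y \<in> X" "ljoin K x y = y" for x y
  proof -
    have "\<sigma> Join = Some (length [x, y])" using sg by (auto simp: lat_sig_def lattice_sig_def lattice0_sig_def lattice01_sig_def)
    moreover have "set [x, y] \<subseteq> ?C" using that X(1) by auto
    ultimately have "r (ljoin K x y) = opn Q Join (map r [x, y])" using hom unfolding hom_on_def by blast
    then show ?thesis using that(3) by simp
  qed
  then have "\<forall>x\<in>r ` X. \<forall>y\<in>r ` X. lle Q x y \<or> lle Q y x" using X(5) by blast
  moreover have "r ` X \<subseteq> carrier Q" "finite (r ` X)" using X(1,2) by (auto simp: QC)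
  ultimately have "enat (rk s top) \<le> lh Q" unfolding lh_def by (intro Sup_upper) blast
  then show ?thesis using QV simple fin by blast
qed


section \<open>Realizing congruence lattices by regular rings\<close>

lemma finite_length_modularI:
  assumes md: "modular_lattice \<sigma> L" and sg: "lat_sig \<sigma>" and M: "subuniverse \<sigma> L M" "M \<noteq> {}"
    and fl: "finite_length (sub_algebra L M)"
  shows "finite_length_modular M (ljoin L) (lmeet L)"
proof -
  have sub: "M \<subseteq> carrier L" and cl: "\<And>f xs. \<lbrakk>\<sigma> f = Some (length xs); set xs \<subseteq> M\<rbrakk> \<Longrightarrow> opn L f xs \<in> M"
    using M(1) by (auto simp: subuniverse_def)
  have sj: "\<sigma> Join = Some 2" "\<sigma> Meet = Some 2"
    using sg by (auto simp: lat_sig_def lattice_sig_def lattice0_sig_def lattice01_sig_def)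
  have la: "lattice_algebra \<sigma> L" and mo: "\<And>x y z. \<lbrakk>x \<in> carrier L; y \<in> carrier L; z \<in> carrier L; lle L x z\<rbrakk> \<Longrightarrow>
      ljoin L x (lmeet L y z) = lmeet L (ljoin L x y) z"
    using md by (auto simp: modular_lattice_def)
  have ax: "ljoin L x y = ljoin L y x \<and> lmeet L x y = lmeet L y x \<and>
        ljoin L (ljoin L x y) z = ljoin L x (ljoin L y z) \<and>
        lmeet L (lmeet L x y) z = lmeet L x (lmeet L y z) \<and>
        ljoin L x (lmeet L x y) = x \<and> lmeet L x (ljoin L x y) = x"
    if "x \<in> M" "y \<in> M" "z \<in> M" for x y z
    using la that sub unfolding lattice_algebra_def by blast
  obtain N where N: "lh (sub_algebra L M) = enat N" using fl by (metis enat_ord_simps(4) not_infinity_eq)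
  \<comment> \<open>A chain of length \<open>k\<close> has \<open>k + 1\<close> elements, hence
    \<open>Suc N\<close>.\<close>
  have "card D \<le> Suc N" if D: "D \<subseteq> M" "finite D" "\<forall>x\<in>D. \<forall>y\<in>D. ljoin L x y = y \<or> ljoin L y x = x" for D
  proof (cases "card D")
    case (Suc k)
    then have "enat k \<le> lh (sub_algebra L M)" unfolding lh_def
      by (intro Sup_upper CollectI exI[of _ k] conjI refl exI[of _ D]) (use D in auto)
    then show ?thesis using N Suc by simp
  qed simp
  then have bd: "\<exists>N. \<forall>D\<subseteq>M. finite D \<and> (\<forall>x\<in>D. \<forall>y\<in>D. ljoin L x y = y \<or> ljoin L y x = x) \<longrightarrow> card D \<le> N" by blast
  show ?thesis
  proof
    show "\<lbrakk>x \<in> M; y \<in> M\<rbrakk> \<Longrightarrow> ljoin L x y \<in> M" "\<lbrakk>x \<in> M; y \<in> M\<rbrakk> \<Longrightarrow> lmeet L x y \<in> M" for x y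
      using cl[of _ "[x, y]"] sj by simp_all
    show "\<lbrakk>x \<in> M; y \<in> M; z \<in> M; ljoin L x z = z\<rbrakk> \<Longrightarrow> ljoin L x (lmeet L y z) = lmeet L (ljoin L x y) z" for x y z
      using mo sub by blast
    show "\<lbrakk>x \<in> M; y \<in> M\<rbrakk> \<Longrightarrow> ljoin L x y = ljoin L y x" "\<lbrakk>x \<in> M; y \<in> M\<rbrakk> \<Longrightarrow> lmeet L x y = lmeet L y x"
      "\<lbrakk>x \<in> M; y \<in> M\<rbrakk> \<Longrightarrow> ljoin L x (lmeet L x y) = x" "\<lbrakk>x \<in> M; y \<in> M\<rbrakk> \<Longrightarrow> lmeet L x (ljoin L x y) = x" for x y
      using ax[of x y x] by blast+
    show "\<lbrakk>x \<in> M; y \<in> M; z \<in> M\<rbrakk> \<Longrightarrow> ljoin L (ljoin L x y) z = ljoin L x (ljoin L y z)"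
      "\<lbrakk>x \<in> M; y \<in> M; z \<in> M\<rbrakk> \<Longrightarrow> lmeet L (lmeet L x y) z = lmeet L x (lmeet L y z)" for x y z
      using ax[of x y z] by blast+
  qed (rule M(2), rule bd)
qed

lemma subuniverse_hull:
  assumes A: "is_algebra \<sigma> A" and X: "X \<subseteq> carrier A"
  shows "subuniverse \<sigma> A (subuniverse \<sigma> A hull X)"
proof -
  have "subuniverse \<sigma> A (carrier A)" using A by (auto simp: subuniverse_def is_algebra_def)
  then have "subuniverse \<sigma> A hull X \<subseteq> carrier A" using X by (intro hull_minimal)
  moreover have "opn A f xs \<in> subuniverse \<sigma> A hull X" if "\<sigma> f = Some (length xs)" "set xs \<subseteq> subuniverse \<sigma> A hull X" for f xs
    unfolding hull_def
  proof (rule InterI, elim CollectE conjE)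
    fix B assume B: "subuniverse \<sigma> A B" "X \<subseteq> B"
    have "set xs \<subseteq> B" using that(2) hull_minimal[of X B "subuniverse \<sigma> A", OF B(2,1)] by (rule subset_trans)
    then show "opn A f xs \<in> B" using B(1) that(1) by (simp add: subuniverse_def)
  qed
  ultimately show ?thesis unfolding subuniverse_def[of \<sigma> A "subuniverse \<sigma> A hull X"] by simp
qed

lemma finitely_generated_hull:
  assumes A: "is_algebra \<sigma> A" and X: "finite X" "X \<subseteq> carrier A"
  shows "finitely_generated \<sigma> (sub_algebra A (subuniverse \<sigma> A hull X))"
proof -
  define M where "M = subuniverse \<sigma> A hull X"
  have M: "subuniverse \<sigma> A M" "X \<subseteq> M" unfolding M_def by (rule subuniverse_hull[OF A X(2)], rule hull_subset)
  have least: "M \<subseteq> B" if "subuniverse \<sigma> A B" "X \<subseteq> B" for B unfolding M_def using that(2,1) by (rule hull_minimal)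
  have iff: "subuniverse \<sigma> (sub_algebra A M) B \<longleftrightarrow> subuniverse \<sigma> A B \<and> B \<subseteq> M" for B
    using M(1) by (auto simp: subuniverse_def)
  have "subuniverse \<sigma> (sub_algebra A M) hull X = M"
    by (rule hull_unique) (use M iff least in simp_all)
  then have "finitely_generated \<sigma> (sub_algebra A M)"
    unfolding finitely_generated_def using X(1) M(2) by (intro exI[of _ X]) simp
  then show ?thesis unfolding M_def .
qed

text \<open>If the copies fill every target block, each diagonal position of the target has a
  source, and \<open>e\<close> matches diagonal pairs exactly with diagonal pairs.\<close>

lemma bhom_one:
  assumes e: "e \<in> block_maps S n T n' m" and fin: "finite S"
    and eq: "\<And>t. t \<in> T \<Longrightarrow> (\<Sum>s\<in>S. m s t * n s) = n' t"
  shows "bhom e \<one>\<^bsub>block_ring P S n\<^esub> = \<one>\<^bsub>block_ring P T n'\<^esub>"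
proof (rule ext)
  fix x :: "'a pos \<times> 'a pos"
  have one: "\<one>\<^bsub>block_ring P' U k\<^esub> (p, q) = (if p = q \<and> p \<in> positions U k then 1 else 0)"
    for P' and U :: "'z set" and k p q by (simp add: block_ring_def)
  obtain q q' where x: "x = (q, q')" by (cases x)
  obtain t k where q: "q = (t, k)" by (cases q)
  show "bhom e \<one>\<^bsub>block_ring P S n\<^esub> x = \<one>\<^bsub>block_ring P T n'\<^esub> x"
  proof (cases "e (q, q')")
    case None
    have "q \<noteq> q' \<or> q \<notin> positions T n'"
    proof (rule ccontr)
      assume "\<not> (q \<noteq> q' \<or> q \<notin> positions T n')"
      then have "t \<in> T" "k < n' t" "e ((t, k), (t, k)) = None" using None q by (auto simp: positions_def)
      then show False using block_maps_total[OF e fin _ _ eq] by blast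
    qed
    then show ?thesis using None by (auto simp: x bhom_def one)
  next
    case (Some z)
    obtain p p' where z: "z = (p, p')" by (cases z)
    note S = Some[unfolded z]
    have pp: "p \<in> positions S n" "q \<in> positions T n'"
      using block_mapsD(1,2)[OF e S] by (auto simp: same_block_def)
    have "p = p' \<longleftrightarrow> q = q'"
    proof
      assume "p = p'"
      then show "q = q'" using block_maps_unique[OF e, of q q p p q'] block_maps_refl[OF e S] S by simp
    next
      assume "q = q'"
      then show "p = p'" using block_maps_refl[OF e S] S by simp
    qed
    then show ?thesis using S pp by (simp add: x bhom_def one)
  qed
qed

text \<open>Both sides are order isomorphic to \<open>system_ideals I lq S R\<close>, which depends
  on neither lattice.\<close>

lemma congruence_systems_order_iso:
  assumes "congruence_system C jn mt I lq K S R \<psi> w" "congruence_system C' jn' mt' I lq K' S R \<psi>' w'"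
  shows "\<exists>h. order_iso h {\<theta>. cong2 C jn mt \<theta>} {\<theta>. cong2 C' jn' mt' \<theta>}"
proof -
  interpret X: congruence_system C jn mt I lq K S R \<psi> w by (rule assms(1))
  interpret Y: congruence_system C' jn' mt' I lq K' S R \<psi>' w' by (rule assms(2))
  have "order_iso X.ideal_of {\<theta>. cong2 C jn mt \<theta>} (system_ideals I lq S R)"
    unfolding order_iso_def using X.ideal_of_bij X.ideal_of_subset_iff by simp
  moreover have "order_iso Y.ideal_of {\<theta>. cong2 C' jn' mt' \<theta>} (system_ideals I lq S R)"
    unfolding order_iso_def using Y.ideal_of_bij Y.ideal_of_subset_iff by simp
  ultimately show ?thesis using order_iso_comp order_iso_inv by blast
qed

text \<open>The last conclusion treats one identity at a time and asks for some \<open>N\<close>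
  above the length of each simple member of finite length; so it serves for all dimensions together
  as well as for one fixed dimension.\<close>

lemma ex_regular_ring:
  fixes L :: "('a, lat_op) ualg"
  assumes L: "L \<in> models \<sigma> E" and E: "E \<subseteq> identities \<sigma>" and sg: "lat_sig \<sigma>" and \<tau>: "lat_sig \<tau>"
    and md: "modular_lattice \<sigma> L" and bd: "One \<in> dom \<tau> \<longrightarrow> Zero \<in> dom \<sigma> \<and> One \<in> dom \<sigma>"
    and fl: "\<forall>M. subuniverse \<sigma> L M \<longrightarrow> M \<noteq> {} \<longrightarrow> finitely_generated \<sigma> (sub_algebra L M) \<longrightarrow> finite_length (sub_algebra L M)"
    and card: "|carrier L| \<le>o aleph1" and universe: "uncountable (UNIV :: 'u set)"
  shows "\<exists>(A :: 'u ring) h. regular_ring A \<and> is_algebra \<tau> (LL A) \<and>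
    order_iso h (congruences \<sigma> L) (congruences \<tau> (LL A)) \<and>
    (\<forall>u v. trm_ok \<tau> u \<and> trm_ok \<tau> v \<and> (\<forall>Q :: ('a, lat_op) ualg. Q \<in> models \<sigma> E \<and> simple_algebra \<sigma> Q \<and> finite_length Q \<longrightarrow>
        (\<exists>N. lh Q \<le> enat N \<and> satisfies (Sub_pow TYPE('f::field) N) (u, v))) \<longrightarrow> satisfies (LL A) (u, v))"
proof -
  let ?W = "carrier L" and ?j = "ljoin L" and ?m = "lmeet L"
  have alg: "is_algebra \<sigma> L" using L by (simp add: models_def)
  define I where "I = {x :: 'a \<times> nat. fst x \<in> ?W}"
  from ladder_exists[OF card] obtain lq :: "'a \<times> nat \<Rightarrow> 'a \<times> nat \<Rightarrow> bool" where
    lq1: "(\<forall>x y. fst y \<in> ?W \<and> lq x y \<longrightarrow> fst x \<in> ?W) \<and>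
     (\<forall>x. lq x x) \<and>
     (\<forall>x y z. fst z \<in> ?W \<and> lq x y \<and> lq y z \<longrightarrow> lq x z) \<and>
     (\<forall>x y. fst x \<in> ?W \<and> fst y \<in> ?W \<and> lq x y \<and> lq y x \<longrightarrow> x = y) \<and>
     (\<forall>x. fst x \<in> ?W \<longrightarrow> finite {y. lq y x}) \<and>
     (\<forall>x y. fst x \<in> ?W \<and> fst y \<in> ?W \<longrightarrow> (\<exists>z. fst z \<in> ?W \<and> lq x z \<and> lq y z)) \<and>
     (\<forall>x. fst x \<in> ?W \<longrightarrow> {y. lq y x \<and> y \<noteq> x} = {} \<or>
        (\<exists>y z u. fst y \<in> ?W \<and> fst z \<in> ?W \<and> fst u \<in> ?W \<and>
           {a. lq a x \<and> a \<noteq> x} = {a. lq a y} \<union> {a. lq a z} \<and> {a. lq a y} \<inter> {a. lq a z} = {a. lq a u}))"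
    by (rule exE)
  have down: "\<And>i j. \<lbrakk>j \<in> I; lq i j\<rbrakk> \<Longrightarrow> i \<in> I"
    using lq1[THEN conjunct1] unfolding I_def mem_Collect_eq by blast
  note lq2 = lq1[THEN conjunct2]
  have rfl: "\<And>i. lq i i" using lq2[THEN conjunct1] by (rule spec)
  note lq3 = lq2[THEN conjunct2]
  have trns: "\<And>i j k. \<lbrakk>k \<in> I; lq i j; lq j k\<rbrakk> \<Longrightarrow> lq i k"
    using lq3[THEN conjunct1] unfolding I_def mem_Collect_eq by blast
  note lq4 = lq3[THEN conjunct2]
  have antis: "\<And>i j. \<lbrakk>i \<in> I; j \<in> I; lq i j; lq j i\<rbrakk> \<Longrightarrow> i = j"
    using lq4[THEN conjunct1] unfolding I_def mem_Collect_eq by blast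
  note lq5 = lq4[THEN conjunct2]
  have finl: "\<And>i. i \<in> I \<Longrightarrow> finite {j. lq j i}"
    using lq5[THEN conjunct1] unfolding I_def mem_Collect_eq by blast
  note lq6 = lq5[THEN conjunct2]
  have dir: "\<And>i j. \<lbrakk>i \<in> I; j \<in> I\<rbrakk> \<Longrightarrow> \<exists>k\<in>I. lq i k \<and> lq j k"
    using lq6[THEN conjunct1]
    unfolding I_def mem_Collect_eq Bex_def by blast
  have ladder: "{y. lq y x \<and> y \<noteq> x} = {} \<or>
       (\<exists>y z u. y \<in> I \<and> z \<in> I \<and> u \<in> I \<and> {a. lq a x \<and> a \<noteq> x} = {a. lq a y} \<union> {a. lq a z} \<and>
          {a. lq a y} \<inter> {a. lq a z} = {a. lq a u})" if "x \<in> I" for x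
    using lq6[THEN conjunct2, THEN spec, THEN mp, OF that[unfolded I_def mem_Collect_eq]] unfolding I_def mem_Collect_eq .
  have Ine: "I \<noteq> {}" using alg by (auto simp: I_def is_algebra_def)
  \<comment> \<open>Finitely many generators that grow with \<open>i\<close>; \<open>fst i\<close>
    is among them, so every element of \<open>L\<close> appears at some stage.\<close>
  define G where "G = (\<lambda>i. fst ` {j. lq j i})"
  have G: "finite (G i)" "G i \<subseteq> ?W" "fst i \<in> G i" if "i \<in> I" for i
    using finl[OF that] down[OF that] rfl[of i] by (auto simp: G_def I_def)
  have Gm: "G i \<subseteq> G j" if "j \<in> I" "lq i j" for i j using trns[OF that(1) _ that(2)] by (auto simp: G_def)
  define K where "K = (\<lambda>i. subuniverse \<sigma> L hull G i)"
  have K: "subuniverse \<sigma> L (K i)" "G i \<subseteq> K i" "K i \<subseteq> ?W" if "i \<in> I" for i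
  proof -
    show 1: "subuniverse \<sigma> L (K i)" unfolding K_def by (rule subuniverse_hull[OF alg G(2)[OF that]])
    show "G i \<subseteq> K i" unfolding K_def by (rule hull_subset)
    show "K i \<subseteq> ?W" using 1 by (simp add: subuniverse_def)
  qed
  have Kne: "K i \<noteq> {}" if "i \<in> I" for i using K(2)[OF that] G(3)[OF that] by blast
  have Km: "K i \<subseteq> K j" if "j \<in> I" "lq i j" for i j unfolding K_def by (rule hull_mono[OF Gm[OF that]])
  have Kfl: "finite_length (sub_algebra L (K i))" if "i \<in> I" for i
    by (rule fl[rule_format, OF K(1)[OF that] Kne[OF that]]) (unfold K_def, rule finitely_generated_hull[OF alg G(1,2)[OF that]])
  have flm: "finite_length_modular (K i) ?j ?m" if "i \<in> I" for i
    by (rule finite_length_modularI[OF md sg K(1)[OF that] Kne[OF that] Kfl[OF that]])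
  define S where "S = (\<lambda>i. finite_length_modular.pclasses (K i) ?j ?m)"
  define rk where "rk = (\<lambda>i. finite_length_modular.rk (K i) ?j)"
  define tp where "tp = (\<lambda>i. finite_length_modular.top (K i) ?j)"
  define n where "n = (\<lambda>i s. rk i s (tp i))"
  define m where "m = (\<lambda>(i :: 'a \<times> nat) j :: 'a \<times> nat. modular_pair.mult (K j) ?j)"
  note defs = S_def rk_def tp_def n_def m_def
  have mp: "modular_pair (K i) (K j) ?j ?m" if "j \<in> I" "lq i j" for i j
    unfolding modular_pair_def modular_pair_axioms_def using flm down that Km[OF that] by blast
  have finS: "finite (S i)" if "i \<in> I" for i
    unfolding S_def by (rule finite_length_modular.finite_classes[OF flm[OF that]])
  have npos: "0 < n i s" if "i \<in> I" "s \<in> S i" for i s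
    using finite_length_modular.rk_top_pos[OF flm[OF that(1)]] that(2) by (simp add: defs)
  have mpos: "\<exists>t\<in>S j. 0 < m i j s t" if "j \<in> I" "lq i j" "s \<in> S i" for i j s
    using modular_pair.mult_pos[OF mp[OF that(1,2)]] that(3) by (simp add: defs)
  have mle: "(\<Sum>s\<in>S i. m i j s t * n i s) \<le> n j t" if "j \<in> I" "lq i j" "t \<in> S j" for i j t
    using modular_pair.mult_rank(1)[OF mp[OF that(1,2)]] that(3) by (simp add: defs)
  have mm: "m i k s u = (\<Sum>t\<in>S j. m i j s t * m j k t u)"
    if "k \<in> I" "lq i j" "lq j k" "s \<in> S i" "u \<in> S k" for i j k s u
    unfolding defs
    by (rule mult_mult[OF mp[OF down[OF that(1,3)] that(2)] mp[OF that(1,3)] mp[OF that(1) trns[OF that(1,2,3)]]])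
      (use that in \<open>simp_all add: defs\<close>)
  have mone: "m i i s t = (if s = t then 1 else 0)" if i: "i \<in> I" and st: "s \<in> S i" "t \<in> S i" for i s t
  proof -
    interpret modular_pair "K i" "K i" ?j ?m by (rule mp[OF i rfl])
    have S: "s \<in> lo.pclasses" "t \<in> lo.pclasses" using st by (simp_all add: S_def)
    obtain a b where ab: "(a, b) \<in> s" using lo.classes_ne[OF S(1)] by blast
    have "lo.rk t a + mult s t = lo.rk t a + (if (a, b) \<in> t then 1 else 0)"
      using mult_eq[OF S(2,1) ab] lo.rk_cov[OF S(2) lo.classes_mem[OF S(1) ab]] by simp
    moreover have "(a, b) \<in> t \<longleftrightarrow> s = t" using lo.classes_unique[OF S ab] ab by blast
    ultimately show ?thesis by (simp add: m_def)
  qed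
  define M where "M = (\<lambda>i j. block_maps (S i) (n i) (S j) (n j) (m i j))"
  \<comment> \<open>The identity permutation gives the identity on pairs within a block, which is
    neutral for composition with block maps.\<close>
  define one where "one = (\<lambda>i. perm_map (S i) (n i) (\<lambda>_ k. k))"
  have one: "one i x = (if x \<in> same_block (S i) (n i) then Some x else None)" for i x
    by (cases x) (simp add: one_def perm_map_def)
  have "\<exists>h. (\<forall>j\<in>I. \<forall>i. lq i j \<longrightarrow> h i j \<in> M i j) \<and>
     (\<forall>k\<in>I. \<forall>i j. lq i j \<and> lq j k \<longrightarrow> h i j \<circ>\<^sub>m h j k = h i k) \<and> (\<forall>i\<in>I. h i i = one i)"
  proof (rule coherent_system[where lq = lq and M = M and one = one and I = I, OF down rfl trns antis finl ladder])
    show "one i \<in> M i i" if "i \<in> I" for i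
      unfolding M_def one_def by (rule perm_map_in) (use mone[OF that] in \<open>simp_all add: bij_betw_def\<close>)
    show "f \<circ>\<^sub>m g \<in> M i k" if "k \<in> I" "lq i j" "lq j k" "f \<in> M i j" "g \<in> M j k" for i j k f g
      using that(4,5) unfolding M_def
      by (rule block_maps_comp[OF _ _ finS[OF down[OF that(1,3)]]]) (rule mm[OF that(1-3)])
    show "one i \<circ>\<^sub>m f = f" if "j \<in> I" "lq i j" "f \<in> M i j" for i j f
    proof (rule ext)
      fix x
      show "(one i \<circ>\<^sub>m f) x = f x"
        using block_mapsD(2)[OF that(3)[unfolded M_def], of x] by (cases "f x") (simp_all add: map_comp_def one)
    qed
    show "f \<circ>\<^sub>m one j = f" if "j \<in> I" "lq i j" "f \<in> M i j" for i j f
    proof (rule ext)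
      fix x
      show "(f \<circ>\<^sub>m one j) x = f x"
        using block_mapsD(1)[OF that(3)[unfolded M_def], of x] by (cases "f x") (simp_all add: map_comp_def one)
    qed
    show "(f \<circ>\<^sub>m g) \<circ>\<^sub>m h = f \<circ>\<^sub>m (g \<circ>\<^sub>m h)"
      for f g h :: "('a \<times> 'a) set pos \<times> ('a \<times> 'a) set pos \<rightharpoonup> ('a \<times> 'a) set pos \<times> ('a \<times> 'a) set pos"
      by (rule ext) (simp add: map_comp_def split: option.split)
    show "M i j \<noteq> {}" if "j \<in> I" "lq i j" for i j
    proof -
      from labelling_exists[OF finS[OF down[OF that]] mle[OF that]]
      obtain \<gamma> where "labelling (S i) (n i) (S j) (n j) (m i j) \<gamma>" by (rule exE)
      from label_map_in[OF this] show ?thesis unfolding M_def by blast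
    qed
    show "\<exists>a\<in>M j j. f = g \<circ>\<^sub>m a" if "j \<in> I" "lq i j" "f \<in> M i j" "g \<in> M i j" for i j f g
      unfolding M_def
      by (rule block_maps_conjugate[OF that(3)[unfolded M_def] that(4)[unfolded M_def] mone[OF that(1)]])
  qed
  then obtain h where h: "\<And>i j. \<lbrakk>j \<in> I; lq i j\<rbrakk> \<Longrightarrow> h i j \<in> M i j"
    "\<And>i j k. \<lbrakk>k \<in> I; lq i j; lq j k\<rbrakk> \<Longrightarrow> h i j \<circ>\<^sub>m h j k = h i k" by (elim exE conjE) metis
  obtain P :: "'f set" where P: "subfield_set P" "countable P" using ex_countable_subfield by blast
  let ?B = "\<lambda>i. block_ring P (S i) (n i)"
  \<comment> \<open>There are at most \<open>aleph1\<close> indices and each stage is countable, so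
    the disjoint union of the stages fits into any uncountable universe.\<close>
  have "|I| \<le>o aleph1"
  proof -
    have "I = ?W \<times> UNIV" by (auto simp: I_def)
    then show ?thesis
      using card_of_Times_ordLeq_infinite_Field[OF aleph1_Field(1) card countable_le_aleph1 aleph1_Field(2), of "UNIV :: nat set"] by simp
  qed
  then have "|Sigma I (\<lambda>i. carrier (?B i))| \<le>o aleph1"
    by (rule card_of_Sigma_ordLeq_infinite_Field[OF aleph1_Field])
      (intro ballI countable_le_aleph1 countable_block_ring finS P(2))
  then have cS: "|Sigma I (\<lambda>i. carrier (?B i))| \<le>o |UNIV :: 'u set|"
    using aleph1_le_uncountable[OF universe] by (rule ordLeq_transitive)
  have "\<exists>\<eta> :: 'a \<times> nat \<Rightarrow> (('a \<times> 'a) set pos \<times> ('a \<times> 'a) set pos \<Rightarrow> 'f) \<Rightarrow> 'u. \<forall>i\<in>I. \<forall>j\<in>I. \<forall>a\<in>carrier (?B i). \<forall>b\<in>carrier (?B j).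
      \<eta> i a = \<eta> j b \<longleftrightarrow> (\<exists>k\<in>I. lq i k \<and> lq j k \<and> bhom (h i k) a = bhom (h j k) b)"
    by (rule ex_limit_embedding[where h = h and lq = lq, OF cS]) (rule rfl, erule (2) trns, erule (1) dir, erule (2) h(2))
  then obtain \<eta> :: "'a \<times> nat \<Rightarrow> (('a \<times> 'a) set pos \<times> ('a \<times> 'a) set pos \<Rightarrow> 'f) \<Rightarrow> 'u" where \<eta>:
    "\<forall>i\<in>I. \<forall>j\<in>I. \<forall>a\<in>carrier (?B i). \<forall>b\<in>carrier (?B j).
      \<eta> i a = \<eta> j b \<longleftrightarrow> (\<exists>k\<in>I. lq i k \<and> lq j k \<and> bhom (h i k) a = bhom (h j k) b)"
    by (rule exE)
  interpret MS: matricial_system P I lq S n m h \<eta>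
    by (intro matricial_system.intro matricial_system_axioms.intro P(1))
      (simp_all only: Ine rfl dir finS npos mpos h(1)[unfolded M_def] h(2), (fact trns | use \<eta> in blast)+)
  \<comment> \<open>The lattice side of the coding, with the same \<open>I\<close>,
    \<open>lq\<close>, \<open>S\<close> and positivity of \<open>m\<close> as on the ring side, and
    with kernels of ranks in place of block kernels.\<close>
  interpret CL: congruence_system ?W ?j ?m I lq K S "\<lambda>i j s t. 0 < m i j s t"
    "\<lambda>i s. finite_length_modular.ker (K i) ?j ?m (rk i s)" "\<lambda>i s. finite_length_modular.rep s"
  proof
    show "I \<noteq> {}" by (rule Ine)
    show "\<lbrakk>i \<in> I; j \<in> I\<rbrakk> \<Longrightarrow> \<exists>k\<in>I. lq i k \<and> lq j k" for i j by (rule dir)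
    show "?W = (\<Union>i\<in>I. K i)"
    proof
      show "?W \<subseteq> (\<Union>i\<in>I. K i)"
      proof
        fix x assume "x \<in> ?W"
        then have "(x, 0) \<in> I" by (simp add: I_def)
        then show "x \<in> (\<Union>i\<in>I. K i)" using K(2)[of "(x, 0)"] G(3)[of "(x, 0)"] by auto
      qed
    qed (use K(3) in blast)
    show "\<lbrakk>i \<in> I; j \<in> I; lq i j\<rbrakk> \<Longrightarrow> K i \<subseteq> K j" for i j by (rule Km)
    fix i assume i: "i \<in> I"
    interpret k: finite_length_modular "K i" ?j ?m by (rule flm[OF i])
    show "\<lbrakk>x \<in> K i; y \<in> K i\<rbrakk> \<Longrightarrow> ?j x y \<in> K i" "\<lbrakk>x \<in> K i; y \<in> K i\<rbrakk> \<Longrightarrow> ?m x y \<in> K i" for x y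
      by (fact k.jn_closed, fact k.mt_closed)
    show "cong2 (K i) ?j ?m (k.ker (rk i s))" if "s \<in> S i" for s
      using k.ker_cong[OF k.rk_valuation] that by (simp add: defs)
    show "k.rep s \<in> K i \<times> K i" if "s \<in> S i" for s using k.rep_in that by (simp add: defs)
    show "k.rep s \<in> k.ker (rk i t) \<longleftrightarrow> t \<noteq> s" if "s \<in> S i" "t \<in> S i" for s t using k.rep_ker that by (simp add: defs)
    show "(x, y) \<in> \<theta> \<longleftrightarrow> (\<forall>s\<in>S i. (x, y) \<notin> k.ker (rk i s) \<longrightarrow> k.rep s \<in> \<theta>)"
      if "cong2 ?W ?j ?m \<theta>" "x \<in> K i" "y \<in> K i" for \<theta> x y
      using k.cong2_determined[OF that(1) K(3)[OF i] that(2,3)] by (simp add: defs)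
    fix j assume j: "j \<in> I" "lq i j"
    show "(x, y) \<in> finite_length_modular.ker (K j) ?j ?m (rk j t) \<longleftrightarrow> (\<forall>s\<in>S i. 0 < m i j s t \<longrightarrow> (x, y) \<in> k.ker (rk i s))"
      if "t \<in> S j" "x \<in> K i" "y \<in> K i" for t x y
      using modular_pair.ker_restrict[OF mp[OF j] _ that(2,3)] that(1) by (simp add: defs)
  qed
  \<comment> \<open>Each \<open>K i\<close> contains the constants of \<open>L\<close>, which are
    therefore its bounds; the copies then fill the target blocks exactly, and units are
    preserved.\<close>
  have un: "MS.unital" if "One \<in> dom \<tau>"
    unfolding MS.unital_def
  proof (intro ballI impI)
    fix i j assume ij: "i \<in> I" "j \<in> I" "lq i j"
    interpret modular_pair "K i" "K j" ?j ?m by (rule mp[OF ij(2,3)])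
    have zo: "Zero \<in> dom \<sigma>" "One \<in> dom \<sigma>" using bd[rule_format, OF that] by simp_all
    then have s0: "\<sigma> Zero = Some 0" "\<sigma> One = Some 0"
      using sg by (auto simp: lat_sig_def lattice_sig_def lattice0_sig_def lattice01_sig_def split: if_splits)
    have c: "opn L Zero [] \<in> K k" "opn L One [] \<in> K k" if "k \<in> I" for k
      using K(1)[OF that] s0 unfolding subuniverse_def by auto
    have le: "?j (opn L Zero []) x = x" "?j x (opn L One []) = opn L One []" if "x \<in> ?W" for x
      using md zo that by (auto simp: modular_lattice_def lattice_algebra_def)
    have b: "finite_length_modular.bot (K k) ?j = opn L Zero [] \<and> finite_length_modular.top (K k) ?j = opn L One []"
      if k: "k \<in> I" for k
    proof -
      interpret k: finite_length_modular "K k" ?j ?m by (rule flm[OF k])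
      show ?thesis
        using k.leq_antisym[OF k.bot(1) c(1)[OF k] k.bot(2)[OF c(1)[OF k]] le(1)] k.bot(1)
          k.leq_antisym[OF k.top(1) c(2)[OF k] le(2) k.top(2)[OF c(2)[OF k]]] k.top(1) K(3)[OF k] by blast
    qed
    have eq: "(\<Sum>s\<in>S i. m i j s t * n i s) = n j t" if "t \<in> S j" for t
      using mult_rank(2)[of t] b[OF ij(1)] b[OF ij(2)] that by (simp add: defs)
    show "bhom (h i j) \<one>\<^bsub>?B i\<^esub> = \<one>\<^bsub>?B j\<^esub>"
      by (rule bhom_one[OF h(1)[OF ij(2,3), unfolded M_def] finS[OF ij(1)] eq])
  qed
  have Aalg: "is_algebra \<tau> (LL MS.A)" by (rule MS.LL_A_algebra[OF \<tau> un])
  obtain g where "order_iso g {\<theta>. cong2 ?W ?j ?m \<theta>} {\<theta>. cong2 (carrier (LL MS.A)) (ljoin (LL MS.A)) (lmeet (LL MS.A)) \<theta>}"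
    using congruence_systems_order_iso[OF CL.congruence_system_axioms MS.LL_congruence_system] by (rule exE)
  then have iso: "order_iso g (congruences \<sigma> L) (congruences \<tau> (LL MS.A))"
    by (simp only: congruence_iff_cong2[OF sg alg] congruence_iff_cong2[OF \<tau> Aalg])
  have "satisfies (LL MS.A) (u, v)" if ok: "trm_ok \<tau> u" "trm_ok \<tau> v"
    and sat: "\<forall>Q :: ('a, lat_op) ualg. Q \<in> models \<sigma> E \<and> simple_algebra \<sigma> Q \<and> finite_length Q \<longrightarrow>
        (\<exists>N. lh Q \<le> enat N \<and> satisfies (Sub_pow TYPE('f) N) (u, v))" for u v
  proof (rule MS.LL_A_satisfies[OF \<tau> un ok])
    fix i s assume iS: "i \<in> I" "s \<in> S i"
    have KV: "sub_algebra L (K i) \<in> models \<sigma> E" by (rule models_sub_algebra[OF L K(1)[OF iS(1)] Kne[OF iS(1)]])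
    \<comment> \<open>The block size \<open>n i s\<close> is at most the length of a simple quotient
      of \<open>K i\<close>, and that quotient again satisfies \<open>E\<close>.\<close>
    have "\<exists>Q :: ('a, lat_op) ualg. Q \<in> models \<sigma> E \<and> simple_algebra \<sigma> Q \<and> finite_length Q \<and> enat (n i s) \<le> lh Q"
      using simple_quotient[OF KV E sg, of s] flm[OF iS(1)] iS(2) by (simp add: defs)
    then obtain Q :: "('a, lat_op) ualg" and N where "enat (n i s) \<le> lh Q" "lh Q \<le> enat N" and N: "satisfies (Sub_pow TYPE('f) N) (u, v)"
      using sat by blast
    then have "n i s \<le> N" using order_trans by fastforce
    then show "satisfies (Sub_pow TYPE('f) (n i s)) (u, v)" by (rule subpow_satisfies_le[OF \<tau> ok _ N])
  qed
  moreover have "regular_ring MS.A" using MS.A_regular by (simp add: regular_def regular_axioms_def nonunital_def regular_ring_def)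
  ultimately show ?thesis using Aalg iso by (intro exI[of _ MS.A] exI[of _ g] conjI allI impI) auto
qed


section \<open>Critical points\<close>

text \<open>Cardinals are well-ordered, so the choice in \<open>crit\<close> finds a least one; not
  being at most \<open>aleph1\<close>, it is at least the successor.\<close>

lemma le_crit_aleph2:
  assumes "\<And>S. \<lbrakk>S \<in> Con_c_class \<sigma> \<V>; |carrier S| \<le>o aleph1\<rbrakk> \<Longrightarrow> S \<in> Con_c_class \<tau> \<W>"
  shows "le_crit aleph2 (crit \<sigma> \<V> \<tau> \<W>)"
proof (cases "Con_c_class \<sigma> \<V> - Con_c_class \<tau> \<W> = {}")
  case True
  then show ?thesis by (simp add: crit_def le_crit_def)
next
  case False
  define D where "D = Con_c_class \<sigma> \<V> - Con_c_class \<tau> \<W>"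
  define \<kappa> where "\<kappa> = (SOME \<kappa>. (\<exists>S\<in>D. \<kappa> = |carrier S| ) \<and> (\<forall>S\<in>D. \<kappa> \<le>o |carrier S| ))"
  have "(\<lambda>S. |carrier S| ) ` D \<noteq> {}" using False by (simp add: D_def)
  then have "\<exists>\<kappa>\<in>(\<lambda>S. |carrier S| ) ` D. \<forall>\<kappa>'\<in>(\<lambda>S. |carrier S| ) ` D. \<kappa> \<le>o \<kappa>'"
    by (rule exists_minim_Card_order) (simp add: card_of_Card_order)
  then have "\<exists>\<kappa>. (\<exists>S\<in>D. \<kappa> = |carrier S| ) \<and> (\<forall>S\<in>D. \<kappa> \<le>o |carrier S| )" by blast
  then have "(\<exists>S\<in>D. \<kappa> = |carrier S| ) \<and> (\<forall>S\<in>D. \<kappa> \<le>o |carrier S| )" unfolding \<kappa>_def by (rule someI_ex)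
  then obtain S where S: "S \<in> D" "\<kappa> = |carrier S|" by blast
  then have "\<not> |carrier S| \<le>o aleph1" using assms[of S] by (auto simp: D_def)
  then have "aleph1 <o |carrier S|"
    by (rule not_ordLeq_iff_ordLess[OF card_order_on_well_order_on[OF aleph1_Field(2)] card_of_Well_order, THEN iffD1])
  then have "aleph2 \<le>o \<kappa>" unfolding S(2) by (rule cardSuc_least[OF aleph1_Field(2) card_of_Card_order])
  then show ?thesis using False unfolding crit_def le_crit_def Let_def D_def[symmetric] \<kappa>_def by simp
qed

text \<open>The lattice \<open>L\<close> behind the semilattice may be too large, so it is replaced
  by a subalgebra with at most \<open>aleph1\<close> elements and isomorphic compact congruences. A
  ring realizes this subalgebra, and its lattice of right ideals is copied into the
  universe.\<close>

lemma Con_c_class_transfer: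
  fixes \<sigma> \<tau> :: "lat_op similarity" and S :: "('u, lat_op) ualg" and \<K> :: "('b, lat_op) ualg set"
  assumes E: "E \<subseteq> identities \<sigma>" and sg: "finite (dom \<sigma>)"
    and realize: "\<And>L :: ('u, lat_op) ualg. \<lbrakk>L \<in> models \<sigma> E; |carrier L| \<le>o aleph1\<rbrakk> \<Longrightarrow>
      \<exists>(A :: 'u ring) h. order_iso h (congruences \<sigma> L) (congruences \<tau> (LL A)) \<and> LL A \<in> Variety_of \<tau> \<K>"
    and S: "S \<in> Con_c_class \<sigma> (models \<sigma> E)" "|carrier S| \<le>o aleph1"
  shows "S \<in> Con_c_class \<tau> (Variety_of \<tau> \<K>)"
proof -
  obtain L :: "('u, lat_op) ualg" where L: "L \<in> models \<sigma> E" "isomorphic semilattice0_sig S (Con_c \<sigma> L)"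
    and Salg: "is_algebra semilattice0_sig S" using S(1) by (auto simp: Con_c_class_def)
  have Cc: "Con_c \<rho> A = incl_lattice (fg_congruences \<rho> A)" for \<rho> :: "lat_op similarity" and A :: "('u, lat_op) ualg"
    by (simp add: Con_c_def fg_congruences_def)
  have alg: "is_algebra \<sigma> L" using L(1) by (simp add: models_def)
  obtain f where "bij_betw f (carrier S) (fg_congruences \<sigma> L)" using L(2) by (auto simp: isomorphic_def Cc)
  then have "|fg_congruences \<sigma> L| =o |carrier S|" using card_of_ordIso ordIso_symmetric by blast
  then have "|fg_congruences \<sigma> L| \<le>o aleph1" using S(2) by (rule ordIso_ordLeq_trans)
  from small_subalgebra_fg[OF alg sg this] obtain M h1 where M: "subuniverse \<sigma> L M" "M \<noteq> {}" "|M| \<le>o aleph1"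
    and h1: "order_iso h1 (fg_congruences \<sigma> (sub_algebra L M)) (fg_congruences \<sigma> L)" by (elim exE conjE)
  have M': "sub_algebra L M \<in> models \<sigma> E" by (rule models_sub_algebra[OF L(1) M(1,2)])
  have "|carrier (sub_algebra L M)| \<le>o aleph1" using M(3) by simp
  from realize[OF M' this] obtain A :: "'u ring" and h2 where
    h2: "order_iso h2 (congruences \<sigma> (sub_algebra L M)) (congruences \<tau> (LL A))" and A: "LL A \<in> Variety_of \<tau> \<K>"
    by (elim exE conjE)
  have Aalg: "is_algebra \<tau> (LL A)" using A by (simp add: Variety_of_def models_def)
  \<comment> \<open>Sending a right ideal to a chosen generator embeds the lattice into the
    universe.\<close>
  define g where "g = (\<lambda>X. SOME a. X = (\<lambda>x. a \<otimes>\<^bsub>A\<^esub> x) ` carrier A)"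
  have g: "X = (\<lambda>x. g X \<otimes>\<^bsub>A\<^esub> x) ` carrier A" if "X \<in> carrier (LL A)" for X
  proof -
    have "\<exists>a. X = (\<lambda>x. a \<otimes>\<^bsub>A\<^esub> x) ` carrier A" using that by (auto simp: LL_def principal_right_ideals_def)
    then show ?thesis unfolding g_def by (rule someI_ex)
  qed
  have "inj_on g (carrier (LL A))" by (rule inj_onI) (metis g)
  with A[unfolded Variety_of_def] obtain B :: "('u, lat_op) ualg" and h3 where
    B: "B \<in> Variety_of \<tau> \<K>" and h3: "order_iso h3 (congruences \<tau> (LL A)) (congruences \<tau> B)"
    using transport_algebra[of "LL A" \<tau> "{e \<in> identities \<tau>. \<forall>A\<in>\<K>. satisfies A e}" g] unfolding Variety_of_def by blast
  have Balg: "is_algebra \<tau> B" using B by (simp add: Variety_of_def models_def)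
  have Malg: "is_algebra \<sigma> (sub_algebra L M)" using M' by (simp add: models_def)
  have iso: "order_iso (h3 \<circ> (h2 \<circ> the_inv_into (fg_congruences \<sigma> (sub_algebra L M)) h1)) (fg_congruences \<sigma> L) (fg_congruences \<tau> B)"
    by (rule order_iso_comp[OF order_iso_comp[OF order_iso_inv[OF h1] order_iso_fg[OF Malg Aalg h2]] order_iso_fg[OF Aalg Balg h3]])
  have "isomorphic semilattice0_sig (Con_c \<sigma> L) (Con_c \<tau> B)" unfolding Cc
    by (rule order_iso_isomorphic_semilattice[OF iso fg_congruences_joins[OF alg] fg_congruences_bottom])
  then have "isomorphic semilattice0_sig S (Con_c \<tau> B)" by (rule isomorphic_trans[OF L(2)])
  then show ?thesis unfolding Con_c_class_def using B Salg by blast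
qed

text \<open>\<open>\<K>\<close> is left open: for each simple member of finite length it has to
  contain a subspace lattice of at least that dimension. This covers both halves of the final
  statement.\<close>

lemma realization:
  fixes \<sigma> \<tau> :: "lat_op similarity" and \<V> :: "('u, lat_op) ualg set"
  assumes universe: "uncountable (UNIV :: 'u set)"
    and sig: "(\<sigma> = lattice_sig \<and> \<tau> = lattice0_sig) \<or> (\<sigma> = lattice01_sig \<and> \<tau> = lattice01_sig)"
    and variety: "variety \<sigma> \<V>"
    and modular: "\<forall>L\<in>\<V>. modular_lattice \<sigma> L"
    and fin_len: "\<forall>L\<in>\<V>. finitely_generated \<sigma> L \<longrightarrow> finite_length L"
    and \<K>: "\<And>Q. \<lbrakk>Q \<in> \<V>; simple_algebra \<sigma> Q; finite_length Q\<rbrakk> \<Longrightarrow> \<exists>N. lh Q \<le> enat N \<and> Sub_pow TYPE('f::field) N \<in> \<K>"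
  shows "le_crit aleph2 (crit \<sigma> \<V> \<tau> (Variety_of \<tau> \<K>)) \<and>
     (\<forall>L\<in>\<V>. |carrier L| \<le>o aleph1 \<longrightarrow>
        (\<exists>A :: 'u ring. regular_ring A \<and> isomorphic lattice_sig (Con \<sigma> L) (Con \<tau> (LL A)) \<and> LL A \<in> Variety_of \<tau> \<K>))"
proof -
  obtain E where E: "E \<subseteq> identities \<sigma>" "\<V> = models \<sigma> E" using variety by (auto simp: variety_def)
  have ls: "lat_sig \<sigma>" "lat_sig \<tau>" using sig by (auto simp: lat_sig_def)
  have bd: "One \<in> dom \<tau> \<longrightarrow> Zero \<in> dom \<sigma> \<and> One \<in> dom \<sigma>"
    using sig by (auto simp: lattice0_sig_def lattice01_sig_def split: if_splits)
  have fd: "finite (dom \<sigma>)" using sig by (auto simp: lattice_sig_def lattice01_sig_def)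
  have real: "\<exists>(A :: 'u ring) h. regular_ring A \<and> order_iso h (congruences \<sigma> L) (congruences \<tau> (LL A)) \<and> LL A \<in> Variety_of \<tau> \<K>"
    if L: "L \<in> models \<sigma> E" "|carrier L| \<le>o aleph1" for L :: "('u, lat_op) ualg"
  proof -
    have md: "modular_lattice \<sigma> L" using modular L(1) E(2) by blast
    have fl: "\<forall>M. subuniverse \<sigma> L M \<longrightarrow> M \<noteq> {} \<longrightarrow> finitely_generated \<sigma> (sub_algebra L M) \<longrightarrow> finite_length (sub_algebra L M)"
      using fin_len models_sub_algebra[OF L(1)] E(2) by blast
    from ex_regular_ring[where 'f = 'f and 'u = 'u, OF L(1) E(1) ls md bd fl L(2) universe]
    obtain A :: "'u ring" and h where A: "regular_ring A" "is_algebra \<tau> (LL A)"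
        "order_iso h (congruences \<sigma> L) (congruences \<tau> (LL A))"
      and sat: "\<forall>u v. trm_ok \<tau> u \<and> trm_ok \<tau> v \<and> (\<forall>Q :: ('u, lat_op) ualg. Q \<in> models \<sigma> E \<and> simple_algebra \<sigma> Q \<and> finite_length Q \<longrightarrow>
        (\<exists>N. lh Q \<le> enat N \<and> satisfies (Sub_pow TYPE('f::field) N) (u, v))) \<longrightarrow> satisfies (LL A) (u, v)"
      by (elim exE conjE)
    have "satisfies (LL A) e" if e: "e \<in> identities \<tau>" "\<forall>B\<in>\<K>. satisfies B e" for e
    proof -
      obtain u v where uv: "e = (u, v)" by (cases e)
      have ok: "trm_ok \<tau> u" "trm_ok \<tau> v" using e(1) by (auto simp: uv identities_def)
      have "\<exists>N. lh Q \<le> enat N \<and> satisfies (Sub_pow TYPE('f) N) (u, v)"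
        if Q: "Q \<in> models \<sigma> E \<and> simple_algebra \<sigma> Q \<and> finite_length Q" for Q :: "('u, lat_op) ualg"
      proof -
        obtain N where "lh Q \<le> enat N" "Sub_pow TYPE('f) N \<in> \<K>" using \<K>[of Q] Q E(2) by blast
        then show ?thesis using e(2) uv by blast
      qed
      then show ?thesis using sat ok uv by blast
    qed
    then have "LL A \<in> Variety_of \<tau> \<K>" using A(2) by (simp add: Variety_of_def models_def)
    then show ?thesis using A(1,3) by blast
  qed
  have "le_crit aleph2 (crit \<sigma> \<V> \<tau> (Variety_of \<tau> \<K>))" unfolding E(2)
    by (rule le_crit_aleph2, rule Con_c_class_transfer[OF E(1) fd]) (use real in blast)+
  moreover have "\<exists>A :: 'u ring. regular_ring A \<and> isomorphic lattice_sig (Con \<sigma> L) (Con \<tau> (LL A)) \<and> LL A \<in> Variety_of \<tau> \<K>"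
    if L: "L \<in> \<V>" "|carrier L| \<le>o aleph1" for L
  proof -
    have LE: "L \<in> models \<sigma> E" using L(1) E(2) by simp
    from real[OF LE L(2)] obtain A :: "'u ring" and h where A: "regular_ring A" "order_iso h (congruences \<sigma> L) (congruences \<tau> (LL A))"
        "LL A \<in> Variety_of \<tau> \<K>" by (elim exE conjE)
    have "is_algebra \<sigma> L" using LE by (simp add: models_def)
    then have "isomorphic lattice_sig (Con \<sigma> L) (Con \<tau> (LL A))" unfolding Con_def
      by (intro order_iso_isomorphic_lattice[OF A(2)] congruences_joins_meets)
    then show ?thesis using A by blast
  qed
  ultimately show ?thesis by blast
qed

theorem theorem3p11:
  fixes \<sigma> \<tau> :: "lat_op similarity" and \<V> :: "('u, lat_op) ualg set"
  assumes universe: "uncountable (UNIV :: 'u set)"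
    and sig: "(\<sigma> = lattice_sig \<and> \<tau> = lattice0_sig) \<or>
              (\<sigma> = lattice01_sig \<and> \<tau> = lattice01_sig)"
    and variety: "variety \<sigma> \<V>"
    and modular: "\<forall>L\<in>\<V>. modular_lattice \<sigma> L"
    and fin_len: "\<forall>L\<in>\<V>. finitely_generated \<sigma> L \<longrightarrow> finite_length L"
  shows
    "le_crit aleph2 (crit \<sigma> \<V> \<tau> (Variety_of \<tau> (range (Sub_pow TYPE('f::field))))) \<and>
     (\<forall>L\<in>\<V>. |carrier L| \<le>o aleph1 \<longrightarrow>
        (\<exists>A :: 'u ring. regular_ring A \<and>
           isomorphic lattice_sig (Con \<sigma> L) (Con \<tau> (LL A)) \<and>
           LL A \<in> Variety_of \<tau> (range (Sub_pow TYPE('f))))) \<and>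
     (\<forall>n :: nat.
        (\<forall>K\<in>\<V>. simple_algebra \<sigma> K \<and> finite_length K \<longrightarrow> lh K \<le> enat n) \<longrightarrow>
        le_crit aleph2 (crit \<sigma> \<V> \<tau> (Variety_of \<tau> {Sub_pow TYPE('f) n})) \<and>
        (\<forall>L\<in>\<V>. |carrier L| \<le>o aleph1 \<longrightarrow>
           (\<exists>A :: 'u ring. regular_ring A \<and>
              isomorphic lattice_sig (Con \<sigma> L) (Con \<tau> (LL A)) \<and>
              LL A \<in> Variety_of \<tau> {Sub_pow TYPE('f) n})))"
proof -
  note real = realization[OF universe sig variety modular fin_len, where 'f = 'f]
  \<comment> \<open>For all dimensions together \<open>N\<close> is the length of \<open>Q\<close>
    itself; for a fixed \<open>n\<close> the hypothesis on simple lattices allows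
    \<open>N = n\<close>.\<close>
  have "\<exists>N. lh Q \<le> enat N \<and> Sub_pow TYPE('f) N \<in> range (Sub_pow TYPE('f))" if "finite_length Q" for Q :: "('u, lat_op) ualg"
    using that by (metis enat_ord_simps(4) not_infinity_eq order_refl rangeI)
  then have "le_crit aleph2 (crit \<sigma> \<V> \<tau> (Variety_of \<tau> (range (Sub_pow TYPE('f))))) \<and>
     (\<forall>L\<in>\<V>. |carrier L| \<le>o aleph1 \<longrightarrow> (\<exists>A :: 'u ring. regular_ring A \<and>
           isomorphic lattice_sig (Con \<sigma> L) (Con \<tau> (LL A)) \<and> LL A \<in> Variety_of \<tau> (range (Sub_pow TYPE('f)))))"
    by (intro real)
  moreover have "le_crit aleph2 (crit \<sigma> \<V> \<tau> (Variety_of \<tau> {Sub_pow TYPE('f) n})) \<and>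
     (\<forall>L\<in>\<V>. |carrier L| \<le>o aleph1 \<longrightarrow> (\<exists>A :: 'u ring. regular_ring A \<and>
           isomorphic lattice_sig (Con \<sigma> L) (Con \<tau> (LL A)) \<and> LL A \<in> Variety_of \<tau> {Sub_pow TYPE('f) n}))"
    if "\<forall>K\<in>\<V>. simple_algebra \<sigma> K \<and> finite_length K \<longrightarrow> lh K \<le> enat n" for n
    by (intro real) (use that in blast)
  ultimately show ?thesis by blast
qed

end
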